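(* Let $A\in\mathrm{mod}\,\Lambda$ and $n\geq 1$. Then: (1) $\mathrm{Tr}\, A\cong\mathrm{cTr}\, D(A)$. (2) $\mathrm{cTr}\, A \cong\mathrm{Tr}\, D(A)$. (3) $A$ is $n$-torsionfree if and only if $D(A)$ is $n$-cotorsionfree. (4) $A$ is $n$-cotorsionfree if and only if $D(A)$ is $n$-torsionfree.
   Context: $\Lambda$ is an artin $R$-algebra over a commutative artin ring $R$; $\mathrm{mod}\,\Lambda$ (resp. $\mathrm{mod}\,\Lambda^{op}$) is the class of finitely generated left (resp. right) $\Lambda$-modules. $D=\mathrm{Hom}_R(-,I^0(R/J(R)))$ is the Matlis duality between $\mathrm{mod}\,\Lambda^{op}$ and $\mathrm{mod}\,\Lambda$, where $J(R)$ is the Jacobson radical of $R$ and $I^0(R/J(R))$ is the injective envelope of $R/J(R)$. Write $(-)^*=\mathrm{Hom}_\Lambda(-,\Lambda)$. Transpose: for a finitely generated (left or right) $\Lambda$-module $A$ with minimal projective presentation $P_1\xrightarrow{g}P_0\to A\to0$, $\mathrm{Tr}\,A:=\mathrm{Coker}(g^*:P_0^*\to P_1^* )$, a module on the opposite side. $A$ is $n$-torsionfree if $\mathrm{Ext}_\Lambda^i(\mathrm{Tr}\,A,\Lambda)=0$ for all $1\le i\le n$ (Ext over the side on which $\mathrm{Tr}\, A$ is a module). Cotranspose: for a finitely generated (left or right) $\Lambda$-module $A$ with minimal injective presentation $0\to A\to I^0(A)\xrightarrow{f^0}I^1(A)$ (the start of a minimal injective resolution), $\mathrm{cTr}\,A:=\mathrm{Coker}\big(\mathrm{Hom}_\Lambda(D(\Lambda),f^0)\big)$,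 a module on the same side as $A$, where $D(\Lambda)$ is regarded as a $(\Lambda,\Lambda)$-bimodule. A left module $A$ is $n$-cotorsionfree if $\mathrm{Tor}^\Lambda_i(D(\Lambda),\mathrm{cTr}\,A)=0$ for all $1\le i\le n$; symmetrically, a right module $B$ is $n$-cotorsionfree if $\mathrm{Tor}^\Lambda_i(\mathrm{cTr}\,B,D(\Lambda))=0$ for all $1\le i\le n$. *)

theory Defs
  imports "HOL-Algebra.Module" "HOL-Algebra.QuotRing" "HOL-Algebra.Free_Abelian_Groups"
begin

section \<open>Left and right modules over a noncommutative ring\<close>

text \<open>
  The locale \<open>module\<close> of HOL-Algebra demands a commutative ring of scalars.  We keep its record
  type (whose \<open>mult\<close> and \<open>one\<close> fields play no role for a module) and its locale \<open>submodule\<close>, which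
  does not mention commutativity.  Right modules over \<open>L\<close> are left modules over \<open>opp L\<close>:
  \<open>r \<odot> m\<close> then stands for \<open>m r\<close>.
\<close>

locale lmodule = R?: ring R + M?: abelian_group M
  for R :: "'a ring" (structure) and M :: "('a, 'm) module" (structure) +
  assumes smult_closed:
      "\<lbrakk>a \<in> carrier R; x \<in> carrier M\<rbrakk> \<Longrightarrow> a \<odot>\<^bsub>M\<^esub> x \<in> carrier M"
    and smult_l_distr:
      "\<lbrakk>a \<in> carrier R; b \<in> carrier R; x \<in> carrier M\<rbrakk> \<Longrightarrow>
        (a \<oplus> b) \<odot>\<^bsub>M\<^esub> x = a \<odot>\<^bsub>M\<^esub> x \<oplus>\<^bsub>M\<^esub> b \<odot>\<^bsub>M\<^esub> x"
    and smult_r_distr: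
      "\<lbrakk>a \<in> carrier R; x \<in> carrier M; y \<in> carrier M\<rbrakk> \<Longrightarrow>
        a \<odot>\<^bsub>M\<^esub> (x \<oplus>\<^bsub>M\<^esub> y) = a \<odot>\<^bsub>M\<^esub> x \<oplus>\<^bsub>M\<^esub> a \<odot>\<^bsub>M\<^esub> y"
    and smult_assoc:
      "\<lbrakk>a \<in> carrier R; b \<in> carrier R; x \<in> carrier M\<rbrakk> \<Longrightarrow>
        (a \<otimes> b) \<odot>\<^bsub>M\<^esub> x = a \<odot>\<^bsub>M\<^esub> (b \<odot>\<^bsub>M\<^esub> x)"
    and smult_one:
      "x \<in> carrier M \<Longrightarrow> \<one> \<odot>\<^bsub>M\<^esub> x = x"

definition opp :: "'a ring \<Rightarrow> 'a ring" where
  "opp R = R\<lparr>monoid.mult := \<lambda>x y. y \<otimes>\<^bsub>R\<^esub> x\<rparr>"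

lemma opp_opp [simp]: "opp (opp R) = R"
  by (simp add: opp_def)

definition regular :: "'a ring \<Rightarrow> ('a, 'a) module" where
  "regular R = \<lparr>carrier = carrier R, monoid.mult = monoid.mult R, monoid.one = \<one>\<^bsub>R\<^esub>,
     ring.zero = \<zero>\<^bsub>R\<^esub>, add = add R, smult = monoid.mult R\<rparr>"

definition restrict_scalars :: "('r \<Rightarrow> 'a) \<Rightarrow> ('a, 'm) module \<Rightarrow> ('r, 'm) module" where
  "restrict_scalars \<phi> M = \<lparr>carrier = carrier M, monoid.mult = monoid.mult M, monoid.one = \<one>\<^bsub>M\<^esub>,
     ring.zero = \<zero>\<^bsub>M\<^esub>, add = add M, smult = (\<lambda>r m. \<phi> r \<odot>\<^bsub>M\<^esub> m)\<rparr>"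

definition submod :: "('a, 'm) module \<Rightarrow> 'm set \<Rightarrow> ('a, 'm) module" where
  "submod M N = M\<lparr>carrier := N\<rparr>"

text \<open>All elements of a coset \<open>X\<close> of \<open>N\<close> yield the same coset in the union below.\<close>

definition quot_mod :: "('a, 'm) module \<Rightarrow> 'm set \<Rightarrow> ('a, 'm set) module" where
  "quot_mod M N = \<lparr>carrier = a_rcosets\<^bsub>M\<^esub> N, monoid.mult = undefined, monoid.one = undefined,
     ring.zero = N, add = set_add M, smult = (\<lambda>r X. \<Union>x\<in>X. N +>\<^bsub>M\<^esub> (r \<odot>\<^bsub>M\<^esub> x))\<rparr>"

definition fin_gen :: "'a ring \<Rightarrow> ('a, 'm) module \<Rightarrow> bool" where
  "fin_gen R M \<longleftrightarrow> (\<exists>S \<subseteq> carrier M. finite S \<and>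
     (\<forall>m \<in> carrier M. \<exists>c \<in> S \<rightarrow> carrier R. m = (\<Oplus>\<^bsub>M\<^esub>s\<in>S. c s \<odot>\<^bsub>M\<^esub> s)))"

section \<open>Homomorphisms\<close>

text \<open>
  Homomorphisms are extensional functions, so that equality of homomorphisms is equality in HOL
  and the sets below can serve as carriers.
\<close>

definition hom_set :: "'a ring \<Rightarrow> ('a, 'm) module \<Rightarrow> ('a, 'n) module \<Rightarrow> ('m \<Rightarrow> 'n) set" where
  "hom_set R M N = {f \<in> carrier M \<rightarrow>\<^sub>E carrier N.
     (\<forall>x \<in> carrier M. \<forall>y \<in> carrier M. f (x \<oplus>\<^bsub>M\<^esub> y) = f x \<oplus>\<^bsub>N\<^esub> f y) \<and>
     (\<forall>r \<in> carrier R. \<forall>x \<in> carrier M. f (r \<odot>\<^bsub>M\<^esub> x) = r \<odot>\<^bsub>N\<^esub> f x)}"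

definition mod_iso :: "'a ring \<Rightarrow> ('a, 'm) module \<Rightarrow> ('a, 'n) module \<Rightarrow> bool" where
  "mod_iso R M N \<longleftrightarrow> (\<exists>f \<in> hom_set R M N. bij_betw f (carrier M) (carrier N))"

definition mker :: "('a, 'm) module \<Rightarrow> ('a, 'n) module \<Rightarrow> ('m \<Rightarrow> 'n) \<Rightarrow> 'm set" where
  "mker M N f = {x \<in> carrier M. f x = \<zero>\<^bsub>N\<^esub>}"

definition coker :: "('a, 'm) module \<Rightarrow> ('a, 'n) module \<Rightarrow> ('m \<Rightarrow> 'n) \<Rightarrow> ('a, 'n set) module" where
  "coker M N f = quot_mod N (f ` carrier M)"

definition hom_group :: "'a ring \<Rightarrow> ('a, 'm) module \<Rightarrow> ('a, 'n) module \<Rightarrow> ('m \<Rightarrow> 'n) monoid" where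
  "hom_group R M N = \<lparr>carrier = hom_set R M N,
     monoid.mult = (\<lambda>f g. \<lambda>x\<in>carrier M. f x \<oplus>\<^bsub>N\<^esub> g x),
     monoid.one = (\<lambda>x\<in>carrier M. \<zero>\<^bsub>N\<^esub>)\<rparr>"

text \<open>
  A Hom group turned into a module by a given action, which in each use below comes from a
  second, commuting module structure on one of the two arguments.
\<close>

definition hom_mod :: "'a ring \<Rightarrow> ('a, 'm) module \<Rightarrow> ('a, 'n) module \<Rightarrow>
    ('c \<Rightarrow> ('m \<Rightarrow> 'n) \<Rightarrow> ('m \<Rightarrow> 'n)) \<Rightarrow> ('c, 'm \<Rightarrow> 'n) module" where
  "hom_mod R M N act = \<lparr>carrier = hom_set R M N, monoid.mult = undefined, monoid.one = undefined,
     ring.zero = one (hom_group R M N), add = monoid.mult (hom_group R M N), smult = act\<rparr>"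

section \<open>Projective and injective modules, resolutions\<close>

text \<open>
  HOL cannot quantify over all types inside a definition, so the test modules in \<open>projective\<close> and
  \<open>injective\<close> have carriers in the type \<open>nat \<Rightarrow> 'a\<close>, where \<open>'a\<close> is the type of the scalars.  Every
  finitely generated module, being a quotient of some \<open>R\<^sup>n\<close>, is isomorphic to a module with carrier
  in this type (a subset of the right cardinality with transported operations).  Hence all modules
  of \<open>mod R\<close>, in particular all left ideals, are available as test modules, so by Baer's criterion
  \<open>injective\<close> is injectivity against modules of every size.  For a module \<open>P\<close> with carrier in
  \<open>nat \<Rightarrow> 'a\<close>, the free module on the set \<open>P\<close> also has a copy in that type, so \<open>projective\<close> is
  projectivity against modules of every size.
\<close>

definition projective :: "'a ring \<Rightarrow> ('a, 'p) module \<Rightarrow> bool" where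
  "projective R P \<longleftrightarrow> lmodule R P \<and>
     (\<forall>(X :: ('a, nat \<Rightarrow> 'a) module) (Y :: ('a, nat \<Rightarrow> 'a) module). lmodule R X \<longrightarrow> lmodule R Y \<longrightarrow>
       (\<forall>q \<in> hom_set R X Y. q ` carrier X = carrier Y \<longrightarrow>
         (\<forall>f \<in> hom_set R P Y. \<exists>g \<in> hom_set R P X. \<forall>x \<in> carrier P. q (g x) = f x)))"

definition injective :: "'a ring \<Rightarrow> ('a, 'i) module \<Rightarrow> bool" where
  "injective R I \<longleftrightarrow> lmodule R I \<and>
     (\<forall>(X :: ('a, nat \<Rightarrow> 'a) module) (Y :: ('a, nat \<Rightarrow> 'a) module). lmodule R X \<longrightarrow> lmodule R Y \<longrightarrow>
       (\<forall>u \<in> hom_set R X Y. inj_on u (carrier X) \<longrightarrow>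
         (\<forall>f \<in> hom_set R X I. \<exists>g \<in> hom_set R Y I. \<forall>x \<in> carrier X. g (u x) = f x)))"

definition superfluous :: "'a ring \<Rightarrow> ('a, 'm) module \<Rightarrow> 'm set \<Rightarrow> bool" where
  "superfluous R M N \<longleftrightarrow> submodule N R M \<and>
     (\<forall>K. submodule K R M \<longrightarrow> K <+>\<^bsub>M\<^esub> N = carrier M \<longrightarrow> K = carrier M)"

definition essential :: "'a ring \<Rightarrow> ('a, 'm) module \<Rightarrow> 'm set \<Rightarrow> bool" where
  "essential R M N \<longleftrightarrow> submodule N R M \<and>
     (\<forall>K. submodule K R M \<longrightarrow> K \<inter> N = {\<zero>\<^bsub>M\<^esub>} \<longrightarrow> K = {\<zero>\<^bsub>M\<^esub>})"

definition projective_cover ::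
    "'a ring \<Rightarrow> ('a, 'p) module \<Rightarrow> ('p \<Rightarrow> 'm) \<Rightarrow> ('a, 'm) module \<Rightarrow> bool" where
  "projective_cover R P p M \<longleftrightarrow> projective R P \<and> p \<in> hom_set R P M \<and>
     p ` carrier P = carrier M \<and> superfluous R P (mker P M p)"

definition injective_envelope ::
    "'a ring \<Rightarrow> ('a, 'm) module \<Rightarrow> ('m \<Rightarrow> 'i) \<Rightarrow> ('a, 'i) module \<Rightarrow> bool" where
  "injective_envelope R M j I \<longleftrightarrow> injective R I \<and> j \<in> hom_set R M I \<and>
     inj_on j (carrier M) \<and> essential R I (j ` carrier M)"

text \<open>\<open>P1 \<rightarrow> P0 \<rightarrow> M \<rightarrow> 0\<close> with \<open>P0\<close> a projective cover of \<open>M\<close> and \<open>P1\<close> one of the kernel.\<close>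

definition min_proj_presentation ::
    "'a ring \<Rightarrow> ('a, 'p) module \<Rightarrow> ('p \<Rightarrow> 'q) \<Rightarrow> ('a, 'q) module \<Rightarrow> ('q \<Rightarrow> 'm) \<Rightarrow>
      ('a, 'm) module \<Rightarrow> bool" where
  "min_proj_presentation R P1 g P0 p M \<longleftrightarrow>
     projective_cover R P0 p M \<and> projective_cover R P1 g (submod P0 (mker P0 M p))"

text \<open>
  \<open>0 \<rightarrow> M \<rightarrow> I0 \<rightarrow> I1\<close> exact with \<open>I0\<close> an injective envelope of \<open>M\<close> and \<open>I1\<close> one of the image of
  \<open>f\<close>, which is isomorphic to the cokernel of \<open>M \<rightarrow> I0\<close>.
\<close>

definition min_inj_presentation ::
    "'a ring \<Rightarrow> ('a, 'm) module \<Rightarrow> ('m \<Rightarrow> 'i) \<Rightarrow> ('a, 'i) module \<Rightarrow> ('i \<Rightarrow> 'j) \<Rightarrow>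
      ('a, 'j) module \<Rightarrow> bool" where
  "min_inj_presentation R M j I0 f I1 \<longleftrightarrow>
     injective_envelope R M j I0 \<and> f \<in> hom_set R I0 I1 \<and> mker I0 I1 f = j ` carrier M \<and>
     injective_envelope R (submod I1 (f ` carrier I0)) (restrict id (f ` carrier I0)) I1"

text \<open>\<open>\<dots> \<rightarrow> P 2 \<rightarrow> P 1 \<rightarrow> P 0 \<rightarrow> M \<rightarrow> 0\<close> with differentials \<open>d i : P (i + 1) \<rightarrow> P i\<close>.\<close>

definition proj_resolution ::
    "'a ring \<Rightarrow> (nat \<Rightarrow> ('a, 'p) module) \<Rightarrow> (nat \<Rightarrow> 'p \<Rightarrow> 'p) \<Rightarrow> ('p \<Rightarrow> 'm) \<Rightarrow>
      ('a, 'm) module \<Rightarrow> bool" where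
  "proj_resolution R P d e M \<longleftrightarrow>
     (\<forall>i. projective R (P i)) \<and>
     e \<in> hom_set R (P 0) M \<and> e ` carrier (P 0) = carrier M \<and>
     (\<forall>i. d i \<in> hom_set R (P (Suc i)) (P i)) \<and>
     d 0 ` carrier (P 1) = mker (P 0) M e \<and>
     (\<forall>i. d (Suc i) ` carrier (P (Suc (Suc i))) = mker (P (Suc i)) (P i) (d i))"

text \<open>
  Every finitely generated module over a left noetherian ring has a projective resolution with
  all carriers in \<open>nat \<Rightarrow> 'a\<close>; we choose one.  The same applies below to minimal presentations over
  an artin algebra, whose terms are finitely generated.  The choice is immaterial up to
  isomorphism.
\<close>

definition some_resolution ::
    "'a ring \<Rightarrow> ('a, 'm) module \<Rightarrow>
      (nat \<Rightarrow> ('a, nat \<Rightarrow> 'a) module) \<times> (nat \<Rightarrow> (nat \<Rightarrow> 'a) \<Rightarrow> nat \<Rightarrow> 'a) \<times> ((nat \<Rightarrow> 'a) \<Rightarrow> 'm)" where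
  "some_resolution R M = (SOME (P, d, e). proj_resolution R P d e M)"

section \<open>Ext and Tor\<close>

text \<open>The homology at \<open>B\<close> of \<open>A \<rightarrow> B \<rightarrow> C\<close>, written with HOL-Algebra's multiplicative groups.\<close>

definition homology_at ::
    "'x monoid \<Rightarrow> ('x \<Rightarrow> 'y) \<Rightarrow> 'y monoid \<Rightarrow> ('y \<Rightarrow> 'z) \<Rightarrow> 'z monoid \<Rightarrow> 'y set monoid" where
  "homology_at A f B g C = (B\<lparr>carrier := kernel B C g\<rparr>) Mod (f ` carrier A)"

definition Ext :: "'a ring \<Rightarrow> nat \<Rightarrow> ('a, 'm) module \<Rightarrow> ('a, 'n) module \<Rightarrow>
    ((nat \<Rightarrow> 'a) \<Rightarrow> 'n) set monoid" where
  "Ext R i M N =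
    (let (P, d, e) = some_resolution R M;
         C = (\<lambda>k. hom_group R (P k) N);
         \<delta> = (\<lambda>k h. compose (carrier (P (Suc k))) h (d k))
     in case i of
          0 \<Rightarrow> ((C 0)\<lparr>carrier := kernel (C 0) (C 1) (\<delta> 0)\<rparr>) Mod {one (C 0)}
        | Suc j \<Rightarrow> homology_at (C j) (\<delta> j) (C (Suc j)) (\<delta> (Suc j)) (C (Suc (Suc j))))"

text \<open>
  \<open>M \<otimes>\<^sub>R N\<close> for a right module \<open>M\<close>, given as a left module over \<open>opp R\<close>, and a left module \<open>N\<close>:
  the free abelian group on pairs modulo biadditivity and \<open>m r \<otimes> n = m \<otimes> r n\<close>.
\<close>

definition tensor_rel :: "'a ring \<Rightarrow> ('a, 'm) module \<Rightarrow> ('a, 'n) module \<Rightarrow>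
    ('m \<times> 'n \<Rightarrow>\<^sub>0 int) set" where
  "tensor_rel R M N = generate (free_Abelian_group (carrier M \<times> carrier N))
     ({frag_of (m \<oplus>\<^bsub>M\<^esub> m', n) - frag_of (m, n) - frag_of (m', n) | m m' n.
         m \<in> carrier M \<and> m' \<in> carrier M \<and> n \<in> carrier N} \<union>
      {frag_of (m, n \<oplus>\<^bsub>N\<^esub> n') - frag_of (m, n) - frag_of (m, n') | m n n'.
         m \<in> carrier M \<and> n \<in> carrier N \<and> n' \<in> carrier N} \<union>
      {frag_of (r \<odot>\<^bsub>M\<^esub> m, n) - frag_of (m, r \<odot>\<^bsub>N\<^esub> n) | r m n.
         r \<in> carrier R \<and> m \<in> carrier M \<and> n \<in> carrier N})"

definition tensor :: "'a ring \<Rightarrow> ('a, 'm) module \<Rightarrow> ('a, 'n) module \<Rightarrow>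
    ('m \<times> 'n \<Rightarrow>\<^sub>0 int) set monoid" where
  "tensor R M N = free_Abelian_group (carrier M \<times> carrier N) Mod tensor_rel R M N"

text \<open>The map \<open>id \<otimes> f : M \<otimes> N \<rightarrow> M \<otimes> N'\<close>, again as a union of equal cosets.\<close>

definition tensor_map :: "'a ring \<Rightarrow> ('a, 'm) module \<Rightarrow> ('n \<Rightarrow> 'k) \<Rightarrow> ('a, 'k) module \<Rightarrow>
    ('m \<times> 'n \<Rightarrow>\<^sub>0 int) set \<Rightarrow> ('m \<times> 'k \<Rightarrow>\<^sub>0 int) set" where
  "tensor_map R M f N' X = (\<Union>x\<in>X. tensor_rel R M N' #>\<^bsub>free_Abelian_group (carrier M \<times> carrier N')\<^esub>
     frag_extend (\<lambda>(m, n). frag_of (m, f n)) x)"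

text \<open>Tor is computed by resolving the left module \<open>N\<close>.\<close>

definition Tor :: "'a ring \<Rightarrow> nat \<Rightarrow> ('a, 'm) module \<Rightarrow> ('a, 'n) module \<Rightarrow>
    ('m \<times> (nat \<Rightarrow> 'a) \<Rightarrow>\<^sub>0 int) set set monoid" where
  "Tor R i M N =
    (let (P, d, e) = some_resolution R N;
         T = (\<lambda>k. tensor R M (P k));
         \<tau> = (\<lambda>k. tensor_map R M (d k) (P k))
     in case i of
          0 \<Rightarrow> T 0 Mod (\<tau> 0 ` carrier (T 1))
        | Suc j \<Rightarrow> homology_at (T (Suc (Suc j))) (\<tau> (Suc j)) (T (Suc j)) (\<tau> j) (T j))"

section \<open>Artin algebras and the Matlis duality\<close>

locale artinian_cring = cring +
  assumes dcc: "\<lbrakk>\<And>k. ideal (I k) R; \<And>k. I (Suc k) \<subseteq> I k\<rbrakk> \<Longrightarrow> \<exists>N. \<forall>k\<ge>N. I (k :: nat) = I N"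

definition jacobson_radical :: "'r ring \<Rightarrow> 'r set" where
  "jacobson_radical R = carrier R \<inter> \<Inter>{I. maximalideal I R}"

locale artin_algebra = R: artinian_cring R + L: ring L
  for R :: "'r ring" and \<phi> :: "'r \<Rightarrow> 'a" and L :: "'a ring" +
  assumes structure_hom: "\<phi> \<in> ring_hom R L"
    and central: "\<lbrakk>r \<in> carrier R; a \<in> carrier L\<rbrakk> \<Longrightarrow> \<phi> r \<otimes>\<^bsub>L\<^esub> a = a \<otimes>\<^bsub>L\<^esub> \<phi> r"
    and fin_gen_over_base: "fin_gen R (restrict_scalars \<phi> (regular L))"

text \<open>
  \<open>D M = Hom\<^sub>R(M, E)\<close>, where \<open>E\<close> will be an injective envelope of \<open>R / J(R)\<close>, with the action
  \<open>(f l)(m) = f (l m)\<close>: a module over \<open>opp L\<close> if \<open>M\<close> is one over \<open>L\<close>, and over \<open>L\<close> if \<open>M\<close> is one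
  over \<open>opp L\<close>.
\<close>

definition Dual :: "'r ring \<Rightarrow> ('r \<Rightarrow> 'a) \<Rightarrow> ('r, 'e) module \<Rightarrow> ('a, 'm) module \<Rightarrow>
    ('a, 'm \<Rightarrow> 'e) module" where
  "Dual R \<phi> E M = hom_mod R (restrict_scalars \<phi> M) E (\<lambda>l f. \<lambda>m\<in>carrier M. f (l \<odot>\<^bsub>M\<^esub> m))"

text \<open>
  The two sides of the bimodule \<open>D(L)\<close>, with \<open>(l f)(x) = f (x l)\<close> and \<open>(f l)(x) = f (l x)\<close>.
  The second is a module over \<open>opp L\<close>.  They have the same underlying group.
\<close>

abbreviation DL_left :: "'r ring \<Rightarrow> ('r \<Rightarrow> 'a) \<Rightarrow> ('r, 'e) module \<Rightarrow> 'a ring \<Rightarrow>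
    ('a, 'a \<Rightarrow> 'e) module" where
  "DL_left R \<phi> E L \<equiv> Dual R \<phi> E (regular (opp L))"

abbreviation DL_right :: "'r ring \<Rightarrow> ('r \<Rightarrow> 'a) \<Rightarrow> ('r, 'e) module \<Rightarrow> 'a ring \<Rightarrow>
    ('a, 'a \<Rightarrow> 'e) module" where
  "DL_right R \<phi> E L \<equiv> Dual R \<phi> E (regular L)"

section \<open>Transpose and cotranspose\<close>

text \<open>
  The following notions are defined for left modules over \<open>L\<close>; for right modules one instantiates
  \<open>L\<close> by \<open>opp L\<close>.
\<close>

text \<open>\<open>M\<^sup>* = Hom\<^sub>L(M, L)\<close>, an \<open>opp L\<close>-module by \<open>(f l)(m) = f m \<cdot> l\<close>.\<close>

definition star :: "'a ring \<Rightarrow> ('a, 'm) module \<Rightarrow> ('a, 'm \<Rightarrow> 'a) module" where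
  "star L M = hom_mod L M (regular L) (\<lambda>l f. \<lambda>m\<in>carrier M. f m \<otimes>\<^bsub>L\<^esub> l)"

definition Tr :: "'a ring \<Rightarrow> ('a, 'm) module \<Rightarrow> ('a, ((nat \<Rightarrow> 'a) \<Rightarrow> 'a) set) module" where
  "Tr L M =
    (let (P1, g, P0, p) = (SOME (P1 :: ('a, nat \<Rightarrow> 'a) module, g, P0 :: ('a, nat \<Rightarrow> 'a) module, p).
                             min_proj_presentation L P1 g P0 p M)
     in coker (star L P0) (star L P1) (\<lambda>h. compose (carrier P1) h g))"

text \<open>\<open>Hom\<^sub>L(D(L), M)\<close>, an \<open>L\<close>-module by \<open>(l h)(f) = h (f l)\<close>.\<close>

definition hom_DL :: "'r ring \<Rightarrow> ('r \<Rightarrow> 'a) \<Rightarrow> ('r, 'e) module \<Rightarrow> 'a ring \<Rightarrow>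
    ('a, 'm) module \<Rightarrow> ('a, ('a \<Rightarrow> 'e) \<Rightarrow> 'm) module" where
  "hom_DL R \<phi> E L M = hom_mod L (DL_left R \<phi> E L) M
     (\<lambda>l h. \<lambda>f\<in>carrier (DL_left R \<phi> E L). h (l \<odot>\<^bsub>DL_right R \<phi> E L\<^esub> f))"

definition cTr :: "'r ring \<Rightarrow> ('r \<Rightarrow> 'a) \<Rightarrow> ('r, 'e) module \<Rightarrow> 'a ring \<Rightarrow>
    ('a, 'm) module \<Rightarrow> ('a, (('a \<Rightarrow> 'e) \<Rightarrow> (nat \<Rightarrow> 'a)) set) module" where
  "cTr R \<phi> E L M =
    (let (j, I0, f, I1) = (SOME (j, I0 :: ('a, nat \<Rightarrow> 'a) module, f, I1 :: ('a, nat \<Rightarrow> 'a) module).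
                             min_inj_presentation L M j I0 f I1)
     in coker (hom_DL R \<phi> E L I0) (hom_DL R \<phi> E L I1)
          (\<lambda>h. compose (carrier (DL_left R \<phi> E L)) f h))"

definition n_torsionfree :: "'a ring \<Rightarrow> nat \<Rightarrow> ('a, 'm) module \<Rightarrow> bool" where
  "n_torsionfree L n M \<longleftrightarrow>
     (\<forall>i \<in> {1..n}. trivial_group (Ext (opp L) i (Tr L M) (regular (opp L))))"

text \<open>
  For a right module, that is with \<open>L\<close> replaced by \<open>opp L\<close>, the group below is \<open>Tor\<close> over \<open>opp L\<close>
  of \<open>D(L)\<close> and \<open>cTr M\<close>, which is \<open>Tor\<close> over \<open>L\<close> of \<open>cTr M\<close> and \<open>D(L)\<close>.
\<close>

definition n_cotorsionfree :: "'r ring \<Rightarrow> ('r \<Rightarrow> 'a) \<Rightarrow> ('r, 'e) module \<Rightarrow> 'a ring \<Rightarrow> nat \<Rightarrow>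
    ('a, 'm) module \<Rightarrow> bool" where
  "n_cotorsionfree R \<phi> E L n M \<longleftrightarrow>
     (\<forall>i \<in> {1..n}. trivial_group (Tor L i (DL_right R \<phi> E L) (cTr R \<phi> E L M)))"

end

theory Submission
  imports Defs
begin

text \<open>
  Over an artinian commutative ring \<open>R\<close>, which has finite length, the elements of \<open>E\<close> killed by a
  maximal ideal form a simple module.  Hence \<open>E\<close> is a cogenerator, and by induction on the length
  every module of finite length is reflexive for \<open>D\<close>.  So \<open>D\<close> exchanges projective covers with
  injective envelopes and turns a minimal projective presentation of \<open>A\<close> into a minimal injective
  presentation of \<open>D A\<close>.  Since \<open>L \<cong> D (D L)\<close>, a map \<open>D L \<rightarrow> D P\<close> is the dual of a unique map \<open>P \<rightarrow> L\<close>;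
  this identifies \<open>Hom(D L, D P)\<close> with \<open>P\<^sup>*\<close> naturally in \<open>P\<close>, and the cokernels \<open>cTr (D A)\<close> and \<open>Tr A\<close>
  agree.  Applied to \<open>D A\<close>, with \<open>D (D A) \<cong> A\<close>, this also gives (2).

  For a projective resolution \<open>P\<close> of \<open>M\<close>, the adjunction \<open>Hom\<^sub>R(D L \<otimes> P, E) \<cong> Hom\<^sub>L(P, L)\<close> and the fact
  that \<open>E\<close> is an injective cogenerator show that \<open>Tor\<^sub>i(D L, M)\<close> vanishes if and only if \<open>Ext\<^sup>i(M, L)\<close>
  does.  With \<open>M\<close> the transpose, this turns (1) and (2) into (3) and (4).
\<close>

section \<open>Modules, submodules and homomorphisms\<close>

text \<open>\<open>Tr\<close> and \<open>cTr\<close> each choose a minimal presentation with terms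
  in \<open>nat \<Rightarrow> 'a\<close>, but the dual of the presentation chosen by
  \<open>Tr\<close> has terms in function types into \<open>'e\<close>. It is therefore moved into
  the right type along injections, which shows that \<open>cTr\<close> has something to choose, and
  the uniqueness of minimal injective presentations links it to the actual choice. For the same
  reason injectivity is extended by Baer's criterion, and projectivity by splitting off a free
  module, to test modules of every type.

  That \<open>R\<close> has finite length is derived from \<open>E\<close> itself. Length is
  recorded only as a strictly increasing function on submodules, which suffices for extremal choices
  and for inductions.

  The modules compared in (3) and (4) are isomorphic, but their chosen resolutions are unrelated.
  Resolutions are compared on the side of Ext, where maps between modules suffice, and the passage
  to Tor happens on a single resolution. Statements on right modules are instances of those on left
  modules, because the hypotheses are symmetric in \<open>L\<close> and
  \<open>opp L\<close>.\<close>

context lmodule begin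

lemma smult_zero_left [simp]: "x \<in> carrier M \<Longrightarrow> \<zero> \<odot>\<^bsub>M\<^esub> x = \<zero>\<^bsub>M\<^esub>"
proof -
  assume x: "x \<in> carrier M"
  have "\<zero> \<odot>\<^bsub>M\<^esub> x \<oplus>\<^bsub>M\<^esub> \<zero> \<odot>\<^bsub>M\<^esub> x = \<zero> \<odot>\<^bsub>M\<^esub> x"
    using smult_l_distr[of \<zero> \<zero> x] x by simp
  then show ?thesis
    by (metis M.add.r_cancel_one R.zero_closed smult_closed x)
qed

lemma smult_zero_right [simp]: "r \<in> carrier R \<Longrightarrow> r \<odot>\<^bsub>M\<^esub> \<zero>\<^bsub>M\<^esub> = \<zero>\<^bsub>M\<^esub>"
proof -
  assume r: "r \<in> carrier R"
  have "r \<odot>\<^bsub>M\<^esub> \<zero>\<^bsub>M\<^esub> \<oplus>\<^bsub>M\<^esub> r \<odot>\<^bsub>M\<^esub> \<zero>\<^bsub>M\<^esub> = r \<odot>\<^bsub>M\<^esub> \<zero>\<^bsub>M\<^esub>"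
    using smult_r_distr[of r "\<zero>\<^bsub>M\<^esub>" "\<zero>\<^bsub>M\<^esub>"] r by simp
  then show ?thesis
    by (metis M.add.r_cancel_one M.zero_closed smult_closed r)
qed

lemma smult_minus_left: "\<lbrakk>r \<in> carrier R; x \<in> carrier M\<rbrakk> \<Longrightarrow> (\<ominus> r) \<odot>\<^bsub>M\<^esub> x = \<ominus>\<^bsub>M\<^esub> (r \<odot>\<^bsub>M\<^esub> x)"
  by (metis M.minus_equality R.a_inv_closed R.l_neg smult_closed smult_l_distr smult_zero_left)

lemma minus_eq_smult: "x \<in> carrier M \<Longrightarrow> \<ominus>\<^bsub>M\<^esub> x = (\<ominus> \<one>) \<odot>\<^bsub>M\<^esub> x"
  by (simp add: smult_minus_left smult_one)

lemma submoduleI: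
  assumes "K \<subseteq> carrier M" "\<zero>\<^bsub>M\<^esub> \<in> K" "\<And>x y. \<lbrakk>x \<in> K; y \<in> K\<rbrakk> \<Longrightarrow> x \<oplus>\<^bsub>M\<^esub> y \<in> K"
    "\<And>r x. \<lbrakk>r \<in> carrier R; x \<in> K\<rbrakk> \<Longrightarrow> r \<odot>\<^bsub>M\<^esub> x \<in> K"
  shows "submodule K R M"
proof -
  have "\<ominus>\<^bsub>M\<^esub> x \<in> K" if "x \<in> K" for x
    using that assms(1,4) minus_eq_smult[of x] by auto
  then show ?thesis
    using assms by (auto intro!: submodule.intro subgroup.intro submodule_axioms.intro simp: a_inv_def)
qed

lemma submodule_carrier: "submodule (carrier M) R M"
  by (rule submoduleI) (auto simp: smult_closed)

lemma submodule_zero: "submodule {\<zero>\<^bsub>M\<^esub>} R M"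
  by (rule submoduleI) auto

lemma submodule_minus: "\<lbrakk>submodule K R M; x \<in> K\<rbrakk> \<Longrightarrow> \<ominus>\<^bsub>M\<^esub> x \<in> K"
  using subgroup.m_inv_closed[OF submodule.axioms(1)] by (fastforce simp: a_inv_def)

end

lemma submodule_subset: "submodule K R M \<Longrightarrow> K \<subseteq> carrier M"
  using subgroup.subset[OF submodule.axioms(1)] by fastforce

lemma submodule_mem: "\<lbrakk>submodule K R M; x \<in> K\<rbrakk> \<Longrightarrow> x \<in> carrier M"
  using submodule_subset by blast

lemma submodule_zero_mem: "submodule K R M \<Longrightarrow> \<zero>\<^bsub>M\<^esub> \<in> K"
  using subgroup.one_closed[OF submodule.axioms(1)] by fastforce

lemma submodule_add: "\<lbrakk>submodule K R M; x \<in> K; y \<in> K\<rbrakk> \<Longrightarrow> x \<oplus>\<^bsub>M\<^esub> y \<in> K"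
  using subgroup.m_closed[OF submodule.axioms(1)] by fastforce

lemma submodule_smult: "\<lbrakk>submodule K R M; r \<in> carrier R; x \<in> K\<rbrakk> \<Longrightarrow> r \<odot>\<^bsub>M\<^esub> x \<in> K"
  by (rule submodule.smult_closed)

lemma (in lmodule) submodule_diff: "\<lbrakk>submodule K R M; x \<in> K; y \<in> K\<rbrakk> \<Longrightarrow> x \<ominus>\<^bsub>M\<^esub> y \<in> K"
  unfolding a_minus_def by (rule submodule_add) (auto intro: submodule_minus)

lemma submod_simps [simp]:
  "carrier (submod M K) = K" "\<zero>\<^bsub>submod M K\<^esub> = \<zero>\<^bsub>M\<^esub>"
  "x \<oplus>\<^bsub>submod M K\<^esub> y = x \<oplus>\<^bsub>M\<^esub> y" "r \<odot>\<^bsub>submod M K\<^esub> x = r \<odot>\<^bsub>M\<^esub> x"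
  by (auto simp: submod_def)

lemma submod_submod [simp]: "submod (submod M K) K' = submod M K'"
  by (simp add: submod_def)

lemma submod_carrier [simp]: "submod M (carrier M) = M"
  by (simp add: submod_def)

lemma restrict_scalars_simps [simp]:
  "carrier (restrict_scalars \<phi> M) = carrier M" "\<zero>\<^bsub>restrict_scalars \<phi> M\<^esub> = \<zero>\<^bsub>M\<^esub>"
  "x \<oplus>\<^bsub>restrict_scalars \<phi> M\<^esub> y = x \<oplus>\<^bsub>M\<^esub> y" "r \<odot>\<^bsub>restrict_scalars \<phi> M\<^esub> x = \<phi> r \<odot>\<^bsub>M\<^esub> x"
  by (auto simp: restrict_scalars_def)

lemma regular_simps [simp]:
  "carrier (regular L) = carrier L" "\<zero>\<^bsub>regular L\<^esub> = \<zero>\<^bsub>L\<^esub>"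
  "x \<oplus>\<^bsub>regular L\<^esub> y = x \<oplus>\<^bsub>L\<^esub> y" "r \<odot>\<^bsub>regular L\<^esub> x = r \<otimes>\<^bsub>L\<^esub> x"
  by (auto simp: regular_def)

lemma opp_simps [simp]:
  "carrier (opp L) = carrier L" "\<zero>\<^bsub>opp L\<^esub> = \<zero>\<^bsub>L\<^esub>" "\<one>\<^bsub>opp L\<^esub> = \<one>\<^bsub>L\<^esub>"
  "x \<oplus>\<^bsub>opp L\<^esub> y = x \<oplus>\<^bsub>L\<^esub> y" "x \<otimes>\<^bsub>opp L\<^esub> y = y \<otimes>\<^bsub>L\<^esub> x"
  by (auto simp: opp_def)

text \<open>The last premise stands in for additive inverses: \<open>\<ominus> \<one>\<close> acts
  on \<open>x\<close> as an inverse because the sum of the two scalars acts as zero.\<close>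

lemma lmoduleI:
  assumes "ring R"
    "\<And>x y. \<lbrakk>x \<in> carrier M; y \<in> carrier M\<rbrakk> \<Longrightarrow> x \<oplus>\<^bsub>M\<^esub> y \<in> carrier M"
    "\<zero>\<^bsub>M\<^esub> \<in> carrier M"
    "\<And>x y z. \<lbrakk>x \<in> carrier M; y \<in> carrier M; z \<in> carrier M\<rbrakk> \<Longrightarrow> (x \<oplus>\<^bsub>M\<^esub> y) \<oplus>\<^bsub>M\<^esub> z = x \<oplus>\<^bsub>M\<^esub> (y \<oplus>\<^bsub>M\<^esub> z)"
    "\<And>x y. \<lbrakk>x \<in> carrier M; y \<in> carrier M\<rbrakk> \<Longrightarrow> x \<oplus>\<^bsub>M\<^esub> y = y \<oplus>\<^bsub>M\<^esub> x"
    "\<And>x. x \<in> carrier M \<Longrightarrow> \<zero>\<^bsub>M\<^esub> \<oplus>\<^bsub>M\<^esub> x = x"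
    "\<And>r x. \<lbrakk>r \<in> carrier R; x \<in> carrier M\<rbrakk> \<Longrightarrow> r \<odot>\<^bsub>M\<^esub> x \<in> carrier M"
    "\<And>r s x. \<lbrakk>r \<in> carrier R; s \<in> carrier R; x \<in> carrier M\<rbrakk> \<Longrightarrow> (r \<oplus>\<^bsub>R\<^esub> s) \<odot>\<^bsub>M\<^esub> x = r \<odot>\<^bsub>M\<^esub> x \<oplus>\<^bsub>M\<^esub> s \<odot>\<^bsub>M\<^esub> x"
    "\<And>r x y. \<lbrakk>r \<in> carrier R; x \<in> carrier M; y \<in> carrier M\<rbrakk> \<Longrightarrow> r \<odot>\<^bsub>M\<^esub> (x \<oplus>\<^bsub>M\<^esub> y) = r \<odot>\<^bsub>M\<^esub> x \<oplus>\<^bsub>M\<^esub> r \<odot>\<^bsub>M\<^esub> y"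
    "\<And>r s x. \<lbrakk>r \<in> carrier R; s \<in> carrier R; x \<in> carrier M\<rbrakk> \<Longrightarrow> (r \<otimes>\<^bsub>R\<^esub> s) \<odot>\<^bsub>M\<^esub> x = r \<odot>\<^bsub>M\<^esub> (s \<odot>\<^bsub>M\<^esub> x)"
    "\<And>x. x \<in> carrier M \<Longrightarrow> \<one>\<^bsub>R\<^esub> \<odot>\<^bsub>M\<^esub> x = x"
    "\<And>x. x \<in> carrier M \<Longrightarrow> \<zero>\<^bsub>R\<^esub> \<odot>\<^bsub>M\<^esub> x = \<zero>\<^bsub>M\<^esub>"
  shows "lmodule R M"
proof -
  interpret R: ring R by fact
  have "\<exists>y\<in>carrier M. y \<oplus>\<^bsub>M\<^esub> x = \<zero>\<^bsub>M\<^esub>" if x: "x \<in> carrier M" for x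
  proof -
    have "(\<ominus>\<^bsub>R\<^esub> \<one>\<^bsub>R\<^esub>) \<odot>\<^bsub>M\<^esub> x \<oplus>\<^bsub>M\<^esub> \<one>\<^bsub>R\<^esub> \<odot>\<^bsub>M\<^esub> x = \<zero>\<^bsub>M\<^esub>"
      using assms(8)[of "\<ominus>\<^bsub>R\<^esub> \<one>\<^bsub>R\<^esub>" "\<one>\<^bsub>R\<^esub>" x] x assms(12) by (simp add: R.l_neg)
    then show ?thesis using assms(7)[of "\<ominus>\<^bsub>R\<^esub> \<one>\<^bsub>R\<^esub>" x] assms(11) x by auto
  qed
  then have "abelian_group M"
    by (intro abelian_groupI) (use assms(2-6) in auto)
  then show ?thesis
    by (intro lmodule.intro lmodule_axioms.intro) (use assms in auto)
qed

lemma lmodule_submod: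
  assumes "lmodule R M" "submodule K R M"
  shows "lmodule R (submod M K)"
proof -
  interpret lmodule R M by fact
  note [simp] = submodule_mem[OF assms(2)]
  show ?thesis
    by (rule lmoduleI)
      (auto simp: R.ring_axioms M.a_ac smult_l_distr smult_r_distr smult_assoc smult_one
        submodule_zero_mem[OF assms(2)] intro: submodule_add[OF assms(2)] submodule_smult[OF assms(2)])
qed

lemma submodule_submod_iff:
  assumes "lmodule R M" "submodule K R M"
  shows "submodule K' R (submod M K) \<longleftrightarrow> submodule K' R M \<and> K' \<subseteq> K"
proof -
  interpret M: lmodule R M by fact
  interpret K: lmodule R "submod M K" by (rule lmodule_submod[OF assms])
  show ?thesis
  proof
    assume K': "submodule K' R (submod M K)"
    show "submodule K' R M \<and> K' \<subseteq> K"
      using submodule_subset[OF K'] submodule_subset[OF assms(2)] submodule_zero_mem[OF K']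
        submodule_add[OF K'] submodule_smult[OF K']
      by (auto intro!: M.submoduleI)
  next
    assume K': "submodule K' R M \<and> K' \<subseteq> K"
    then show "submodule K' R (submod M K)"
      using submodule_zero_mem[of K'] submodule_add[of K'] submodule_smult[of K']
      by (intro K.submoduleI) auto
  qed
qed

lemma lmodule_regular: "ring L \<Longrightarrow> lmodule L (regular L)"
proof -
  assume "ring L"
  interpret ring L by fact
  show ?thesis
    by (rule lmoduleI) (auto simp: ring_axioms a_ac l_distr r_distr m_assoc)
qed

lemma ring_opp: "ring L \<Longrightarrow> ring (opp L)"
proof -
  assume "ring L"
  interpret ring L by fact
  have "abelian_group (opp L)"
    by (rule abelian_groupI) (auto simp: a_assoc intro: a_comm add.l_inv_ex)
  moreover have "monoid (opp L)"
    by (rule monoidI) (auto simp: m_assoc)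
  ultimately show ?thesis
    by (intro ringI) (auto simp: l_distr r_distr abelian_group_def
        intro: abelian_group.axioms monoid.m_assoc)
qed

lemma lmodule_restrict_scalars:
  assumes "ring R" "\<phi> \<in> ring_hom R L" "lmodule L M"
  shows "lmodule R (restrict_scalars \<phi> M)"
proof -
  interpret lmodule L M by fact
  have [simp]: "\<phi> r \<in> carrier L" if "r \<in> carrier R" for r
    using ring_hom_closed[OF assms(2) that] .
  have "\<phi> \<zero>\<^bsub>R\<^esub> = \<zero>\<^bsub>L\<^esub>"
    using ring_hom_zero[OF assms(2,1)] R.ring_axioms by blast
  then show ?thesis
    using assms(1) ring_hom_one[OF assms(2)] ring_hom_mult[OF assms(2)] ring_hom_add[OF assms(2)]
    by (intro lmoduleI)
      (auto simp: M.a_ac smult_l_distr smult_r_distr smult_assoc smult_one smult_closed)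
qed

subsection \<open>Homomorphisms\<close>

lemma hom_setI:
  assumes "f \<in> extensional (carrier M)" "\<And>x. x \<in> carrier M \<Longrightarrow> f x \<in> carrier N"
    "\<And>x y. \<lbrakk>x \<in> carrier M; y \<in> carrier M\<rbrakk> \<Longrightarrow> f (x \<oplus>\<^bsub>M\<^esub> y) = f x \<oplus>\<^bsub>N\<^esub> f y"
    "\<And>r x. \<lbrakk>r \<in> carrier R; x \<in> carrier M\<rbrakk> \<Longrightarrow> f (r \<odot>\<^bsub>M\<^esub> x) = r \<odot>\<^bsub>N\<^esub> f x"
  shows "f \<in> hom_set R M N"
  using assms by (auto simp: hom_set_def PiE_def)

lemma hom_restrictI:
  assumes "lmodule R M" "\<And>x. x \<in> carrier M \<Longrightarrow> f x \<in> carrier N"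
    "\<And>x y. \<lbrakk>x \<in> carrier M; y \<in> carrier M\<rbrakk> \<Longrightarrow> f (x \<oplus>\<^bsub>M\<^esub> y) = f x \<oplus>\<^bsub>N\<^esub> f y"
    "\<And>r x. \<lbrakk>r \<in> carrier R; x \<in> carrier M\<rbrakk> \<Longrightarrow> f (r \<odot>\<^bsub>M\<^esub> x) = r \<odot>\<^bsub>N\<^esub> f x"
  shows "(\<lambda>x\<in>carrier M. f x) \<in> hom_set R M N"
proof -
  interpret lmodule R M by fact
  show ?thesis
    by (rule hom_setI) (auto simp: assms(2-) smult_closed)
qed

lemma hom_closed: "\<lbrakk>f \<in> hom_set R M N; x \<in> carrier M\<rbrakk> \<Longrightarrow> f x \<in> carrier N"
  by (auto simp: hom_set_def)

lemma hom_image: "f \<in> hom_set R M N \<Longrightarrow> f ` carrier M \<subseteq> carrier N"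
  by (auto simp: hom_set_def)

lemma hom_add: "\<lbrakk>f \<in> hom_set R M N; x \<in> carrier M; y \<in> carrier M\<rbrakk> \<Longrightarrow> f (x \<oplus>\<^bsub>M\<^esub> y) = f x \<oplus>\<^bsub>N\<^esub> f y"
  by (auto simp: hom_set_def)

lemma hom_smult: "\<lbrakk>f \<in> hom_set R M N; r \<in> carrier R; x \<in> carrier M\<rbrakk> \<Longrightarrow> f (r \<odot>\<^bsub>M\<^esub> x) = r \<odot>\<^bsub>N\<^esub> f x"
  by (auto simp: hom_set_def)

lemma hom_ext:
  "\<lbrakk>f \<in> hom_set R M N; g \<in> hom_set R M N'; \<And>x. x \<in> carrier M \<Longrightarrow> f x = g x\<rbrakk> \<Longrightarrow> f = g"
  by (auto simp: hom_set_def PiE_def intro: extensionalityI)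

lemma hom_zero:
  assumes "lmodule R M" "lmodule R N" "f \<in> hom_set R M N"
  shows "f \<zero>\<^bsub>M\<^esub> = \<zero>\<^bsub>N\<^esub>"
proof -
  interpret M: lmodule R M by fact
  interpret N: lmodule R N by fact
  have "f (\<zero>\<^bsub>R\<^esub> \<odot>\<^bsub>M\<^esub> \<zero>\<^bsub>M\<^esub>) = \<zero>\<^bsub>N\<^esub>"
    using hom_smult[OF assms(3), of "\<zero>\<^bsub>R\<^esub>" "\<zero>\<^bsub>M\<^esub>"] hom_closed[OF assms(3), of "\<zero>\<^bsub>M\<^esub>"] by simp
  then show ?thesis by simp
qed

lemma hom_minus:
  assumes "lmodule R M" "lmodule R N" "f \<in> hom_set R M N" "x \<in> carrier M"
  shows "f (\<ominus>\<^bsub>M\<^esub> x) = \<ominus>\<^bsub>N\<^esub> f x"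
proof -
  interpret M: lmodule R M by fact
  interpret N: lmodule R N by fact
  show ?thesis
    using hom_smult[OF assms(3), of "\<ominus>\<^bsub>R\<^esub> \<one>\<^bsub>R\<^esub>" x] hom_closed[OF assms(3)] assms(4)
    by (simp add: M.minus_eq_smult N.minus_eq_smult)
qed

lemma hom_diff:
  assumes "lmodule R M" "lmodule R N" "f \<in> hom_set R M N" "x \<in> carrier M" "y \<in> carrier M"
  shows "f (x \<ominus>\<^bsub>M\<^esub> y) = f x \<ominus>\<^bsub>N\<^esub> f y"
proof -
  interpret M: lmodule R M by fact
  show ?thesis
    using assms hom_minus[OF assms(1-3)] hom_add[OF assms(3)] by (simp add: a_minus_def)
qed

lemma (in abelian_group) diff_eq_zero_iff:
  assumes "x \<in> carrier G" "y \<in> carrier G"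
  shows "x \<ominus> y = \<zero> \<longleftrightarrow> x = y"
  using assms by (metis a_minus_def a_inv_closed add.inv_equality local.minus_minus r_neg)

lemma hom_inj_iff:
  assumes "lmodule R M" "lmodule R N" "f \<in> hom_set R M N"
  shows "inj_on f (carrier M) \<longleftrightarrow> (\<forall>x\<in>carrier M. f x = \<zero>\<^bsub>N\<^esub> \<longrightarrow> x = \<zero>\<^bsub>M\<^esub>)"
proof -
  interpret M: lmodule R M by fact
  interpret N: lmodule R N by fact
  note f = assms(3) and [simp] = hom_closed[OF assms(3)] hom_zero[OF assms]
  show ?thesis
  proof
    assume "inj_on f (carrier M)"
    then show "\<forall>x\<in>carrier M. f x = \<zero>\<^bsub>N\<^esub> \<longrightarrow> x = \<zero>\<^bsub>M\<^esub>"
      by (metis M.zero_closed assms hom_zero inj_onD)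
  next
    assume *: "\<forall>x\<in>carrier M. f x = \<zero>\<^bsub>N\<^esub> \<longrightarrow> x = \<zero>\<^bsub>M\<^esub>"
    show "inj_on f (carrier M)"
    proof (rule inj_onI)
      fix x y assume x: "x \<in> carrier M" and y: "y \<in> carrier M" and "f x = f y"
      then have "f (x \<ominus>\<^bsub>M\<^esub> y) = \<zero>\<^bsub>N\<^esub>"
        using hom_diff[OF assms x y] by (simp add: N.diff_eq_zero_iff)
      then show "x = y" using * x y M.diff_eq_zero_iff by auto
    qed
  qed
qed

lemma hom_compose:
  assumes "lmodule R M" "f \<in> hom_set R M N" "g \<in> hom_set R N P"
  shows "compose (carrier M) g f \<in> hom_set R M P"
  using hom_closed[OF assms(2)] hom_closed[OF assms(3)] hom_add[OF assms(2)] hom_add[OF assms(3)]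
    hom_smult[OF assms(2)] hom_smult[OF assms(3)]
  unfolding compose_def by (intro hom_restrictI[OF assms(1)]) auto

lemma hom_id: "lmodule R M \<Longrightarrow> (\<lambda>x\<in>carrier M. x) \<in> hom_set R M M"
  by (rule hom_restrictI) auto

lemma hom_incl: "\<lbrakk>lmodule R M; submodule K R M\<rbrakk> \<Longrightarrow> (\<lambda>x\<in>K. x) \<in> hom_set R (submod M K) M"
  using hom_restrictI[OF lmodule_submod, of R M K "\<lambda>x. x" M] submodule_mem[of K R M] by auto

lemma hom_restrict_submod:
  assumes "lmodule R M" "submodule K R M" "f \<in> hom_set R M N"
  shows "restrict f K \<in> hom_set R (submod M K) N"
  using hom_restrictI[OF lmodule_submod[OF assms(1,2)], of f N] submodule_mem[OF assms(2)]
    hom_closed[OF assms(3)] hom_add[OF assms(3)] hom_smult[OF assms(3)] by auto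

lemma hom_to_submod:
  "\<lbrakk>f \<in> hom_set R M N; f ` carrier M \<subseteq> K\<rbrakk> \<Longrightarrow> f \<in> hom_set R M (submod N K)"
  by (auto simp: hom_set_def)

lemma hom_from_submod:
  "\<lbrakk>f \<in> hom_set R M (submod N K); K \<subseteq> carrier N\<rbrakk> \<Longrightarrow> f \<in> hom_set R M N"
  by (auto simp: hom_set_def)

lemma submodule_image:
  assumes "lmodule R M" "lmodule R N" "f \<in> hom_set R M N" "submodule K R M"
  shows "submodule (f ` K) R N"
proof -
  interpret M: lmodule R M by fact
  interpret N: lmodule R N by fact
  note [simp] = submodule_mem[OF assms(4)]
  show ?thesis
  proof (rule N.submoduleI)
    show "f ` K \<subseteq> carrier N" using hom_closed[OF assms(3)] by auto
    show "\<zero>\<^bsub>N\<^esub> \<in> f ` K"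
      using hom_zero[OF assms(1-3)] submodule_zero_mem[OF assms(4)] by (metis imageI)
    show "x \<oplus>\<^bsub>N\<^esub> y \<in> f ` K" if "x \<in> f ` K" "y \<in> f ` K" for x y
      using that submodule_add[OF assms(4)] hom_add[OF assms(3)]
      by (smt (verit) image_iff submodule_mem[OF assms(4)])
    show "r \<odot>\<^bsub>N\<^esub> x \<in> f ` K" if "r \<in> carrier R" "x \<in> f ` K" for r x
      using that submodule_smult[OF assms(4)] hom_smult[OF assms(3)]
      by (smt (verit) image_iff submodule_mem[OF assms(4)])
  qed
qed

lemma submodule_vimage:
  assumes "lmodule R M" "lmodule R N" "f \<in> hom_set R M N" "submodule K R N"
  shows "submodule {x \<in> carrier M. f x \<in> K} R M"
proof -
  interpret M: lmodule R M by fact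
  interpret N: lmodule R N by fact
  show ?thesis
    using hom_add[OF assms(3)] hom_smult[OF assms(3)] submodule_add[OF assms(4)]
      submodule_smult[OF assms(4)] submodule_zero_mem[OF assms(4)] hom_zero[OF assms(1-3)]
    by (intro M.submoduleI) (auto simp: M.smult_closed)
qed

lemma submodule_mker:
  assumes "lmodule R M" "lmodule R N" "f \<in> hom_set R M N"
  shows "submodule (mker M N f) R M"
  using submodule_vimage[OF assms lmodule.submodule_zero[OF assms(2)]] by (simp add: mker_def)

lemma submodule_Int: "\<lbrakk>lmodule R M; submodule K R M; submodule K' R M\<rbrakk> \<Longrightarrow> submodule (K \<inter> K') R M"
  using submodule_subset[of K] 
  by (intro lmodule.submoduleI) (auto intro: submodule_add submodule_smult submodule_zero_mem)

lemma mem_set_add: "x \<in> A <+>\<^bsub>M\<^esub> B \<longleftrightarrow> (\<exists>a\<in>A. \<exists>b\<in>B. x = a \<oplus>\<^bsub>M\<^esub> b)"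
  by (auto simp: set_add_def')

lemma submodule_set_add:
  assumes "lmodule R M" "submodule K R M" "submodule K' R M"
  shows "submodule (K <+>\<^bsub>M\<^esub> K') R M"
proof -
  interpret lmodule R M by fact
  note [simp] = submodule_mem[OF assms(2)] submodule_mem[OF assms(3)]
  show ?thesis
  proof (rule submoduleI)
    show "K <+>\<^bsub>M\<^esub> K' \<subseteq> carrier M" by (auto simp: mem_set_add)
    show "\<zero>\<^bsub>M\<^esub> \<in> K <+>\<^bsub>M\<^esub> K'"
      using submodule_zero_mem[OF assms(2)] submodule_zero_mem[OF assms(3)]
      unfolding mem_set_add by (intro bexI[of _ "\<zero>\<^bsub>M\<^esub>"]) simp_all
    show "x \<oplus>\<^bsub>M\<^esub> y \<in> K <+>\<^bsub>M\<^esub> K'" if xy: "x \<in> K <+>\<^bsub>M\<^esub> K'" "y \<in> K <+>\<^bsub>M\<^esub> K'" for x y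
    proof -
      obtain a b a' b' where *: "a \<in> K" "a' \<in> K" "b \<in> K'" "b' \<in> K'" "x = a \<oplus>\<^bsub>M\<^esub> b" "y = a' \<oplus>\<^bsub>M\<^esub> b'"
        using xy unfolding mem_set_add by blast
      then have "x \<oplus>\<^bsub>M\<^esub> y = (a \<oplus>\<^bsub>M\<^esub> a') \<oplus>\<^bsub>M\<^esub> (b \<oplus>\<^bsub>M\<^esub> b')"
        by (simp add: M.a_ac)
      then show ?thesis
        using * submodule_add[OF assms(2)] submodule_add[OF assms(3)] unfolding mem_set_add by blast
    qed
    show "r \<odot>\<^bsub>M\<^esub> x \<in> K <+>\<^bsub>M\<^esub> K'" if rx: "r \<in> carrier R" "x \<in> K <+>\<^bsub>M\<^esub> K'" for r x
    proof -
      obtain a b where *: "a \<in> K" "b \<in> K'" "x = a \<oplus>\<^bsub>M\<^esub> b"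
        using rx unfolding mem_set_add by blast
      then have "r \<odot>\<^bsub>M\<^esub> x = r \<odot>\<^bsub>M\<^esub> a \<oplus>\<^bsub>M\<^esub> r \<odot>\<^bsub>M\<^esub> b"
        using rx by (simp add: smult_r_distr)
      then show ?thesis
        using * rx submodule_smult[OF assms(2)] submodule_smult[OF assms(3)] unfolding mem_set_add by blast
    qed
  qed
qed

lemma set_add_upper:
  assumes "lmodule R M" "submodule K R M" "submodule K' R M"
  shows "K \<subseteq> K <+>\<^bsub>M\<^esub> K'" "K' \<subseteq> K <+>\<^bsub>M\<^esub> K'"
proof -
  interpret lmodule R M by fact
  show "K \<subseteq> K <+>\<^bsub>M\<^esub> K'"
  proof
    fix x assume "x \<in> K"
    moreover have "x = x \<oplus>\<^bsub>M\<^esub> \<zero>\<^bsub>M\<^esub>" using submodule_mem[OF assms(2) \<open>x \<in> K\<close>] by simp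
    ultimately show "x \<in> K <+>\<^bsub>M\<^esub> K'"
      using submodule_zero_mem[OF assms(3)] unfolding mem_set_add by blast
  qed
  show "K' \<subseteq> K <+>\<^bsub>M\<^esub> K'"
  proof
    fix x assume "x \<in> K'"
    moreover have "x = \<zero>\<^bsub>M\<^esub> \<oplus>\<^bsub>M\<^esub> x" using submodule_mem[OF assms(3) \<open>x \<in> K'\<close>] by simp
    ultimately show "x \<in> K <+>\<^bsub>M\<^esub> K'"
      using submodule_zero_mem[OF assms(2)] unfolding mem_set_add by blast
  qed
qed

lemma set_add_least: "\<lbrakk>submodule J R M; K \<subseteq> J; K' \<subseteq> J\<rbrakk> \<Longrightarrow> K <+>\<^bsub>M\<^esub> K' \<subseteq> J"
  by (auto simp: mem_set_add intro!: submodule_add[of J])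

definition multiples :: "'a ring \<Rightarrow> ('a, 'm) module \<Rightarrow> 'm \<Rightarrow> 'm set" where
  "multiples R M x = (\<lambda>r. r \<odot>\<^bsub>M\<^esub> x) ` carrier R"

lemma submodule_multiples:
  assumes "lmodule R M" "x \<in> carrier M"
  shows "submodule (multiples R M x) R M"
proof -
  interpret lmodule R M by fact
  have "(\<lambda>r\<in>carrier (regular R). r \<odot>\<^bsub>M\<^esub> x) \<in> hom_set R (regular R) M"
    using assms(2) lmodule_regular[OF R.ring_axioms]
    by (intro hom_restrictI) (auto simp: smult_closed smult_l_distr smult_assoc)
  from submodule_image[OF _ assms(1) this lmodule.submodule_carrier] lmodule_regular[OF R.ring_axioms]
  show ?thesis by (simp add: multiples_def)
qed

lemma mem_multiples: "\<lbrakk>lmodule R M; x \<in> carrier M\<rbrakk> \<Longrightarrow> x \<in> multiples R M x"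
  unfolding multiples_def
  by (metis (no_types, lifting) image_eqI lmodule.axioms(1) lmodule.smult_one ring.ring_simprules(6))

subsection \<open>Isomorphisms and transport of structure\<close>

text \<open>This is \<open>mod_iso\<close> with its witness exposed: commuting squares and the
  transport of submodules need the map itself.\<close>

definition mod_isom :: "'a ring \<Rightarrow> ('a, 'm) module \<Rightarrow> ('a, 'n) module \<Rightarrow> ('m \<Rightarrow> 'n) \<Rightarrow> bool" where
  "mod_isom R M N f \<longleftrightarrow> f \<in> hom_set R M N \<and> bij_betw f (carrier M) (carrier N)"

lemma mod_iso_iff: "mod_iso R M N \<longleftrightarrow> (\<exists>f. mod_isom R M N f)"
  by (auto simp: mod_iso_def mod_isom_def)

lemma mod_isom_comp:
  assumes "lmodule R M" "mod_isom R M N f" "mod_isom R N P g"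
  shows "mod_isom R M P (compose (carrier M) g f)"
  using assms hom_compose[of R M f N g P] bij_betw_trans[of f "carrier M" "carrier N" g "carrier P"]
  by (auto simp: mod_isom_def compose_def cong: bij_betw_cong)

lemma mod_isom_inv:
  assumes "lmodule R M" "lmodule R N" "mod_isom R M N f"
  obtains g where "mod_isom R N M g" "\<And>x. x \<in> carrier M \<Longrightarrow> g (f x) = x"
    "\<And>y. y \<in> carrier N \<Longrightarrow> f (g y) = y"
proof -
  interpret M: lmodule R M by fact
  interpret N: lmodule R N by fact
  have f: "f \<in> hom_set R M N" and b: "bij_betw f (carrier M) (carrier N)"
    using assms by (auto simp: mod_isom_def)
  define h where "h = inv_into (carrier M) f"
  have hf [simp]: "h (f x) = x" if "x \<in> carrier M" for x
    using b that by (simp add: h_def bij_betw_inv_into_left)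
  have fh [simp]: "f (h y) = y" if "y \<in> carrier N" for y
    using b that by (simp add: h_def bij_betw_inv_into_right)
  have h: "bij_betw h (carrier N) (carrier M)"
    unfolding h_def by (rule bij_betw_inv_into[OF b])
  then have hc [simp]: "h y \<in> carrier M" if "y \<in> carrier N" for y
    using that by (auto dest: bij_betwE)
  have "restrict h (carrier N) \<in> hom_set R N M"
  proof (rule hom_restrictI[OF assms(2)])
    fix x y assume "x \<in> carrier N" "y \<in> carrier N"
    then show "h (x \<oplus>\<^bsub>N\<^esub> y) = h x \<oplus>\<^bsub>M\<^esub> h y"
      using hf[of "h x \<oplus>\<^bsub>M\<^esub> h y"] hom_add[OF f, of "h x" "h y"] by simp
  next
    fix r y assume "r \<in> carrier R" "y \<in> carrier N"
    then show "h (r \<odot>\<^bsub>N\<^esub> y) = r \<odot>\<^bsub>M\<^esub> h y"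
      using hf[of "r \<odot>\<^bsub>M\<^esub> h y"] hom_smult[OF f, of r "h y"] by (simp add: M.smult_closed)
  qed simp
  moreover have "bij_betw (restrict h (carrier N)) (carrier N) (carrier M)"
    using h by (simp cong: bij_betw_cong)
  ultimately show ?thesis
    using that[of "restrict h (carrier N)"] hom_closed[OF f] by (auto simp: mod_isom_def)
qed

lemma mod_iso_sym: "\<lbrakk>lmodule R M; lmodule R N; mod_iso R M N\<rbrakk> \<Longrightarrow> mod_iso R N M"
  by (metis mod_iso_iff mod_isom_inv)

lemma mod_iso_trans: "\<lbrakk>lmodule R M; mod_iso R M N; mod_iso R N P\<rbrakk> \<Longrightarrow> mod_iso R M P"
  by (metis mod_iso_iff mod_isom_comp)

text \<open>Copies a module along a map that is injective on its carrier. It brings modules of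
  foreign types, such as duals, into \<open>nat \<Rightarrow> 'a\<close>, the type in which test
  modules and chosen presentations live.\<close>

definition transport :: "('a, 'm) module \<Rightarrow> ('m \<Rightarrow> 'k) \<Rightarrow> ('a, 'k) module" where
  "transport M c = \<lparr>carrier = c ` carrier M, monoid.mult = undefined, monoid.one = undefined,
     ring.zero = c \<zero>\<^bsub>M\<^esub>,
     add = (\<lambda>x y. c (inv_into (carrier M) c x \<oplus>\<^bsub>M\<^esub> inv_into (carrier M) c y)),
     smult = (\<lambda>r x. c (r \<odot>\<^bsub>M\<^esub> inv_into (carrier M) c x))\<rparr>"

lemma
  assumes "lmodule R M" "inj_on c (carrier M)"
  shows lmodule_transport: "lmodule R (transport M c)"
    and mod_isom_transport: "mod_isom R M (transport M c) (restrict c (carrier M))"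
proof -
  interpret M: lmodule R M by fact
  have [simp]: "inv_into (carrier M) c (c x) = x" if "x \<in> carrier M" for x
    using assms(2) that by (rule inv_into_f_f)
  have [simp]: "carrier (transport M c) = c ` carrier M" "\<zero>\<^bsub>transport M c\<^esub> = c \<zero>\<^bsub>M\<^esub>"
    "\<And>x y. x \<oplus>\<^bsub>transport M c\<^esub> y = c (inv_into (carrier M) c x \<oplus>\<^bsub>M\<^esub> inv_into (carrier M) c y)"
    "\<And>r x. r \<odot>\<^bsub>transport M c\<^esub> x = c (r \<odot>\<^bsub>M\<^esub> inv_into (carrier M) c x)"
    by (auto simp: transport_def)
  show "lmodule R (transport M c)"
    by (rule lmoduleI)
      (auto simp: M.R.ring_axioms M.a_ac M.smult_l_distr M.smult_r_distr M.smult_assoc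
        M.smult_one M.smult_closed)
  show "mod_isom R M (transport M c) (restrict c (carrier M))"
    using assms(2) unfolding mod_isom_def
    by (auto intro!: hom_restrictI[OF assms(1)] simp: bij_betw_def)
qed

text \<open>The homomorphism theorem for an arbitrary surjection in place of the projection to a
  quotient. Elements with the same image under \<open>q\<close> differ by an element of its kernel,
  so \<open>f\<close> is constant on the fibres and \<open>g\<close> can be read off from any
  section of \<open>q\<close>.\<close>

lemma hom_factor:
  assumes "lmodule R X" "lmodule R Y" "lmodule R Z"
    and "q \<in> hom_set R X Y" "q ` carrier X = carrier Y" "f \<in> hom_set R X Z"
    and "\<And>x. \<lbrakk>x \<in> carrier X; q x = \<zero>\<^bsub>Y\<^esub>\<rbrakk> \<Longrightarrow> f x = \<zero>\<^bsub>Z\<^esub>"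
  obtains g where "g \<in> hom_set R Y Z" "\<And>x. x \<in> carrier X \<Longrightarrow> g (q x) = f x"
proof -
  interpret X: lmodule R X by fact
  interpret Y: lmodule R Y by fact
  interpret Z: lmodule R Z by fact
  define s where "s = inv_into (carrier X) q"
  have s: "s y \<in> carrier X" "q (s y) = y" if "y \<in> carrier Y" for y
    using that assms(5) by (metis s_def inv_into_into, metis s_def f_inv_into_f)
  have eq: "f x = f x'" if "x \<in> carrier X" "x' \<in> carrier X" "q x = q x'" for x x'
  proof -
    have "q (x \<ominus>\<^bsub>X\<^esub> x') = \<zero>\<^bsub>Y\<^esub>"
      using that hom_diff[OF assms(1,2,4)] hom_closed[OF assms(4)] by (simp add: Y.diff_eq_zero_iff)
    then have "f (x \<ominus>\<^bsub>X\<^esub> x') = \<zero>\<^bsub>Z\<^esub>"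
      using assms(7) that by simp
    then show ?thesis
      using that hom_diff[OF assms(1,3,6)] hom_closed[OF assms(6)] by (simp add: Z.diff_eq_zero_iff)
  qed
  have "(\<lambda>y\<in>carrier Y. f (s y)) \<in> hom_set R Y Z"
  proof (rule hom_restrictI[OF assms(2)])
    show "f (s y) \<in> carrier Z" if "y \<in> carrier Y" for y
      using s that hom_closed[OF assms(6)] by blast
    show "f (s (x \<oplus>\<^bsub>Y\<^esub> y)) = f (s x) \<oplus>\<^bsub>Z\<^esub> f (s y)" if "x \<in> carrier Y" "y \<in> carrier Y" for x y
      using that s hom_add[OF assms(4)] hom_add[OF assms(6)]
        eq[of "s (x \<oplus>\<^bsub>Y\<^esub> y)" "s x \<oplus>\<^bsub>X\<^esub> s y"] by simp
    show "f (s (r \<odot>\<^bsub>Y\<^esub> x)) = r \<odot>\<^bsub>Z\<^esub> f (s x)" if "r \<in> carrier R" "x \<in> carrier Y" for r x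
      using that s hom_smult[OF assms(4)] hom_smult[OF assms(6)]
        eq[of "s (r \<odot>\<^bsub>Y\<^esub> x)" "r \<odot>\<^bsub>X\<^esub> s x"] by (simp add: X.smult_closed Y.smult_closed)
  qed
  moreover have "(\<lambda>y\<in>carrier Y. f (s y)) (q x) = f x" if x: "x \<in> carrier X" for x
    using eq[OF s(1) x s(2)] hom_closed[OF assms(4) x] by simp
  ultimately show ?thesis using that by blast
qed

subsection \<open>Quotient modules\<close>

locale lmodule_sub = lmodule + fixes N assumes N: "submodule N R M"
begin

sublocale abelian_subgroup N M
  using N by (intro abelian_subgroupI3 additive_subgroup.intro M.abelian_group_axioms)
    (auto dest: submodule.axioms(1))

lemma coset_eq_iff:
  assumes "x \<in> carrier M" "y \<in> carrier M"
  shows "N +>\<^bsub>M\<^esub> x = N +>\<^bsub>M\<^esub> y \<longleftrightarrow> x \<ominus>\<^bsub>M\<^esub> y \<in> N"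
proof
  assume "N +>\<^bsub>M\<^esub> x = N +>\<^bsub>M\<^esub> y"
  then have "x \<in> N +>\<^bsub>M\<^esub> y" using a_rcos_self[OF assms(1)] by simp
  then show "x \<ominus>\<^bsub>M\<^esub> y \<in> N" using a_rcos_module[OF assms(2,1)] by (simp add: a_minus_def)
next
  assume "x \<ominus>\<^bsub>M\<^esub> y \<in> N"
  then have "x \<in> N +>\<^bsub>M\<^esub> y" using a_rcos_module[OF assms(2,1)] by (simp add: a_minus_def)
  then show "N +>\<^bsub>M\<^esub> x = N +>\<^bsub>M\<^esub> y" using a_repr_independence'[OF _ assms(2)] by metis
qed

text \<open>Representatives of one coset differ by an element of \<open>N\<close>, and
  \<open>N\<close> is stable under \<open>r\<close>; the union in \<open>quot_mod\<close> is thus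
  taken over copies of a single coset.\<close>

lemma quot_smult:
  assumes "r \<in> carrier R" "x \<in> carrier M"
  shows "(\<Union>y\<in>N +>\<^bsub>M\<^esub> x. N +>\<^bsub>M\<^esub> (r \<odot>\<^bsub>M\<^esub> y)) = N +>\<^bsub>M\<^esub> (r \<odot>\<^bsub>M\<^esub> x)"
proof -
  have "N +>\<^bsub>M\<^esub> (r \<odot>\<^bsub>M\<^esub> y) = N +>\<^bsub>M\<^esub> (r \<odot>\<^bsub>M\<^esub> x)" if y: "y \<in> N +>\<^bsub>M\<^esub> x" for y
  proof -
    have yM: "y \<in> carrier M"
      using y a_elemrcos_carrier[OF assms(2)] by blast
    have "y \<ominus>\<^bsub>M\<^esub> x \<in> N" using y a_rcos_module[OF assms(2) yM] by (simp add: a_minus_def)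
    then have "r \<odot>\<^bsub>M\<^esub> (y \<ominus>\<^bsub>M\<^esub> x) \<in> N" using submodule_smult[OF N assms(1)] by simp
    moreover have "r \<odot>\<^bsub>M\<^esub> (\<ominus>\<^bsub>M\<^esub> x) = \<ominus>\<^bsub>M\<^esub> (r \<odot>\<^bsub>M\<^esub> x)"
      using smult_r_distr[OF assms(1), of x "\<ominus>\<^bsub>M\<^esub> x"] assms smult_closed
      by (metis M.a_inv_closed M.minus_equality M.a_comm M.r_neg smult_zero_right)
    then have "r \<odot>\<^bsub>M\<^esub> (y \<ominus>\<^bsub>M\<^esub> x) = r \<odot>\<^bsub>M\<^esub> y \<ominus>\<^bsub>M\<^esub> r \<odot>\<^bsub>M\<^esub> x"
      using assms yM by (simp add: a_minus_def smult_r_distr)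
    ultimately show ?thesis using coset_eq_iff assms yM smult_closed by simp
  qed
  then have "(\<Union>y\<in>N +>\<^bsub>M\<^esub> x. N +>\<^bsub>M\<^esub> (r \<odot>\<^bsub>M\<^esub> y)) = (\<Union>y\<in>N +>\<^bsub>M\<^esub> x. N +>\<^bsub>M\<^esub> (r \<odot>\<^bsub>M\<^esub> x))"
    by (rule SUP_cong[OF refl])
  then show ?thesis using a_rcos_self[OF assms(2)] by (simp only: UN_constant) auto
qed

lemma quot_mod_simps [simp]:
  "carrier (quot_mod M N) = (\<lambda>x. N +>\<^bsub>M\<^esub> x) ` carrier M" "\<zero>\<^bsub>quot_mod M N\<^esub> = N +>\<^bsub>M\<^esub> \<zero>\<^bsub>M\<^esub>"
  "\<lbrakk>x \<in> carrier M; y \<in> carrier M\<rbrakk> \<Longrightarrow> (N +>\<^bsub>M\<^esub> x) \<oplus>\<^bsub>quot_mod M N\<^esub> (N +>\<^bsub>M\<^esub> y) = N +>\<^bsub>M\<^esub> (x \<oplus>\<^bsub>M\<^esub> y)"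
  "\<lbrakk>r \<in> carrier R; x \<in> carrier M\<rbrakk> \<Longrightarrow> r \<odot>\<^bsub>quot_mod M N\<^esub> (N +>\<^bsub>M\<^esub> x) = N +>\<^bsub>M\<^esub> (r \<odot>\<^bsub>M\<^esub> x)"
proof -
  show "\<zero>\<^bsub>quot_mod M N\<^esub> = N +>\<^bsub>M\<^esub> \<zero>\<^bsub>M\<^esub>"
    using M.a_coset_add_zero[OF submodule_subset[OF N]] by (simp add: quot_mod_def)
qed (auto simp: quot_mod_def A_RCOSETS_def' a_rcos_sum quot_smult)

lemma lmodule_quot_mod: "lmodule R (quot_mod M N)"
  by (rule lmoduleI)
    (auto simp: R.ring_axioms M.a_ac smult_l_distr smult_r_distr smult_assoc smult_one smult_closed)

definition proj where "proj = (\<lambda>x\<in>carrier M. N +>\<^bsub>M\<^esub> x)"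

lemma proj_hom: "proj \<in> hom_set R M (quot_mod M N)"
  unfolding proj_def by (rule hom_restrictI[OF lmodule_axioms]) auto

lemma proj_image: "proj ` carrier M = carrier (quot_mod M N)"
  by (simp add: proj_def)

lemma proj_eq_zero: "x \<in> carrier M \<Longrightarrow> proj x = \<zero>\<^bsub>quot_mod M N\<^esub> \<longleftrightarrow> x \<in> N"
  by (simp add: proj_def coset_eq_iff a_minus_def minus_eq_smult)

end

lemma lmodule_subI: "\<lbrakk>lmodule R M; submodule N R M\<rbrakk> \<Longrightarrow> lmodule_sub R M N"
  by (simp add: lmodule_sub_def lmodule_sub_axioms_def)

lemma lmodule_coker:
  assumes "lmodule R M" "lmodule R N" "f \<in> hom_set R M N"
  shows "lmodule R (coker M N f)"
  unfolding coker_def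
  by (intro lmodule_sub.lmodule_quot_mod lmodule_subI submodule_image[OF assms] assms
      lmodule.submodule_carrier)

text \<open>Since \<alpha> is onto, \<beta> maps the image of \<open>f\<close> exactly onto the
  image of \<open>f'\<close>. Hence \<beta> followed by the projection has the image of
  \<open>f\<close> as its kernel, and the induced map of cokernels is injective as well as
  surjective.\<close>

lemma coker_iso:
  assumes M: "lmodule R M" "lmodule R N" "lmodule R M'" "lmodule R N'"
    and f: "f \<in> hom_set R M N" "f' \<in> hom_set R M' N'"
    and iso: "mod_isom R M M' \<alpha>" "mod_isom R N N' \<beta>"
    and comm: "\<And>x. x \<in> carrier M \<Longrightarrow> \<beta> (f x) = f' (\<alpha> x)"
  shows "mod_iso R (coker M N f) (coker M' N' f')"
proof -
  interpret N: lmodule R N by fact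
  interpret N': lmodule R N' by fact
  define K where "K = f ` carrier M"
  define K' where "K' = f' ` carrier M'"
  interpret Q: lmodule_sub R N K
    using submodule_image[OF M(1,2) f(1) lmodule.submodule_carrier[OF M(1)]] M
    by (simp add: K_def lmodule_subI)
  interpret Q': lmodule_sub R N' K'
    using submodule_image[OF M(3,4) f(2) lmodule.submodule_carrier[OF M(3)]] M
    by (simp add: K'_def lmodule_subI)
  have \<alpha>: "\<alpha> ` carrier M = carrier M'" and \<beta>: "\<beta> \<in> hom_set R N N'" "\<beta> ` carrier N = carrier N'"
    and \<beta>inj: "inj_on \<beta> (carrier N)"
    using iso by (auto simp: mod_isom_def bij_betw_def)
  have K': "K' = \<beta> ` K"
    unfolding K_def K'_def \<alpha>[symmetric] image_image using comm by auto
  define h where "h = compose (carrier N) Q'.proj \<beta>"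
  have h: "h \<in> hom_set R N (quot_mod N' K')"
    unfolding h_def by (rule hom_compose[OF M(2) \<beta>(1) Q'.proj_hom])
  have hx: "h x = \<zero>\<^bsub>quot_mod N' K'\<^esub> \<longleftrightarrow> x \<in> K" if "x \<in> carrier N" for x
  proof -
    have "h x = \<zero>\<^bsub>quot_mod N' K'\<^esub> \<longleftrightarrow> \<beta> x \<in> K'"
      unfolding h_def using that hom_closed[OF \<beta>(1)] Q'.proj_eq_zero by (simp add: compose_def)
    also have "\<dots> \<longleftrightarrow> x \<in> K"
      using that submodule_subset[OF Q.N] \<beta>inj unfolding K' by (metis inj_on_image_mem_iff)
    finally show ?thesis .
  qed
  obtain g where g: "g \<in> hom_set R (quot_mod N K) (quot_mod N' K')"
    "\<And>x. x \<in> carrier N \<Longrightarrow> g (Q.proj x) = h x"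
    using hom_factor[OF M(2) Q.lmodule_quot_mod Q'.lmodule_quot_mod Q.proj_hom Q.proj_image h]
      hx Q.proj_eq_zero by metis
  have "g ` carrier (quot_mod N K) = h ` carrier N"
    using g(2) unfolding Q.proj_image[symmetric] image_image by simp
  also have "\<dots> = Q'.proj ` \<beta> ` carrier N"
    by (simp add: h_def compose_def image_image)
  also have "\<dots> = carrier (quot_mod N' K')"
    unfolding \<beta>(2) by (rule Q'.proj_image)
  finally have "g ` carrier (quot_mod N K) = carrier (quot_mod N' K')" .
  moreover have "inj_on g (carrier (quot_mod N K))"
    unfolding hom_inj_iff[OF Q.lmodule_quot_mod Q'.lmodule_quot_mod g(1)]
    using g(2) hx Q.proj_eq_zero unfolding Q.proj_image[symmetric] by (metis (no_types, lifting) imageE)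
  ultimately show ?thesis
    using g(1) unfolding mod_iso_def coker_def K_def[symmetric] K'_def[symmetric] bij_betw_def by blast
qed

subsection \<open>Baer's criterion\<close>

text \<open>The part of Baer's criterion that uses test modules: the map extends to the whole ring,
  and \<open>e\<close> is the image of \<one> under the extension.\<close>

lemma injective_regular:
  fixes I :: "('a, 'i) module"
  assumes "injective R I" "submodule J R (regular R)" "h \<in> hom_set R (submod (regular R) J) I"
  obtains e where "e \<in> carrier I" "\<And>r. r \<in> J \<Longrightarrow> h r = r \<odot>\<^bsub>I\<^esub> e"
proof -
  interpret I: lmodule R I using assms(1) by (simp add: injective_def)
  have reg: "lmodule R (regular R)" by (rule lmodule_regular[OF I.R.ring_axioms])
  have J: "lmodule R (submod (regular R) J)" by (rule lmodule_submod[OF reg assms(2)])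
  \<comment> \<open>Constant sequences embed the scalars into \<open>nat \<Rightarrow> 'a\<close>,
    so that the ideal and the ring become test modules for \<open>injective\<close>.\<close>
  define c where "c = (\<lambda>r::'a. \<lambda>_::nat. r)"
  define X where "X = transport (submod (regular R) J) c"
  define Y where "Y = transport (regular R) c"
  have inj: "inj_on c A" for A by (auto simp: c_def inj_on_def fun_eq_iff)
  have X: "lmodule R X" and cX: "mod_isom R (submod (regular R) J) X (restrict c J)"
    using lmodule_transport[OF J inj] mod_isom_transport[OF J inj] by (auto simp: X_def)
  have Y: "lmodule R Y" and cY: "mod_isom R (regular R) Y (restrict c (carrier R))"
    using lmodule_transport[OF reg inj] mod_isom_transport[OF reg inj] by (auto simp: Y_def)
  obtain d where d: "mod_isom R X (submod (regular R) J) d" "\<And>r. r \<in> J \<Longrightarrow> d (c r) = r"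
    using mod_isom_inv[OF J X cX] by (metis restrict_apply' submod_simps(1))
  define u where "u = compose (carrier X) (restrict c (carrier R)) (compose (carrier X) (\<lambda>r\<in>J. r) d)"
  have dh: "d \<in> hom_set R X (submod (regular R) J)" and dinj: "inj_on d (carrier X)"
    using d by (auto simp: mod_isom_def bij_betw_def)
  have cYh: "restrict c (carrier R) \<in> hom_set R (regular R) Y"
    using cY by (simp add: mod_isom_def)
  have JR: "J \<subseteq> carrier R" using submodule_subset[OF assms(2)] by simp
  have u: "u \<in> hom_set R X Y"
    unfolding u_def by (rule hom_compose[OF X hom_compose[OF X dh hom_incl[OF reg assms(2)]] cYh])
  have uc: "u x = c (d x)" if "x \<in> carrier X" for x
    using that hom_closed[OF dh] JR by (auto simp: u_def compose_def)
  have "inj_on u (carrier X)"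
    using dinj unfolding inj_on_def by (metis uc inj UNIV_I inj_onD)
  then obtain g where g: "g \<in> hom_set R Y I"
    "\<And>x. x \<in> carrier X \<Longrightarrow> g (u x) = compose (carrier X) h d x"
    using assms(1)[unfolded injective_def, THEN conjunct2, rule_format, OF X Y u _ hom_compose[OF X dh assms(3)]]
    by blast
  have one: "c \<one>\<^bsub>R\<^esub> \<in> carrier Y"
    using hom_closed[OF cYh, of "\<one>\<^bsub>R\<^esub>"] by simp
  show ?thesis
  proof (rule that[of "g (c \<one>\<^bsub>R\<^esub>)"])
    show "g (c \<one>\<^bsub>R\<^esub>) \<in> carrier I" using hom_closed[OF g(1) one] .
    fix r assume r: "r \<in> J"
    then have rR: "r \<in> carrier R" using JR by auto
    have cr: "c r \<in> carrier X"
      using cX r by (auto simp: mod_isom_def bij_betw_def)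
    have "h r = g (u (c r))"
      using g(2)[OF cr] cr d(2)[OF r] by (simp add: compose_def)
    also have "u (c r) = c r" using uc[OF cr] d(2)[OF r] by simp
    also have "c r = r \<odot>\<^bsub>Y\<^esub> c \<one>\<^bsub>R\<^esub>"
      using hom_smult[OF cYh, of r "\<one>\<^bsub>R\<^esub>"] rR by simp
    finally show "h r = r \<odot>\<^bsub>I\<^esub> g (c \<one>\<^bsub>R\<^esub>)"
      using hom_smult[OF g(1) rR one] by simp
  qed
qed

text \<open>Baer's criterion proper. Here \<open>Y\<close> may have any type, whereas the definition
  of \<open>injective\<close> tests carriers in \<open>nat \<Rightarrow> 'a\<close>.\<close>

lemma injective_extend:
  fixes I :: "('a, 'i) module" and Y :: "('a, 'y) module"
  assumes inj: "injective R I" and Y: "lmodule R Y" and X: "submodule X R Y"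
    and f: "f \<in> hom_set R (submod Y X) I"
  obtains g where "g \<in> hom_set R Y I" "\<And>x. x \<in> X \<Longrightarrow> g x = f x"
proof -
  interpret I: lmodule R I using inj by (simp add: injective_def)
  interpret Y: lmodule R Y by fact
  have reg: "lmodule R (regular R)" by (rule lmodule_regular[OF I.R.ring_axioms])
  \<comment> \<open>Partial extensions of \<open>f\<close> are kept as graphs closed under the
    module operations. Their order is inclusion, and the upper bound of a chain is its union, with
    no domains to match.\<close>
  define \<A> where "\<A> = {G. G \<subseteq> carrier Y \<times> carrier I \<and> (\<forall>x\<in>X. (x, f x) \<in> G) \<and>
    (\<forall>x a y b. (x, a) \<in> G \<longrightarrow> (y, b) \<in> G \<longrightarrow> (x \<oplus>\<^bsub>Y\<^esub> y, a \<oplus>\<^bsub>I\<^esub> b) \<in> G) \<and>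
    (\<forall>r\<in>carrier R. \<forall>x a. (x, a) \<in> G \<longrightarrow> (r \<odot>\<^bsub>Y\<^esub> x, r \<odot>\<^bsub>I\<^esub> a) \<in> G) \<and>
    (\<forall>x a b. (x, a) \<in> G \<longrightarrow> (x, b) \<in> G \<longrightarrow> a = b)}"
  have fc: "f x \<in> carrier I" if "x \<in> X" for x using hom_closed[OF f] that by simp
  have "(\<lambda>x. (x, f x)) ` X \<in> \<A>"
    unfolding \<A>_def using fc submodule_mem[OF X] hom_add[OF f] hom_smult[OF f]
      submodule_add[OF X] submodule_smult[OF X] by (auto simp: image_iff)
  then have ne: "\<A> \<noteq> {}" by blast
  have chain: "\<Union>\<C> \<in> \<A>" if C: "\<C> \<noteq> {}" "subset.chain \<A> \<C>" for \<C>
  proof -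
    have sub: "\<C> \<subseteq> \<A>" using C by (simp add: subset.chain_def)
    have tot: "\<exists>G\<in>\<C>. p \<in> G \<and> q \<in> G" if pq: "p \<in> \<Union>\<C>" "q \<in> \<Union>\<C>" for p q
    proof -
      obtain G H where GH: "G \<in> \<C>" "p \<in> G" "H \<in> \<C>" "q \<in> H" using pq by blast
      then have "G \<subseteq> H \<or> H \<subseteq> G" using C(2) unfolding subset_chain_def by blast
      then show ?thesis using GH by blast
    qed
    note A = subsetD[OF sub, unfolded \<A>_def, simplified]
    show ?thesis
      unfolding \<A>_def mem_Collect_eq
    proof (intro conjI allI ballI impI)
      show "\<Union>\<C> \<subseteq> carrier Y \<times> carrier I" using A by blast
      show "(x, f x) \<in> \<Union>\<C>" if "x \<in> X" for x using A C(1) that by blast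
      show "(x \<oplus>\<^bsub>Y\<^esub> y, a \<oplus>\<^bsub>I\<^esub> b) \<in> \<Union>\<C>" if "(x, a) \<in> \<Union>\<C>" "(y, b) \<in> \<Union>\<C>" for x a y b
        using tot[OF that] A by blast
      show "(r \<odot>\<^bsub>Y\<^esub> x, r \<odot>\<^bsub>I\<^esub> a) \<in> \<Union>\<C>" if "r \<in> carrier R" "(x, a) \<in> \<Union>\<C>" for r x a
        using A that by blast
      show "a = b" if "(x, a) \<in> \<Union>\<C>" "(x, b) \<in> \<Union>\<C>" for x a b
        using tot[OF that] A by blast
    qed
  qed
  obtain G where G: "G \<in> \<A>" and max: "\<And>G'. \<lbrakk>G' \<in> \<A>; G \<subseteq> G'\<rbrakk> \<Longrightarrow> G' = G"
    using subset_Zorn_nonempty[OF ne chain] by metis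
  have GY: "x \<in> carrier Y" "a \<in> carrier I" if "(x, a) \<in> G" for x a
    using G that unfolding \<A>_def by blast+
  have Gf: "(x, f x) \<in> G" if "x \<in> X" for x
    using G that unfolding \<A>_def by blast
  have Gadd: "(x \<oplus>\<^bsub>Y\<^esub> y, a \<oplus>\<^bsub>I\<^esub> b) \<in> G" if "(x, a) \<in> G" "(y, b) \<in> G" for x a y b
    using G that unfolding \<A>_def by blast
  have Gsm: "(r \<odot>\<^bsub>Y\<^esub> x, r \<odot>\<^bsub>I\<^esub> a) \<in> G" if "r \<in> carrier R" "(x, a) \<in> G" for r x a
    using G that unfolding \<A>_def by blast
  have Gun: "a = b" if "(x, a) \<in> G" "(x, b) \<in> G" for x a b
    using G that unfolding \<A>_def by blast
  have Gneg: "(\<ominus>\<^bsub>Y\<^esub> x, \<ominus>\<^bsub>I\<^esub> a) \<in> G" if "(x, a) \<in> G" for x a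
    using Gsm[OF _ that, of "\<ominus>\<^bsub>R\<^esub> \<one>\<^bsub>R\<^esub>"] GY[OF that] by (simp add: Y.minus_eq_smult I.minus_eq_smult)
  have Gdiff: "(x \<ominus>\<^bsub>Y\<^esub> y, a \<ominus>\<^bsub>I\<^esub> b) \<in> G" if "(x, a) \<in> G" "(y, b) \<in> G" for x a y b
    using Gadd[OF that(1) Gneg[OF that(2)]] by (simp add: a_minus_def)
  have G0: "(\<zero>\<^bsub>Y\<^esub>, \<zero>\<^bsub>I\<^esub>) \<in> G"
    using Gf[OF submodule_zero_mem[OF X]] hom_zero[OF lmodule_submod[OF Y X] I.lmodule_axioms f] by simp
  have tot: "\<exists>e. (y, e) \<in> G" if y: "y \<in> carrier Y" for y
  proof -
    \<comment> \<open>\<open>J\<close> consists of the scalars that move \<open>y\<close> into the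
      domain of the maximal graph. On it \<open>r\<close> is sent to the value at
      \<open>r y\<close>; an \<open>e\<close> that represents this map is a value for
      \<open>y\<close> consistent with the graph.\<close>
    define J where "J = {r \<in> carrier R. \<exists>a. (r \<odot>\<^bsub>Y\<^esub> y, a) \<in> G}"
    define h where "h = (\<lambda>r. THE a. (r \<odot>\<^bsub>Y\<^esub> y, a) \<in> G)"
    have h: "h r = a" if "(r \<odot>\<^bsub>Y\<^esub> y, a) \<in> G" for r a
      unfolding h_def using that Gun by blast
    have J: "submodule J R (regular R)"
    proof (rule lmodule.submoduleI[OF reg])
      show "J \<subseteq> carrier (regular R)" by (auto simp: J_def)
      show "\<zero>\<^bsub>regular R\<^esub> \<in> J" using G0 y by (auto simp: J_def)
      show "r \<oplus>\<^bsub>regular R\<^esub> s \<in> J" if "r \<in> J" "s \<in> J" for r s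
        using that Gadd y by (fastforce simp: J_def Y.smult_l_distr)
      show "r \<odot>\<^bsub>regular R\<^esub> s \<in> J" if "r \<in> carrier R" "s \<in> J" for r s
        using that Gsm[OF that(1)] y by (fastforce simp: J_def Y.smult_assoc)
    qed
    have "restrict h (carrier (submod (regular R) J)) \<in> hom_set R (submod (regular R) J) I"
    proof (rule hom_restrictI[OF lmodule_submod[OF reg J]])
      show "h r \<in> carrier I" if "r \<in> carrier (submod (regular R) J)" for r
        using that h GY by (auto simp: J_def)
      show "h (r \<oplus>\<^bsub>submod (regular R) J\<^esub> s) = h r \<oplus>\<^bsub>I\<^esub> h s"
        if "r \<in> carrier (submod (regular R) J)" "s \<in> carrier (submod (regular R) J)" for r s
        using that h Gadd y by (fastforce simp: J_def Y.smult_l_distr)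
      show "h (r \<odot>\<^bsub>submod (regular R) J\<^esub> s) = r \<odot>\<^bsub>I\<^esub> h s"
        if "r \<in> carrier R" "s \<in> carrier (submod (regular R) J)" for r s
        using that h Gsm[OF that(1)] y by (fastforce simp: J_def Y.smult_assoc)
    qed
    then obtain e where e: "e \<in> carrier I" "\<And>r. r \<in> J \<Longrightarrow> h r = r \<odot>\<^bsub>I\<^esub> e"
      using injective_regular[OF inj J] by (metis restrict_apply' submod_simps(1))
    define G' where "G' = {(x \<oplus>\<^bsub>Y\<^esub> r \<odot>\<^bsub>Y\<^esub> y, a \<oplus>\<^bsub>I\<^esub> r \<odot>\<^bsub>I\<^esub> e) | x a r. (x, a) \<in> G \<and> r \<in> carrier R}"
    have G'I: "(x \<oplus>\<^bsub>Y\<^esub> r \<odot>\<^bsub>Y\<^esub> y, a \<oplus>\<^bsub>I\<^esub> r \<odot>\<^bsub>I\<^esub> e) \<in> G'" if "(x, a) \<in> G" "r \<in> carrier R" for x a r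
      using that unfolding G'_def by blast
    have sub: "G \<subseteq> G'"
      using G'I[of _ _ "\<zero>\<^bsub>R\<^esub>"] y e(1) GY by fastforce
    have "G' \<in> \<A>"
      unfolding \<A>_def mem_Collect_eq
    proof (intro conjI allI ballI impI)
      show "G' \<subseteq> carrier Y \<times> carrier I"
        unfolding G'_def using GY y e(1) by (auto simp: Y.smult_closed I.smult_closed)
      show "(x, f x) \<in> G'" if "x \<in> X" for x using sub Gf that by blast
      show "(p \<oplus>\<^bsub>Y\<^esub> q, a \<oplus>\<^bsub>I\<^esub> b) \<in> G'" if pq: "(p, a) \<in> G'" "(q, b) \<in> G'" for p a q b
      proof -
        obtain x c r x' c' r' where *: "(x, c) \<in> G" "r \<in> carrier R" "p = x \<oplus>\<^bsub>Y\<^esub> r \<odot>\<^bsub>Y\<^esub> y"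
          "a = c \<oplus>\<^bsub>I\<^esub> r \<odot>\<^bsub>I\<^esub> e" "(x', c') \<in> G" "r' \<in> carrier R" "q = x' \<oplus>\<^bsub>Y\<^esub> r' \<odot>\<^bsub>Y\<^esub> y"
          "b = c' \<oplus>\<^bsub>I\<^esub> r' \<odot>\<^bsub>I\<^esub> e" using pq unfolding G'_def by blast
        have "p \<oplus>\<^bsub>Y\<^esub> q = (x \<oplus>\<^bsub>Y\<^esub> x') \<oplus>\<^bsub>Y\<^esub> (r \<oplus>\<^bsub>R\<^esub> r') \<odot>\<^bsub>Y\<^esub> y"
          "a \<oplus>\<^bsub>I\<^esub> b = (c \<oplus>\<^bsub>I\<^esub> c') \<oplus>\<^bsub>I\<^esub> (r \<oplus>\<^bsub>R\<^esub> r') \<odot>\<^bsub>I\<^esub> e"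
          using * GY y e(1) by (simp_all add: Y.smult_l_distr I.smult_l_distr Y.smult_closed
              I.smult_closed Y.M.a_ac I.M.a_ac)
        then show ?thesis using G'I[OF Gadd[OF *(1,5)], of "r \<oplus>\<^bsub>R\<^esub> r'"] * by simp
      qed
      show "(s \<odot>\<^bsub>Y\<^esub> p, s \<odot>\<^bsub>I\<^esub> a) \<in> G'" if sp: "s \<in> carrier R" "(p, a) \<in> G'" for s p a
      proof -
        obtain x c r where *: "(x, c) \<in> G" "r \<in> carrier R" "p = x \<oplus>\<^bsub>Y\<^esub> r \<odot>\<^bsub>Y\<^esub> y"
          "a = c \<oplus>\<^bsub>I\<^esub> r \<odot>\<^bsub>I\<^esub> e" using sp unfolding G'_def by blast
        have "s \<odot>\<^bsub>Y\<^esub> p = s \<odot>\<^bsub>Y\<^esub> x \<oplus>\<^bsub>Y\<^esub> (s \<otimes>\<^bsub>R\<^esub> r) \<odot>\<^bsub>Y\<^esub> y"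
          "s \<odot>\<^bsub>I\<^esub> a = s \<odot>\<^bsub>I\<^esub> c \<oplus>\<^bsub>I\<^esub> (s \<otimes>\<^bsub>R\<^esub> r) \<odot>\<^bsub>I\<^esub> e"
          using * GY y e(1) sp by (simp_all add: Y.smult_r_distr I.smult_r_distr Y.smult_closed
              I.smult_closed Y.smult_assoc I.smult_assoc)
        then show ?thesis using G'I[OF Gsm[OF sp(1) *(1)], of "s \<otimes>\<^bsub>R\<^esub> r"] * sp by simp
      qed
      \<comment> \<open>Two representations of \<open>p\<close> differ by a multiple of
        \<open>y\<close> that lies in the old domain, where the graph already takes the value
        prescribed by \<open>e\<close>.\<close>
      show "a = b" if pq: "(p, a) \<in> G'" "(p, b) \<in> G'" for p a b
      proof -
        obtain x c r x' c' r' where *: "(x, c) \<in> G" "r \<in> carrier R" "p = x \<oplus>\<^bsub>Y\<^esub> r \<odot>\<^bsub>Y\<^esub> y"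
          "a = c \<oplus>\<^bsub>I\<^esub> r \<odot>\<^bsub>I\<^esub> e" "(x', c') \<in> G" "r' \<in> carrier R" "p = x' \<oplus>\<^bsub>Y\<^esub> r' \<odot>\<^bsub>Y\<^esub> y"
          "b = c' \<oplus>\<^bsub>I\<^esub> r' \<odot>\<^bsub>I\<^esub> e" using pq unfolding G'_def by blast
        note [simp] = GY[OF *(1)] GY[OF *(5)] y e(1) Y.smult_closed I.smult_closed *(2,6)
        have r': "r' = (r' \<ominus>\<^bsub>R\<^esub> r) \<oplus>\<^bsub>R\<^esub> r"
          by (simp add: a_minus_def I.R.a_assoc I.R.l_neg)
        have "x \<oplus>\<^bsub>Y\<^esub> r \<odot>\<^bsub>Y\<^esub> y = (x' \<oplus>\<^bsub>Y\<^esub> (r' \<ominus>\<^bsub>R\<^esub> r) \<odot>\<^bsub>Y\<^esub> y) \<oplus>\<^bsub>Y\<^esub> r \<odot>\<^bsub>Y\<^esub> y"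
          using *(3,7) r' Y.smult_l_distr[of "r' \<ominus>\<^bsub>R\<^esub> r" r y] by (simp add: Y.M.a_assoc)
        then have x: "x = x' \<oplus>\<^bsub>Y\<^esub> (r' \<ominus>\<^bsub>R\<^esub> r) \<odot>\<^bsub>Y\<^esub> y" by simp
        then have "x \<ominus>\<^bsub>Y\<^esub> x' = (r' \<ominus>\<^bsub>R\<^esub> r) \<odot>\<^bsub>Y\<^esub> y"
          by (simp add: a_minus_def Y.M.a_assoc Y.M.a_comm Y.M.r_neg1)
        then have d: "((r' \<ominus>\<^bsub>R\<^esub> r) \<odot>\<^bsub>Y\<^esub> y, c \<ominus>\<^bsub>I\<^esub> c') \<in> G"
          using Gdiff[OF *(1,5)] by simp
        then have "c \<ominus>\<^bsub>I\<^esub> c' = (r' \<ominus>\<^bsub>R\<^esub> r) \<odot>\<^bsub>I\<^esub> e"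
          using e(2)[of "r' \<ominus>\<^bsub>R\<^esub> r"] h by (auto simp: J_def)
        then have "c = c' \<oplus>\<^bsub>I\<^esub> (r' \<ominus>\<^bsub>R\<^esub> r) \<odot>\<^bsub>I\<^esub> e"
          by (metis I.M.a_comm I.M.a_inv_closed I.M.l_neg I.M.minus_closed I.M.r_zero I.M.a_assoc
              GY[OF *(1)] GY[OF *(5)] a_minus_def)
        then have "a = c' \<oplus>\<^bsub>I\<^esub> ((r' \<ominus>\<^bsub>R\<^esub> r) \<odot>\<^bsub>I\<^esub> e \<oplus>\<^bsub>I\<^esub> r \<odot>\<^bsub>I\<^esub> e)"
          using *(4) by (simp add: I.M.a_assoc)
        then show "a = b"
          using *(8) r' I.smult_l_distr[of "r' \<ominus>\<^bsub>R\<^esub> r" r e] by simp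
      qed
    qed
    then have "G' = G" using max sub by blast
    moreover have "(y, e) \<in> G'"
      using G'I[OF G0, of "\<one>\<^bsub>R\<^esub>"] y e(1) by (simp add: Y.smult_one I.smult_one)
    ultimately show ?thesis by blast
  qed
  define g where "g = (\<lambda>y. THE a. (y, a) \<in> G)"
  have g: "g y = a" if "(y, a) \<in> G" for y a
    unfolding g_def using that Gun by blast
  have "restrict g (carrier Y) \<in> hom_set R Y I"
  proof (rule hom_restrictI[OF Y])
    show "g y \<in> carrier I" if "y \<in> carrier Y" for y using tot[OF that] g GY by blast
    show "g (x \<oplus>\<^bsub>Y\<^esub> y) = g x \<oplus>\<^bsub>I\<^esub> g y" if "x \<in> carrier Y" "y \<in> carrier Y" for x y
      using tot[OF that(1)] tot[OF that(2)] g Gadd by metis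
    show "g (r \<odot>\<^bsub>Y\<^esub> x) = r \<odot>\<^bsub>I\<^esub> g x" if "r \<in> carrier R" "x \<in> carrier Y" for r x
      using tot[OF that(2)] g Gsm[OF that(1)] by metis
  qed
  moreover have "restrict g (carrier Y) x = f x" if "x \<in> X" for x
    using that submodule_mem[OF X] g Gf by simp
  ultimately show ?thesis using that by blast
qed

subsection \<open>Linear combinations, finite generation and free modules\<close>

text \<open>Indexing by numbers allows repeated vectors, and the coefficients form a sequence so
  that they can be an element of \<open>free_mod\<close>. Entries from \<open>n\<close> on are
  ignored.\<close>

primrec lincomb :: "('a, 'm) module \<Rightarrow> (nat \<Rightarrow> 'm) \<Rightarrow> nat \<Rightarrow> (nat \<Rightarrow> 'a) \<Rightarrow> 'm" where
  "lincomb M x 0 c = \<zero>\<^bsub>M\<^esub>"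
| "lincomb M x (Suc n) c = lincomb M x n c \<oplus>\<^bsub>M\<^esub> c n \<odot>\<^bsub>M\<^esub> x n"

context lmodule begin

lemma lincomb_closed [simp]:
  "\<lbrakk>\<And>i. i < n \<Longrightarrow> x i \<in> carrier M; \<And>i. c i \<in> carrier R\<rbrakk> \<Longrightarrow> lincomb M x n c \<in> carrier M"
  by (induction n) (auto simp: smult_closed)

lemma lincomb_add:
  assumes "\<And>i. i < n \<Longrightarrow> x i \<in> carrier M" "\<And>i. c i \<in> carrier R" "\<And>i. d i \<in> carrier R"
  shows "lincomb M x n (\<lambda>i. c i \<oplus> d i) = lincomb M x n c \<oplus>\<^bsub>M\<^esub> lincomb M x n d"
  using assms(1)
proof (induction n)
  case (Suc n)
  then have "lincomb M x n c \<in> carrier M" "lincomb M x n d \<in> carrier M" "x n \<in> carrier M"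
    using assms(2,3) by auto
  with Suc assms(2,3) show ?case
    by (simp add: smult_l_distr smult_closed M.a_ac)
qed simp

lemma lincomb_smult:
  assumes "\<And>i. i < n \<Longrightarrow> x i \<in> carrier M" "\<And>i. c i \<in> carrier R" "r \<in> carrier R"
  shows "lincomb M x n (\<lambda>i. r \<otimes> c i) = r \<odot>\<^bsub>M\<^esub> lincomb M x n c"
  using assms(1)
proof (induction n)
  case (Suc n)
  then have "lincomb M x n c \<in> carrier M" "x n \<in> carrier M"
    using assms(2) by auto
  with Suc assms(2,3) show ?case
    by (simp add: smult_r_distr smult_closed smult_assoc)
qed (use assms in simp)

definition unit_vec :: "nat \<Rightarrow> nat \<Rightarrow> 'a" where
  "unit_vec i = (\<lambda>j. if j = i then \<one> else \<zero>)"

lemma lincomb_unit_vec: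
  assumes "\<And>i. i < n \<Longrightarrow> x i \<in> carrier M"
  shows "lincomb M x n (unit_vec i) = (if i < n then x i else \<zero>\<^bsub>M\<^esub>)"
  using assms by (induction n) (auto simp: unit_vec_def smult_one less_Suc_eq)

lemma lincomb_mem_submodule:
  assumes "submodule K R M" "\<And>i. i < n \<Longrightarrow> x i \<in> K" "\<And>i. c i \<in> carrier R"
  shows "lincomb M x n c \<in> K"
  using assms(2)
proof (induction n)
  case 0
  then show ?case using submodule_zero_mem[OF assms(1)] by simp
next
  case (Suc n)
  then show ?case
    using submodule_add[OF assms(1)] submodule_smult[OF assms(1) assms(3)] by simp
qed

end

lemma hom_lincomb:
  assumes "lmodule R M" "lmodule R N" "f \<in> hom_set R M N"
    "\<And>i. i < n \<Longrightarrow> x i \<in> carrier M" "\<And>i. c i \<in> carrier R"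
  shows "f (lincomb M x n c) = lincomb N (\<lambda>i. f (x i)) n c"
proof -
  interpret M: lmodule R M by fact
  show ?thesis
    using assms(4)
  proof (induction n)
    case 0
    then show ?case using hom_zero[OF assms(1-3)] by simp
  next
    case (Suc n)
    then show ?case
      using assms(5) hom_add[OF assms(3)] hom_smult[OF assms(3)] by (simp add: M.smult_closed)
  qed
qed

text \<open>Sequences that vanish from \<open>n\<close> on represent \<open>R\<^sup>n\<close> for
  every \<open>n\<close> in the one type of the test modules.\<close>

definition free_mod :: "'a ring \<Rightarrow> nat \<Rightarrow> ('a, nat \<Rightarrow> 'a) module" where
  "free_mod R n = \<lparr>carrier = {c. \<forall>i. c i \<in> carrier R \<and> (n \<le> i \<longrightarrow> c i = \<zero>\<^bsub>R\<^esub>)},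
     monoid.mult = undefined, monoid.one = undefined, ring.zero = (\<lambda>_. \<zero>\<^bsub>R\<^esub>),
     add = (\<lambda>c d i. c i \<oplus>\<^bsub>R\<^esub> d i), smult = (\<lambda>r c i. r \<otimes>\<^bsub>R\<^esub> c i)\<rparr>"

lemma free_mod_simps [simp]:
  "c \<in> carrier (free_mod R n) \<longleftrightarrow> (\<forall>i. c i \<in> carrier R \<and> (n \<le> i \<longrightarrow> c i = \<zero>\<^bsub>R\<^esub>))"
  "\<zero>\<^bsub>free_mod R n\<^esub> = (\<lambda>_. \<zero>\<^bsub>R\<^esub>)" "c \<oplus>\<^bsub>free_mod R n\<^esub> d = (\<lambda>i. c i \<oplus>\<^bsub>R\<^esub> d i)"
  "r \<odot>\<^bsub>free_mod R n\<^esub> c = (\<lambda>i. r \<otimes>\<^bsub>R\<^esub> c i)"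
  by (auto simp: free_mod_def)

lemma lmodule_free_mod: "ring R \<Longrightarrow> lmodule R (free_mod R n)"
proof -
  assume "ring R"
  interpret ring R by fact
  show ?thesis
    by (rule lmoduleI) (auto simp: fun_eq_iff ring_axioms a_ac l_distr r_distr m_assoc)
qed

definition lin_hom :: "'a ring \<Rightarrow> ('a, 'm) module \<Rightarrow> nat \<Rightarrow> (nat \<Rightarrow> 'm) \<Rightarrow> (nat \<Rightarrow> 'a) \<Rightarrow> 'm" where
  "lin_hom R M n x = (\<lambda>c\<in>carrier (free_mod R n). lincomb M x n c)"

lemma lin_hom:
  assumes "lmodule R M" "\<And>i. i < n \<Longrightarrow> x i \<in> carrier M"
  shows "lin_hom R M n x \<in> hom_set R (free_mod R n) M"
proof -
  interpret lmodule R M by fact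
  show ?thesis
    unfolding lin_hom_def using assms(2)
    by (intro hom_restrictI lmodule_free_mod R.ring_axioms) (auto simp: lincomb_add lincomb_smult)
qed

lemma (in lmodule) unit_vec_mem: "i < n \<Longrightarrow> unit_vec i \<in> carrier (free_mod R n)"
  by (auto simp: unit_vec_def)

lemma free_mod_expand:
  assumes "ring R" "c \<in> carrier (free_mod R n)"
  shows "c = lincomb (free_mod R n) (lmodule.unit_vec R) n c"
proof -
  interpret ring R by fact
  interpret F: lmodule R "free_mod R n" by (rule lmodule_free_mod) fact
  have "lincomb (free_mod R n) F.unit_vec m c = (\<lambda>i. if i < m then c i else \<zero>\<^bsub>R\<^esub>)" if "m \<le> n" for m
    using that assms(2) by (induction m) (auto simp: F.unit_vec_def fun_eq_iff less_Suc_eq)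
  from this[of n] show ?thesis using assms(2) by (auto simp: fun_eq_iff)
qed

lemma hom_free_mod:
  assumes "lmodule R M" "f \<in> hom_set R (free_mod R n) M" "c \<in> carrier (free_mod R n)"
  shows "f c = lincomb M (\<lambda>i. f (lmodule.unit_vec R i)) n c"
proof -
  interpret M: lmodule R M by fact
  interpret F: lmodule R "free_mod R n" by (rule lmodule_free_mod) (rule M.R.ring_axioms)
  have "f c = f (lincomb (free_mod R n) F.unit_vec n c)"
    using free_mod_expand[OF M.R.ring_axioms assms(3)] by simp
  also have "\<dots> = lincomb M (\<lambda>i. f (F.unit_vec i)) n c"
    by (rule hom_lincomb[OF F.lmodule_axioms assms(1,2) F.unit_vec_mem]) (use assms(3) in auto)
  finally show ?thesis .
qed

lemma free_mod_lift:
  assumes "lmodule R X" "lmodule R Y" "q \<in> hom_set R X Y" "q ` carrier X = carrier Y"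
    "f \<in> hom_set R (free_mod R n) Y"
  obtains g where "g \<in> hom_set R (free_mod R n) X" "\<And>c. c \<in> carrier (free_mod R n) \<Longrightarrow> q (g c) = f c"
proof -
  interpret X: lmodule R X by fact
  have "\<exists>x. x \<in> carrier X \<and> q x = f (X.unit_vec i)" if "i < n" for i
    using assms(4) hom_closed[OF assms(5) X.unit_vec_mem[OF that]] by (metis imageE)
  then obtain x where x: "\<And>i. i < n \<Longrightarrow> x i \<in> carrier X \<and> q (x i) = f (X.unit_vec i)"
    by metis
  have "q (lin_hom R X n x c) = f c" if c: "c \<in> carrier (free_mod R n)" for c
  proof -
    have "q (lin_hom R X n x c) = lincomb Y (\<lambda>i. q (x i)) n c"
      using hom_lincomb[OF assms(1-3), of n x c] x c by (simp add: lin_hom_def)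
    also have "\<dots> = lincomb Y (\<lambda>i. f (X.unit_vec i)) n c"
    proof -
      have "lincomb Y (\<lambda>i. q (x i)) m c = lincomb Y (\<lambda>i. f (X.unit_vec i)) m c" if "m \<le> n" for m
        using that by (induction m) (auto simp: x)
      then show ?thesis by simp
    qed
    also have "\<dots> = f c"
      by (rule hom_free_mod[OF assms(2,5) c, symmetric])
    finally show ?thesis .
  qed
  then show ?thesis using that lin_hom[OF assms(1), of n x] x by blast
qed

lemma (in lmodule) finsum_mem_submodule:
  assumes "submodule K R M" "finite S" "\<And>s. s \<in> S \<Longrightarrow> f s \<in> K"
  shows "(\<Oplus>\<^bsub>M\<^esub>s\<in>S. f s) \<in> K"
  using assms(2,3)
proof (induction S)
  case empty
  then show ?case using submodule_zero_mem[OF assms(1)] by simp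
next
  case (insert s S)
  then have "f \<in> S \<rightarrow> carrier M" "f s \<in> carrier M"
    using submodule_mem[OF assms(1)] by auto
  then show ?case using insert submodule_add[OF assms(1)] by simp
qed

lemma finsum_eq_lincomb:
  assumes "lmodule R M" "\<And>i. i < n \<Longrightarrow> x i \<in> carrier M" "inj_on x {..<n}" "\<And>i. c i \<in> carrier R"
  shows "\<exists>d \<in> x ` {..<n} \<rightarrow> carrier R. (\<Oplus>\<^bsub>M\<^esub>s\<in>x ` {..<n}. d s \<odot>\<^bsub>M\<^esub> s) = lincomb M x n c"
proof -
  interpret lmodule R M by fact
  define d where "d = (\<lambda>s. c (inv_into {..<n} x s))"
  have d: "d (x i) = c i" if "i < n" for i
    using that assms(3) by (simp add: d_def)
  have "(\<Oplus>\<^bsub>M\<^esub>s\<in>x ` {..<m}. d s \<odot>\<^bsub>M\<^esub> s) = lincomb M x m c" if "m \<le> n" for m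
    using that
  proof (induction m)
    case (Suc m)
    have "x m \<notin> x ` {..<m}"
      using assms(3) Suc.prems by (auto dest!: inj_onD)
    moreover have "(\<lambda>s. d s \<odot>\<^bsub>M\<^esub> s) \<in> x ` {..<m} \<rightarrow> carrier M"
      using Suc.prems assms(2,4) d by (auto intro!: smult_closed)
    ultimately show ?case
      using Suc assms(2,4) d smult_closed
      by (simp add: lessThan_Suc M.a_comm)
  qed simp
  then show ?thesis using d assms(4) by (intro bexI[of _ d]) auto
qed

lemma fin_gen_iff:
  assumes "lmodule R M"
  shows "fin_gen R M \<longleftrightarrow> (\<exists>S \<subseteq> carrier M. finite S \<and> (\<forall>K. submodule K R M \<longrightarrow> S \<subseteq> K \<longrightarrow> K = carrier M))"
proof -
  interpret lmodule R M by fact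
  show ?thesis
  proof
    assume "fin_gen R M"
    then obtain S where S: "S \<subseteq> carrier M" "finite S"
      "\<forall>m\<in>carrier M. \<exists>c\<in>S \<rightarrow> carrier R. m = (\<Oplus>\<^bsub>M\<^esub>s\<in>S. c s \<odot>\<^bsub>M\<^esub> s)"
      unfolding fin_gen_def by blast
    have "K = carrier M" if K: "submodule K R M" "S \<subseteq> K" for K
    proof
      show "carrier M \<subseteq> K"
      proof
        fix m assume "m \<in> carrier M"
        then obtain c where c: "c \<in> S \<rightarrow> carrier R" "m = (\<Oplus>\<^bsub>M\<^esub>s\<in>S. c s \<odot>\<^bsub>M\<^esub> s)" using S(3) by blast
        have "c s \<odot>\<^bsub>M\<^esub> s \<in> K" if "s \<in> S" for s
          by (rule submodule_smult[OF K(1)]) (use c(1) that K(2) in auto)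
        then show "m \<in> K" unfolding c(2) by (rule finsum_mem_submodule[OF K(1) S(2)])
      qed
    qed (rule submodule_subset[OF K(1)])
    then show "\<exists>S \<subseteq> carrier M. finite S \<and> (\<forall>K. submodule K R M \<longrightarrow> S \<subseteq> K \<longrightarrow> K = carrier M)"
      using S by blast
  next
    assume "\<exists>S \<subseteq> carrier M. finite S \<and> (\<forall>K. submodule K R M \<longrightarrow> S \<subseteq> K \<longrightarrow> K = carrier M)"
    then obtain S where S: "S \<subseteq> carrier M" "finite S" "\<And>K. submodule K R M \<Longrightarrow> S \<subseteq> K \<Longrightarrow> K = carrier M"
      by blast
    obtain x and n :: nat where x: "S = x ` {..<n}" "inj_on x {..<n}"
      using finite_imp_nat_seg_image_inj_on[OF S(2)] by (metis lessThan_def)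
    have xM: "x i \<in> carrier M" if "i < n" for i using that S(1) x(1) by auto
    let ?K = "lin_hom R M n x ` carrier (free_mod R n)"
    have K: "submodule ?K R M"
      using lmodule_free_mod[OF R.ring_axioms]
      by (intro submodule_image[OF _ assms lin_hom[OF assms xM]] lmodule.submodule_carrier)
    have "S \<subseteq> ?K"
    proof
      fix s assume "s \<in> S"
      then obtain i where i: "i < n" "s = x i" using x by auto
      then have "s = lin_hom R M n x (unit_vec i)"
        using unit_vec_mem[OF i(1)] lincomb_unit_vec[of n x] xM by (simp add: lin_hom_def)
      then show "s \<in> ?K" using unit_vec_mem[OF i(1)] by blast
    qed
    then have "?K = carrier M" by (rule S(3)[OF K])
    have "\<exists>c\<in>S \<rightarrow> carrier R. m = (\<Oplus>\<^bsub>M\<^esub>s\<in>S. c s \<odot>\<^bsub>M\<^esub> s)" if "m \<in> carrier M" for m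
    proof -
      have "m \<in> ?K" using that \<open>?K = carrier M\<close> by simp
      then obtain c where c: "c \<in> carrier (free_mod R n)" "m = lin_hom R M n x c" by blast
      then have "m = lincomb M x n c" by (simp add: lin_hom_def)
      with c(1) show ?thesis
        using finsum_eq_lincomb[OF assms xM x(2), of c] x(1) by (metis free_mod_simps(1))
    qed
    then show "fin_gen R M" unfolding fin_gen_def using S(1,2) by blast
  qed
qed

lemma fin_gen_free_cover:
  assumes "lmodule R M" "fin_gen R M"
  obtains n q where "q \<in> hom_set R (free_mod R n) M" "q ` carrier (free_mod R n) = carrier M"
proof -
  interpret lmodule R M by fact
  obtain S where S: "S \<subseteq> carrier M" "finite S" "\<And>K. submodule K R M \<Longrightarrow> S \<subseteq> K \<Longrightarrow> K = carrier M"
    using assms(2) unfolding fin_gen_iff[OF assms(1)] by blast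
  obtain x and n :: nat where x: "S = x ` {..<n}"
    using finite_imp_nat_seg_image_inj_on[OF S(2)] by (metis lessThan_def)
  have xM: "x i \<in> carrier M" if "i < n" for i using that S(1) x by auto
  let ?q = "lin_hom R M n x"
  have F: "lmodule R (free_mod R n)" by (rule lmodule_free_mod[OF R.ring_axioms])
  have "S \<subseteq> ?q ` carrier (free_mod R n)"
  proof
    fix s assume "s \<in> S"
    then obtain i where i: "i < n" "s = x i" using x by auto
    then have "s = ?q (unit_vec i)"
      using unit_vec_mem[OF i(1)] lincomb_unit_vec[of n x] xM by (simp add: lin_hom_def)
    then show "s \<in> ?q ` carrier (free_mod R n)" using unit_vec_mem[OF i(1)] by blast
  qed
  moreover have "submodule (?q ` carrier (free_mod R n)) R M"
    by (rule submodule_image[OF F assms(1) lin_hom[OF assms(1) xM] lmodule.submodule_carrier[OF F]])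
  ultimately have "?q ` carrier (free_mod R n) = carrier M" by (intro S(3))
  then show ?thesis using lin_hom[OF assms(1) xM] by (intro that)
qed

lemma fin_gen_image:
  assumes "lmodule R M" "lmodule R N" "q \<in> hom_set R M N" "q ` carrier M = carrier N" "fin_gen R M"
  shows "fin_gen R N"
proof -
  obtain S where S: "S \<subseteq> carrier M" "finite S" "\<And>K. submodule K R M \<Longrightarrow> S \<subseteq> K \<Longrightarrow> K = carrier M"
    using assms(5) unfolding fin_gen_iff[OF assms(1)] by blast
  have "K = carrier N" if K: "submodule K R N" "q ` S \<subseteq> K" for K
  proof -
    have "{x \<in> carrier M. q x \<in> K} = carrier M"
      by (rule S(3)[OF submodule_vimage[OF assms(1-3) K(1)]]) (use K S in auto)
    then show ?thesis using submodule_subset[OF K(1)] unfolding assms(4)[symmetric] by auto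
  qed
  moreover have "q ` S \<subseteq> carrier N" using S(1) assms(4) by blast
  ultimately show ?thesis
    unfolding fin_gen_iff[OF assms(2)] using S(2) by blast
qed

text \<open>A section of a surjection from a free module embeds the carrier. Finite generation thus
  supplies the injections along which modules of other types are transported.\<close>

lemma fin_gen_inj_into:
  fixes M :: "('a, 'm) module"
  assumes "lmodule R M" "fin_gen R M"
  obtains c :: "'m \<Rightarrow> nat \<Rightarrow> 'a" where "inj_on c (carrier M)"
proof -
  obtain n q where q: "q ` carrier (free_mod R n) = carrier M"
    using fin_gen_free_cover[OF assms] by metis
  have "inj_on (inv_into (carrier (free_mod R n)) q) (carrier M)"
    unfolding q[symmetric] by (rule inj_on_inv_into) simp
  then show ?thesis using that by blast
qed

text \<open>\<open>\<sigma>\<close> and \<open>\<pi>\<close> exhibit \<open>P\<close> as a retract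
  of a free module, a form of projectivity that refers to no type of test modules.\<close>

definition free_summand ::
    "'a ring \<Rightarrow> ('a, 'p) module \<Rightarrow> nat \<Rightarrow> ('p \<Rightarrow> nat \<Rightarrow> 'a) \<Rightarrow> ((nat \<Rightarrow> 'a) \<Rightarrow> 'p) \<Rightarrow> bool" where
  "free_summand R P n \<sigma> \<pi> \<longleftrightarrow> lmodule R P \<and> \<sigma> \<in> hom_set R P (free_mod R n) \<and>
     \<pi> \<in> hom_set R (free_mod R n) P \<and> (\<forall>x\<in>carrier P. \<pi> (\<sigma> x) = x)"

text \<open>The lift is built on the free module, where it is determined by the unit vectors, and
  pulled back along \<open>\<sigma>\<close>. As \<open>X\<close> and \<open>Y\<close> have arbitrary
  types, it also applies to duals.\<close>

lemma free_summand_lift: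
  assumes "free_summand R P n \<sigma> \<pi>"
    and X: "lmodule R X" "lmodule R Y" "q \<in> hom_set R X Y" "q ` carrier X = carrier Y"
    and f: "f \<in> hom_set R P Y"
  obtains g where "g \<in> hom_set R P X" "\<And>x. x \<in> carrier P \<Longrightarrow> q (g x) = f x"
proof -
  have P: "lmodule R P" and \<sigma>: "\<sigma> \<in> hom_set R P (free_mod R n)"
    and \<pi>: "\<pi> \<in> hom_set R (free_mod R n) P" and \<pi>\<sigma>: "\<And>x. x \<in> carrier P \<Longrightarrow> \<pi> (\<sigma> x) = x"
    using assms(1) by (auto simp: free_summand_def)
  have F: "lmodule R (free_mod R n)"
    using P lmodule_free_mod by (auto simp: lmodule_def)
  obtain g where g: "g \<in> hom_set R (free_mod R n) X"
    "\<And>c. c \<in> carrier (free_mod R n) \<Longrightarrow> q (g c) = compose (carrier (free_mod R n)) f \<pi> c"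
    using free_mod_lift[OF X hom_compose[OF F \<pi> f]] by blast
  have "q (compose (carrier P) g \<sigma> x) = f x" if "x \<in> carrier P" for x
    using g(2)[OF hom_closed[OF \<sigma> that]] hom_closed[OF \<sigma> that] \<pi>\<sigma>[OF that] that
    by (simp add: compose_def)
  then show ?thesis using that hom_compose[OF P \<sigma> g(1)] by blast
qed

lemma free_summand_projective:
  assumes "free_summand R P n \<sigma> \<pi>"
  shows "projective R P"
  unfolding projective_def
proof (intro conjI allI impI ballI)
  show "lmodule R P" using assms by (simp add: free_summand_def)
  fix X Y :: "('a, nat \<Rightarrow> 'a) module" and q f
  assume *: "lmodule R X" "lmodule R Y" "q \<in> hom_set R X Y" "q ` carrier X = carrier Y"
    "f \<in> hom_set R P Y"
  obtain g where "g \<in> hom_set R P X" "\<And>x. x \<in> carrier P \<Longrightarrow> q (g x) = f x"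
    using free_summand_lift[OF assms *] by metis
  then show "\<exists>g\<in>hom_set R P X. \<forall>x\<in>carrier P. q (g x) = f x" by blast
qed

lemma projective_free_summand:
  fixes P :: "('a, nat \<Rightarrow> 'a) module"
  assumes "projective R P" "fin_gen R P"
  obtains n \<sigma> \<pi> where "free_summand R P n \<sigma> \<pi>"
proof -
  have P: "lmodule R P" using assms(1) by (simp add: projective_def)
  then have F: "lmodule R (free_mod R n)" for n
    using lmodule_free_mod by (auto simp: lmodule_def)
  obtain n \<pi> where \<pi>: "\<pi> \<in> hom_set R (free_mod R n) P" "\<pi> ` carrier (free_mod R n) = carrier P"
    by (rule fin_gen_free_cover[OF P assms(2)])
  have "\<exists>\<sigma>\<in>hom_set R P (free_mod R n). \<forall>x\<in>carrier P. \<pi> (\<sigma> x) = (\<lambda>x\<in>carrier P. x) x"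
    using assms(1)[unfolded projective_def, THEN conjunct2, rule_format, OF F P \<pi> hom_id[OF P]] .
  then obtain \<sigma> where "\<sigma> \<in> hom_set R P (free_mod R n)" "\<forall>x\<in>carrier P. \<pi> (\<sigma> x) = x"
    by auto
  then show ?thesis using that P \<pi> unfolding free_summand_def by blast
qed

section \<open>Modules of finite length\<close>

text \<open>A strictly increasing rank on the submodules bounds the length of their chains.\<close>

definition flen :: "'a ring \<Rightarrow> ('a, 'm) module \<Rightarrow> bool" where
  "flen R M \<longleftrightarrow> (\<exists>\<rho> :: 'm set \<Rightarrow> nat. \<forall>K K'. submodule K R M \<longrightarrow> submodule K' R M \<longrightarrow> K \<subset> K' \<longrightarrow> \<rho> K < \<rho> K')"

lemma flen_minimal:
  assumes "flen R M" "submodule K0 R M" "P K0"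
  obtains K where "submodule K R M" "P K" "\<And>K'. \<lbrakk>submodule K' R M; P K'; K' \<subseteq> K\<rbrakk> \<Longrightarrow> K' = K"
proof -
  obtain \<rho> :: "'b set \<Rightarrow> nat" where \<rho>: "\<And>K K'. \<lbrakk>submodule K R M; submodule K' R M; K \<subset> K'\<rbrakk> \<Longrightarrow> \<rho> K < \<rho> K'"
    using assms(1) unfolding flen_def by blast
  obtain K where K: "submodule K R M \<and> P K" "\<And>K'. submodule K' R M \<and> P K' \<Longrightarrow> \<rho> K \<le> \<rho> K'"
    using ex_has_least_nat[of "\<lambda>K. submodule K R M \<and> P K" K0 \<rho>] assms by blast
  have "K' = K" if "submodule K' R M" "P K'" "K' \<subseteq> K" for K'
    using K(2)[of K'] \<rho>[of K' K] K(1) that by (metis linorder_not_le psubsetI)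
  then show ?thesis using that K(1) by blast
qed

text \<open>Take a finite set whose span has the largest rank; adjoining an element outside the span
  would give a larger one.\<close>

lemma flen_fin_gen:
  assumes "lmodule R M" "flen R M"
  shows "fin_gen R M"
proof -
  interpret lmodule R M by fact
  obtain \<rho> :: "'b set \<Rightarrow> nat" where \<rho>: "\<And>K K'. \<lbrakk>submodule K R M; submodule K' R M; K \<subset> K'\<rbrakk> \<Longrightarrow> \<rho> K < \<rho> K'"
    using assms(2) unfolding flen_def by blast
  define sp where "sp = (\<lambda>S. \<Inter>{K. submodule K R M \<and> S \<subseteq> K})"
  have sp: "submodule (sp S) R M" if "S \<subseteq> carrier M" for S
  proof (rule submoduleI)
    show "sp S \<subseteq> carrier M" using submodule_carrier that by (auto simp: sp_def)
  qed (auto simp: sp_def intro: submodule_zero_mem submodule_add submodule_smult)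
  have sup: "S \<subseteq> sp S" for S by (auto simp: sp_def)
  have "\<forall>S. S \<subseteq> carrier M \<and> finite S \<longrightarrow> \<rho> (sp S) < Suc (\<rho> (carrier M))"
    using \<rho>[OF sp submodule_carrier] submodule_subset[OF sp]
    by (metis less_Suc_eq psubsetI)
  then obtain S where S: "S \<subseteq> carrier M" "finite S"
    "\<And>S'. S' \<subseteq> carrier M \<and> finite S' \<Longrightarrow> \<rho> (sp S') \<le> \<rho> (sp S)"
    using ex_has_greatest_nat[of "\<lambda>S. S \<subseteq> carrier M \<and> finite S" "{}" "\<lambda>S. \<rho> (sp S)"] by (metis empty_subsetI finite.emptyI)
  have "K = carrier M" if K: "submodule K R M" "S \<subseteq> K" for K
  proof (rule ccontr)
    assume "K \<noteq> carrier M"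
    then obtain x where x: "x \<in> carrier M" "x \<notin> K" using submodule_subset[OF K(1)] by blast
    have "x \<notin> sp S" using x(2) K by (auto simp: sp_def)
    then have "sp S \<subset> sp (insert x S)" using sup[of "insert x S"] by (auto simp: sp_def)
    then have "\<rho> (sp S) < \<rho> (sp (insert x S))" using \<rho> sp S(1) x(1) by simp
    then show False using S(3)[of "insert x S"] S(1,2) x(1) by auto
  qed
  then show ?thesis unfolding fin_gen_iff[OF assms(1)] using S by blast
qed

text \<open>The rank of \<open>K\<close> is the rank of its image plus the rank of its intersection
  with the kernel. Both summands are monotone, and by the modular law they cannot both stay the same
  under a proper inclusion.\<close>

lemma flen_ext:
  assumes "lmodule R M" "lmodule R N" "f \<in> hom_set R M N"
    and "flen R N" "flen R (submod M (mker M N f))"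
  shows "flen R M"
proof -
  interpret M: lmodule R M by fact
  define Z where "Z = mker M N f"
  have Z: "submodule Z R M" unfolding Z_def by (rule submodule_mker[OF assms(1-3)])
  obtain \<rho> :: "'c set \<Rightarrow> nat" where \<rho>: "\<And>K K'. \<lbrakk>submodule K R N; submodule K' R N; K \<subset> K'\<rbrakk> \<Longrightarrow> \<rho> K < \<rho> K'"
    using assms(4) unfolding flen_def by blast
  obtain \<tau> :: "'b set \<Rightarrow> nat" where \<tau>: "\<And>K K'. \<lbrakk>submodule K R M; K \<subseteq> Z; submodule K' R M; K' \<subseteq> Z; K \<subset> K'\<rbrakk> \<Longrightarrow> \<tau> K < \<tau> K'"
    using assms(5) unfolding flen_def Z_def[symmetric] submodule_submod_iff[OF assms(1) Z] by blast
  have "\<rho> (f ` K) + \<tau> (K \<inter> Z) < \<rho> (f ` K') + \<tau> (K' \<inter> Z)"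
    if K: "submodule K R M" "submodule K' R M" "K \<subset> K'" for K K'
  proof -
    have sm: "submodule (f ` K) R N" "submodule (f ` K') R N" "submodule (K \<inter> Z) R M" "submodule (K' \<inter> Z) R M"
      using submodule_image[OF assms(1-3)] submodule_Int[OF assms(1)] K Z by auto
    have le: "\<rho> (f ` K) \<le> \<rho> (f ` K')" "\<tau> (K \<inter> Z) \<le> \<tau> (K' \<inter> Z)"
    proof -
      have "f ` K = f ` K' \<or> f ` K \<subset> f ` K'" using K(3) by blast
      then show "\<rho> (f ` K) \<le> \<rho> (f ` K')" using \<rho>[OF sm(1,2)] by force
      have "K \<inter> Z = K' \<inter> Z \<or> K \<inter> Z \<subset> K' \<inter> Z" using K(3) by blast
      then show "\<tau> (K \<inter> Z) \<le> \<tau> (K' \<inter> Z)" using \<tau>[OF sm(3) _ sm(4)] by force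
    qed
    have "f ` K \<noteq> f ` K' \<or> K \<inter> Z \<noteq> K' \<inter> Z"
    proof (rule ccontr)
      assume "\<not> ?thesis"
      then have eq: "f ` K = f ` K'" "K \<inter> Z = K' \<inter> Z" by auto
      obtain x where x: "x \<in> K'" "x \<notin> K" using K(3) by blast
      obtain y where y: "y \<in> K" "f x = f y" using x(1) eq(1) by (metis image_iff)
      have c: "x \<in> carrier M" "y \<in> carrier M"
        using submodule_mem[OF K(2) x(1)] submodule_mem[OF K(1) y(1)] by auto
      have "f (x \<ominus>\<^bsub>M\<^esub> y) = \<zero>\<^bsub>N\<^esub>"
        using hom_diff[OF assms(1-3) c] y(2) hom_closed[OF assms(3) c(2)] assms(2)
        by (metis abelian_group.diff_eq_zero_iff lmodule.axioms(2))
      moreover have "x \<ominus>\<^bsub>M\<^esub> y \<in> K'" using M.submodule_diff[OF K(2)] x(1) y(1) K(3) by blast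
      ultimately have "x \<ominus>\<^bsub>M\<^esub> y \<in> K" using eq(2) c by (auto simp: Z_def mker_def)
      then have "y \<oplus>\<^bsub>M\<^esub> (x \<ominus>\<^bsub>M\<^esub> y) \<in> K" using submodule_add[OF K(1) y(1)] by blast
      moreover have "y \<oplus>\<^bsub>M\<^esub> (x \<ominus>\<^bsub>M\<^esub> y) = x"
        using c by (simp add: a_minus_def M.M.a_lcomm M.M.r_neg)
      ultimately show False using x(2) by simp
    qed
    then consider "f ` K \<subset> f ` K'" | "K \<inter> Z \<subset> K' \<inter> Z" using K(3) by blast
    then show ?thesis
    proof cases
      case 1
      then show ?thesis using \<rho>[OF sm(1,2)] le(2) by linarith
    next
      case 2
      then show ?thesis using \<tau>[OF sm(3) _ sm(4)] le(1) by (meson Int_lower2 add_le_less_mono)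
    qed
  qed
  then show ?thesis unfolding flen_def by (intro exI[of _ "\<lambda>K. \<rho> (f ` K) + \<tau> (K \<inter> Z)"]) blast
qed

lemma flen_trivial: "carrier M \<subseteq> {\<zero>\<^bsub>M\<^esub>} \<Longrightarrow> flen R M"
proof -
  assume "carrier M \<subseteq> {\<zero>\<^bsub>M\<^esub>}"
  then have "K = {\<zero>\<^bsub>M\<^esub>}" if "submodule K R M" for K
    using submodule_subset[OF that] submodule_zero_mem[OF that] by blast
  then show ?thesis unfolding flen_def by blast
qed

lemma flen_simple:
  assumes "\<And>K. submodule K R M \<Longrightarrow> K = {\<zero>\<^bsub>M\<^esub>} \<or> K = carrier M"
  shows "flen R M"
proof -
  have "(if K = {\<zero>\<^bsub>M\<^esub>} then 0 else 1 :: nat) < (if K' = {\<zero>\<^bsub>M\<^esub>} then 0 else 1)"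
    if "submodule K R M" "submodule K' R M" "K \<subset> K'" for K K'
    using assms[OF that(1)] submodule_subset[OF that(2)] submodule_zero_mem[OF that(1)] that(3) by auto
  then show ?thesis unfolding flen_def by (intro exI[of _ "\<lambda>K. if K = {\<zero>\<^bsub>M\<^esub>} then 0 else 1"]) simp
qed

lemma flen_inj:
  assumes "lmodule R M" "lmodule R N" "f \<in> hom_set R M N" "inj_on f (carrier M)" "flen R N"
  shows "flen R M"
proof (rule flen_ext[OF assms(1-3,5)])
  show "flen R (submod M (mker M N f))"
    using assms(4) unfolding hom_inj_iff[OF assms(1-3)]
    by (intro flen_trivial) (auto simp: mker_def)
qed

lemma flen_submod:
  assumes "lmodule R M" "submodule K R M" "flen R M"
  shows "flen R (submod M K)"
  by (rule flen_inj[OF lmodule_submod[OF assms(1,2)] assms(1) hom_incl[OF assms(1,2)] _ assms(3)])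
    (auto simp: inj_on_def)

lemma flen_surj:
  assumes "lmodule R M" "lmodule R N" "f \<in> hom_set R M N" "f ` carrier M = carrier N" "flen R M"
  shows "flen R N"
proof -
  obtain \<rho> :: "'b set \<Rightarrow> nat" where \<rho>: "\<And>K K'. \<lbrakk>submodule K R M; submodule K' R M; K \<subset> K'\<rbrakk> \<Longrightarrow> \<rho> K < \<rho> K'"
    using assms(5) unfolding flen_def by blast
  have "\<rho> {x \<in> carrier M. f x \<in> K} < \<rho> {x \<in> carrier M. f x \<in> K'}"
    if K: "submodule K R N" "submodule K' R N" "K \<subset> K'" for K K'
  proof (rule \<rho>[OF submodule_vimage[OF assms(1-3) K(1)] submodule_vimage[OF assms(1-3) K(2)]])
    obtain y where y: "y \<in> K'" "y \<notin> K" using K(3) by blast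
    then obtain x where "x \<in> carrier M" "f x = y"
      using submodule_mem[OF K(2) y(1)] assms(4) by (metis imageE)
    then show "{x \<in> carrier M. f x \<in> K} \<subset> {x \<in> carrier M. f x \<in> K'}"
      using K(3) y by blast
  qed
  then show ?thesis unfolding flen_def by (intro exI[of _ "\<lambda>K. \<rho> {x \<in> carrier M. f x \<in> K}"]) blast
qed

lemma flen_free_mod:
  assumes "ring R" "flen R (regular R)"
  shows "flen R (free_mod R n)"
proof (induction n)
  case 0
  then show ?case by (intro flen_trivial) auto
next
  case (Suc n)
  let ?F = "free_mod R (Suc n)"
  have F: "lmodule R ?F" by (rule lmodule_free_mod[OF assms(1)])
  have f: "(\<lambda>c\<in>carrier ?F. c n) \<in> hom_set R ?F (regular R)"
    by (rule hom_restrictI[OF F]) auto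
  \<comment> \<open>The encoding by vanishing tails makes this kernel equal, not merely isomorphic,
    to the free module of the previous rank.\<close>
  have "mker ?F (regular R) (\<lambda>c\<in>carrier ?F. c n) = carrier (free_mod R n)"
  proof (intro Set.set_eqI iffI)
    fix c assume "c \<in> mker ?F (regular R) (\<lambda>c\<in>carrier ?F. c n)"
    then show "c \<in> carrier (free_mod R n)"
      by (auto simp: mker_def) (metis le_antisym not_less_eq_eq)
  qed (auto simp: mker_def)
  then have "submod ?F (mker ?F (regular R) (\<lambda>c\<in>carrier ?F. c n)) = free_mod R n"
    by (simp add: submod_def free_mod_def)
  then show ?case
    using flen_ext[OF F lmodule_regular[OF assms(1)] f assms(2)] Suc by simp
qed

lemma fin_gen_iff_flen:
  assumes "lmodule R M" "flen R (regular R)"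
  shows "fin_gen R M \<longleftrightarrow> flen R M"
proof
  have R: "ring R" using assms(1) by (simp add: lmodule_def)
  assume "fin_gen R M"
  then obtain n q where "q \<in> hom_set R (free_mod R n) M" "q ` carrier (free_mod R n) = carrier M"
    by (rule fin_gen_free_cover[OF assms(1)])
  then show "flen R M"
    using flen_surj[OF lmodule_free_mod[OF R] assms(1)] flen_free_mod[OF R assms(2)] by blast
qed (rule flen_fin_gen[OF assms(1)])

section \<open>Artinian commutative rings\<close>

locale artin_base = artinian_cring R for R :: "'r ring" (structure)
begin

lemma reg: "lmodule R (regular R)"
  by (rule lmodule_regular[OF ring_axioms])

lemma ideal_iff_submodule: "ideal I R \<longleftrightarrow> submodule I R (regular R)"
proof
  assume "ideal I R"
  then interpret ideal I R .
  show "submodule I R (regular R)"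
    by (rule lmodule.submoduleI[OF reg]) (auto simp: I_l_closed)
next
  assume I: "submodule I R (regular R)"
  note s = submodule_subset[OF I, simplified] submodule_zero_mem[OF I, simplified]
    submodule_add[OF I, simplified] submodule_smult[OF I, simplified]
    lmodule.submodule_minus[OF reg I]
  have "a_inv R x = a_inv (regular R) x" for x
    by (simp add: a_inv_def m_inv_def)
  then have "inv\<^bsub>add_monoid R\<^esub> x \<in> I" if "x \<in> I" for x
    using s(5)[OF that] by (simp add: a_inv_def)
  then have "subgroup I (add_monoid R)"
    using s(1-3) by (intro subgroup.intro) auto
  then show "ideal I R"
  proof (rule idealI[OF ring_axioms])
    fix a x assume a: "a \<in> I" and x: "x \<in> carrier R"
    show "x \<otimes> a \<in> I" by (rule s(4)[OF x a])
    then show "a \<otimes> x \<in> I" using m_comm[OF x subsetD[OF s(1) a]] by simp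
  qed
qed

text \<open>Without a minimal ideal, dependent choice would produce a strictly descending sequence
  of ideals, against \<open>dcc\<close>.\<close>

lemma submodule_regular_minimal:
  assumes "submodule I0 R (regular R)" "P I0"
  obtains I where "submodule I R (regular R)" "P I"
    "\<And>I'. \<lbrakk>submodule I' R (regular R); P I'; I' \<subseteq> I\<rbrakk> \<Longrightarrow> I' = I"
proof (rule ccontr)
  assume "\<not> thesis"
  with that have *: "\<exists>I'. (submodule I' R (regular R) \<and> P I') \<and> I' \<subset> I"
    if "submodule I R (regular R) \<and> P I" for I
    using that by (metis psubsetI)
  have "\<exists>s. \<forall>k::nat. (submodule (s k) R (regular R) \<and> P (s k)) \<and> s (Suc k) \<subset> s k"
  proof (rule dependent_nat_choice)
    show "\<exists>I. submodule I R (regular R) \<and> P I" using assms by blast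
  qed (rule *)
  then obtain s where s: "\<And>k. submodule (s k) R (regular R) \<and> P (s k)" "\<And>k::nat. s (Suc k) \<subset> s k"
    by metis
  then obtain N where "\<forall>k\<ge>N. s k = s N"
    using dcc[of s] unfolding ideal_iff_submodule by blast
  then have "s (Suc N) = s N" by (meson le_SucI order_refl)
  then show False using s(2)[of N] by simp
qed

text \<open>The last clause says that \<open>R / m\<close> is a field.\<close>

definition maxid :: "'r set \<Rightarrow> bool" where
  "maxid m \<longleftrightarrow> submodule m R (regular R) \<and> \<one> \<notin> m \<and>
     (\<forall>r\<in>carrier R - m. \<exists>s\<in>carrier R. \<one> \<ominus> s \<otimes> r \<in> m)"

lemma maxid_submodule: "maxid m \<Longrightarrow> submodule m R (regular R)"
  by (simp add: maxid_def)

lemma maxid_mem: "\<lbrakk>maxid m; x \<in> m\<rbrakk> \<Longrightarrow> x \<in> carrier R"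
  using submodule_mem[of m R "regular R" x] by (simp add: maxid_def)

lemma maxid_inverse:
  assumes "maxid m" "r \<in> carrier R" "r \<notin> m"
  obtains s where "s \<in> carrier R" "\<one> \<ominus> s \<otimes> r \<in> m"
  using assms unfolding maxid_def by blast

section \<open>Maximal ideals and the Jacobson radical\<close>

lemma maxidI:
  assumes "submodule m R (regular R)" "\<one> \<notin> m"
    "\<And>I. \<lbrakk>submodule I R (regular R); m \<subseteq> I; \<one> \<notin> I\<rbrakk> \<Longrightarrow> I = m"
  shows "maxid m"
proof -
  have "\<exists>s\<in>carrier R. \<one> \<ominus> s \<otimes> r \<in> m" if r: "r \<in> carrier R" "r \<notin> m" for r
  proof -
    let ?I = "m <+>\<^bsub>regular R\<^esub> multiples R (regular R) r"
    have mult: "submodule (multiples R (regular R) r) R (regular R)"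
      using submodule_multiples[OF reg, of r] r by simp
    have "r \<in> ?I"
      using set_add_upper(2)[OF reg assms(1) mult] mem_multiples[OF reg, of r] r by auto
    then have "\<one> \<in> ?I"
      using assms(3)[OF submodule_set_add[OF reg assms(1) mult] set_add_upper(1)[OF reg assms(1) mult]] r(2)
      by blast
    then obtain a s where as: "a \<in> m" "s \<in> carrier R" "\<one> = a \<oplus> s \<otimes> r"
      unfolding mem_set_add multiples_def by auto
    have "a \<in> carrier R" using submodule_mem[OF assms(1) as(1)] by simp
    then have "\<one> \<ominus> s \<otimes> r = a" using as r by (simp add: a_minus_def a_assoc r_neg)
    then show ?thesis using as(1,2) by (intro bexI[of _ s]) simp_all
  qed
  then show ?thesis using assms(1,2) by (simp add: maxid_def)
qed

lemma maxid_maximal: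
  assumes "maxid m" "submodule I R (regular R)" "m \<subseteq> I" "\<one> \<notin> I"
  shows "I = m"
proof (rule ccontr)
  assume "I \<noteq> m"
  then obtain r where r: "r \<in> I" "r \<notin> m" using assms(3) by blast
  then have rR: "r \<in> carrier R" using submodule_mem[OF assms(2)] by simp
  then obtain s where s: "s \<in> carrier R" "\<one> \<ominus> s \<otimes> r \<in> m"
    using maxid_inverse[OF assms(1) rR r(2)] by blast
  have "s \<otimes> r \<oplus> (\<one> \<ominus> s \<otimes> r) \<in> I"
    using submodule_add[OF assms(2), of "s \<otimes> r" "\<one> \<ominus> s \<otimes> r"] submodule_smult[OF assms(2) s(1) r(1)]
      s(2) assms(3) by auto
  moreover have "s \<otimes> r \<oplus> (\<one> \<ominus> s \<otimes> r) = \<one>"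
    using s(1) rR by (simp add: a_minus_def a_lcomm r_neg)
  ultimately show False using assms(4) by simp
qed

lemma maxid_subset_eq: "\<lbrakk>maxid m; maxid m'; m \<subseteq> m'\<rbrakk> \<Longrightarrow> m' = m"
  using maxid_maximal[of m m'] by (simp add: maxid_def)

lemma maxid_prime:
  assumes "maxid m" "a \<in> carrier R" "b \<in> carrier R" "a \<otimes> b \<in> m" "a \<notin> m"
  shows "b \<in> m"
proof -
  note m = maxid_submodule[OF assms(1)]
  obtain s where s: "s \<in> carrier R" "\<one> \<ominus> s \<otimes> a \<in> m"
    using maxid_inverse[OF assms(1,2,5)] by blast
  have "b \<otimes> (\<one> \<ominus> s \<otimes> a) \<oplus> s \<otimes> (a \<otimes> b) \<in> m"
    using submodule_add[OF m] submodule_smult[OF m] s assms(3,4) by simp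
  moreover have "b \<otimes> (\<one> \<ominus> s \<otimes> a) \<oplus> s \<otimes> (a \<otimes> b) = b"
    using s(1) assms(2,3) by algebra
  ultimately show ?thesis by simp
qed

lemma ex_maxid:
  assumes "submodule I R (regular R)" "\<one> \<notin> I"
  obtains m where "maxid m" "I \<subseteq> m"
proof -
  define \<A> where "\<A> = {K. submodule K R (regular R) \<and> I \<subseteq> K \<and> \<one> \<notin> K}"
  have ne: "\<A> \<noteq> {}" using assms by (auto simp: \<A>_def)
  have chain: "\<Union>\<C> \<in> \<A>" if C: "\<C> \<noteq> {}" "subset.chain \<A> \<C>" for \<C>
  proof -
    have sub: "K \<in> \<A>" if "K \<in> \<C>" for K using C(2) that by (auto simp: subset.chain_def)
    have sm: "submodule K R (regular R)" "I \<subseteq> K" "\<one> \<notin> K" if "K \<in> \<C>" for K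
      using sub[OF that] by (auto simp: \<A>_def)
    have "submodule (\<Union>\<C>) R (regular R)"
    proof (rule lmodule.submoduleI[OF reg])
      show "\<Union>\<C> \<subseteq> carrier (regular R)" using submodule_subset[OF sm(1)] by blast
      show "\<zero>\<^bsub>regular R\<^esub> \<in> \<Union>\<C>" using submodule_zero_mem[OF sm(1)] C(1) by blast
      fix x y assume xy: "x \<in> \<Union>\<C>" "y \<in> \<Union>\<C>"
      then obtain G H where GH: "G \<in> \<C>" "x \<in> G" "H \<in> \<C>" "y \<in> H" by blast
      then have "G \<subseteq> H \<or> H \<subseteq> G" using C(2) unfolding subset_chain_def by blast
      then have "(x \<in> G \<and> y \<in> G) \<or> (x \<in> H \<and> y \<in> H)" using GH by blast
      then show "x \<oplus>\<^bsub>regular R\<^esub> y \<in> \<Union>\<C>"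
        using submodule_add[OF sm(1)[OF GH(1)]] submodule_add[OF sm(1)[OF GH(3)]] GH by blast
    next
      fix r x assume rx: "r \<in> carrier R" "x \<in> \<Union>\<C>"
      then obtain G where "G \<in> \<C>" "x \<in> G" by blast
      then show "r \<odot>\<^bsub>regular R\<^esub> x \<in> \<Union>\<C>"
        using submodule_smult[OF sm(1) rx(1)] by blast
    qed
    then show ?thesis using sm(2,3) C(1) by (auto simp: \<A>_def)
  qed
  obtain m where m: "m \<in> \<A>" "\<And>K. \<lbrakk>K \<in> \<A>; m \<subseteq> K\<rbrakk> \<Longrightarrow> K = m"
    using subset_Zorn_nonempty[OF ne chain] by metis
  have "maxid m"
    by (rule maxidI) (use m in \<open>auto simp: \<A>_def\<close>)
  then show ?thesis using that m(1) by (auto simp: \<A>_def)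
qed

lemma maxid_iff_maximalideal: "maxid m \<longleftrightarrow> maximalideal m R"
proof
  assume m: "maxid m"
  show "maximalideal m R"
  proof (rule maximalidealI)
    show "ideal m R" using maxid_submodule[OF m] by (simp add: ideal_iff_submodule)
    show "carrier R \<noteq> m" using m by (auto simp: maxid_def)
    show "J = m \<or> J = carrier R" if J: "ideal J R" "m \<subseteq> J" "J \<subseteq> carrier R" for J
    proof (cases "\<one> \<in> J")
      case True
      then show ?thesis using ideal.one_imp_carrier[OF J(1)] by simp
    next
      case False
      then show ?thesis using maxid_maximal[OF m _ J(2)] J(1) by (simp add: ideal_iff_submodule)
    qed
  qed
next
  assume "maximalideal m R"
  then interpret maximalideal m R .
  have one: "\<one> \<notin> J" if "ideal J R" "J \<noteq> carrier R" for J
    using ideal.one_imp_carrier[OF that(1)] that(2) by blast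
  show "maxid m"
  proof (rule maxidI)
    show "submodule m R (regular R)" using is_ideal by (simp add: ideal_iff_submodule)
    show "\<one> \<notin> m" using one[OF is_ideal] I_notcarr by auto
    show "I = m" if "submodule I R (regular R)" "m \<subseteq> I" "\<one> \<notin> I" for I
      using I_maximal[of I] that submodule_subset[OF that(1)] by (auto simp: ideal_iff_submodule)
  qed
qed

lemma jacobson_radical_iff: "x \<in> jacobson_radical R \<longleftrightarrow> x \<in> carrier R \<and> (\<forall>m. maxid m \<longrightarrow> x \<in> m)"
  by (auto simp: jacobson_radical_def maxid_iff_maximalideal)

lemma submodule_jacobson_radical: "submodule (jacobson_radical R) R (regular R)"
proof (rule lmodule.submoduleI[OF reg])
  show "jacobson_radical R \<subseteq> carrier (regular R)" by (simp add: jacobson_radical_def)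
  show "\<zero>\<^bsub>regular R\<^esub> \<in> jacobson_radical R"
    using submodule_zero_mem[OF maxid_submodule] by (simp add: jacobson_radical_iff)
  show "x \<oplus>\<^bsub>regular R\<^esub> y \<in> jacobson_radical R"
    if "x \<in> jacobson_radical R" "y \<in> jacobson_radical R" for x y
    using that submodule_add[OF maxid_submodule, of _ x y] by (simp add: jacobson_radical_iff)
  show "r \<odot>\<^bsub>regular R\<^esub> x \<in> jacobson_radical R"
    if "r \<in> carrier R" "x \<in> jacobson_radical R" for r x
    using that submodule_smult[OF maxid_submodule, of _ r x] by (simp add: jacobson_radical_iff)
qed

end

section \<open>Matlis duality over the base ring\<close>

text \<open>The ring \<open>L'\<close> is either \<open>opp L\<close> or, when \<open>L\<close> is commutative, \<open>L\<close> itself.\<close>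

lemma lmodule_Dual_gen:
  assumes "ring R" "\<phi> \<in> ring_hom R L" "lmodule R E" "lmodule L M" "ring L'"
    and L': "carrier L' = carrier L" "\<zero>\<^bsub>L'\<^esub> = \<zero>\<^bsub>L\<^esub>" "\<one>\<^bsub>L'\<^esub> = \<one>\<^bsub>L\<^esub>"
      "\<And>x y. \<lbrakk>x \<in> carrier L; y \<in> carrier L\<rbrakk> \<Longrightarrow> x \<oplus>\<^bsub>L'\<^esub> y = x \<oplus>\<^bsub>L\<^esub> y"
      "\<And>x y. \<lbrakk>x \<in> carrier L; y \<in> carrier L\<rbrakk> \<Longrightarrow> x \<otimes>\<^bsub>L'\<^esub> y = y \<otimes>\<^bsub>L\<^esub> x"
    and central: "\<And>r a. \<lbrakk>r \<in> carrier R; a \<in> carrier L\<rbrakk> \<Longrightarrow> \<phi> r \<otimes>\<^bsub>L\<^esub> a = a \<otimes>\<^bsub>L\<^esub> \<phi> r"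
  shows "lmodule L' (Dual R \<phi> E M)"
proof -
  interpret M: lmodule L M by fact
  interpret E: lmodule R E by fact
  let ?M = "restrict_scalars \<phi> M"
  have rM: "lmodule R ?M" by (rule lmodule_restrict_scalars[OF assms(1,2,4)])
  have \<phi>: "\<phi> r \<in> carrier L" if "r \<in> carrier R" for r
    using ring_hom_closed[OF assms(2) that] .
  have c: "f x \<in> carrier E" if "f \<in> hom_set R ?M E" "x \<in> carrier M" for f x
    using hom_closed[OF that(1)] that(2) by simp
  let ?D = "Dual R \<phi> E M"
  have D: "carrier ?D = hom_set R ?M E" "\<zero>\<^bsub>?D\<^esub> = (\<lambda>x\<in>carrier M. \<zero>\<^bsub>E\<^esub>)"
    "\<And>f g. f \<oplus>\<^bsub>?D\<^esub> g = (\<lambda>x\<in>carrier M. f x \<oplus>\<^bsub>E\<^esub> g x)"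
    "\<And>l f. l \<odot>\<^bsub>?D\<^esub> f = (\<lambda>x\<in>carrier M. f (l \<odot>\<^bsub>M\<^esub> x))"
    by (auto simp: Dual_def hom_mod_def hom_group_def)
  have eqI: "f = g" if "f \<in> carrier ?D" "g \<in> carrier ?D" "\<And>x. x \<in> carrier M \<Longrightarrow> f x = g x" for f g
    using hom_ext[of f R ?M E g E] that by (simp add: D(1))
  have zero: "\<zero>\<^bsub>?D\<^esub> \<in> carrier ?D"
    using hom_restrictI[OF rM, of "\<lambda>x. \<zero>\<^bsub>E\<^esub>" E] by (simp add: D)
  have add: "f \<oplus>\<^bsub>?D\<^esub> g \<in> carrier ?D" if "f \<in> carrier ?D" "g \<in> carrier ?D" for f g
  proof -
    have f: "f \<in> hom_set R ?M E" and g: "g \<in> hom_set R ?M E" using that by (auto simp: D)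
    show ?thesis
      using hom_restrictI[OF rM, of "\<lambda>x. f x \<oplus>\<^bsub>E\<^esub> g x" E] c[OF f] c[OF g]
        hom_add[OF f] hom_add[OF g] hom_smult[OF f] hom_smult[OF g]
      by (simp add: D E.smult_r_distr E.M.a_ac \<phi> M.smult_closed)
  qed
  have act: "l \<odot>\<^bsub>?D\<^esub> f \<in> carrier ?D" if "f \<in> carrier ?D" and l: "l \<in> carrier L" for f l
  proof -
    have f: "f \<in> hom_set R ?M E" using that(1) by (simp add: D)
    have "(\<lambda>x\<in>carrier ?M. f (l \<odot>\<^bsub>M\<^esub> x)) \<in> hom_set R ?M E"
    proof (rule hom_restrictI[OF rM])
      fix r x assume "r \<in> carrier R" "x \<in> carrier ?M"
      then show "f (l \<odot>\<^bsub>M\<^esub> (r \<odot>\<^bsub>?M\<^esub> x)) = r \<odot>\<^bsub>E\<^esub> f (l \<odot>\<^bsub>M\<^esub> x)"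
        using l hom_smult[OF f, of r "l \<odot>\<^bsub>M\<^esub> x"] \<phi> central[of r l]
        by (simp add: M.smult_closed flip: M.smult_assoc)
    qed (use l c[OF f] hom_add[OF f] in \<open>auto simp: M.smult_closed M.smult_r_distr\<close>)
    then show ?thesis by (simp add: D)
  qed
  have c': "f x \<in> carrier E" if "f \<in> carrier ?D" "x \<in> carrier M" for f x
    using c that by (simp add: D)
  have f0: "f \<zero>\<^bsub>M\<^esub> = \<zero>\<^bsub>E\<^esub>" if "f \<in> carrier ?D" for f
    using hom_zero[OF rM assms(3), of f] that by (simp add: D)
  have fadd: "f (x \<oplus>\<^bsub>M\<^esub> y) = f x \<oplus>\<^bsub>E\<^esub> f y" if "f \<in> carrier ?D" "x \<in> carrier M" "y \<in> carrier M" for f x y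
    using hom_add[of f R ?M E x y] that by (simp add: D)
  have p: "(f \<oplus>\<^bsub>?D\<^esub> g) x = f x \<oplus>\<^bsub>E\<^esub> g x" "(l \<odot>\<^bsub>?D\<^esub> f) x = f (l \<odot>\<^bsub>M\<^esub> x)" "\<zero>\<^bsub>?D\<^esub> x = \<zero>\<^bsub>E\<^esub>"
    if "x \<in> carrier M" for f g l x
    using that by (simp_all add: D)
  note [simp] = zero add act p c' M.smult_closed
  show ?thesis
    by (rule lmoduleI[OF assms(5)]; (rule eqI)?)
      (simp_all add: L' E.M.a_ac f0 fadd M.smult_l_distr M.smult_assoc M.smult_one)
qed

lemma Dual_simps:
  "carrier (Dual R \<phi> E M) = hom_set R (restrict_scalars \<phi> M) E"
  "\<zero>\<^bsub>Dual R \<phi> E M\<^esub> = (\<lambda>x\<in>carrier M. \<zero>\<^bsub>E\<^esub>)"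
  "f \<oplus>\<^bsub>Dual R \<phi> E M\<^esub> g = (\<lambda>x\<in>carrier M. f x \<oplus>\<^bsub>E\<^esub> g x)"
  "l \<odot>\<^bsub>Dual R \<phi> E M\<^esub> f = (\<lambda>x\<in>carrier M. f (l \<odot>\<^bsub>M\<^esub> x))"
  by (auto simp: Dual_def hom_mod_def hom_group_def)

lemma restrict_scalars_id [simp]: "restrict_scalars id M = M"
  by (cases M) (simp add: restrict_scalars_def)

lemma restrict_scalars_Dual:
  "restrict_scalars \<phi> (Dual R \<phi> E M) = Dual R id E (restrict_scalars \<phi> M)"
  by (simp add: Dual_def hom_mod_def restrict_scalars_def)

locale matlis_base = artin_base R for R :: "'r ring" (structure) +
  fixes \<iota> :: "'r set \<Rightarrow> 'e" and E :: "('r, 'e) module"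
  assumes envelope: "injective_envelope R (quot_mod (regular R) (jacobson_radical R)) \<iota> E"
begin

lemma inj: "injective R E"
  using envelope by (simp add: injective_envelope_def)

lemma E: "lmodule R E"
  using inj by (simp add: injective_def)

sublocale E: lmodule R E by (rule E)

sublocale Q: lmodule_sub R "regular R" "jacobson_radical R"
  using reg submodule_jacobson_radical by (rule lmodule_subI)

section \<open>The copy of \<open>R / J(R)\<close> in \<open>E\<close> and separation by maps into
  \<open>E\<close>\<close>

definition soc where "soc y = \<iota> (Q.proj y)"

lemma
  shows soc_closed: "y \<in> carrier R \<Longrightarrow> soc y \<in> carrier E"
    and soc_smult: "\<lbrakk>r \<in> carrier R; y \<in> carrier R\<rbrakk> \<Longrightarrow> r \<odot>\<^bsub>E\<^esub> soc y = soc (r \<otimes> y)"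
    and soc_eq_zero: "y \<in> carrier R \<Longrightarrow> soc y = \<zero>\<^bsub>E\<^esub> \<longleftrightarrow> y \<in> jacobson_radical R"
proof -
  have \<iota>: "\<iota> \<in> hom_set R (quot_mod (regular R) (jacobson_radical R)) E"
    "inj_on \<iota> (carrier (quot_mod (regular R) (jacobson_radical R)))"
    using envelope by (auto simp: injective_envelope_def)
  have p: "Q.proj y \<in> carrier (quot_mod (regular R) (jacobson_radical R))" if "y \<in> carrier R" for y
    using hom_closed[OF Q.proj_hom] that by simp
  show "soc y \<in> carrier E" if "y \<in> carrier R"
    unfolding soc_def by (rule hom_closed[OF \<iota>(1) p[OF that]])
  show "r \<odot>\<^bsub>E\<^esub> soc y = soc (r \<otimes> y)" if "r \<in> carrier R" "y \<in> carrier R"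
    using hom_smult[OF \<iota>(1) that(1) p[OF that(2)]] hom_smult[OF Q.proj_hom that(1), of y] that
    by (simp add: soc_def)
  show "soc y = \<zero>\<^bsub>E\<^esub> \<longleftrightarrow> y \<in> jacobson_radical R" if "y \<in> carrier R"
    using \<iota>(2) p[OF that] Q.proj_eq_zero[of y] that hom_zero[OF Q.lmodule_quot_mod E \<iota>(1)]
    unfolding hom_inj_iff[OF Q.lmodule_quot_mod E \<iota>(1)] soc_def by (metis regular_simps(1))
qed

text \<open>Essentiality is applied to the cyclic submodule generated by \<open>e\<close>, which has
  to meet the copy of \<open>R / J(R)\<close>.\<close>

lemma soc_essential:
  assumes "e \<in> carrier E" "e \<noteq> \<zero>\<^bsub>E\<^esub>"
  obtains r y where "r \<in> carrier R" "y \<in> carrier R" "r \<odot>\<^bsub>E\<^esub> e = soc y" "soc y \<noteq> \<zero>\<^bsub>E\<^esub>"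
proof -
  let ?K = "multiples R E e"
  let ?S = "\<iota> ` carrier (quot_mod (regular R) (jacobson_radical R))"
  have K: "submodule ?K R E" by (rule submodule_multiples[OF E assms(1)])
  have "?K \<noteq> {\<zero>\<^bsub>E\<^esub>}" using mem_multiples[OF E assms(1)] assms(2) by blast
  then have "?K \<inter> ?S \<noteq> {\<zero>\<^bsub>E\<^esub>}"
    using envelope K unfolding injective_envelope_def essential_def by blast
  moreover have "\<zero>\<^bsub>E\<^esub> \<in> ?K \<inter> ?S"
    using envelope submodule_zero_mem[OF K] submodule_zero_mem[of ?S R E]
    unfolding injective_envelope_def essential_def by blast
  ultimately obtain z where z: "z \<in> ?K" "z \<in> ?S" "z \<noteq> \<zero>\<^bsub>E\<^esub>" by blast
  then obtain y where "y \<in> carrier R" "z = soc y"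
    unfolding soc_def Q.proj_image[symmetric] by auto
  moreover obtain r where "r \<in> carrier R" "z = r \<odot>\<^bsub>E\<^esub> e"
    using z(1) by (auto simp: multiples_def)
  ultimately show ?thesis using that z(3) by metis
qed

text \<open>A minimal ideal among those not contained in \<open>m\<close> meets \<open>m\<close> in the radical.\<close>

lemma ex_soc:
  assumes m: "maxid m"
  obtains e where "e \<in> carrier E" "e \<noteq> \<zero>\<^bsub>E\<^esub>" "\<And>r. r \<in> m \<Longrightarrow> r \<odot>\<^bsub>E\<^esub> e = \<zero>\<^bsub>E\<^esub>"
proof -
  have "\<not> carrier R \<subseteq> m" using m by (auto simp: maxid_def)
  then obtain I where I: "submodule I R (regular R)" "\<not> I \<subseteq> m"
    "\<And>I'. \<lbrakk>submodule I' R (regular R); \<not> I' \<subseteq> m; I' \<subseteq> I\<rbrakk> \<Longrightarrow> I' = I"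
    using submodule_regular_minimal[of "carrier R" "\<lambda>I. \<not> I \<subseteq> m"] lmodule.submodule_carrier[OF reg]
    by auto
  obtain y where y: "y \<in> I" "y \<notin> m" using I(2) by blast
  have yR: "y \<in> carrier R" using submodule_mem[OF I(1) y(1)] by simp
  \<comment> \<open>If \<open>I\<close> is not inside \<open>m'\<close>, minimality of
    \<open>I\<close> puts the intersection of \<open>I\<close> and \<open>m'\<close> inside
    \<open>m\<close>. For \<open>b\<close> in \<open>m'\<close> the product of \<open>y\<close> and
    \<open>b\<close> lies in that intersection, and \<open>m\<close> is prime and does not contain
    \<open>y\<close>; so \<open>m'\<close> is contained in \<open>m\<close>, and the two
    coincide.\<close>
  have "r \<otimes> y \<in> m'" if r: "r \<in> m" and m': "maxid m'" for r m'
  proof (cases "I \<subseteq> m'")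
    case True
    then show ?thesis
      using submodule_smult[OF maxid_submodule[OF m'] maxid_mem[OF m r], of y] y(1) by auto
  next
    case False
    have "submodule (I \<inter> m') R (regular R)"
      by (rule submodule_Int[OF reg I(1) maxid_submodule[OF m']])
    then have sub: "I \<inter> m' \<subseteq> m" using I(3)[of "I \<inter> m'"] False by blast
    have "m' \<subseteq> m"
    proof
      fix b assume b: "b \<in> m'"
      have bR: "b \<in> carrier R" by (rule maxid_mem[OF m' b])
      have "y \<otimes> b \<in> m'"
        using submodule_smult[OF maxid_submodule[OF m'] yR b] by simp
      moreover have "y \<otimes> b \<in> I"
        using submodule_smult[OF I(1) bR y(1)] m_comm[OF yR bR] by simp
      ultimately show "b \<in> m"
        using maxid_prime[OF m yR bR _ y(2)] sub by blast
    qed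
    then have "m = m'" by (rule maxid_subset_eq[OF m' m])
    then show ?thesis
      using submodule_smult[OF maxid_submodule[OF m] yR r] m_comm[OF yR maxid_mem[OF m r]] by simp
  qed
  then have "r \<otimes> y \<in> jacobson_radical R" if "r \<in> m" for r
    using that maxid_mem[OF m that] yR by (simp add: jacobson_radical_iff)
  then have "r \<odot>\<^bsub>E\<^esub> soc y = \<zero>\<^bsub>E\<^esub>" if "r \<in> m" for r
    using that soc_smult[OF maxid_mem[OF m that] yR] soc_eq_zero maxid_mem[OF m that] yR by simp
  moreover have "soc y \<noteq> \<zero>\<^bsub>E\<^esub>"
    using soc_eq_zero[OF yR] y(2) m by (auto simp: jacobson_radical_iff)
  ultimately show ?thesis using that[of "soc y"] soc_closed[OF yR] by blast
qed

text \<open>On elements killed by \<open>m\<close> the action factors through the field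
  \<open>R / m\<close>, so a scalar outside \<open>m\<close> can be undone there.\<close>

lemma maxid_annihilator_inverse:
  assumes m: "maxid m" and e: "e \<in> carrier E" "\<And>r. r \<in> m \<Longrightarrow> r \<odot>\<^bsub>E\<^esub> e = \<zero>\<^bsub>E\<^esub>"
    and r: "r \<in> carrier R" "r \<notin> m"
  obtains s where "s \<in> carrier R" "\<one> \<ominus> s \<otimes> r \<in> m" "s \<odot>\<^bsub>E\<^esub> (r \<odot>\<^bsub>E\<^esub> e) = e"
proof -
  obtain s where s: "s \<in> carrier R" "\<one> \<ominus> s \<otimes> r \<in> m" using maxid_inverse[OF m r] by blast
  have "e = (\<one> \<ominus> s \<otimes> r) \<odot>\<^bsub>E\<^esub> e \<oplus>\<^bsub>E\<^esub> (s \<otimes> r) \<odot>\<^bsub>E\<^esub> e"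
  proof -
    have "(\<one> \<ominus> s \<otimes> r) \<oplus> s \<otimes> r = \<one>" using s(1) r(1) by (simp add: a_minus_def a_assoc l_neg)
    then show ?thesis
      using E.smult_l_distr[of "\<one> \<ominus> s \<otimes> r" "s \<otimes> r" e] s(1) r(1) e(1) E.smult_one[OF e(1)] by simp
  qed
  then have "e = s \<odot>\<^bsub>E\<^esub> (r \<odot>\<^bsub>E\<^esub> e)"
    using e(2)[OF s(2)] s(1) r(1) e(1) by (simp add: E.smult_assoc E.smult_closed)
  then show ?thesis using that[OF s] by simp
qed

text \<open>Some nonzero multiple of \<open>e\<close> lies in the copy of \<open>R / J(R)\<close> by
  essentiality. Its scalar is outside \<open>m\<close>, and undoing it brings \<open>e\<close>
  itself into the copy.\<close>

lemma soc_of_annihilated: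
  assumes m: "maxid m" and e: "e \<in> carrier E" "\<And>r. r \<in> m \<Longrightarrow> r \<odot>\<^bsub>E\<^esub> e = \<zero>\<^bsub>E\<^esub>" "e \<noteq> \<zero>\<^bsub>E\<^esub>"
  obtains y where "y \<in> carrier R" "e = soc y"
proof -
  obtain r y where ry: "r \<in> carrier R" "y \<in> carrier R" "r \<odot>\<^bsub>E\<^esub> e = soc y" "soc y \<noteq> \<zero>\<^bsub>E\<^esub>"
    using soc_essential[OF e(1,3)] by blast
  then have "r \<notin> m" using e(2) by auto
  then obtain s where s: "s \<in> carrier R" "s \<odot>\<^bsub>E\<^esub> (r \<odot>\<^bsub>E\<^esub> e) = e"
    using maxid_annihilator_inverse[OF m e(1,2) ry(1)] by blast
  then have "e = soc (s \<otimes> y)" using ry soc_smult by simp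
  then show ?thesis using that s(1) ry(2) by blast
qed

text \<open>The elements of \<open>E\<close> killed by \<open>m\<close> form a space of dimension at
  most one over \<open>R / m\<close>: they come from \<open>R / J(R)\<close>, where commutativity
  lets a scalar change places with a representative.\<close>

lemma soc_simple:
  assumes m: "maxid m" and e: "e \<in> carrier E" "\<And>r. r \<in> m \<Longrightarrow> r \<odot>\<^bsub>E\<^esub> e = \<zero>\<^bsub>E\<^esub>" "e \<noteq> \<zero>\<^bsub>E\<^esub>"
    and e': "e' \<in> carrier E" "\<And>r. r \<in> m \<Longrightarrow> r \<odot>\<^bsub>E\<^esub> e' = \<zero>\<^bsub>E\<^esub>"
  obtains s where "s \<in> carrier R" "e' = s \<odot>\<^bsub>E\<^esub> e"
proof (cases "e' = \<zero>\<^bsub>E\<^esub>")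
  case True
  then show ?thesis using that[of \<zero>] e(1) by simp
next
  case False
  obtain y where y: "y \<in> carrier R" "e = soc y" using soc_of_annihilated[OF m e] by blast
  obtain y' where y': "y' \<in> carrier R" "e' = soc y'" using soc_of_annihilated[OF m e' False] by blast
  have my: "r \<otimes> y \<in> jacobson_radical R" if "r \<in> m" for r
    using e(2)[OF that] soc_smult soc_eq_zero maxid_mem[OF m that] y by simp
  \<comment> \<open>Since \<open>soc y\<close> is nonzero, some maximal ideal \<open>m'\<close>
    avoids \<open>y\<close>. It contains all products of \<open>m\<close> with \<open>y\<close> and
    is prime, hence contains \<open>m\<close> and equals it.\<close>
  have "y \<notin> m"
  proof
    assume ym: "y \<in> m"
    obtain m' where m': "maxid m'" "y \<notin> m'"
      using e(3) y soc_eq_zero[OF y(1)] by (auto simp: jacobson_radical_iff)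
    have "m \<subseteq> m'"
    proof
      fix r assume r: "r \<in> m"
      then have "y \<otimes> r \<in> m'"
        using my[OF r] m'(1) m_comm[OF y(1) maxid_mem[OF m r]] by (simp add: jacobson_radical_iff)
      then show "r \<in> m'" using maxid_prime[OF m'(1) y(1) maxid_mem[OF m r] _ m'(2)] by simp
    qed
    then show False using maxid_subset_eq[OF m m'(1)] ym m'(2) by simp
  qed
  then obtain s where s: "s \<in> carrier R" "\<one> \<ominus> s \<otimes> y \<in> m" using maxid_inverse[OF m y(1)] by blast
  have "(\<one> \<ominus> s \<otimes> y) \<odot>\<^bsub>E\<^esub> e' = \<zero>\<^bsub>E\<^esub>" using e'(2)[OF s(2)] .
  moreover have "(\<one> \<ominus> s \<otimes> y) \<oplus> s \<otimes> y = \<one>" using s(1) y(1) by (simp add: a_minus_def a_assoc l_neg)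
  ultimately have "e' = (s \<otimes> y) \<odot>\<^bsub>E\<^esub> e'"
    using E.smult_l_distr[of "\<one> \<ominus> s \<otimes> y" "s \<otimes> y" e'] s(1) y(1) e'(1)
    by (simp add: E.smult_one E.smult_closed)
  \<comment> \<open>With \<open>e'\<close> equal to \<open>soc y'\<close>, the factor
    \<open>y\<close> moves from the scalar into the argument, where it reproduces \<open>e\<close>
    as \<open>soc y\<close>.\<close>
  also have "\<dots> = soc ((s \<otimes> y') \<otimes> y)"
    using s(1) y(1) y' soc_smult[of "s \<otimes> y" y'] by (simp add: m_ac)
  also have "\<dots> = (s \<otimes> y') \<odot>\<^bsub>E\<^esub> e" using s(1) y y'(1) soc_smult[of "s \<otimes> y'" y] by simp
  finally show ?thesis using that[of "s \<otimes> y'"] s(1) y'(1) by simp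
qed

text \<open>The annihilator \<open>I\<close> of the class of \<open>x\<close> in
  \<open>M / K\<close> is proper and lies in some maximal ideal \<open>m\<close>. For a nonzero
  \<open>e\<close> killed by \<open>m\<close>, sending the class of \<open>r x\<close> to
  \<open>r e\<close> is well defined on the cyclic submodule, and injectivity of \<open>E\<close>
  extends it.\<close>

lemma separation:
  assumes M: "lmodule R M" and K: "submodule K R M" and x: "x \<in> carrier M" "x \<notin> K"
  obtains f where "f \<in> hom_set R M E" "\<And>k. k \<in> K \<Longrightarrow> f k = \<zero>\<^bsub>E\<^esub>" "f x \<noteq> \<zero>\<^bsub>E\<^esub>"
proof -
  interpret M: lmodule_sub R M K using M K by (rule lmodule_subI)
  interpret N: lmodule R "quot_mod M K" by (rule M.lmodule_quot_mod)
  let ?x = "M.proj x"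
  let ?C = "multiples R (quot_mod M K) ?x"
  have px: "?x \<in> carrier (quot_mod M K)" using hom_closed[OF M.proj_hom x(1)] .
  have C: "submodule ?C R (quot_mod M K)"
    by (rule submodule_multiples[OF M.lmodule_quot_mod px])
  define I where "I = {r \<in> carrier R. r \<odot>\<^bsub>M\<^esub> x \<in> K}"
  have Iq: "r \<in> I \<longleftrightarrow> r \<odot>\<^bsub>quot_mod M K\<^esub> ?x = \<zero>\<^bsub>quot_mod M K\<^esub>" if "r \<in> carrier R" for r
    using that hom_smult[OF M.proj_hom that x(1)] M.proj_eq_zero[of "r \<odot>\<^bsub>M\<^esub> x"] M.smult_closed[OF that x(1)]
    by (simp add: I_def)
  have I: "submodule I R (regular R)"
    unfolding I_def using x(1) submodule_zero_mem[OF K] submodule_add[OF K] submodule_smult[OF K]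
    by (intro lmodule.submoduleI[OF reg]) (auto simp: M.smult_l_distr M.smult_assoc)
  have "\<one> \<notin> I" using x by (simp add: I_def M.smult_one)
  then obtain m where m: "maxid m" "I \<subseteq> m" using ex_maxid[OF I] by blast
  obtain e where e: "e \<in> carrier E" "e \<noteq> \<zero>\<^bsub>E\<^esub>" "\<And>r. r \<in> m \<Longrightarrow> r \<odot>\<^bsub>E\<^esub> e = \<zero>\<^bsub>E\<^esub>"
    using ex_soc[OF m(1)] by blast
  define q where "q = (\<lambda>r\<in>carrier (regular R). r \<odot>\<^bsub>quot_mod M K\<^esub> ?x)"
  define f where "f = (\<lambda>r\<in>carrier (regular R). r \<odot>\<^bsub>E\<^esub> e)"
  have q: "q \<in> hom_set R (regular R) (submod (quot_mod M K) ?C)"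
    unfolding q_def using px by (intro hom_restrictI[OF reg])
      (auto simp: multiples_def N.smult_l_distr N.smult_assoc simp del: M.quot_mod_simps)
  have q_img: "q ` carrier (regular R) = carrier (submod (quot_mod M K) ?C)"
    by (auto simp: q_def multiples_def)
  have f: "f \<in> hom_set R (regular R) E"
    unfolding f_def using e(1) by (intro hom_restrictI[OF reg])
      (auto simp: E.smult_closed E.smult_l_distr E.smult_assoc)
  have qf: "f r = \<zero>\<^bsub>E\<^esub>" if "r \<in> carrier (regular R)" "q r = \<zero>\<^bsub>submod (quot_mod M K) ?C\<^esub>" for r
    using that Iq[of r] m(2) e(3) by (auto simp: f_def q_def)
  obtain g where g: "g \<in> hom_set R (submod (quot_mod M K) ?C) E"
    "\<And>r. r \<in> carrier (regular R) \<Longrightarrow> g (q r) = f r"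
    using hom_factor[OF reg lmodule_submod[OF M.lmodule_quot_mod C] E q q_img f qf] by metis
  obtain h where h: "h \<in> hom_set R (quot_mod M K) E" "\<And>z. z \<in> ?C \<Longrightarrow> h z = g z"
    using injective_extend[OF inj M.lmodule_quot_mod C g(1)] by metis
  have "h ?x = e"
  proof -
    have "q \<one> = ?x" using px by (simp add: q_def N.smult_one del: M.quot_mod_simps)
    then show ?thesis
      using g(2)[of \<one>] h(2)[OF mem_multiples[OF M.lmodule_quot_mod px]] e(1)
      by (simp add: f_def E.smult_one)
  qed
  show ?thesis
  proof (rule that[OF hom_compose[OF M M.proj_hom h(1)]])
    show "compose (carrier M) h M.proj k = \<zero>\<^bsub>E\<^esub>" if "k \<in> K" for k
      using that submodule_mem[OF K that] M.proj_eq_zero[of k] hom_zero[OF M.lmodule_quot_mod E h(1)]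
      by (simp add: compose_def)
    show "compose (carrier M) h M.proj x \<noteq> \<zero>\<^bsub>E\<^esub>"
      using \<open>h ?x = e\<close> x(1) e(2) by (simp add: compose_def)
  qed
qed

text \<open>
  An ideal \<open>I\<close> minimal among those of infinite length is killed or reproduced by every element of
  \<open>R\<close>, hence is a vector space over the field \<open>R / Ann I\<close>.  A nonzero map \<open>I \<rightarrow> E\<close> has simple image
  and a kernel smaller than \<open>I\<close>.
\<close>

lemma flen_regular: "flen R (regular R)"
proof (rule ccontr)
  assume "\<not> flen R (regular R)"
  then obtain I where I: "submodule I R (regular R)" "\<not> flen R (submod (regular R) I)"
    "\<And>I'. \<lbrakk>submodule I' R (regular R); \<not> flen R (submod (regular R) I'); I' \<subseteq> I\<rbrakk> \<Longrightarrow> I' = I"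
    using submodule_regular_minimal[of "carrier R" "\<lambda>I. \<not> flen R (submod (regular R) I)"]
      lmodule.submodule_carrier[OF reg] submod_carrier[of "regular R"] by auto
  let ?I = "submod (regular R) I"
  have mI: "lmodule R ?I" by (rule lmodule_submod[OF reg I(1)])
  have IR: "i \<in> carrier R" if "i \<in> I" for i using submodule_mem[OF I(1) that] by simp
  have small: "flen R (submod (regular R) J)" if "submodule J R ?I" "J \<noteq> I" for J
    using that I(3)[of J] submodule_submod_iff[OF reg I(1)] by blast
  \<comment> \<open>A nonzero map out of \<open>I\<close> has a kernel smaller than
    \<open>I\<close>, hence of finite length, so its image cannot have finite length as well. This
    is used for multiplication by a scalar and for a map into \<open>E\<close>.\<close>
  have ext: False
    if N: "lmodule R N" "f \<in> hom_set R ?I N" and i: "i \<in> I" "f i \<noteq> \<zero>\<^bsub>N\<^esub>"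
      and fl: "flen R (submod N (f ` I))" for N :: "('r, 'n) module" and f i
  proof -
    have W: "submodule (f ` I) R N"
      using submodule_image[OF mI N lmodule.submodule_carrier[OF mI]] by simp
    have f: "f \<in> hom_set R ?I (submod N (f ` I))"
      using hom_to_submod[OF N(2), of "f ` I"] by simp
    let ?Z = "mker ?I (submod N (f ` I)) f"
    have "?Z \<noteq> I" using i by (auto simp: mker_def)
    then have "flen R (submod ?I ?Z)"
      using small[OF submodule_mker[OF mI lmodule_submod[OF N(1) W] f]] by simp
    then show False
      using flen_ext[OF mI lmodule_submod[OF N(1) W] f fl] I(2) by blast
  qed
  define p where "p = {x \<in> carrier R. \<forall>i\<in>I. x \<otimes> i = \<zero>}"
  have p: "submodule p R (regular R)"
    using IR by (intro lmodule.submoduleI[OF reg]) (auto simp: p_def l_distr m_assoc)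
  \<comment> \<open>A proper submodule of \<open>I\<close> has finite length, so a scalar that does
    not kill \<open>I\<close> must map it onto itself.\<close>
  have img: "(\<lambda>i. x \<otimes> i) ` I = I" if x: "x \<in> carrier R" "x \<notin> p" for x
  proof (rule ccontr)
    assume ne: "(\<lambda>i. x \<otimes> i) ` I \<noteq> I"
    have f: "(\<lambda>i\<in>carrier ?I. x \<otimes> i) \<in> hom_set R ?I (regular R)"
      using x(1) IR by (intro hom_restrictI[OF mI]) (auto simp: r_distr m_lcomm)
    have img: "(\<lambda>i\<in>carrier ?I. x \<otimes> i) ` I = (\<lambda>i. x \<otimes> i) ` I" by auto
    have "submodule ((\<lambda>i. x \<otimes> i) ` I) R ?I"
      unfolding submodule_submod_iff[OF reg I(1)]
      using submodule_image[OF mI reg f lmodule.submodule_carrier[OF mI]]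
        submodule_smult[OF I(1) x(1)] by auto
    then have "flen R (submod (regular R) ((\<lambda>i\<in>carrier ?I. x \<otimes> i) ` I))"
      unfolding img using small ne by blast
    moreover obtain i where "i \<in> I" "x \<otimes> i \<noteq> \<zero>" using x by (auto simp: p_def)
    ultimately show False using ext[OF reg f, of i] by simp
  qed
  obtain v where v: "v \<in> I" "v \<noteq> \<zero>"
    using I(2) flen_trivial[of ?I R] by auto
  have "\<one> \<notin> p" using v IR by (auto simp: p_def)
  have maxp: "maxid p"
    unfolding maxid_def
  proof (intro conjI ballI p \<open>\<one> \<notin> p\<close>)
    fix x assume x: "x \<in> carrier R - p"
    then have xR: "x \<in> carrier R" by simp
    have pow: "(\<lambda>i. (x [^] (k::nat)) \<otimes> i) ` I = I" for k
    proof (induction k)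
      case 0
      then show ?case using IR by (auto simp: image_iff)
    next
      case (Suc k)
      have "(\<lambda>i. (x [^] Suc k) \<otimes> i) ` I = (\<lambda>i. (x [^] k) \<otimes> i) ` (\<lambda>i. x \<otimes> i) ` I"
        unfolding image_image using xR IR by (intro image_cong) (auto simp: m_assoc)
      then show ?case using img[of x] x Suc by simp
    qed
    \<comment> \<open>The ideals generated by the powers of \<open>x\<close> become stationary, so
      \<open>x^k\<close> is \<open>r\<close> times the next power. As \<open>x^k\<close> maps
      \<open>I\<close> onto itself, it follows that \<open>1 - r x\<close> kills \<open>I\<close>,
      which inverts \<open>x\<close> modulo \<open>p\<close>.\<close>
    let ?J = "\<lambda>k::nat. multiples R (regular R) (x [^] k)"
    have J: "submodule (?J k) R (regular R)" for k
      using submodule_multiples[OF reg, of "x [^] k"] xR by simp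
    obtain J0 where J0: "\<exists>k. J0 = ?J k"
      "\<And>I'. \<lbrakk>submodule I' R (regular R); \<exists>k. I' = ?J k; I' \<subseteq> J0\<rbrakk> \<Longrightarrow> I' = J0"
      using submodule_regular_minimal[where P = "\<lambda>I. \<exists>k. I = ?J k", OF J[of 0]] by metis
    then obtain k where k: "J0 = ?J k" by blast
    have "?J (Suc k) \<subseteq> ?J k"
    proof
      fix z assume "z \<in> ?J (Suc k)"
      then obtain r where r: "r \<in> carrier R" "z = r \<otimes> (x [^] k \<otimes> x)" by (auto simp: multiples_def)
      then have "z = (r \<otimes> x) \<otimes> x [^] k" using xR by (simp add: m_ac)
      then show "z \<in> ?J k" using r(1) xR by (auto simp: multiples_def)
    qed
    then have "?J (Suc k) = ?J k" using J0(2)[OF J, of "Suc k"] k by blast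
    moreover have "x [^] k \<in> ?J k" using mem_multiples[OF reg, of "x [^] k"] xR by simp
    ultimately obtain r where r: "r \<in> carrier R" "x [^] k = r \<otimes> (x [^] k \<otimes> x)"
      by (auto simp: multiples_def)
    have "(\<one> \<ominus> r \<otimes> x) \<otimes> i = \<zero>" if i: "i \<in> I" for i
    proof -
      obtain j where j: "j \<in> I" "i = x [^] k \<otimes> j" using pow[of k] i by blast
      have "(\<one> \<ominus> r \<otimes> x) \<otimes> x [^] k = x [^] k \<ominus> r \<otimes> (x [^] k \<otimes> x)"
        using r(1) xR nat_pow_closed[OF xR, of k] by algebra
      also have "\<dots> = \<zero>" using r(2)[symmetric] nat_pow_closed[OF xR, of k] by (simp add: a_minus_def r_neg)
      finally show ?thesis
        using j(2) IR[OF j(1)] r(1) xR by (simp add: m_assoc[symmetric])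
    qed
    then show "\<exists>s\<in>carrier R. \<one> \<ominus> s \<otimes> x \<in> p"
      using r(1) xR by (intro bexI[of _ r]) (auto simp: p_def)
  qed
  obtain f where f: "f \<in> hom_set R ?I E" "f v \<noteq> \<zero>\<^bsub>E\<^esub>"
    using separation[OF mI lmodule.submodule_zero[OF mI], of v] v by auto
  have ann: "r \<odot>\<^bsub>E\<^esub> f i = \<zero>\<^bsub>E\<^esub>" if "r \<in> p" "i \<in> I" for r i
  proof -
    have "r \<odot>\<^bsub>E\<^esub> f i = f (r \<otimes> i)"
      using hom_smult[OF f(1), of r i] that by (simp add: p_def)
    also have "r \<otimes> i = \<zero>" using that by (simp add: p_def)
    finally show ?thesis using hom_zero[OF mI E f(1)] by simp
  qed
  have fI: "submodule (f ` I) R E"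
    using submodule_image[OF mI E f(1) lmodule.submodule_carrier[OF mI]] by simp
  have "flen R (submod E (f ` I))"
  proof (rule flen_simple)
    fix K assume "submodule K R (submod E (f ` I))"
    then have K: "submodule K R E" "K \<subseteq> f ` I" using submodule_submod_iff[OF E fI] by auto
    show "K = {\<zero>\<^bsub>submod E (f ` I)\<^esub>} \<or> K = carrier (submod E (f ` I))"
    proof (cases "K = {\<zero>\<^bsub>E\<^esub>}")
      case False
      then obtain e where e: "e \<in> K" "e \<noteq> \<zero>\<^bsub>E\<^esub>" using submodule_zero_mem[OF K(1)] by blast
      have "e' \<in> K" if e': "e' \<in> f ` I" for e'
      proof -
        obtain s where "s \<in> carrier R" "e' = s \<odot>\<^bsub>E\<^esub> e"
          using soc_simple[OF maxp submodule_mem[OF K(1) e(1)] _ e(2) submodule_mem[OF fI e']]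
            ann e(1) e' K(2) by blast
        then show ?thesis using submodule_smult[OF K(1) _ e(1)] by simp
      qed
      then show ?thesis using K(2) by auto
    qed simp
  qed
  then show False using ext[OF E f(1) v(1) f(2)] by simp
qed

section \<open>Reflexivity of modules of finite length\<close>

lemma lmodule_Dual_id: "lmodule R M \<Longrightarrow> lmodule R (Dual R id E M)"
  by (rule lmodule_Dual_gen[where L = R and L' = R])
    (auto simp: ring_axioms E m_comm ring_hom_def)

text \<open>
  With \<open>N'\<close> maximal in \<open>N\<close> and \<open>x \<in> N - N'\<close>, the functionals vanishing on \<open>N'\<close> form a simple module,
  on which every \<open>\<xi>\<close> agrees with evaluation at a multiple of \<open>x\<close>.
\<close>

lemma flen_Dual_reflexive:
  fixes M :: "('r, 'm) module"
  assumes M: "lmodule R M" and "flen R M"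
  shows "flen R (Dual R id E M) \<and>
    (\<forall>\<xi>\<in>hom_set R (Dual R id E M) E. \<exists>x\<in>carrier M. \<forall>f\<in>hom_set R M E. \<xi> f = f x)"
proof -
  interpret M: lmodule R M by fact
  obtain \<rho> :: "'m set \<Rightarrow> nat" where \<rho>: "\<And>K K'. \<lbrakk>submodule K R M; submodule K' R M; K \<subset> K'\<rbrakk> \<Longrightarrow> \<rho> K < \<rho> K'"
    using assms(2) unfolding flen_def by blast
  \<comment> \<open>The induction runs over the submodules of the fixed \<open>M\<close>, measured
    by its rank function, so that all modules in it keep the type of \<open>M\<close>.\<close>
  have "flen R (Dual R id E (submod M N)) \<and>
    (\<forall>\<xi>\<in>hom_set R (Dual R id E (submod M N)) E. \<exists>x\<in>N. \<forall>f\<in>hom_set R (submod M N) E. \<xi> f = f x)"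
    if "submodule N R M" for N
    using that
  proof (induction "\<rho> N" arbitrary: N rule: less_induct)
    case less
    note N = less.prems
    let ?N = "submod M N"
    let ?D = "Dual R id E ?N"
    have mN: "lmodule R ?N" by (rule lmodule_submod[OF M N])
    have mD: "lmodule R ?D" by (rule lmodule_Dual_id[OF mN])
    interpret D: lmodule R ?D by (rule mD)
    have Dc: "carrier ?D = hom_set R ?N E" by (simp add: Dual_simps)
    show ?case
    proof (cases "N = {\<zero>\<^bsub>M\<^esub>}")
      case True
      have zero: "f = (\<lambda>x\<in>N. \<zero>\<^bsub>E\<^esub>)" if "f \<in> hom_set R ?N E" for f
        using that True hom_zero[OF mN E that] unfolding hom_set_def
        by (intro extensionalityI[of _ N]) (auto simp: PiE_def)
      have "\<xi> f = f \<zero>\<^bsub>M\<^esub>" if "\<xi> \<in> hom_set R ?D E" "f \<in> hom_set R ?N E" for \<xi> f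
      proof -
        have "f = \<zero>\<^bsub>?D\<^esub>" using zero[OF that(2)] by (simp add: Dual_simps)
        then have "\<xi> f = \<zero>\<^bsub>E\<^esub>" using hom_zero[OF mD E that(1)] by simp
        then show ?thesis using hom_zero[OF mN E that(2)] by simp
      qed
      moreover have "flen R ?D"
        by (rule flen_trivial) (use zero in \<open>auto simp: Dual_simps\<close>)
      ultimately show ?thesis using submodule_zero_mem[OF N] by blast
    next
      case False
      \<comment> \<open>A proper submodule of largest rank is maximal in \<open>N\<close>; the rank
        of \<open>N\<close> bounds the search.\<close>
      have "\<forall>N'. submodule N' R M \<and> N' \<subset> N \<longrightarrow> \<rho> N' < \<rho> N" using \<rho> N by blast
      moreover have "submodule {\<zero>\<^bsub>M\<^esub>} R M \<and> {\<zero>\<^bsub>M\<^esub>} \<subset> N"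
        using M.submodule_zero submodule_zero_mem[OF N] False by blast
      ultimately obtain N' where N': "submodule N' R M" "N' \<subset> N"
        and max: "\<And>K. submodule K R M \<and> K \<subset> N \<Longrightarrow> \<rho> K \<le> \<rho> N'"
        using ex_has_greatest_nat[of "\<lambda>N'. submodule N' R M \<and> N' \<subset> N" "{\<zero>\<^bsub>M\<^esub>}" \<rho> "\<rho> N"] by blast
      let ?N' = "submod M N'"
      let ?D' = "Dual R id E ?N'"
      have mN': "lmodule R ?N'" by (rule lmodule_submod[OF M N'(1)])
      have mD': "lmodule R ?D'" by (rule lmodule_Dual_id[OF mN'])
      have IH: "flen R ?D'" "\<And>\<xi>. \<xi> \<in> hom_set R ?D' E \<Longrightarrow> \<exists>x\<in>N'. \<forall>f\<in>hom_set R ?N' E. \<xi> f = f x"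
        using less.hyps[OF \<rho>[OF N'(1) N N'(2)] N'(1)] by blast+
      obtain x where x: "x \<in> N" "x \<notin> N'" using N'(2) by blast
      have xM: "x \<in> carrier M" by (rule submodule_mem[OF N x(1)])
      have gen: "N \<subseteq> N' <+>\<^bsub>M\<^esub> multiples R M z" if z: "z \<in> N" "z \<notin> N'" for z
      proof -
        have zM: "z \<in> carrier M" by (rule submodule_mem[OF N z(1)])
        note mu = submodule_multiples[OF M zM]
        let ?K = "N' <+>\<^bsub>M\<^esub> multiples R M z"
        have K: "submodule ?K R M" by (rule submodule_set_add[OF M N'(1) mu])
        have "?K \<subseteq> N"
          using N'(2) submodule_smult[OF N _ z(1)]
          by (intro set_add_least[OF N]) (auto simp: multiples_def)
        moreover have "N' \<subset> ?K"
          using set_add_upper[OF M N'(1) mu] mem_multiples[OF M zM] z(2) by blast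
        then have "\<not> \<rho> ?K \<le> \<rho> N'" using \<rho>[OF N'(1) K] by simp
        ultimately show ?thesis using max K by blast
      qed
      define I where "I = {r \<in> carrier R. r \<odot>\<^bsub>M\<^esub> x \<in> N'}"
      have I: "submodule I R (regular R)"
        unfolding I_def using xM submodule_zero_mem[OF N'(1)] submodule_add[OF N'(1)] submodule_smult[OF N'(1)]
        by (intro lmodule.submoduleI[OF reg]) (auto simp: M.smult_l_distr M.smult_assoc)
      \<comment> \<open>If \<open>r x\<close> is outside \<open>N'\<close>, it generates
        \<open>N\<close> together with \<open>N'\<close>; expressing \<open>x\<close> in these terms
        yields an inverse of \<open>r\<close> modulo \<open>I\<close>.\<close>
      have maxI: "maxid I"
        unfolding maxid_def
      proof (intro conjI ballI I)
        show "\<one> \<notin> I" using x xM by (simp add: I_def M.smult_one)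
        fix r assume "r \<in> carrier R - I"
        then have r: "r \<in> carrier R" "r \<odot>\<^bsub>M\<^esub> x \<notin> N'" by (auto simp: I_def)
        have "x \<in> N' <+>\<^bsub>M\<^esub> multiples R M (r \<odot>\<^bsub>M\<^esub> x)"
          using gen[OF submodule_smult[OF N r(1) x(1)] r(2)] x(1) by blast
        then obtain n s where ns: "n \<in> N'" "s \<in> carrier R" "x = n \<oplus>\<^bsub>M\<^esub> s \<odot>\<^bsub>M\<^esub> (r \<odot>\<^bsub>M\<^esub> x)"
          unfolding mem_set_add multiples_def by blast
        have nM: "n \<in> carrier M" by (rule submodule_mem[OF N'(1) ns(1)])
        have "(\<one> \<ominus> s \<otimes> r) \<odot>\<^bsub>M\<^esub> x \<oplus>\<^bsub>M\<^esub> (s \<otimes> r) \<odot>\<^bsub>M\<^esub> x = n \<oplus>\<^bsub>M\<^esub> (s \<otimes> r) \<odot>\<^bsub>M\<^esub> x"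
        proof -
          have "(\<one> \<ominus> s \<otimes> r) \<oplus> s \<otimes> r = \<one>" using ns(2) r(1) by (simp add: a_minus_def a_assoc l_neg)
          then show ?thesis
            using M.smult_l_distr[of "\<one> \<ominus> s \<otimes> r" "s \<otimes> r" x] ns(2,3) r(1) xM
            by (simp add: M.smult_one M.smult_assoc)
        qed
        then have "(\<one> \<ominus> s \<otimes> r) \<odot>\<^bsub>M\<^esub> x = n"
          using nM ns(2) r(1) xM by (simp add: M.smult_closed)
        then show "\<exists>s\<in>carrier R. \<one> \<ominus> s \<otimes> r \<in> I"
          using ns(1,2) r(1) by (intro bexI[of _ s]) (auto simp: I_def)
      qed
      have subN': "submodule N' R ?N" using submodule_submod_iff[OF M N] N' by blast
      obtain f0 where f0: "f0 \<in> hom_set R ?N E" "\<And>k. k \<in> N' \<Longrightarrow> f0 k = \<zero>\<^bsub>E\<^esub>" "f0 x \<noteq> \<zero>\<^bsub>E\<^esub>"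
        using separation[OF mN subN', of x] x by auto
      have fx: "f x \<in> carrier E" if "f \<in> hom_set R ?N E" for f
        using hom_closed[OF that] x(1) by simp
      have Ifx: "r \<odot>\<^bsub>E\<^esub> f x = \<zero>\<^bsub>E\<^esub>" if "f \<in> hom_set R ?N E" "\<And>k. k \<in> N' \<Longrightarrow> f k = \<zero>\<^bsub>E\<^esub>" "r \<in> I" for f r
        using hom_smult[OF that(1), of r x] that(2)[of "r \<odot>\<^bsub>M\<^esub> x"] that(3) x(1) by (simp add: I_def)
      \<comment> \<open>Functionals vanishing on \<open>N'\<close> are determined by their value at
        \<open>x\<close>, because \<open>x\<close> and \<open>N'\<close> generate
        \<open>N\<close>.\<close>
      have det: "g = h"
        if g: "g \<in> hom_set R ?N E" "\<And>k. k \<in> N' \<Longrightarrow> g k = \<zero>\<^bsub>E\<^esub>"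
          and h: "h \<in> hom_set R ?N E" "\<And>k. k \<in> N' \<Longrightarrow> h k = \<zero>\<^bsub>E\<^esub>" and eq: "g x = h x" for g h
      proof (rule hom_ext[OF g(1) h(1)])
        fix y assume "y \<in> carrier ?N"
        then have "y \<in> N' <+>\<^bsub>M\<^esub> multiples R M x" using gen[OF x] by auto
        then obtain n u where u: "n \<in> N'" "u \<in> carrier R" "y = n \<oplus>\<^bsub>M\<^esub> u \<odot>\<^bsub>M\<^esub> x"
          unfolding mem_set_add multiples_def by blast
        have nN: "n \<in> N" using u(1) N'(2) by blast
        have uxN: "u \<odot>\<^bsub>M\<^esub> x \<in> N" by (rule submodule_smult[OF N u(2) x(1)])
        have "f y = u \<odot>\<^bsub>E\<^esub> f x" if f: "f \<in> hom_set R ?N E" "\<And>k. k \<in> N' \<Longrightarrow> f k = \<zero>\<^bsub>E\<^esub>" for f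
          using hom_add[OF f(1), of n "u \<odot>\<^bsub>M\<^esub> x"] hom_smult[OF f(1) u(2), of x] f(2)[OF u(1)]
            nN uxN x(1) u fx[OF f(1)] by (simp add: E.smult_closed)
        from this[OF g] this[OF h] eq show "g y = h y" by simp
      qed
      have act: "r \<odot>\<^bsub>?D\<^esub> f \<in> hom_set R ?N E" "\<And>y. y \<in> N \<Longrightarrow> (r \<odot>\<^bsub>?D\<^esub> f) y = r \<odot>\<^bsub>E\<^esub> f y"
        if "f \<in> hom_set R ?N E" "r \<in> carrier R" for f r
        using D.smult_closed[OF that(2), of f] that(1) hom_smult[OF that]
        by (auto simp: Dc) (auto simp: Dual_simps)
      have N'N: "N' \<subseteq> N" using N'(2) by blast
      have act0: "(r \<odot>\<^bsub>?D\<^esub> f) k = \<zero>\<^bsub>E\<^esub>"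
        if "f \<in> hom_set R ?N E" "r \<in> carrier R" "\<And>k. k \<in> N' \<Longrightarrow> f k = \<zero>\<^bsub>E\<^esub>" "k \<in> N'" for f r k
        using act(2)[OF that(1,2), of k] that(3)[of k] that(2) that(4) N'N by auto
      have mult: "\<exists>r\<in>carrier R. f = r \<odot>\<^bsub>?D\<^esub> f0"
        if f: "f \<in> hom_set R ?N E" "\<And>k. k \<in> N' \<Longrightarrow> f k = \<zero>\<^bsub>E\<^esub>" for f
      proof -
        obtain r where r: "r \<in> carrier R" "f x = r \<odot>\<^bsub>E\<^esub> f0 x"
          using soc_simple[OF maxI fx[OF f0(1)] Ifx[OF f0(1,2)] f0(3) fx[OF f(1)] Ifx[OF f]] by blast
        have "f = r \<odot>\<^bsub>?D\<^esub> f0"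
          using act(2)[OF f0(1) r(1) x(1)] r(2)
          by (intro det[OF f act(1)[OF f0(1) r(1)] act0[OF f0(1) r(1) f0(2)]]) auto
        then show ?thesis using r(1) by blast
      qed
      \<comment> \<open>Restriction to \<open>N'\<close> is onto by injectivity of \<open>E\<close>,
        and its kernel consists of the functionals vanishing on \<open>N'\<close>. A simple kernel
        together with the induction hypothesis gives the finite length of the dual.\<close>
      define res where "res = (\<lambda>f\<in>carrier ?D. restrict f N')"
      have res: "res \<in> hom_set R ?D ?D'"
        unfolding res_def
      proof (rule hom_restrictI[OF mD])
        show "restrict f N' \<in> carrier ?D'" if "f \<in> carrier ?D" for f
          using hom_restrict_submod[OF mN subN', of f E] that by (simp add: Dual_simps)
      qed (use N'N submodule_smult[OF N'(1)] in
          \<open>auto simp: Dual_simps fun_eq_iff restrict_def subset_iff\<close>)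
      have res_surj: "res ` carrier ?D = carrier ?D'"
      proof
        show "carrier ?D' \<subseteq> res ` carrier ?D"
        proof
          fix g assume "g \<in> carrier ?D'"
          then have g: "g \<in> hom_set R (submod ?N N') E" by (simp add: Dual_simps)
          obtain h where h: "h \<in> hom_set R ?N E" "\<And>z. z \<in> N' \<Longrightarrow> h z = g z"
            using injective_extend[OF inj mN subN' g] by metis
          have "restrict h N' = g"
            using h(2) g unfolding hom_set_def by (intro extensionalityI[of _ N']) (auto simp: PiE_def)
          then show "g \<in> res ` carrier ?D" using h(1) by (auto simp: res_def Dual_simps)
        qed
      qed (rule hom_image[OF res])
      have ker: "f k = \<zero>\<^bsub>E\<^esub>" if "f \<in> hom_set R ?N E" "res f = \<zero>\<^bsub>?D'\<^esub>" "k \<in> N'" for f k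
        using that by (simp add: res_def Dual_simps) (metis restrict_apply')
      have f0ker: "f0 \<in> mker ?D ?D' res"
        using f0 by (auto simp: mker_def res_def Dual_simps fun_eq_iff)
      have "flen R (submod ?D (mker ?D ?D' res))"
      proof (rule flen_simple)
        let ?Z = "mker ?D ?D' res"
        have Z: "submodule ?Z R ?D" by (rule submodule_mker[OF mD mD' res])
        fix K assume "submodule K R (submod ?D ?Z)"
        then have K: "submodule K R ?D" "K \<subseteq> ?Z" using submodule_submod_iff[OF mD Z] by auto
        show "K = {\<zero>\<^bsub>submod ?D ?Z\<^esub>} \<or> K = carrier (submod ?D ?Z)"
        proof (cases "K = {\<zero>\<^bsub>?D\<^esub>}")
          case False
          then obtain f where f: "f \<in> K" "f \<noteq> \<zero>\<^bsub>?D\<^esub>" using submodule_zero_mem[OF K(1)] by blast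
          have fN: "f \<in> hom_set R ?N E" "res f = \<zero>\<^bsub>?D'\<^esub>"
            using f(1) K(2) by (auto simp: mker_def Dual_simps)
          obtain r where r: "r \<in> carrier R" "f = r \<odot>\<^bsub>?D\<^esub> f0"
            using mult[OF fN(1) ker[OF fN]] by blast
          have "r \<notin> I"
          proof
            assume "r \<in> I"
            then have "f x = \<zero>\<^bsub>?D\<^esub> x"
              using Ifx[OF f0(1,2)] act(2)[OF f0(1) r(1) x(1)] r(2) x(1) by (simp add: Dual_simps)
            then have "f = \<zero>\<^bsub>?D\<^esub>"
              using D.M.zero_closed N'N
              by (intro det[OF fN(1) ker[OF fN]]) (auto simp: Dual_simps)
            then show False using f(2) by simp
          qed
          then obtain s where s: "s \<in> carrier R" "s \<odot>\<^bsub>E\<^esub> (r \<odot>\<^bsub>E\<^esub> f0 x) = f0 x"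
            using maxid_annihilator_inverse[OF maxI fx[OF f0(1)] Ifx[OF f0(1,2)] r(1)] by blast
          have sf: "s \<odot>\<^bsub>?D\<^esub> f \<in> K" by (rule submodule_smult[OF K(1) s(1) f(1)])
          have "f0 = s \<odot>\<^bsub>?D\<^esub> f"
            using act(2)[OF fN(1) s(1) x(1)] act(2)[OF f0(1) r(1) x(1)] r(2) s(2)
            by (intro det[OF f0(1,2) act(1)[OF fN(1) s(1)] act0[OF fN(1) s(1) ker[OF fN]]]) auto
          then have "f0 \<in> K" using sf by simp
          have "g \<in> K" if g: "g \<in> ?Z" for g
          proof -
            have gN: "g \<in> hom_set R ?N E" "res g = \<zero>\<^bsub>?D'\<^esub>"
              using g by (auto simp: mker_def Dual_simps)
            obtain t where t: "t \<in> carrier R" "g = t \<odot>\<^bsub>?D\<^esub> f0"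
              using mult[OF gN(1) ker[OF gN]] by blast
            then show ?thesis using submodule_smult[OF K(1) t(1) \<open>f0 \<in> K\<close>] by simp
          qed
          then show ?thesis using K(2) by auto
        qed simp
      qed
      then have "flen R ?D" using flen_ext[OF mD mD' res IH(1)] by blast
      moreover have "\<exists>z\<in>N. \<forall>f\<in>hom_set R ?N E. \<xi> f = f z" if \<xi>: "\<xi> \<in> hom_set R ?D E" for \<xi>
      proof -
        have \<xi>c: "\<xi> f \<in> carrier E" if "f \<in> hom_set R ?N E" for f
          using hom_closed[OF \<xi>] that by (simp add: Dc)
        have "r \<odot>\<^bsub>E\<^esub> \<xi> f0 = \<zero>\<^bsub>E\<^esub>" if r: "r \<in> I" for r
        proof -
          have rR: "r \<in> carrier R" using r by (simp add: I_def)
          have "r \<odot>\<^bsub>?D\<^esub> f0 = \<zero>\<^bsub>?D\<^esub>"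
            using D.M.zero_closed N'N Ifx[OF f0(1,2) r] act(2)[OF f0(1) rR x(1)] x(1)
            by (intro det[OF act(1)[OF f0(1) rR] act0[OF f0(1) rR f0(2)]]) (auto simp: Dual_simps)
          then show ?thesis
            using hom_smult[OF \<xi> rR, of f0] f0(1) hom_zero[OF mD E \<xi>] by (simp add: Dc)
        qed
        \<comment> \<open>The maximal ideal \<open>I\<close> kills both \<open>f0 x\<close> and
          \<open>\<xi> f0\<close>, so the latter is a multiple of the former. This makes
          \<open>s x\<close> the point at which \<open>\<xi>\<close> evaluates the functionals
          vanishing on \<open>N'\<close>.\<close>
        then obtain s where s: "s \<in> carrier R" "\<xi> f0 = s \<odot>\<^bsub>E\<^esub> f0 x"
          using soc_simple[OF maxI fx[OF f0(1)] Ifx[OF f0(1,2)] f0(3) \<xi>c[OF f0(1)]] by blast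
        have sxN: "s \<odot>\<^bsub>M\<^esub> x \<in> N" by (rule submodule_smult[OF N s(1) x(1)])
        define \<xi>' where "\<xi>' = (\<lambda>f\<in>carrier ?D. \<xi> f \<ominus>\<^bsub>E\<^esub> f (s \<odot>\<^bsub>M\<^esub> x))"
        have \<xi>': "\<xi>' \<in> hom_set R ?D E"
          unfolding \<xi>'_def
        proof (rule hom_restrictI[OF mD])
          fix f assume "f \<in> carrier ?D"
          then have f: "f \<in> hom_set R ?N E" by (simp add: Dc)
          have fs: "f (s \<odot>\<^bsub>M\<^esub> x) \<in> carrier E" using hom_closed[OF f] sxN by simp
          show "\<xi> f \<ominus>\<^bsub>E\<^esub> f (s \<odot>\<^bsub>M\<^esub> x) \<in> carrier E" using \<xi>c[OF f] fs by simp
          show "\<xi> (f \<oplus>\<^bsub>?D\<^esub> g) \<ominus>\<^bsub>E\<^esub> (f \<oplus>\<^bsub>?D\<^esub> g) (s \<odot>\<^bsub>M\<^esub> x) =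
              (\<xi> f \<ominus>\<^bsub>E\<^esub> f (s \<odot>\<^bsub>M\<^esub> x)) \<oplus>\<^bsub>E\<^esub> (\<xi> g \<ominus>\<^bsub>E\<^esub> g (s \<odot>\<^bsub>M\<^esub> x))" if "g \<in> carrier ?D" for g
          proof -
            have g: "g \<in> hom_set R ?N E" using that by (simp add: Dc)
            have gs: "g (s \<odot>\<^bsub>M\<^esub> x) \<in> carrier E" using hom_closed[OF g] sxN by simp
            have "(f \<oplus>\<^bsub>?D\<^esub> g) (s \<odot>\<^bsub>M\<^esub> x) = f (s \<odot>\<^bsub>M\<^esub> x) \<oplus>\<^bsub>E\<^esub> g (s \<odot>\<^bsub>M\<^esub> x)"
              using sxN by (simp add: Dual_simps)
            moreover have "\<xi> (f \<oplus>\<^bsub>?D\<^esub> g) = \<xi> f \<oplus>\<^bsub>E\<^esub> \<xi> g" using hom_add[OF \<xi>] f g by (simp add: Dc)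
            ultimately show ?thesis
              using \<xi>c[OF f] \<xi>c[OF g] fs gs by (simp add: a_minus_def E.M.minus_add E.M.a_ac)
          qed
          show "\<xi> (r \<odot>\<^bsub>?D\<^esub> f) \<ominus>\<^bsub>E\<^esub> (r \<odot>\<^bsub>?D\<^esub> f) (s \<odot>\<^bsub>M\<^esub> x) = r \<odot>\<^bsub>E\<^esub> (\<xi> f \<ominus>\<^bsub>E\<^esub> f (s \<odot>\<^bsub>M\<^esub> x))"
            if r: "r \<in> carrier R" for r
          proof -
            have "(r \<odot>\<^bsub>?D\<^esub> f) (s \<odot>\<^bsub>M\<^esub> x) = r \<odot>\<^bsub>E\<^esub> f (s \<odot>\<^bsub>M\<^esub> x)"
              using hom_smult[OF f r, of "s \<odot>\<^bsub>M\<^esub> x"] sxN by (simp add: Dual_simps)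
            moreover have "\<xi> (r \<odot>\<^bsub>?D\<^esub> f) = r \<odot>\<^bsub>E\<^esub> \<xi> f" using hom_smult[OF \<xi> r] f by (simp add: Dc)
            moreover have "r \<odot>\<^bsub>E\<^esub> (\<ominus>\<^bsub>E\<^esub> f (s \<odot>\<^bsub>M\<^esub> x)) = \<ominus>\<^bsub>E\<^esub> (r \<odot>\<^bsub>E\<^esub> f (s \<odot>\<^bsub>M\<^esub> x))"
              using E.smult_r_distr[OF r, of "f (s \<odot>\<^bsub>M\<^esub> x)" "\<ominus>\<^bsub>E\<^esub> f (s \<odot>\<^bsub>M\<^esub> x)"] r fs
              by (metis E.M.a_comm E.M.a_inv_closed E.M.minus_equality E.M.r_neg E.smult_closed E.smult_zero_right)
            ultimately show ?thesis
              using \<xi>c[OF f] fs r by (simp add: a_minus_def E.smult_r_distr)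
          qed
        qed
        have "\<xi>' f = \<zero>\<^bsub>E\<^esub>" if "f \<in> carrier ?D" "res f = \<zero>\<^bsub>?D'\<^esub>" for f
        proof -
          have f: "f \<in> hom_set R ?N E" using that(1) by (simp add: Dc)
          have fk: "f k = \<zero>\<^bsub>E\<^esub>" if "k \<in> N'" for k by (rule ker[OF f \<open>res f = \<zero>\<^bsub>?D'\<^esub>\<close> that])
          obtain r where r: "r \<in> carrier R" "f = r \<odot>\<^bsub>?D\<^esub> f0" using mult[OF f fk] by blast
          have "\<xi> f = r \<odot>\<^bsub>E\<^esub> (s \<odot>\<^bsub>E\<^esub> f0 x)" using hom_smult[OF \<xi> r(1), of f0] r(2) f0(1) s(2) by (simp add: Dc)
          moreover have "f (s \<odot>\<^bsub>M\<^esub> x) = r \<odot>\<^bsub>E\<^esub> (s \<odot>\<^bsub>E\<^esub> f0 x)"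
            using hom_smult[OF f0(1) r(1), of "s \<odot>\<^bsub>M\<^esub> x"] hom_smult[OF f0(1) s(1), of x] r(2) sxN x(1)
            by (simp add: Dual_simps)
          ultimately show ?thesis
            using that(1) r(1) s(1) fx[OF f0(1)] by (simp add: \<xi>'_def a_minus_def E.smult_closed E.M.r_neg)
        qed
        \<comment> \<open>With evaluation at \<open>s x\<close> subtracted, \<open>\<xi>\<close>
          vanishes on the kernel of restriction and descends to the dual of \<open>N'\<close>, where
          the induction hypothesis provides the point \<open>y\<close>. The sum of \<open>y\<close>
          and \<open>s x\<close> then represents \<open>\<xi>\<close>.\<close>
        then obtain \<eta> where \<eta>: "\<eta> \<in> hom_set R ?D' E" "\<And>f. f \<in> carrier ?D \<Longrightarrow> \<eta> (res f) = \<xi>' f"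
          using hom_factor[OF mD mD' E res res_surj \<xi>'] by metis
        obtain y where y: "y \<in> N'" "\<And>f. f \<in> hom_set R ?N' E \<Longrightarrow> \<eta> f = f y"
          using IH(2)[OF \<eta>(1)] by blast
        have yN: "y \<in> N" using y(1) N'N by blast
        have "\<xi> f = f (y \<oplus>\<^bsub>M\<^esub> s \<odot>\<^bsub>M\<^esub> x)" if f: "f \<in> hom_set R ?N E" for f
        proof -
          have fD: "f \<in> carrier ?D" using f by (simp add: Dc)
          have "res f \<in> hom_set R ?N' E" using hom_closed[OF res fD] by (simp add: Dual_simps)
          then have "\<xi>' f = f y" using \<eta>(2)[OF fD] y fD by (simp add: res_def)
          then have "\<xi> f \<ominus>\<^bsub>E\<^esub> f (s \<odot>\<^bsub>M\<^esub> x) = f y" using fD by (simp add: \<xi>'_def)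
          moreover have c: "f y \<in> carrier E" "f (s \<odot>\<^bsub>M\<^esub> x) \<in> carrier E"
            using hom_closed[OF f] yN sxN by auto
          ultimately have "\<xi> f = f y \<oplus>\<^bsub>E\<^esub> f (s \<odot>\<^bsub>M\<^esub> x)"
            using \<xi>c[OF f] by (metis E.M.a_assoc E.M.a_inv_closed E.M.l_neg E.M.r_zero a_minus_def)
          then show ?thesis using hom_add[OF f, of y "s \<odot>\<^bsub>M\<^esub> x"] yN sxN by simp
        qed
        then show ?thesis using submodule_add[OF N yN sxN] by blast
      qed
      ultimately show ?thesis by blast
    qed
  qed
  from this[OF M.submodule_carrier] show ?thesis by simp
qed

end

section \<open>Injective envelopes and projective covers\<close>

lemma (in abelian_group) add_diff_cancel: "\<lbrakk>x \<in> carrier G; y \<in> carrier G\<rbrakk> \<Longrightarrow> y \<oplus> (x \<ominus> y) = x"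
  by (metis a_comm a_assoc a_inv_closed a_minus_def l_neg r_zero)

lemma mod_isom_hom: "mod_isom R M N f \<Longrightarrow> f \<in> hom_set R M N"
  by (simp add: mod_isom_def)

lemma mod_isom_image: "mod_isom R M N f \<Longrightarrow> f ` carrier M = carrier N"
  by (simp add: mod_isom_def bij_betw_def)

lemma mod_isom_inj: "mod_isom R M N f \<Longrightarrow> inj_on f (carrier M)"
  by (simp add: mod_isom_def bij_betw_def)

lemma mod_isomI:
  "\<lbrakk>f \<in> hom_set R M N; inj_on f (carrier M); f ` carrier M = carrier N\<rbrakk> \<Longrightarrow> mod_isom R M N f"
  by (simp add: mod_isom_def bij_betw_def)

text \<open>Inverting the monomorphism \<open>u\<close> on its image reduces the claim to an
  extension from a submodule; again all types are arbitrary.\<close>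

lemma injective_extend_along:
  assumes I: "injective R I" and X: "lmodule R X" and Y: "lmodule R Y"
    and u: "u \<in> hom_set R X Y" "inj_on u (carrier X)" and f: "f \<in> hom_set R X I"
  obtains g where "g \<in> hom_set R Y I" "\<forall>x\<in>carrier X. g (u x) = f x"
proof -
  have U: "submodule (u ` carrier X) R Y"
    by (rule submodule_image[OF X Y u(1) lmodule.submodule_carrier[OF X]])
  have "mod_isom R X (submod Y (u ` carrier X)) u"
    using hom_to_submod[OF u(1)] u(2) by (auto intro: mod_isomI)
  then obtain v where v: "mod_isom R (submod Y (u ` carrier X)) X v"
    "\<And>x. x \<in> carrier X \<Longrightarrow> v (u x) = x"
    using mod_isom_inv[OF X lmodule_submod[OF Y U]] by metis
  have "compose (u ` carrier X) f v \<in> hom_set R (submod Y (u ` carrier X)) I"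
    using hom_compose[OF lmodule_submod[OF Y U] mod_isom_hom[OF v(1)] f] by simp
  from injective_extend[OF I Y U this] obtain g where g: "g \<in> hom_set R Y I"
    "\<And>y. y \<in> u ` carrier X \<Longrightarrow> g y = compose (u ` carrier X) f v y" by metis
  then have "\<forall>x\<in>carrier X. g (u x) = f x" using v(2) by (simp add: compose_def)
  then show ?thesis using that g(1) by blast
qed

lemma injective_iso:
  assumes I: "injective R I" and I': "lmodule R I'" and a: "mod_isom R I I' a"
  shows "injective R I'"
  unfolding injective_def
proof (intro conjI allI impI ballI I')
  fix X Y :: "('a, nat \<Rightarrow> 'a) module" and u f
  assume X: "lmodule R X" and Y: "lmodule R Y" and u: "u \<in> hom_set R X Y" "inj_on u (carrier X)"
    and f: "f \<in> hom_set R X I'"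
  have mI: "lmodule R I" using I by (simp add: injective_def)
  obtain b where b: "mod_isom R I' I b" "\<And>y. y \<in> carrier I' \<Longrightarrow> a (b y) = y"
    using mod_isom_inv[OF mI I' a] by metis
  obtain g where g: "g \<in> hom_set R Y I" "\<forall>x\<in>carrier X. g (u x) = compose (carrier X) b f x"
    by (rule injective_extend_along[OF I X Y u hom_compose[OF X f mod_isom_hom[OF b(1)]]])
  have "compose (carrier Y) a g (u x) = f x" if "x \<in> carrier X" for x
    using g(2) that b(2) hom_closed[OF f that] hom_closed[OF u(1) that] by (simp add: compose_def)
  then show "\<exists>g\<in>hom_set R Y I'. \<forall>x\<in>carrier X. g (u x) = f x"
    using hom_compose[OF Y g(1) mod_isom_hom[OF a]] by blast
qed

lemma essential_iso:
  assumes "lmodule R M" "lmodule R M'" "essential R M N" "mod_isom R M M' a"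
  shows "essential R M' (a ` N)"
proof -
  have N: "submodule N R M" using assms(3) by (simp add: essential_def)
  obtain b where b: "mod_isom R M' M b" "\<And>x. x \<in> carrier M \<Longrightarrow> b (a x) = x"
    "\<And>y. y \<in> carrier M' \<Longrightarrow> a (b y) = y"
    using mod_isom_inv[OF assms(1,2,4)] by metis
  note ah = mod_isom_hom[OF assms(4)] and bh = mod_isom_hom[OF b(1)]
  have "K = {\<zero>\<^bsub>M'\<^esub>}" if K: "submodule K R M'" "K \<inter> a ` N = {\<zero>\<^bsub>M'\<^esub>}" for K
  proof -
    have "b ` K \<inter> N = {\<zero>\<^bsub>M\<^esub>}"
    proof
      show "b ` K \<inter> N \<subseteq> {\<zero>\<^bsub>M\<^esub>}"
      proof
        fix x assume x: "x \<in> b ` K \<inter> N"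
        then obtain y where y: "y \<in> K" "x = b y" by blast
        then have "y = a x" using b(3) submodule_mem[OF K(1) y(1)] by simp
        then have "y = \<zero>\<^bsub>M'\<^esub>" using K(2) x y(1) by blast
        then show "x \<in> {\<zero>\<^bsub>M\<^esub>}" using y(2) hom_zero[OF assms(2,1) bh] by simp
      qed
      have "b \<zero>\<^bsub>M'\<^esub> \<in> b ` K" using submodule_zero_mem[OF K(1)] by blast
      then show "{\<zero>\<^bsub>M\<^esub>} \<subseteq> b ` K \<inter> N"
        using submodule_zero_mem[OF N] hom_zero[OF assms(2,1) bh] by simp
    qed
    then have bK: "b ` K = {\<zero>\<^bsub>M\<^esub>}"
      using assms(3) submodule_image[OF assms(2,1) bh K(1)] by (simp add: essential_def)
    have "y = \<zero>\<^bsub>M'\<^esub>" if "y \<in> K" for y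
    proof -
      have "b y = \<zero>\<^bsub>M\<^esub>" using bK that by blast
      then show ?thesis using b(3) submodule_mem[OF K(1) that] hom_zero[OF assms(1,2) ah] by metis
    qed
    then show ?thesis using submodule_zero_mem[OF K(1)] by blast
  qed
  then show ?thesis
    unfolding essential_def using submodule_image[OF assms(1,2) ah N] by blast
qed

text \<open>The extension \<open>a\<close> of \<open>j'\<close> after \<open>\<theta>\<close> is
  injective because its kernel meets the essential submodule trivially. A left inverse
  \<open>b\<close> of \<open>a\<close> is injective for the same reason on the other side. As
  \<open>a (b y)\<close> and \<open>y\<close> have the same image under \<open>b\<close>, they are
  equal, which makes \<open>a\<close> surjective.\<close>

lemma injective_envelope_unique:
  assumes M: "lmodule R M" "lmodule R M'" "mod_isom R M M' \<theta>"
    and I: "injective_envelope R M j I" "injective_envelope R M' j' I'"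
  obtains a where "mod_isom R I I' a" "\<forall>x\<in>carrier M. a (j x) = j' (\<theta> x)"
proof -
  have inj: "injective R I" "injective R I'" and j: "j \<in> hom_set R M I" "inj_on j (carrier M)"
    and j': "j' \<in> hom_set R M' I'" "inj_on j' (carrier M')"
    and ess: "essential R I (j ` carrier M)" "essential R I' (j' ` carrier M')"
    using I by (auto simp: injective_envelope_def)
  have mI: "lmodule R I" and mI': "lmodule R I'" using inj by (auto simp: injective_def)
  note \<theta> = mod_isom_hom[OF M(3)]
  obtain a where a: "a \<in> hom_set R I I'" "\<forall>x\<in>carrier M. a (j x) = compose (carrier M) j' \<theta> x"
    by (rule injective_extend_along[OF inj(2) M(1) mI j hom_compose[OF M(1) \<theta> j'(1)]])
  have aj: "a (j x) = j' (\<theta> x)" if "x \<in> carrier M" for x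
    using a(2) that by (simp add: compose_def)
  have "mker I I' a \<inter> j ` carrier M = {\<zero>\<^bsub>I\<^esub>}"
  proof
    show "mker I I' a \<inter> j ` carrier M \<subseteq> {\<zero>\<^bsub>I\<^esub>}"
    proof
      fix z assume "z \<in> mker I I' a \<inter> j ` carrier M"
      then obtain x where x: "x \<in> carrier M" "z = j x" "j' (\<theta> x) = \<zero>\<^bsub>I'\<^esub>"
        using aj by (auto simp: mker_def)
      then have "\<theta> x = \<zero>\<^bsub>M'\<^esub>"
        using j'(2) hom_closed[OF \<theta> x(1)] unfolding hom_inj_iff[OF M(2) mI' j'(1)] by blast
      then have "x = \<zero>\<^bsub>M\<^esub>"
        using mod_isom_inj[OF M(3)] x(1) unfolding hom_inj_iff[OF M(1,2) \<theta>] by blast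
      then show "z \<in> {\<zero>\<^bsub>I\<^esub>}" using x(2) hom_zero[OF M(1) mI j(1)] by simp
    qed
    show "{\<zero>\<^bsub>I\<^esub>} \<subseteq> mker I I' a \<inter> j ` carrier M"
      using submodule_zero_mem[OF submodule_mker[OF mI mI' a(1)]]
        submodule_zero_mem[OF submodule_image[OF M(1) mI j(1) lmodule.submodule_carrier[OF M(1)]]] by blast
  qed
  then have "mker I I' a = {\<zero>\<^bsub>I\<^esub>}"
    using ess(1) submodule_mker[OF mI mI' a(1)] by (simp add: essential_def)
  then have ainj: "inj_on a (carrier I)"
    unfolding hom_inj_iff[OF mI mI' a(1)] by (auto simp: mker_def)
  obtain b where b: "b \<in> hom_set R I' I" "\<forall>x\<in>carrier I. b (a x) = (\<lambda>x\<in>carrier I. x) x"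
    by (rule injective_extend_along[OF inj(1) mI mI' a(1) ainj hom_id[OF mI]])
  have "mker I' I b \<inter> j' ` carrier M' = {\<zero>\<^bsub>I'\<^esub>}"
  proof
    show "mker I' I b \<inter> j' ` carrier M' \<subseteq> {\<zero>\<^bsub>I'\<^esub>}"
    proof
      fix z assume z: "z \<in> mker I' I b \<inter> j' ` carrier M'"
      then obtain x where x: "x \<in> carrier M" "z = j' (\<theta> x)"
        unfolding mod_isom_image[OF M(3), symmetric] by blast
      then have "z = a (j x)" using aj by simp
      then have "j x = \<zero>\<^bsub>I\<^esub>" using z b(2) hom_closed[OF j(1) x(1)] by (simp add: mker_def)
      then show "z \<in> {\<zero>\<^bsub>I'\<^esub>}" using \<open>z = a (j x)\<close> hom_zero[OF mI mI' a(1)] by simp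
    qed
    show "{\<zero>\<^bsub>I'\<^esub>} \<subseteq> mker I' I b \<inter> j' ` carrier M'"
      using submodule_zero_mem[OF submodule_mker[OF mI' mI b(1)]]
        submodule_zero_mem[OF submodule_image[OF M(2) mI' j'(1) lmodule.submodule_carrier[OF M(2)]]] by blast
  qed
  then have "mker I' I b = {\<zero>\<^bsub>I'\<^esub>}"
    using ess(2) submodule_mker[OF mI' mI b(1)] by (simp add: essential_def)
  then have binj: "inj_on b (carrier I')"
    unfolding hom_inj_iff[OF mI' mI b(1)] by (auto simp: mker_def)
  have "a ` carrier I = carrier I'"
  proof
    show "carrier I' \<subseteq> a ` carrier I"
    proof
      fix y assume y: "y \<in> carrier I'"
      have by': "b y \<in> carrier I" by (rule hom_closed[OF b(1) y])
      have "b (a (b y)) = b y" using b(2) by' by simp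
      then have "a (b y) = y" using inj_onD[OF binj _ hom_closed[OF a(1) by'] y] by simp
      then show "y \<in> a ` carrier I" using by' by (metis imageI)
    qed
  qed (rule hom_image[OF a(1)])
  then show ?thesis using that mod_isomI[OF a(1) ainj] aj by blast
qed

text \<open>The isomorphism of the first envelopes matches the kernels of \<open>f\<close> and
  \<open>f'\<close>, so it induces an isomorphism of their images, which extends to the second
  envelopes. This makes \<open>cTr\<close> independent of the presentation chosen in its
  definition.\<close>

lemma min_inj_presentation_unique:
  assumes M: "lmodule R M" "lmodule R M'" "mod_isom R M M' \<theta>"
    and P: "min_inj_presentation R M j I0 f I1" "min_inj_presentation R M' j' I0' f' I1'"
  obtains a b where "mod_isom R I0 I0' a" "mod_isom R I1 I1' b" "\<forall>x\<in>carrier I0. b (f x) = f' (a x)"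
proof -
  let ?J = "f ` carrier I0" and ?J' = "f' ` carrier I0'"
  have I0: "injective_envelope R M j I0" "injective_envelope R M' j' I0'"
    and f: "f \<in> hom_set R I0 I1" "f' \<in> hom_set R I0' I1'"
    and ker: "mker I0 I1 f = j ` carrier M" "mker I0' I1' f' = j' ` carrier M'"
    and I1: "injective_envelope R (submod I1 ?J) (restrict id ?J) I1"
      "injective_envelope R (submod I1' ?J') (restrict id ?J') I1'"
    using P by (auto simp: min_inj_presentation_def)
  have m: "lmodule R I0" "lmodule R I0'" "lmodule R I1" "lmodule R I1'"
    using I0 I1 by (auto simp: injective_envelope_def injective_def)
  obtain a where a: "mod_isom R I0 I0' a" "\<forall>x\<in>carrier M. a (j x) = j' (\<theta> x)"
    by (rule injective_envelope_unique[OF M I0])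
  note ah = mod_isom_hom[OF a(1)]
  have J: "submodule ?J R I1" "submodule ?J' R I1'"
    using submodule_image[OF m(1,3) f(1)] submodule_image[OF m(2,4) f(2)] lmodule.submodule_carrier m
    by blast+
  have mJ: "lmodule R (submod I1 ?J)" "lmodule R (submod I1' ?J')"
    using lmodule_submod m(3,4) J by blast+
  have aker: "a x \<in> mker I0' I1' f' \<longleftrightarrow> x \<in> mker I0 I1 f" if x: "x \<in> carrier I0" for x
  proof -
    have "j' ` carrier M' = a ` j ` carrier M"
      unfolding mod_isom_image[OF M(3), symmetric] image_image using a(2) by auto
    moreover have "j ` carrier M \<subseteq> carrier I0" using ker(1) by (auto simp: mker_def)
    ultimately show ?thesis
      unfolding ker using mod_isom_inj[OF a(1)] x by (simp add: inj_on_image_mem_iff)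
  qed
  have f1: "f \<in> hom_set R I0 (submod I1 ?J)" "f ` carrier I0 = carrier (submod I1 ?J)"
    using hom_to_submod[OF f(1)] by auto
  have f2: "f' \<in> hom_set R I0' (submod I1' ?J')"
    using hom_to_submod[OF f(2)] by auto
  let ?h = "compose (carrier I0) f' a"
  have h: "?h \<in> hom_set R I0 (submod I1' ?J')" by (rule hom_compose[OF m(1) ah f2])
  have hz: "?h x = \<zero>\<^bsub>I1'\<^esub> \<longleftrightarrow> f x = \<zero>\<^bsub>I1\<^esub>" if "x \<in> carrier I0" for x
    using aker[OF that] that hom_closed[OF ah that] by (simp add: mker_def compose_def)
  obtain t where t: "t \<in> hom_set R (submod I1 ?J) (submod I1' ?J')"
    "\<And>x. x \<in> carrier I0 \<Longrightarrow> t (f x) = ?h x"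
    using hom_factor[OF m(1) mJ f1 h] hz by (metis submod_simps(2))
  have "inj_on t (carrier (submod I1 ?J))"
    unfolding hom_inj_iff[OF mJ t(1)] using t(2) hz by auto
  moreover have "t ` carrier (submod I1 ?J) = carrier (submod I1' ?J')"
  proof -
    have "t ` carrier (submod I1 ?J) = ?h ` carrier I0"
      using t(2) by (simp add: image_image)
    also have "\<dots> = f' ` a ` carrier I0" by (simp add: compose_def image_image)
    finally show ?thesis by (simp add: mod_isom_image[OF a(1)])
  qed
  ultimately have t': "mod_isom R (submod I1 ?J) (submod I1' ?J') t"
    by (rule mod_isomI[OF t(1)])
  obtain b where b: "mod_isom R I1 I1' b"
    "\<forall>x\<in>carrier (submod I1 ?J). b (restrict id ?J x) = restrict id ?J' (t x)"
    by (rule injective_envelope_unique[OF mJ t' I1])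
  have "b (f x) = f' (a x)" if "x \<in> carrier I0" for x
    using b(2) t(2) that hom_closed[OF ah that] by (simp add: compose_def)
  then show ?thesis using that[OF a(1) b(1)] by blast
qed

lemma min_inj_presentation_iso_module:
  assumes M: "lmodule R M" "mod_isom R M M' \<theta>" and P: "min_inj_presentation R M' j I0 f I1"
  shows "min_inj_presentation R M (compose (carrier M) j \<theta>) I0 f I1"
proof -
  have j: "j \<in> hom_set R M' I0" "inj_on j (carrier M')"
    using P by (auto simp: min_inj_presentation_def injective_envelope_def)
  have "inj_on (compose (carrier M) j \<theta>) (carrier M)"
    using comp_inj_on[OF mod_isom_inj[OF M(2)], of j] j(2) mod_isom_image[OF M(2)]
    by (simp add: compose_def inj_on_def)
  moreover have "compose (carrier M) j \<theta> ` carrier M = j ` carrier M'"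
    unfolding mod_isom_image[OF M(2), symmetric] by (simp add: compose_def image_image)
  ultimately show ?thesis
    using P hom_compose[OF M(1) mod_isom_hom[OF M(2)] j(1)]
    unfolding min_inj_presentation_def injective_envelope_def by simp
qed

text \<open>Used to replace the terms of a presentation by copies with carriers in
  \<open>nat \<Rightarrow> 'a\<close>, which shows that the choice in \<open>cTr\<close>
  succeeds.\<close>

lemma min_inj_presentation_iso:
  assumes P: "min_inj_presentation R M j I0 f I1" and M: "lmodule R M"
    and I: "lmodule R I0'" "lmodule R I1'" and a: "mod_isom R I0 I0' a" and b: "mod_isom R I1 I1' b"
  shows "\<exists>j' f'. min_inj_presentation R M j' I0' f' I1'"
proof -
  let ?J = "f ` carrier I0"
  have I0: "injective R I0" "j \<in> hom_set R M I0" "inj_on j (carrier M)" "essential R I0 (j ` carrier M)"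
    and f: "f \<in> hom_set R I0 I1" and ker: "mker I0 I1 f = j ` carrier M"
    and I1: "injective R I1" "essential R I1 (restrict id ?J ` carrier (submod I1 ?J))"
    using P by (auto simp: min_inj_presentation_def injective_envelope_def)
  have m: "lmodule R I0" "lmodule R I1" using I0(1) I1(1) by (auto simp: injective_def)
  note ah = mod_isom_hom[OF a] and bh = mod_isom_hom[OF b]
  obtain a' where a': "mod_isom R I0' I0 a'" "\<And>x. x \<in> carrier I0 \<Longrightarrow> a' (a x) = x"
    "\<And>y. y \<in> carrier I0' \<Longrightarrow> a (a' y) = y"
    using mod_isom_inv[OF m(1) I(1) a] by metis
  note a'h = mod_isom_hom[OF a'(1)]
  let ?j = "compose (carrier M) a j"
  let ?f = "compose (carrier I0') b (compose (carrier I0') f a')"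
  have j: "?j \<in> hom_set R M I0'" by (rule hom_compose[OF M I0(2) ah])
  have jimg: "?j ` carrier M = a ` j ` carrier M" by (simp add: compose_def image_image)
  have jinj: "inj_on ?j (carrier M)"
    using inj_onD[OF I0(3)] inj_onD[OF mod_isom_inj[OF a]] hom_closed[OF I0(2)]
    by (intro inj_onI) (simp add: compose_def)
  have f': "?f \<in> hom_set R I0' I1'" by (rule hom_compose[OF I(1) hom_compose[OF I(1) a'h f] bh])
  have fimg: "?f ` carrier I0' = b ` ?J"
    unfolding mod_isom_image[OF a'(1), symmetric] by (simp add: compose_def image_image)
  have "mker I0' I1' ?f = ?j ` carrier M"
  proof -
    have "b (f (a' y)) = \<zero>\<^bsub>I1'\<^esub> \<longleftrightarrow> f (a' y) = \<zero>\<^bsub>I1\<^esub>" if "y \<in> carrier I0'" for y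
      using hom_closed[OF f hom_closed[OF a'h that]] mod_isom_inj[OF b] hom_zero[OF m(2) I(2) bh]
      unfolding hom_inj_iff[OF m(2) I(2) bh] by metis
    then have "mker I0' I1' ?f = {y \<in> carrier I0'. a' y \<in> j ` carrier M}"
      unfolding ker[symmetric] using hom_closed[OF a'h] by (auto simp: mker_def compose_def)
    also have "\<dots> = a ` j ` carrier M"
    proof (intro Set.set_eqI iffI)
      fix y assume "y \<in> {y \<in> carrier I0'. a' y \<in> j ` carrier M}"
      then show "y \<in> a ` j ` carrier M" using a'(3)[of y] by (metis (no_types, lifting) imageI mem_Collect_eq)
    next
      fix y assume "y \<in> a ` j ` carrier M"
      then obtain x where "x \<in> carrier M" "y = a (j x)" by blast
      then show "y \<in> {y \<in> carrier I0'. a' y \<in> j ` carrier M}"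
        using a'(2) hom_closed[OF I0(2)] hom_closed[OF ah] by simp
    qed
    finally show ?thesis using jimg by simp
  qed
  moreover have "injective_envelope R M ?j I0'"
    unfolding injective_envelope_def jimg
    using injective_iso[OF I0(1) I(1) a] j jinj essential_iso[OF m(1) I(1) I0(4) a] by blast
  moreover have "injective_envelope R (submod I1' (?f ` carrier I0')) (restrict id (?f ` carrier I0')) I1'"
    unfolding injective_envelope_def fimg
  proof (intro conjI)
    have J: "submodule ?J R I1"
      by (rule submodule_image[OF m f lmodule.submodule_carrier[OF m(1)]])
    have bJ: "submodule (b ` ?J) R I1'" by (rule submodule_image[OF m(2) I(2) bh J])
    show "injective R I1'" by (rule injective_iso[OF I1(1) I(2) b])
    show "restrict id (b ` ?J) \<in> hom_set R (submod I1' (b ` ?J)) I1'"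
      using hom_incl[OF I(2) bJ] by (simp add: restrict_def id_def)
    show "inj_on (restrict id (b ` ?J)) (carrier (submod I1' (b ` ?J)))"
      by (simp add: inj_on_def)
    show "essential R I1' (restrict id (b ` ?J) ` carrier (submod I1' (b ` ?J)))"
      using essential_iso[OF m(2) I(2) I1(2) b] by simp
  qed
  ultimately have "min_inj_presentation R M ?j I0' ?f I1'"
    unfolding min_inj_presentation_def using f' by blast
  then show ?thesis by blast
qed

text \<open>
  If \<open>K\<close> is minimal with \<open>K + Z = F\<close> and \<open>Z'\<close> is then minimal in \<open>Z\<close> with \<open>K + Z' = F\<close>, then lifting
  \<open>F \<rightarrow> F / Z' \<cong> K / (K \<inter> Z')\<close> along \<open>K \<rightarrow> K / (K \<inter> Z')\<close> shows that the sum is direct.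
\<close>

lemma projective_cover_exists:
  fixes M :: "('a, 'm) module"
  assumes L: "flen L (regular L)" and M: "lmodule L M" "fin_gen L M"
  obtains P :: "('a, nat \<Rightarrow> 'a) module" and p where "projective_cover L P p M" "fin_gen L P"
proof -
  interpret M: lmodule L M by fact
  have ring: "ring L" by (rule M.R.ring_axioms)
  obtain n q where q: "q \<in> hom_set L (free_mod L n) M" "q ` carrier (free_mod L n) = carrier M"
    by (rule fin_gen_free_cover[OF M])
  define F where "F = free_mod L n"
  have F: "lmodule L F" unfolding F_def by (rule lmodule_free_mod[OF ring])
  interpret F: lmodule L F by (rule F)
  note q = q[folded F_def]
  have fF: "flen L F" unfolding F_def by (rule flen_free_mod[OF ring L])
  define Z where "Z = mker F M q"
  have Z: "submodule Z L F" unfolding Z_def by (rule submodule_mker[OF F M(1) q(1)])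
  have ZF: "carrier F <+>\<^bsub>F\<^esub> Z = carrier F" 
    using set_add_upper(1)[OF F F.submodule_carrier Z]
      set_add_least[OF F.submodule_carrier _ submodule_subset[OF Z], of "carrier F"] by blast
  obtain K where K: "submodule K L F" "K <+>\<^bsub>F\<^esub> Z = carrier F"
    and Kmin: "\<And>K'. \<lbrakk>submodule K' L F; K' <+>\<^bsub>F\<^esub> Z = carrier F; K' \<subseteq> K\<rbrakk> \<Longrightarrow> K' = K"
    using flen_minimal[where P = "\<lambda>K. K <+>\<^bsub>F\<^esub> Z = carrier F", OF fF F.submodule_carrier ZF] by metis
  have KZ: "K <+>\<^bsub>F\<^esub> Z = carrier F \<and> Z \<subseteq> Z" using K(2) by simp
  \<comment> \<open>\<open>K\<close> is a minimal supplement of \<open>Z\<close>, and now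
    \<open>Z'\<close> is a minimal supplement of \<open>K\<close> inside \<open>Z\<close>; the two
    minimality conditions are played against each other below.\<close>
  obtain Z' where Z': "submodule Z' L F" "K <+>\<^bsub>F\<^esub> Z' = carrier F" "Z' \<subseteq> Z"
    and Zmin: "\<And>Z''. \<lbrakk>submodule Z'' L F; K <+>\<^bsub>F\<^esub> Z'' = carrier F; Z'' \<subseteq> Z'\<rbrakk> \<Longrightarrow> Z'' = Z'"
    using flen_minimal[where P = "\<lambda>Z'. K <+>\<^bsub>F\<^esub> Z' = carrier F \<and> Z' \<subseteq> Z", OF fF Z KZ]
    by (metis order_trans)
  interpret Q: lmodule_sub L F Z' using F Z'(1) by (rule lmodule_subI)
  let ?Q = "quot_mod F Z'"
  have mK: "lmodule L (submod F K)" by (rule lmodule_submod[OF F K(1)])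
  let ?r = "restrict Q.proj K"
  have r: "?r \<in> hom_set L (submod F K) ?Q"
    by (rule hom_restrict_submod[OF F K(1) Q.proj_hom])
  have KF: "x \<in> carrier F" if "x \<in> K" for x by (rule submodule_mem[OF K(1) that])
  have r_img: "?r ` carrier (submod F K) = carrier ?Q"
  proof
    show "carrier ?Q \<subseteq> ?r ` carrier (submod F K)"
    proof
      fix y assume "y \<in> carrier ?Q"
      then obtain x where x: "x \<in> carrier F" "y = Q.proj x" unfolding Q.proj_image[symmetric] by blast
      then obtain k z where kz: "k \<in> K" "z \<in> Z'" "x = k \<oplus>\<^bsub>F\<^esub> z"
        using Z'(2) unfolding mem_set_add[symmetric] by (metis mem_set_add)
      have zF: "z \<in> carrier F" by (rule submodule_mem[OF Z'(1) kz(2)])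
      have "y = Q.proj k"
        using hom_add[OF Q.proj_hom KF[OF kz(1)] zF] Q.proj_eq_zero[OF zF] kz x(2)
          hom_closed[OF Q.proj_hom KF[OF kz(1)]] lmodule.axioms(2)[OF Q.lmodule_quot_mod]
        by (simp add: abelian_monoid.r_zero[OF abelian_group.axioms(1)] del: Q.quot_mod_simps)
      then show "y \<in> ?r ` carrier (submod F K)" using kz(1) by auto
    qed
  qed (rule hom_image[OF r])
  \<comment> \<open>Freeness of \<open>F\<close> lifts the projection to a map into \<open>K\<close>
    that is the identity modulo \<open>Z'\<close>.\<close>
  obtain \<theta> where \<theta>: "\<theta> \<in> hom_set L F (submod F K)" "\<And>x. x \<in> carrier F \<Longrightarrow> ?r (\<theta> x) = Q.proj x"
  proof -
    have "Q.proj \<in> hom_set L (free_mod L n) ?Q" using Q.proj_hom by (simp only: F_def)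
    from free_mod_lift[OF mK Q.lmodule_quot_mod r r_img this] show ?thesis
      using that unfolding F_def[symmetric] by metis
  qed
  have \<theta>K: "\<theta> x \<in> K" if "x \<in> carrier F" for x using hom_closed[OF \<theta>(1) that] by simp
  have \<theta>d: "\<theta> x \<ominus>\<^bsub>F\<^esub> x \<in> Z'" if x: "x \<in> carrier F" for x
  proof -
    have "Q.proj (\<theta> x) = Q.proj x" using \<theta>(2)[OF x] \<theta>K[OF x] by simp
    then show ?thesis using x KF[OF \<theta>K[OF x]] by (simp add: Q.proj_def Q.coset_eq_iff)
  qed
  have \<theta>h: "\<theta> \<in> hom_set L F F" by (rule hom_from_submod[OF \<theta>(1) submodule_subset[OF K(1)]])
  let ?W = "mker F (submod F K) \<theta>"
  have W: "submodule ?W L F" by (rule submodule_mker[OF F mK \<theta>(1)])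
  have "?W \<subseteq> Z'"
  proof
    fix x assume "x \<in> ?W"
    then have x: "x \<in> carrier F" "\<theta> x = \<zero>\<^bsub>F\<^esub>" by (auto simp: mker_def)
    then have "\<ominus>\<^bsub>F\<^esub> x \<in> Z'" using \<theta>d[OF x(1)] by (simp add: a_minus_def)
    then show "x \<in> Z'" using F.submodule_minus[OF Z'(1)] x(1) by fastforce
  qed
  \<comment> \<open>As \<open>\<theta>\<close> is the identity modulo \<open>Z\<close>, the image of
    \<open>K\<close> still supplements \<open>Z\<close>, and minimality of \<open>K\<close>
    applies.\<close>
  have img: "\<theta> ` K = K"
  proof (rule Kmin)
    show tK: "submodule (\<theta> ` K) L F" by (rule submodule_image[OF F F \<theta>h K(1)])
    show "\<theta> ` K \<subseteq> K" using \<theta>K KF by blast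
    show "\<theta> ` K <+>\<^bsub>F\<^esub> Z = carrier F"
    proof
      show "carrier F \<subseteq> \<theta> ` K <+>\<^bsub>F\<^esub> Z"
      proof
        fix x assume "x \<in> carrier F"
        then obtain k z where kz: "k \<in> K" "z \<in> Z" "x = k \<oplus>\<^bsub>F\<^esub> z"
          using K(2) mem_set_add by metis
        have c: "k \<in> carrier F" "z \<in> carrier F" "\<theta> k \<in> carrier F"
          using KF kz(1) submodule_mem[OF Z kz(2)] \<theta>K by auto
        have "\<theta> k \<ominus>\<^bsub>F\<^esub> k \<in> Z" using \<theta>d[OF c(1)] Z'(3) by blast
        then have "z \<ominus>\<^bsub>F\<^esub> (\<theta> k \<ominus>\<^bsub>F\<^esub> k) \<in> Z" using F.submodule_diff[OF Z kz(2)] by blast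
        moreover have "x = \<theta> k \<oplus>\<^bsub>F\<^esub> (z \<ominus>\<^bsub>F\<^esub> (\<theta> k \<ominus>\<^bsub>F\<^esub> k))"
          using c kz(3) by (simp add: a_minus_def F.M.minus_add F.M.a_ac F.M.r_neg1 F.M.r_neg)
        ultimately show "x \<in> \<theta> ` K <+>\<^bsub>F\<^esub> Z"
          unfolding mem_set_add using imageI[OF kz(1), of \<theta>] by (intro bexI)
      qed
    qed (rule set_add_least[OF F.submodule_carrier submodule_subset[OF tK] submodule_subset[OF Z]])
  qed
  \<comment> \<open>Every value of \<open>\<theta>\<close> is already taken on \<open>K\<close>, so
    the kernel of \<open>\<theta>\<close> supplements \<open>K\<close>; lying inside
    \<open>Z'\<close>, it equals \<open>Z'\<close>.\<close>
  have "K <+>\<^bsub>F\<^esub> ?W = carrier F"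
  proof
    show "carrier F \<subseteq> K <+>\<^bsub>F\<^esub> ?W"
    proof
      fix x assume x: "x \<in> carrier F"
      obtain k where k: "k \<in> K" "\<theta> x = \<theta> k" using img \<theta>K[OF x] by (metis imageE)
      have kF: "k \<in> carrier F" by (rule KF[OF k(1)])
      have "\<theta> (x \<ominus>\<^bsub>F\<^esub> k) = \<zero>\<^bsub>F\<^esub>"
        using hom_diff[OF F F \<theta>h x kF] k(2) KF[OF \<theta>K[OF kF]] by (simp add: F.M.diff_eq_zero_iff)
      then have "x \<ominus>\<^bsub>F\<^esub> k \<in> ?W" using x kF by (simp add: mker_def)
      moreover have "x = k \<oplus>\<^bsub>F\<^esub> (x \<ominus>\<^bsub>F\<^esub> k)" using x kF by (simp add: F.M.add_diff_cancel)
      ultimately show "x \<in> K <+>\<^bsub>F\<^esub> ?W" unfolding mem_set_add using k(1) by (intro bexI)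
    qed
  qed (rule set_add_least[OF F.submodule_carrier submodule_subset[OF K(1)] submodule_subset[OF W]])
  then have "?W = Z'" using Zmin[OF W] \<open>?W \<subseteq> Z'\<close> by blast
  \<comment> \<open>If \<open>x\<close> is \<open>\<theta> y\<close> and is killed, then both
    \<open>x\<close> and \<open>\<theta> y - y\<close> lie in \<open>Z'\<close>, hence so does
    \<open>y\<close>; but \<open>Z'\<close> is the kernel of \<open>\<theta>\<close>, so
    \<open>x\<close> is zero.\<close>
  have \<theta>_inj: "x = \<zero>\<^bsub>F\<^esub>" if x: "x \<in> K" "\<theta> x = \<zero>\<^bsub>F\<^esub>" for x
  proof -
    obtain y where y: "y \<in> K" "x = \<theta> y" using img x(1) by (metis imageE)
    have yF: "y \<in> carrier F" by (rule KF[OF y(1)])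
    have "x \<in> Z'" using that KF[OF that(1)] \<open>?W = Z'\<close> by (auto simp: mker_def)
    then have "x \<ominus>\<^bsub>F\<^esub> (\<theta> y \<ominus>\<^bsub>F\<^esub> y) \<in> Z'" using F.submodule_diff[OF Z'(1) _ \<theta>d[OF yF]] by blast
    moreover have "x \<ominus>\<^bsub>F\<^esub> (\<theta> y \<ominus>\<^bsub>F\<^esub> y) = y"
      using KF[OF that(1)] yF unfolding y(2)[symmetric] by (simp add: a_minus_def F.M.minus_add F.M.r_neg2)
    ultimately have "y \<in> ?W" using \<open>?W = Z'\<close> by simp
    then show ?thesis using y(2) by (simp add: mker_def)
  qed
  let ?t = "restrict \<theta> K"
  have t: "?t \<in> hom_set L (submod F K) (submod F K)"
    by (rule hom_restrict_submod[OF F K(1) \<theta>(1)])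
  have "mod_isom L (submod F K) (submod F K) ?t"
  proof (rule mod_isomI[OF t])
    show "inj_on ?t (carrier (submod F K))"
      unfolding hom_inj_iff[OF mK mK t] using \<theta>_inj by simp
    show "?t ` carrier (submod F K) = carrier (submod F K)" using img by simp
  qed
  then obtain s where s: "mod_isom L (submod F K) (submod F K) s" "\<And>x. x \<in> K \<Longrightarrow> s (?t x) = x"
    using mod_isom_inv[OF mK mK] by (metis submod_simps(1))
  \<comment> \<open>With \<open>s\<close> inverse to \<open>\<theta>\<close> on \<open>K\<close>,
    applying \<open>\<theta>\<close> and then \<open>s\<close> retracts \<open>F\<close> onto
    \<open>K\<close>.\<close>
  have "free_summand L (submod F K) n (\<lambda>x\<in>K. x) (compose (carrier F) s \<theta>)"
    unfolding free_summand_def F_def[symmetric]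
    using mK hom_incl[OF F K(1)] hom_compose[OF F \<theta>(1) mod_isom_hom[OF s(1)]] s(2) KF
    by (auto simp: compose_def)
  then have proj: "projective L (submod F K)" by (rule free_summand_projective)
  let ?p = "restrict q K"
  have p: "?p \<in> hom_set L (submod F K) M" by (rule hom_restrict_submod[OF F K(1) q(1)])
  have p_img: "?p ` carrier (submod F K) = carrier M"
  proof
    show "carrier M \<subseteq> ?p ` carrier (submod F K)"
    proof
      fix y assume "y \<in> carrier M"
      then obtain x where x: "x \<in> carrier F" "y = q x" using q(2) by blast
      obtain k z where kz: "k \<in> K" "z \<in> Z" "x = k \<oplus>\<^bsub>F\<^esub> z" using K(2) x(1) mem_set_add by metis
      have "q z = \<zero>\<^bsub>M\<^esub>" "z \<in> carrier F" using kz(2) by (auto simp: Z_def mker_def)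
      then have "y = q k" using hom_add[OF q(1) KF[OF kz(1)], of z] kz x(2) hom_closed[OF q(1) KF[OF kz(1)]] by simp
      then show "y \<in> ?p ` carrier (submod F K)" using kz(1) by auto
    qed
  qed (rule hom_image[OF p])
  have "superfluous L (submod F K) (mker (submod F K) M ?p)"
    unfolding superfluous_def
  proof (intro conjI allI impI)
    show "submodule (mker (submod F K) M ?p) L (submod F K)" by (rule submodule_mker[OF mK M(1) p])
    fix K' assume "submodule K' L (submod F K)"
      and eq: "K' <+>\<^bsub>submod F K\<^esub> mker (submod F K) M ?p = carrier (submod F K)"
    then have K': "submodule K' L F" "K' \<subseteq> K" using submodule_submod_iff[OF F K(1)] by auto
    have "K' <+>\<^bsub>F\<^esub> Z = carrier F"
    proof
      show "carrier F \<subseteq> K' <+>\<^bsub>F\<^esub> Z"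
      proof
        fix x assume "x \<in> carrier F"
        then obtain k z where kz: "k \<in> K" "z \<in> Z" "x = k \<oplus>\<^bsub>F\<^esub> z" using K(2) mem_set_add by metis
        have "k \<in> K' <+>\<^bsub>submod F K\<^esub> mker (submod F K) M ?p" using eq kz(1) by simp
        then obtain k' z' where k'z': "k' \<in> K'" "z' \<in> K" "q z' = \<zero>\<^bsub>M\<^esub>" "k = k' \<oplus>\<^bsub>F\<^esub> z'"
          unfolding mem_set_add by (auto simp: mker_def)
        have "z' \<oplus>\<^bsub>F\<^esub> z \<in> Z" using submodule_add[OF Z _ kz(2)] k'z'(2,3) KF by (auto simp: Z_def mker_def)
        moreover have "x = k' \<oplus>\<^bsub>F\<^esub> (z' \<oplus>\<^bsub>F\<^esub> z)"
          using kz k'z' KF submodule_mem[OF K'(1)] submodule_mem[OF Z] by (simp add: F.M.a_assoc)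
        ultimately show "x \<in> K' <+>\<^bsub>F\<^esub> Z" unfolding mem_set_add using k'z'(1) by (intro bexI)
      qed
    qed (rule set_add_least[OF F.submodule_carrier submodule_subset[OF K'(1)] submodule_subset[OF Z]])
    then show "K' = carrier (submod F K)" using Kmin[OF K'(1) _ K'(2)] by simp
  qed
  then have "projective_cover L (submod F K) ?p M"
    unfolding projective_cover_def using proj p p_img by blast
  moreover have "fin_gen L (submod F K)"
    by (rule flen_fin_gen[OF mK flen_submod[OF F K(1) fF]])
  ultimately show ?thesis by (rule that)
qed

lemma projective_cover_fin_gen:
  assumes cover: "projective_cover R P p M" and M: "lmodule R M" "fin_gen R M"
  shows "fin_gen R P"
proof -
  have P: "lmodule R P" and p: "p \<in> hom_set R P M" "p ` carrier P = carrier M"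
    and sup: "superfluous R P (mker P M p)"
    using cover by (auto simp: projective_cover_def projective_def)
  interpret P: lmodule R P by (rule P)
  interpret M: lmodule R M by fact
  have Z: "submodule (mker P M p) R P" by (rule submodule_mker[OF P M(1) p(1)])
  obtain S where S: "S \<subseteq> carrier M" "finite S" "\<And>K. submodule K R M \<Longrightarrow> S \<subseteq> K \<Longrightarrow> K = carrier M"
    using M(2) unfolding fin_gen_iff[OF M(1)] by blast
  obtain T where T: "T \<subseteq> carrier P" "finite T" "p ` T = S"
    using S(1,2) p(2) by (metis finite_subset_image)
  have "K = carrier P" if K: "submodule K R P" "T \<subseteq> K" for K
  proof -
    have pK: "p ` K = carrier M"
      by (rule S(3)[OF submodule_image[OF P M(1) p(1) K(1)]]) (use T(3) K(2) in blast)
    have "K <+>\<^bsub>P\<^esub> mker P M p = carrier P"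
    proof
      show "carrier P \<subseteq> K <+>\<^bsub>P\<^esub> mker P M p"
      proof
        fix x assume x: "x \<in> carrier P"
        then obtain k where k: "k \<in> K" "p x = p k" using pK hom_closed[OF p(1) x] by (metis imageE)
        have kP: "k \<in> carrier P" by (rule submodule_mem[OF K(1) k(1)])
        have "p (x \<ominus>\<^bsub>P\<^esub> k) = \<zero>\<^bsub>M\<^esub>"
          using hom_diff[OF P M(1) p(1) x kP] k(2) hom_closed[OF p(1) kP] by (simp add: M.M.diff_eq_zero_iff)
        then have "x \<ominus>\<^bsub>P\<^esub> k \<in> mker P M p" using x kP by (simp add: mker_def)
        moreover have "x = k \<oplus>\<^bsub>P\<^esub> (x \<ominus>\<^bsub>P\<^esub> k)" using x kP by (simp add: P.M.add_diff_cancel)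
        ultimately show "x \<in> K <+>\<^bsub>P\<^esub> mker P M p" unfolding mem_set_add using k(1) by (intro bexI)
      qed
    qed (rule set_add_least[OF P.submodule_carrier submodule_subset[OF K(1)] submodule_subset[OF Z]])
    then show ?thesis using sup K(1) by (simp add: superfluous_def)
  qed
  then show ?thesis unfolding fin_gen_iff[OF P] using T(1,2) by blast
qed

lemma min_proj_presentation_exists:
  fixes M :: "('a, 'm) module"
  assumes L: "flen L (regular L)" and M: "lmodule L M" "fin_gen L M"
  obtains P1 P0 :: "('a, nat \<Rightarrow> 'a) module" and g p where "min_proj_presentation L P1 g P0 p M"
proof -
  obtain P0 :: "('a, nat \<Rightarrow> 'a) module" and p where P0: "projective_cover L P0 p M" "fin_gen L P0"
    by (rule projective_cover_exists[OF L M])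
  have mP: "lmodule L P0" and p: "p \<in> hom_set L P0 M"
    using P0 by (auto simp: projective_cover_def projective_def)
  have Z: "submodule (mker P0 M p) L P0" by (rule submodule_mker[OF mP M(1) p])
  have mZ: "lmodule L (submod P0 (mker P0 M p))" by (rule lmodule_submod[OF mP Z])
  have "fin_gen L (submod P0 (mker P0 M p))"
    using flen_fin_gen[OF mZ flen_submod[OF mP Z]] P0(2) fin_gen_iff_flen[OF mP L] by blast
  then obtain P1 :: "('a, nat \<Rightarrow> 'a) module" and g
    where "projective_cover L P1 g (submod P0 (mker P0 M p))"
    by (rule projective_cover_exists[OF L mZ])
  then show ?thesis using that P0(1) by (simp add: min_proj_presentation_def)
qed

section \<open>The duality of an artin algebra\<close>

locale matlis = matlis_base R \<iota> E + artin_algebra R \<phi> L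
  for R :: "'r ring" and \<iota> :: "'r set \<Rightarrow> 'e" and E :: "('r, 'e) module"
    and \<phi> :: "'r \<Rightarrow> 'a" and L :: "'a ring"
begin

abbreviation rs :: "('a, 'm) module \<Rightarrow> ('r, 'm) module" where "rs \<equiv> restrict_scalars \<phi>"

abbreviation D :: "('a, 'm) module \<Rightarrow> ('a, 'm \<Rightarrow> 'e) module" where "D \<equiv> Dual R \<phi> E"

lemma lmodule_rs: "lmodule L M \<Longrightarrow> lmodule R (rs M)"
  by (rule lmodule_restrict_scalars[OF ring_axioms structure_hom])

lemma \<phi>_closed: "r \<in> carrier R \<Longrightarrow> \<phi> r \<in> carrier L"
  by (rule ring_hom_closed[OF structure_hom])

lemma hom_rs: "f \<in> hom_set L M N \<Longrightarrow> f \<in> hom_set R (rs M) (rs N)"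
  by (auto simp: hom_set_def \<phi>_closed)

lemma submodule_rs:
  assumes "lmodule L M" "submodule K L M"
  shows "submodule K R (rs M)"
  using submodule_subset[OF assms(2)] submodule_zero_mem[OF assms(2)] submodule_add[OF assms(2)]
    submodule_smult[OF assms(2) \<phi>_closed]
  by (intro lmodule.submoduleI[OF lmodule_rs[OF assms(1)]]) auto

lemma ring_opp_L: "ring (opp L)"
  by (rule ring_opp[OF L.ring_axioms])

text \<open>Makes every result of the locale available for right modules. Finite generation over
  \<open>R\<close> carries over because \<open>\<phi>\<close> is central, so both multiplications
  give \<open>L\<close> the same submodules over \<open>R\<close>.\<close>

lemma matlis_opp: "matlis R \<iota> E \<phi> (opp L)"
proof (intro matlis.intro artin_algebra.intro)
  show "ring (opp L)" by (rule ring_opp_L)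
  show "matlis_base R \<iota> E" by (rule matlis_base_axioms)
  show "artinian_cring R" by (rule artinian_cring_axioms)
  have hom: "\<phi> \<in> ring_hom R (opp L)"
  proof (rule ring_hom_memI)
    fix x y assume xy: "x \<in> carrier R" "y \<in> carrier R"
    show "\<phi> (x \<otimes>\<^bsub>R\<^esub> y) = \<phi> x \<otimes>\<^bsub>opp L\<^esub> \<phi> y"
      using ring_hom_mult[OF structure_hom xy] central[OF xy(1) \<phi>_closed[OF xy(2)]] by simp
    show "\<phi> (x \<oplus>\<^bsub>R\<^esub> y) = \<phi> x \<oplus>\<^bsub>opp L\<^esub> \<phi> y"
      using ring_hom_add[OF structure_hom xy] by simp
  qed (use \<phi>_closed ring_hom_one[OF structure_hom] in auto)
  have m: "lmodule R (rs (regular L))" "lmodule R (rs (regular (opp L)))"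
    using lmodule_rs[OF lmodule_regular[OF L.ring_axioms]]
      lmodule_restrict_scalars[OF ring_axioms hom lmodule_regular[OF ring_opp_L]] by auto
  have "submodule K R (rs (regular L))" if K: "submodule K R (rs (regular (opp L)))" for K
  proof (rule lmodule.submoduleI[OF m(1)])
    fix r x assume r: "r \<in> carrier R" and x: "x \<in> K"
    have "x \<in> carrier L" using submodule_mem[OF K x] by simp
    then show "r \<odot>\<^bsub>rs (regular L)\<^esub> x \<in> K"
      using submodule_smult[OF K r x] central[OF r, of x] by simp
  qed (use submodule_subset[OF K] submodule_zero_mem[OF K] submodule_add[OF K] in auto)
  moreover obtain S where "S \<subseteq> carrier (rs (regular L))" "finite S"
    "\<forall>K. submodule K R (rs (regular L)) \<longrightarrow> S \<subseteq> K \<longrightarrow> K = carrier (rs (regular L))"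
    using fin_gen_over_base unfolding fin_gen_iff[OF m(1)] by blast
  ultimately have "fin_gen R (rs (regular (opp L)))"
    unfolding fin_gen_iff[OF m(2)] by (intro exI[of _ S]) simp
  then show "artin_algebra_axioms R \<phi> (opp L)"
    using hom central by (intro artin_algebra_axioms.intro) simp_all
qed

text \<open>The products of generators of \<open>L\<close> over \<open>R\<close> with generators of
  \<open>M\<close> over \<open>L\<close> generate \<open>M\<close> over \<open>R\<close>.\<close>

lemma fin_gen_rs:
  assumes M: "lmodule L M" and "fin_gen L M"
  shows "fin_gen R (rs M)"
proof -
  interpret M: lmodule L M by fact
  have mL: "lmodule R (rs (regular L))" by (rule lmodule_rs[OF lmodule_regular[OF L.ring_axioms]])
  obtain S where S: "S \<subseteq> carrier M" "finite S" "\<And>K. submodule K L M \<Longrightarrow> S \<subseteq> K \<Longrightarrow> K = carrier M"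
    using assms(2) unfolding fin_gen_iff[OF M] by blast
  obtain T where T: "T \<subseteq> carrier L" "finite T"
    "\<And>K. submodule K R (rs (regular L)) \<Longrightarrow> T \<subseteq> K \<Longrightarrow> K = carrier L"
    using fin_gen_over_base unfolding fin_gen_iff[OF mL] by auto
  let ?G = "(\<lambda>(t, s). t \<odot>\<^bsub>M\<^esub> s) ` (T \<times> S)"
  have "K = carrier (rs M)" if K: "submodule K R (rs M)" "?G \<subseteq> K" for K
  proof -
    have KM: "x \<in> carrier M" if "x \<in> K" for x using submodule_mem[OF K(1) that] by simp
    note sub = submodule_zero_mem[OF K(1), simplified] submodule_add[OF K(1), simplified]
      submodule_smult[OF K(1), simplified]
    have LS: "l \<odot>\<^bsub>M\<^esub> s \<in> K" if l: "l \<in> carrier L" and s: "s \<in> S" for l s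
    proof -
      have sM: "s \<in> carrier M" using s S(1) by blast
      have "{l \<in> carrier L. l \<odot>\<^bsub>M\<^esub> s \<in> K} = carrier L"
      proof (rule T(3))
        show "submodule {l \<in> carrier L. l \<odot>\<^bsub>M\<^esub> s \<in> K} R (rs (regular L))"
          using sM sub \<phi>_closed
          by (intro lmodule.submoduleI[OF mL]) (auto simp: M.smult_l_distr M.smult_assoc)
        show "T \<subseteq> {l \<in> carrier L. l \<odot>\<^bsub>M\<^esub> s \<in> K}" using T(1) K(2) s by auto
      qed
      then show ?thesis using l by blast
    qed
    \<comment> \<open>The largest submodule over \<open>L\<close> inside \<open>K\<close>; it
      contains the generators \<open>S\<close>, so it is everything.\<close>
    let ?K = "{k \<in> K. \<forall>l\<in>carrier L. l \<odot>\<^bsub>M\<^esub> k \<in> K}"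
    have "submodule ?K L M"
      using KM sub by (intro M.submoduleI) (auto simp: M.smult_r_distr simp flip: M.smult_assoc)
    moreover have "S \<subseteq> ?K"
    proof
      fix s assume s: "s \<in> S"
      then have "s \<in> K" using LS[OF L.one_closed s] S(1) by (auto simp: M.smult_one)
      then show "s \<in> ?K" using LS s by blast
    qed
    ultimately have "?K = carrier M" by (rule S(3))
    then show ?thesis using KM by auto
  qed
  moreover have "?G \<subseteq> carrier (rs M)" using S(1) T(1) M.smult_closed by auto
  moreover have "finite ?G" using S(2) T(2) by blast
  ultimately show ?thesis unfolding fin_gen_iff[OF lmodule_rs[OF M]] by blast
qed

lemma flen_rs_imp: "\<lbrakk>lmodule L M; flen R (rs M)\<rbrakk> \<Longrightarrow> flen L M"
  unfolding flen_def using submodule_rs by metis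

text \<open>Expresses finite generation as a condition on length over \<open>R\<close>, the form in
  which the duality preserves it.\<close>

lemma fin_gen_iff_flen_rs: "lmodule L M \<Longrightarrow> fin_gen L M \<longleftrightarrow> flen R (rs M)"
  using fin_gen_rs fin_gen_iff_flen[OF lmodule_rs flen_regular] flen_fin_gen[OF _ flen_rs_imp] by blast

lemma flen_rs_regular: "flen R (rs (regular L))"
  using fin_gen_over_base fin_gen_iff_flen[OF lmodule_rs[OF lmodule_regular[OF L.ring_axioms]] flen_regular]
  by blast

lemma flen_regular_L: "flen L (regular L)"
  by (rule flen_rs_imp[OF lmodule_regular[OF L.ring_axioms] flen_rs_regular])

lemma lmodule_Dual: "lmodule L M \<Longrightarrow> lmodule (opp L) (D M)"
  by (rule lmodule_Dual_gen[OF ring_axioms structure_hom E _ ring_opp_L])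
    (auto simp: central)

lemma mem_Dual: "f \<in> carrier (D M) \<longleftrightarrow> f \<in> hom_set R (rs M) E"
  by (simp add: Dual_simps)

lemma Dual_closed: "\<lbrakk>f \<in> carrier (D M); x \<in> carrier M\<rbrakk> \<Longrightarrow> f x \<in> carrier E"
  using hom_closed[of f R "rs M" E x] by (simp add: mem_Dual)

lemma Dual_add_arg:
  "\<lbrakk>f \<in> carrier (D M); x \<in> carrier M; y \<in> carrier M\<rbrakk> \<Longrightarrow> f (x \<oplus>\<^bsub>M\<^esub> y) = f x \<oplus>\<^bsub>E\<^esub> f y"
  using hom_add[of f R "rs M" E x y] by (simp add: mem_Dual)

lemma Dual_smult_arg:
  "\<lbrakk>f \<in> carrier (D M); r \<in> carrier R; x \<in> carrier M\<rbrakk> \<Longrightarrow> f (\<phi> r \<odot>\<^bsub>M\<^esub> x) = r \<odot>\<^bsub>E\<^esub> f x"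
  using hom_smult[of f R "rs M" E r x] by (simp add: mem_Dual)

lemma Dual_zero_arg: "\<lbrakk>lmodule L M; f \<in> carrier (D M)\<rbrakk> \<Longrightarrow> f \<zero>\<^bsub>M\<^esub> = \<zero>\<^bsub>E\<^esub>"
  using hom_zero[OF lmodule_rs E, of M f] by (simp add: mem_Dual)

lemma Dual_ext:
  "\<lbrakk>f \<in> carrier (D M); g \<in> carrier (D M); \<And>x. x \<in> carrier M \<Longrightarrow> f x = g x\<rbrakk> \<Longrightarrow> f = g"
  using hom_ext[of f R "rs M" E g E] by (simp add: mem_Dual)

lemma DualI:
  assumes "lmodule L M" "\<And>x. x \<in> carrier M \<Longrightarrow> f x \<in> carrier E"
    "\<And>x y. \<lbrakk>x \<in> carrier M; y \<in> carrier M\<rbrakk> \<Longrightarrow> f (x \<oplus>\<^bsub>M\<^esub> y) = f x \<oplus>\<^bsub>E\<^esub> f y"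
    "\<And>r x. \<lbrakk>r \<in> carrier R; x \<in> carrier M\<rbrakk> \<Longrightarrow> f (\<phi> r \<odot>\<^bsub>M\<^esub> x) = r \<odot>\<^bsub>E\<^esub> f x"
  shows "(\<lambda>x\<in>carrier M. f x) \<in> carrier (D M)"
  using hom_restrictI[OF lmodule_rs[OF assms(1)], of f E] assms(2-) by (simp add: mem_Dual)

lemma Dual_add [simp]: "x \<in> carrier M \<Longrightarrow> (f \<oplus>\<^bsub>D M\<^esub> g) x = f x \<oplus>\<^bsub>E\<^esub> g x"
  by (simp add: Dual_simps)

lemma Dual_smult [simp]: "x \<in> carrier M \<Longrightarrow> (l \<odot>\<^bsub>D M\<^esub> f) x = f (l \<odot>\<^bsub>M\<^esub> x)"
  by (simp add: Dual_simps)

lemma Dual_zero [simp]: "x \<in> carrier M \<Longrightarrow> \<zero>\<^bsub>D M\<^esub> x = \<zero>\<^bsub>E\<^esub>"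
  by (simp add: Dual_simps)

lemma flen_rs_Dual: "\<lbrakk>lmodule L M; flen R (rs M)\<rbrakk> \<Longrightarrow> flen R (rs (D M))"
  using flen_Dual_reflexive[OF lmodule_rs, THEN conjunct1] by (simp only: restrict_scalars_Dual)

lemma Dual_separation:
  assumes "lmodule L M" "submodule K R (rs M)" "x \<in> carrier M" "x \<notin> K"
  obtains f where "f \<in> carrier (D M)" "\<forall>k\<in>K. f k = \<zero>\<^bsub>E\<^esub>" "f x \<noteq> \<zero>\<^bsub>E\<^esub>"
  using separation[OF lmodule_rs[OF assms(1)] assms(2) _ assms(4)] assms(3)
  by (metis mem_Dual restrict_scalars_simps(1))

lemma Dual_separates:
  assumes "lmodule L M" "x \<in> carrier M" "y \<in> carrier M" "\<And>f. f \<in> carrier (D M) \<Longrightarrow> f x = f y"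
  shows "x = y"
proof (rule ccontr)
  interpret M: lmodule L M by fact
  interpret rM: lmodule R "rs M" by (rule lmodule_rs[OF assms(1)])
  assume "x \<noteq> y"
  then have "x \<ominus>\<^bsub>M\<^esub> y \<notin> {\<zero>\<^bsub>rs M\<^esub>}" using assms(2,3) by (simp add: M.M.diff_eq_zero_iff)
  then obtain f where f: "f \<in> carrier (D M)" "f (x \<ominus>\<^bsub>M\<^esub> y) \<noteq> \<zero>\<^bsub>E\<^esub>"
    using Dual_separation[OF assms(1) rM.submodule_zero] assms(2,3) M.M.minus_closed by metis
  have "f x = f ((x \<ominus>\<^bsub>M\<^esub> y) \<oplus>\<^bsub>M\<^esub> y)"
    using assms(2,3) by (simp add: M.M.add_diff_cancel M.M.a_comm)
  then have "f x = f (x \<ominus>\<^bsub>M\<^esub> y) \<oplus>\<^bsub>E\<^esub> f y"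
    using Dual_add_arg[OF f(1)] assms(2,3) by simp
  moreover have c: "f y \<in> carrier E" "f (x \<ominus>\<^bsub>M\<^esub> y) \<in> carrier E"
    using Dual_closed[OF f(1)] assms(2,3) by auto
  ultimately have "f (x \<ominus>\<^bsub>M\<^esub> y) \<oplus>\<^bsub>E\<^esub> f y = \<zero>\<^bsub>E\<^esub> \<oplus>\<^bsub>E\<^esub> f y"
    using assms(4)[OF f(1)] by simp
  then show False using E.M.add.right_cancel[OF c E.M.zero_closed] f(2) by simp
qed

lemma reflexive:
  assumes "lmodule L M" "flen R (rs M)" "\<xi> \<in> carrier (Dual R \<phi> E (D M))"
  obtains x where "x \<in> carrier M" "\<forall>f\<in>carrier (D M). \<xi> f = f x"
proof -
  have "\<xi> \<in> hom_set R (Dual R id E (rs M)) E"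
    using assms(3) by (simp add: Dual_simps restrict_scalars_Dual)
  then show ?thesis
    using flen_Dual_reflexive[OF lmodule_rs[OF assms(1)] assms(2)] that by (auto simp: mem_Dual)
qed

text \<open>Separation by functionals gives injectivity, and reflexivity over \<open>R\<close> gives
  surjectivity. Scalars act on a functional through its argument, so dualising twice restores the
  original side.\<close>

lemma eval_iso:
  assumes M: "lmodule L M" and fl: "flen R (rs M)"
  shows "mod_isom L M (D (D M)) (\<lambda>x\<in>carrier M. \<lambda>f\<in>carrier (D M). f x)"
proof -
  interpret op: matlis R \<iota> E \<phi> "opp L" by (rule matlis_opp)
  interpret M: lmodule L M by fact
  interpret DM: lmodule "opp L" "D M" by (rule lmodule_Dual[OF M])
  have mDD: "lmodule L (D (D M))" using op.lmodule_Dual[OF DM.lmodule_axioms] by simp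
  interpret DD: lmodule L "D (D M)" by (rule mDD)
  have ev: "(\<lambda>f\<in>carrier (D M). f x) \<in> carrier (D (D M))" if "x \<in> carrier M" for x
    using that Dual_closed Dual_smult_arg \<phi>_closed
    by (intro op.DualI[OF DM.lmodule_axioms]) auto
  have hom: "(\<lambda>x\<in>carrier M. \<lambda>f\<in>carrier (D M). f x) \<in> hom_set L M (D (D M))"
  proof (rule hom_restrictI[OF M ev])
    fix x y assume xy: "x \<in> carrier M" "y \<in> carrier M"
    show "(\<lambda>f\<in>carrier (D M). f (x \<oplus>\<^bsub>M\<^esub> y)) = (\<lambda>f\<in>carrier (D M). f x) \<oplus>\<^bsub>D (D M)\<^esub> (\<lambda>f\<in>carrier (D M). f y)"
      using xy ev DD.M.add.m_closed Dual_add_arg by (intro op.Dual_ext[of _ "D M"]) auto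
  next
    fix r x assume r: "r \<in> carrier L" and x: "x \<in> carrier M"
    show "(\<lambda>f\<in>carrier (D M). f (r \<odot>\<^bsub>M\<^esub> x)) = r \<odot>\<^bsub>D (D M)\<^esub> (\<lambda>f\<in>carrier (D M). f x)"
      using r x ev M.smult_closed DD.smult_closed DM.smult_closed
      by (intro op.Dual_ext[of _ "D M"]) auto
  qed
  show ?thesis
  proof (rule mod_isomI[OF hom])
    show "inj_on (\<lambda>x\<in>carrier M. \<lambda>f\<in>carrier (D M). f x) (carrier M)"
    proof (rule inj_onI)
      fix x y assume xy: "x \<in> carrier M" "y \<in> carrier M"
        "(\<lambda>x\<in>carrier M. \<lambda>f\<in>carrier (D M). f x) x = (\<lambda>x\<in>carrier M. \<lambda>f\<in>carrier (D M). f x) y"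
      then have eq: "(\<lambda>f\<in>carrier (D M). f x) = (\<lambda>f\<in>carrier (D M). f y)" by simp
      have "f x = f y" if "f \<in> carrier (D M)" for f
        using fun_cong[OF eq, of f] that by simp
      then show "x = y" by (rule Dual_separates[OF M xy(1,2)])
    qed
    show "(\<lambda>x\<in>carrier M. \<lambda>f\<in>carrier (D M). f x) ` carrier M = carrier (D (D M))"
    proof
      show "carrier (D (D M)) \<subseteq> (\<lambda>x\<in>carrier M. \<lambda>f\<in>carrier (D M). f x) ` carrier M"
      proof
        fix \<xi> assume \<xi>: "\<xi> \<in> carrier (D (D M))"
        obtain x where x: "x \<in> carrier M" "\<forall>f\<in>carrier (D M). \<xi> f = f x" by (rule reflexive[OF M fl \<xi>])
        then have "\<xi> = (\<lambda>f\<in>carrier (D M). f x)"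
          using \<xi> ev[OF x(1)] by (intro op.Dual_ext[of _ "D M"]) auto
        then show "\<xi> \<in> (\<lambda>x\<in>carrier M. \<lambda>f\<in>carrier (D M). f x) ` carrier M" using x(1) by auto
      qed
    qed (rule hom_image[OF hom])
  qed
qed

section \<open>Exactness of the duality, annihilators, and duals of projective modules\<close>

definition Dmap :: "('a, 'm) module \<Rightarrow> ('a, 'n) module \<Rightarrow> ('m \<Rightarrow> 'n) \<Rightarrow> ('n \<Rightarrow> 'e) \<Rightarrow> ('m \<Rightarrow> 'e)" where
  "Dmap M N f = (\<lambda>h\<in>carrier (D N). \<lambda>x\<in>carrier M. h (f x))"

lemma Dmap_apply [simp]: "\<lbrakk>h \<in> carrier (D N); x \<in> carrier M\<rbrakk> \<Longrightarrow> Dmap M N f h x = h (f x)"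
  by (simp add: Dmap_def)

lemma Dmap_hom:
  assumes "lmodule L M" "lmodule L N" "f \<in> hom_set L M N"
  shows "Dmap M N f \<in> hom_set (opp L) (D N) (D M)"
proof -
  interpret M: lmodule L M by fact
  interpret N: lmodule L N by fact
  interpret DM: lmodule "opp L" "D M" by (rule lmodule_Dual[OF assms(1)])
  interpret DN: lmodule "opp L" "D N" by (rule lmodule_Dual[OF assms(2)])
  note fc = hom_closed[OF assms(3)]
  have c: "(\<lambda>x\<in>carrier M. h (f x)) \<in> carrier (D M)" if "h \<in> carrier (D N)" for h
    using that fc hom_add[OF assms(3)] hom_smult[OF assms(3) \<phi>_closed] Dual_closed[OF that]
      Dual_add_arg[OF that] Dual_smult_arg[OF that]
    by (intro DualI[OF assms(1)]) auto
  show ?thesis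
    unfolding Dmap_def
  proof (rule hom_restrictI[OF DN.lmodule_axioms c])
    fix g h assume "g \<in> carrier (D N)" "h \<in> carrier (D N)"
    then show "(\<lambda>x\<in>carrier M. (g \<oplus>\<^bsub>D N\<^esub> h) (f x)) = (\<lambda>x\<in>carrier M. g (f x)) \<oplus>\<^bsub>D M\<^esub> (\<lambda>x\<in>carrier M. h (f x))"
      using c fc DN.M.add.m_closed DM.M.add.m_closed by (intro Dual_ext[of _ M]) auto
  next
    fix r h assume "r \<in> carrier (opp L)" "h \<in> carrier (D N)"
    then show "(\<lambda>x\<in>carrier M. (r \<odot>\<^bsub>D N\<^esub> h) (f x)) = r \<odot>\<^bsub>D M\<^esub> (\<lambda>x\<in>carrier M. h (f x))"
      using c fc DN.smult_closed[of r h] DM.smult_closed[of r] hom_smult[OF assms(3), of r] M.smult_closed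
      by (intro Dual_ext[of _ M]) auto
  qed
qed

text \<open>For a submodule \<open>K\<close>, this is the copy of the dual of the quotient
  \<open>M / K\<close> inside the dual of \<open>M\<close>.\<close>

definition ann :: "('a, 'm) module \<Rightarrow> 'm set \<Rightarrow> ('m \<Rightarrow> 'e) set" where
  "ann M K = {f \<in> carrier (D M). \<forall>x\<in>K. f x = \<zero>\<^bsub>E\<^esub>}"

text \<open>A functional that vanishes on the kernel of \<open>f\<close> descends to the image of
  \<open>f\<close> and extends from there by injectivity of \<open>E\<close>; this is the exactness
  of the duality.\<close>

lemma Dmap_image:
  assumes M: "lmodule L M" and N: "lmodule L N" and f: "f \<in> hom_set L M N"
  shows "Dmap M N f ` carrier (D N) = ann M (mker M N f)"
proof
  show "Dmap M N f ` carrier (D N) \<subseteq> ann M (mker M N f)"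
    using hom_closed[OF Dmap_hom[OF assms]] Dual_zero_arg[OF N] by (auto simp: ann_def mker_def)
  show "ann M (mker M N f) \<subseteq> Dmap M N f ` carrier (D N)"
  proof
    fix h assume h: "h \<in> ann M (mker M N f)"
    let ?W = "f ` carrier M"
    have W: "submodule ?W R (rs N)"
      using submodule_rs[OF N submodule_image[OF assms lmodule.submodule_carrier[OF M]]] .
    have f': "f \<in> hom_set R (rs M) (submod (rs N) ?W)" "f ` carrier (rs M) = carrier (submod (rs N) ?W)"
      using hom_to_submod[OF hom_rs[OF f], of ?W] by auto
    have h0: "h x = \<zero>\<^bsub>E\<^esub>" if "x \<in> mker M N f" for x
      using h that by (simp add: ann_def)
    have hR: "h \<in> hom_set R (rs M) E" using h by (auto simp: ann_def mem_Dual)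
    obtain g where g: "g \<in> hom_set R (submod (rs N) ?W) E" "\<And>x. x \<in> carrier (rs M) \<Longrightarrow> g (f x) = h x"
    proof (rule hom_factor[OF lmodule_rs[OF M] lmodule_submod[OF lmodule_rs[OF N] W] E f' hR])
      show "h x = \<zero>\<^bsub>E\<^esub>" if "x \<in> carrier (rs M)" "f x = \<zero>\<^bsub>submod (rs N) ?W\<^esub>" for x
        using h0[of x] that by (simp add: mker_def)
    qed (rule that)
    obtain k where k: "k \<in> hom_set R (rs N) E" "\<And>y. y \<in> ?W \<Longrightarrow> k y = g y"
      using injective_extend[OF inj lmodule_rs[OF N] W g(1)] by metis
    have kD: "k \<in> carrier (D N)" using k(1) by (simp add: mem_Dual)
    have "Dmap M N f k = h"
      using h kD hom_closed[OF Dmap_hom[OF assms] kD] k(2) g(2)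
      by (intro Dual_ext[of _ M]) (auto simp: ann_def)
    then show "h \<in> Dmap M N f ` carrier (D N)" using kD by blast
  qed
qed

lemma Dmap_surj:
  assumes "lmodule L M" "lmodule L N" "f \<in> hom_set L M N" "inj_on f (carrier M)"
  shows "Dmap M N f ` carrier (D N) = carrier (D M)"
proof -
  have "mker M N f \<subseteq> {\<zero>\<^bsub>M\<^esub>}"
    using assms(4) unfolding hom_inj_iff[OF assms(1-3)] by (auto simp: mker_def)
  then have "ann M (mker M N f) = carrier (D M)"
    using Dual_zero_arg[OF assms(1)] by (auto simp: ann_def)
  then show ?thesis using Dmap_image[OF assms(1-3)] by simp
qed

lemma submodule_ann:
  assumes "lmodule L M" "submodule K L M"
  shows "submodule (ann M K) (opp L) (D M)"
proof -
  interpret DM: lmodule "opp L" "D M" by (rule lmodule_Dual[OF assms(1)])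
  show ?thesis
    using submodule_mem[OF assms(2)] submodule_smult[OF assms(2)] DM.smult_closed
    by (intro DM.submoduleI) (auto simp: ann_def)
qed

lemma essential_ann:
  assumes M: "lmodule L M" and fl: "flen R (rs M)" and N: "superfluous L M N"
  shows "essential (opp L) (D M) (ann M N)"
proof -
  interpret op: matlis R \<iota> E \<phi> "opp L" by (rule matlis_opp)
  interpret M: lmodule L M by fact
  interpret DM: lmodule "opp L" "D M" by (rule lmodule_Dual[OF M])
  have sN: "submodule N L M" using N by (simp add: superfluous_def)
  have "K = {\<zero>\<^bsub>D M\<^esub>}" if K: "submodule K (opp L) (D M)" "K \<inter> ann M N = {\<zero>\<^bsub>D M\<^esub>}" for K
  proof -
    have KD: "f \<in> carrier (D M)" if "f \<in> K" for f using submodule_mem[OF K(1) that] .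
    define K' where "K' = {x \<in> carrier M. \<forall>f\<in>K. f x = \<zero>\<^bsub>E\<^esub>}"
    have K': "submodule K' L M"
    proof (rule M.submoduleI)
      show "l \<odot>\<^bsub>M\<^esub> x \<in> K'" if l: "l \<in> carrier L" and x: "x \<in> K'" for l x
      proof -
        have xM: "x \<in> carrier M" using x by (simp add: K'_def)
        have "f (l \<odot>\<^bsub>M\<^esub> x) = \<zero>\<^bsub>E\<^esub>" if "f \<in> K" for f
          using submodule_smult[OF K(1) _ that, of l] l x Dual_smult[OF xM, of l f] by (auto simp: K'_def)
        then show ?thesis using M.smult_closed[OF l xM] by (simp add: K'_def)
      qed
    next
      show "x \<oplus>\<^bsub>M\<^esub> y \<in> K'" if "x \<in> K'" "y \<in> K'" for x y
      proof -
        have x: "x \<in> carrier M" "\<And>f. f \<in> K \<Longrightarrow> f x = \<zero>\<^bsub>E\<^esub>" and y: "y \<in> carrier M" "\<And>f. f \<in> K \<Longrightarrow> f y = \<zero>\<^bsub>E\<^esub>"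
          using that by (auto simp: K'_def)
        have "f (x \<oplus>\<^bsub>M\<^esub> y) = \<zero>\<^bsub>E\<^esub>" if "f \<in> K" for f
          using Dual_add_arg[OF KD[OF that] x(1) y(1)] x(2)[OF that] y(2)[OF that] by simp
        then show ?thesis using x(1) y(1) by (simp add: K'_def)
      qed
    qed (use Dual_zero_arg[OF M KD] in \<open>auto simp: K'_def\<close>)
    have dbl: "f \<in> K" if f: "f \<in> carrier (D M)" "\<forall>x\<in>K'. f x = \<zero>\<^bsub>E\<^esub>" for f
    proof (rule ccontr)
      assume "f \<notin> K"
      then obtain \<xi> where \<xi>: "\<xi> \<in> carrier (D (D M))" "\<forall>k\<in>K. \<xi> k = \<zero>\<^bsub>E\<^esub>" "\<xi> f \<noteq> \<zero>\<^bsub>E\<^esub>"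
        using op.Dual_separation[OF DM.lmodule_axioms op.submodule_rs[OF DM.lmodule_axioms K(1)] f(1)]
        by metis
      obtain x where x: "x \<in> carrier M" "\<forall>f\<in>carrier (D M). \<xi> f = f x" by (rule reflexive[OF M fl \<xi>(1)])
      then have "x \<in> K'" using \<xi>(2) KD by (simp add: K'_def)
      then show False using f x(2) \<xi>(3) by simp
    qed
    have sKN: "submodule (K' <+>\<^bsub>M\<^esub> N) L M" by (rule submodule_set_add[OF M K' sN])
    have "K' <+>\<^bsub>M\<^esub> N = carrier M"
    proof (rule ccontr)
      assume "K' <+>\<^bsub>M\<^esub> N \<noteq> carrier M"
      then obtain x where x: "x \<in> carrier M" "x \<notin> K' <+>\<^bsub>M\<^esub> N" using submodule_subset[OF sKN] by blast
      obtain f where f: "f \<in> carrier (D M)" "\<forall>y\<in>K' <+>\<^bsub>M\<^esub> N. f y = \<zero>\<^bsub>E\<^esub>" "f x \<noteq> \<zero>\<^bsub>E\<^esub>"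
        by (rule Dual_separation[OF M submodule_rs[OF M sKN] x])
      then have "f \<in> K" "f \<in> ann M N"
        using dbl[OF f(1)] subsetD[OF set_add_upper(1)[OF M K' sN]] subsetD[OF set_add_upper(2)[OF M K' sN]]
        by (auto simp: ann_def)
      then have "f = \<zero>\<^bsub>D M\<^esub>" using K(2) by blast
      then show False using f(3) x(1) by simp
    qed
    then have "K' = carrier M" using N K' by (simp add: superfluous_def)
    then have "f = \<zero>\<^bsub>D M\<^esub>" if "f \<in> K" for f
      using KD[OF that] that by (intro Dual_ext[of _ M]) (auto simp: K'_def)
    then show ?thesis using submodule_zero_mem[OF K(1)] by blast
  qed
  then show ?thesis unfolding essential_def using submodule_ann[OF M sN] by blast
qed

text \<open>One direction of the adjunction between maps from \<open>X\<close> to the dual of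
  \<open>P\<close> and maps from \<open>P\<close> to the dual of \<open>X\<close>.\<close>

definition flip :: "('a, 'x) module \<Rightarrow> ('a, 'p) module \<Rightarrow> ('x \<Rightarrow> 'p \<Rightarrow> 'e) \<Rightarrow> ('p \<Rightarrow> 'x \<Rightarrow> 'e)" where
  "flip X P f = (\<lambda>p\<in>carrier P. \<lambda>x\<in>carrier X. f x p)"

lemma flip_hom:
  assumes X: "lmodule (opp L) X" and P: "lmodule L P" and f: "f \<in> hom_set (opp L) X (D P)"
  shows "flip X P f \<in> hom_set L P (D X)"
proof -
  interpret op: matlis R \<iota> E \<phi> "opp L" by (rule matlis_opp)
  interpret X: lmodule "opp L" X by fact
  interpret P: lmodule L P by fact
  interpret DX: lmodule L "D X" using op.lmodule_Dual[OF X] by simp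
  have fc: "f x \<in> carrier (D P)" if "x \<in> carrier X" for x using hom_closed[OF f that] .
  have c: "(\<lambda>x\<in>carrier X. f x p) \<in> carrier (D X)" if "p \<in> carrier P" for p
    using that fc Dual_closed[OF fc] hom_add[OF f] hom_smult[OF f] \<phi>_closed Dual_smult_arg[OF fc]
    by (intro op.DualI[OF X]) auto
  show ?thesis
    unfolding flip_def
  proof (rule hom_restrictI[OF P c])
    fix p q assume "p \<in> carrier P" "q \<in> carrier P"
    then show "(\<lambda>x\<in>carrier X. f x (p \<oplus>\<^bsub>P\<^esub> q)) = (\<lambda>x\<in>carrier X. f x p) \<oplus>\<^bsub>D X\<^esub> (\<lambda>x\<in>carrier X. f x q)"
      using c DX.M.add.m_closed Dual_add_arg[OF fc] by (intro op.Dual_ext[of _ X]) auto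
  next
    fix l p assume "l \<in> carrier L" "p \<in> carrier P"
    then show "(\<lambda>x\<in>carrier X. f x (l \<odot>\<^bsub>P\<^esub> p)) = l \<odot>\<^bsub>D X\<^esub> (\<lambda>x\<in>carrier X. f x p)"
      using c DX.smult_closed P.smult_closed X.smult_closed[of l] hom_smult[OF f, of l]
      by (intro op.Dual_ext[of _ X]) auto
  qed
qed

text \<open>Exchanging arguments turns the extension of \<open>f\<close> along the injection
  \<open>u\<close> into the lifting of a map from \<open>P\<close> along the surjection dual to
  \<open>u\<close>, which a summand of a free module allows.\<close>

lemma injective_Dual:
  assumes P: "free_summand L P n \<sigma> \<pi>"
  shows "injective (opp L) (D P)"
  unfolding injective_def
proof (intro conjI allI impI ballI)
  interpret op: matlis R \<iota> E \<phi> "opp L" by (rule matlis_opp)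
  have mP: "lmodule L P" using P by (simp add: free_summand_def)
  show "lmodule (opp L) (D P)" by (rule lmodule_Dual[OF mP])
  fix X Y :: "('a, nat \<Rightarrow> 'a) module" and u f
  assume X: "lmodule (opp L) X" and Y: "lmodule (opp L) Y" and u: "u \<in> hom_set (opp L) X Y"
    and uinj: "inj_on u (carrier X)" and f: "f \<in> hom_set (opp L) X (D P)"
  have DX: "lmodule L (D X)" and DY: "lmodule L (D Y)"
    using op.lmodule_Dual[OF X] op.lmodule_Dual[OF Y] by auto
  have Du: "op.Dmap X Y u \<in> hom_set L (D Y) (D X)"
    using op.Dmap_hom[OF X Y u] by simp
  obtain h where h: "h \<in> hom_set L P (D Y)" "\<And>p. p \<in> carrier P \<Longrightarrow> op.Dmap X Y u (h p) = flip X P f p"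
    using free_summand_lift[OF P DY DX Du op.Dmap_surj[OF X Y u uinj] flip_hom[OF X mP f]] by metis
  let ?g = "op.flip P Y h"
  have g: "?g \<in> hom_set (opp L) Y (D P)"
    by (rule op.flip_hom) (use Y mP h(1) in auto)
  have "?g (u x) = f x" if x: "x \<in> carrier X" for x
  proof (rule Dual_ext[of _ P])
    show "?g (u x) \<in> carrier (D P)" by (rule hom_closed[OF g hom_closed[OF u x]])
    show "f x \<in> carrier (D P)" by (rule hom_closed[OF f x])
    fix p assume p: "p \<in> carrier P"
    have "h p (u x) = flip X P f p x"
      using h(2)[OF p] op.Dmap_apply[OF hom_closed[OF h(1) p] x, of u] by simp
    then show "?g (u x) p = f x p"
      using p x hom_closed[OF u x] by (simp add: op.flip_def flip_def)
  qed
  then show "\<exists>g\<in>hom_set (opp L) Y (D P). \<forall>x\<in>carrier X. g (u x) = f x" using g by blast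
qed

lemma Dual_min_presentation:
  fixes P0 P1 :: "('a, nat \<Rightarrow> 'a) module"
  assumes M: "lmodule L M" "fin_gen L M" and P: "min_proj_presentation L P1 g P0 p M"
  shows "lmodule L P0" "lmodule L P1" "g \<in> hom_set L P1 P0" "fin_gen L P0" "fin_gen L P1"
    "min_inj_presentation (opp L) (D M) (Dmap P0 M p) (D P0) (Dmap P1 P0 g) (D P1)"
proof -
  have cov: "projective_cover L P0 p M" "projective_cover L P1 g (submod P0 (mker P0 M p))"
    using P by (auto simp: min_proj_presentation_def)
  have pr: "projective L P0" "projective L P1" and p: "p \<in> hom_set L P0 M" "p ` carrier P0 = carrier M"
    and g: "g \<in> hom_set L P1 (submod P0 (mker P0 M p))" "g ` carrier P1 = mker P0 M p"
    and sup: "superfluous L P0 (mker P0 M p)" "superfluous L P1 (mker P1 P0 g)"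
    using cov by (auto simp: projective_cover_def mker_def)
  show mP: "lmodule L P0" "lmodule L P1" using pr by (auto simp: projective_def)
  interpret op: matlis R \<iota> E \<phi> "opp L" by (rule matlis_opp)
  interpret M: lmodule L M by fact
  have Z: "submodule (mker P0 M p) L P0" by (rule submodule_mker[OF mP(1) M(1) p(1)])
  have mZ: "lmodule L (submod P0 (mker P0 M p))" by (rule lmodule_submod[OF mP(1) Z])
  show gh: "g \<in> hom_set L P1 P0" by (rule hom_from_submod[OF g(1) submodule_subset[OF Z]])
  show fg0: "fin_gen L P0" by (rule projective_cover_fin_gen[OF cov(1) M])
  then have "fin_gen L (submod P0 (mker P0 M p))"
    using flen_fin_gen[OF mZ flen_submod[OF mP(1) Z]] fin_gen_iff_flen[OF mP(1) flen_regular_L] by blast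
  then show fg1: "fin_gen L P1" by (rule projective_cover_fin_gen[OF cov(2) mZ])
  have fl: "flen R (rs P0)" "flen R (rs P1)" using fg0 fg1 fin_gen_iff_flen_rs mP by auto
  obtain n \<sigma> \<pi> where s0: "free_summand L P0 n \<sigma> \<pi>" by (rule projective_free_summand[OF pr(1) fg0])
  obtain n' \<sigma>' \<pi>' where s1: "free_summand L P1 n' \<sigma>' \<pi>'" by (rule projective_free_summand[OF pr(2) fg1])
  have mD: "lmodule (opp L) (D M)" "lmodule (opp L) (D P0)" "lmodule (opp L) (D P1)"
    using lmodule_Dual M(1) mP by auto
  note Dp = Dmap_hom[OF mP(1) M(1) p(1)] and Dg = Dmap_hom[OF mP(2,1) gh]
  have imp: "Dmap P0 M p ` carrier (D M) = ann P0 (mker P0 M p)"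
    by (rule Dmap_image[OF mP(1) M(1) p(1)])
  have img: "Dmap P1 P0 g ` carrier (D P0) = ann P1 (mker P1 P0 g)"
    by (rule Dmap_image[OF mP(2,1) gh])
  have "inj_on (Dmap P0 M p) (carrier (D M))"
  proof (rule inj_onI)
    fix h k assume hk: "h \<in> carrier (D M)" "k \<in> carrier (D M)" "Dmap P0 M p h = Dmap P0 M p k"
    show "h = k"
    proof (rule Dual_ext[OF hk(1,2)])
      fix x assume "x \<in> carrier M"
      then obtain y where y: "y \<in> carrier P0" "x = p y" using p(2) by blast
      then show "h x = k x" using fun_cong[OF hk(3), of y] hk(1,2) by simp
    qed
  qed
  then have "injective_envelope (opp L) (D M) (Dmap P0 M p) (D P0)"
    unfolding injective_envelope_def imp
    using injective_Dual[OF s0] Dp essential_ann[OF mP(1) fl(1) sup(1)] by blast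
  moreover have "mker (D P0) (D P1) (Dmap P1 P0 g) = Dmap P0 M p ` carrier (D M)"
  proof -
    have "Dmap P1 P0 g h = \<zero>\<^bsub>D P1\<^esub> \<longleftrightarrow> (\<forall>x\<in>mker P0 M p. h x = \<zero>\<^bsub>E\<^esub>)" if h: "h \<in> carrier (D P0)" for h
    proof
      assume eq: "Dmap P1 P0 g h = \<zero>\<^bsub>D P1\<^esub>"
      show "\<forall>x\<in>mker P0 M p. h x = \<zero>\<^bsub>E\<^esub>"
      proof
        fix x assume "x \<in> mker P0 M p"
        then obtain y where "y \<in> carrier P1" "x = g y" using g(2) by blast
        then show "h x = \<zero>\<^bsub>E\<^esub>" using fun_cong[OF eq, of y] h by simp
      qed
    next
      assume "\<forall>x\<in>mker P0 M p. h x = \<zero>\<^bsub>E\<^esub>"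
      then have "h (g y) = \<zero>\<^bsub>E\<^esub>" if "y \<in> carrier P1" for y using g(2) that by blast
      then show "Dmap P1 P0 g h = \<zero>\<^bsub>D P1\<^esub>"
        using hom_closed[OF Dg h] h abelian_group.axioms(1)[OF lmodule.axioms(2)[OF mD(3)]]
        by (intro Dual_ext[of _ P1]) (auto intro: abelian_monoid.zero_closed)
    qed
    then show ?thesis unfolding imp by (auto simp: mker_def[of "D P0"] ann_def)
  qed
  moreover have "injective_envelope (opp L) (submod (D P1) (Dmap P1 P0 g ` carrier (D P0)))
      (restrict id (Dmap P1 P0 g ` carrier (D P0))) (D P1)"
    unfolding injective_envelope_def img
    using injective_Dual[OF s1] essential_ann[OF mP(2) fl(2) sup(2)]
      hom_incl[OF mD(3) submodule_ann[OF mP(2) submodule_mker[OF mP(2,1) gh]]]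
    by (simp add: restrict_def id_def inj_on_def)
  ultimately show "min_inj_presentation (opp L) (D M) (Dmap P0 M p) (D P0) (Dmap P1 P0 g) (D P1)"
    unfolding min_inj_presentation_def using Dg by blast
qed

end

section \<open>Transpose and cotranspose\<close>

lemma hom_mod_simps:
  "carrier (hom_mod R M N act) = hom_set R M N"
  "\<zero>\<^bsub>hom_mod R M N act\<^esub> = (\<lambda>x\<in>carrier M. \<zero>\<^bsub>N\<^esub>)"
  "f \<oplus>\<^bsub>hom_mod R M N act\<^esub> g = (\<lambda>x\<in>carrier M. f x \<oplus>\<^bsub>N\<^esub> g x)"
  "l \<odot>\<^bsub>hom_mod R M N act\<^esub> f = act l f"
  by (auto simp: hom_mod_def hom_group_def)

lemma lmodule_hom_mod:
  assumes M: "lmodule R M" and N: "lmodule R N" and S: "ring S"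
    and act: "\<And>s f. \<lbrakk>s \<in> carrier S; f \<in> hom_set R M N\<rbrakk> \<Longrightarrow> act s f \<in> hom_set R M N"
    and add: "\<And>s t f x. \<lbrakk>s \<in> carrier S; t \<in> carrier S; f \<in> hom_set R M N; x \<in> carrier M\<rbrakk> \<Longrightarrow>
      act (s \<oplus>\<^bsub>S\<^esub> t) f x = act s f x \<oplus>\<^bsub>N\<^esub> act t f x"
    and distr: "\<And>s f g x. \<lbrakk>s \<in> carrier S; f \<in> hom_set R M N; g \<in> hom_set R M N; x \<in> carrier M\<rbrakk> \<Longrightarrow>
      act s (\<lambda>x\<in>carrier M. f x \<oplus>\<^bsub>N\<^esub> g x) x = act s f x \<oplus>\<^bsub>N\<^esub> act s g x"
    and mult: "\<And>s t f x. \<lbrakk>s \<in> carrier S; t \<in> carrier S; f \<in> hom_set R M N; x \<in> carrier M\<rbrakk> \<Longrightarrow>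
      act (s \<otimes>\<^bsub>S\<^esub> t) f x = act s (act t f) x"
    and one: "\<And>f x. \<lbrakk>f \<in> hom_set R M N; x \<in> carrier M\<rbrakk> \<Longrightarrow> act \<one>\<^bsub>S\<^esub> f x = f x"
    and zero: "\<And>f x. \<lbrakk>f \<in> hom_set R M N; x \<in> carrier M\<rbrakk> \<Longrightarrow> act \<zero>\<^bsub>S\<^esub> f x = \<zero>\<^bsub>N\<^esub>"
  shows "lmodule S (hom_mod R M N act)"
proof -
  interpret M: lmodule R M by fact
  interpret N: lmodule R N by fact
  interpret S: ring S by fact
  let ?H = "hom_mod R M N act"
  have eqI: "f = g" if "f \<in> carrier ?H" "g \<in> carrier ?H" "\<And>x. x \<in> carrier M \<Longrightarrow> f x = g x" for f g
    using hom_ext[of f R M N g N] that by (simp add: hom_mod_simps)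
  have z: "\<zero>\<^bsub>?H\<^esub> \<in> carrier ?H"
    using hom_restrictI[OF M, of "\<lambda>x. \<zero>\<^bsub>N\<^esub>" N] by (simp add: hom_mod_simps)
  have p: "f \<oplus>\<^bsub>?H\<^esub> g \<in> carrier ?H" if "f \<in> carrier ?H" "g \<in> carrier ?H" for f g
  proof -
    have f: "f \<in> hom_set R M N" and g: "g \<in> hom_set R M N" using that by (auto simp: hom_mod_simps)
    show ?thesis
      using hom_restrictI[OF M, of "\<lambda>x. f x \<oplus>\<^bsub>N\<^esub> g x" N] hom_closed[OF f] hom_closed[OF g]
        hom_add[OF f] hom_add[OF g] hom_smult[OF f] hom_smult[OF g]
      by (simp add: hom_mod_simps N.smult_r_distr N.M.a_ac N.smult_closed)
  qed
  have a: "l \<odot>\<^bsub>?H\<^esub> f \<in> carrier ?H" if "l \<in> carrier S" "f \<in> carrier ?H" for l f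
    using that act by (simp add: hom_mod_simps)
  have c: "f x \<in> carrier N" if "f \<in> carrier ?H" "x \<in> carrier M" for f x
    using that hom_closed[of f R M N] by (simp add: hom_mod_simps)
  have pt: "(f \<oplus>\<^bsub>?H\<^esub> g) x = f x \<oplus>\<^bsub>N\<^esub> g x" "\<zero>\<^bsub>?H\<^esub> x = \<zero>\<^bsub>N\<^esub>" if "x \<in> carrier M" for f g x
    using that by (auto simp: hom_mod_simps)
  note [simp] = z p a c pt
  show ?thesis
  proof (rule lmoduleI[OF S]; (rule eqI)?)
    fix r s f x assume "r \<in> carrier S" "s \<in> carrier S" "f \<in> carrier ?H" "x \<in> carrier M"
    then show "((r \<oplus>\<^bsub>S\<^esub> s) \<odot>\<^bsub>?H\<^esub> f) x = (r \<odot>\<^bsub>?H\<^esub> f \<oplus>\<^bsub>?H\<^esub> s \<odot>\<^bsub>?H\<^esub> f) x"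
      "((r \<otimes>\<^bsub>S\<^esub> s) \<odot>\<^bsub>?H\<^esub> f) x = (r \<odot>\<^bsub>?H\<^esub> (s \<odot>\<^bsub>?H\<^esub> f)) x"
      using add[of r s f x] mult[of r s f x] by (simp_all add: hom_mod_simps(1,4))
  next
    fix r f g x assume "r \<in> carrier S" "f \<in> carrier ?H" "g \<in> carrier ?H" "x \<in> carrier M"
    then show "(r \<odot>\<^bsub>?H\<^esub> (f \<oplus>\<^bsub>?H\<^esub> g)) x = (r \<odot>\<^bsub>?H\<^esub> f \<oplus>\<^bsub>?H\<^esub> r \<odot>\<^bsub>?H\<^esub> g) x"
      using distr[of r f g x] by (simp add: hom_mod_simps)
  next
    fix f x assume "f \<in> carrier ?H" "x \<in> carrier M"
    then show "(\<one>\<^bsub>S\<^esub> \<odot>\<^bsub>?H\<^esub> f) x = f x" "(\<zero>\<^bsub>S\<^esub> \<odot>\<^bsub>?H\<^esub> f) x = \<zero>\<^bsub>?H\<^esub> x"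
      using one[of f x] zero[of f x] by (simp_all add: hom_mod_simps)
  qed (simp_all add: N.M.a_ac)
qed

text \<open>Induced maps are written without restriction in \<open>Tr\<close> and
  \<open>cTr\<close>, while members of \<open>hom_set\<close> are extensional; the cokernel does not
  see the difference.\<close>

lemma coker_restrict: "coker M N (restrict f (carrier M)) = coker M N f"
  by (simp add: coker_def)

context matlis begin

lemma star_simps:
  "carrier (star L M) = hom_set L M (regular L)"
  "x \<in> carrier M \<Longrightarrow> (f \<oplus>\<^bsub>star L M\<^esub> g) x = f x \<oplus>\<^bsub>L\<^esub> g x"
  "x \<in> carrier M \<Longrightarrow> (l \<odot>\<^bsub>star L M\<^esub> f) x = f x \<otimes>\<^bsub>L\<^esub> l"
  by (auto simp: star_def hom_mod_simps)

lemma lmodule_star: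
  assumes "lmodule L M"
  shows "lmodule (opp L) (star L M)"
proof -
  interpret M: lmodule L M by fact
  have reg': "lmodule L (regular L)" by (rule lmodule_regular[OF L.ring_axioms])
  have c: "f x \<in> carrier L" if "f \<in> hom_set L M (regular L)" "x \<in> carrier M" for f x
    using hom_closed[OF that] by simp
  show ?thesis
    unfolding star_def
  proof (rule lmodule_hom_mod[OF assms reg' ring_opp_L])
    fix l f assume l: "l \<in> carrier (opp L)" and f: "f \<in> hom_set L M (regular L)"
    show "(\<lambda>m\<in>carrier M. f m \<otimes>\<^bsub>L\<^esub> l) \<in> hom_set L M (regular L)"
      using l c[OF f] hom_add[OF f] hom_smult[OF f]
      by (intro hom_restrictI[OF assms]) (auto simp: L.l_distr L.m_assoc)
  qed (auto simp: c L.l_distr L.r_distr L.m_assoc)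
qed

section \<open>The two actions on the dual of \<open>L\<close> and the modules of maps out of
  it\<close>

abbreviation DLl :: "('a, 'a \<Rightarrow> 'e) module" where "DLl \<equiv> D (regular (opp L))"
abbreviation DLr :: "('a, 'a \<Rightarrow> 'e) module" where "DLr \<equiv> D (regular L)"

text \<open>Centrality of \<open>\<phi>\<close> makes linearity over \<open>R\<close> the same
  condition for both multiplications, so the bimodule has one underlying set.\<close>

lemma DL_carrier: "carrier DLr = carrier DLl"
proof -
  have "(\<forall>r\<in>carrier R. \<forall>x\<in>carrier L. f (\<phi> r \<otimes>\<^bsub>L\<^esub> x) = r \<odot>\<^bsub>E\<^esub> f x) \<longleftrightarrow>
      (\<forall>r\<in>carrier R. \<forall>x\<in>carrier L. f (x \<otimes>\<^bsub>L\<^esub> \<phi> r) = r \<odot>\<^bsub>E\<^esub> f x)" for f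
    using central by metis
  then show ?thesis by (auto simp: Dual_simps hom_set_def)
qed

lemma lmodule_DLl: "lmodule L DLl"
  using matlis.lmodule_Dual[OF matlis_opp lmodule_regular[OF ring_opp_L]] by simp

lemma lmodule_DLr: "lmodule (opp L) DLr"
  by (rule lmodule_Dual[OF lmodule_regular[OF L.ring_axioms]])

lemma DL_smult:
  assumes "x \<in> carrier L"
  shows "(l \<odot>\<^bsub>DLl\<^esub> f) x = f (x \<otimes>\<^bsub>L\<^esub> l)" "(l \<odot>\<^bsub>DLr\<^esub> f) x = f (l \<otimes>\<^bsub>L\<^esub> x)"
    "(f \<oplus>\<^bsub>DLl\<^esub> g) x = f x \<oplus>\<^bsub>E\<^esub> g x" "(f \<oplus>\<^bsub>DLr\<^esub> g) x = f x \<oplus>\<^bsub>E\<^esub> g x"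
  using assms by (auto simp: Dual_simps)

lemma DL_ext: "\<lbrakk>f \<in> carrier DLl; g \<in> carrier DLl; \<And>x. x \<in> carrier L \<Longrightarrow> f x = g x\<rbrakk> \<Longrightarrow> f = g"
  using Dual_ext[of f "regular L" g] by (simp add: DL_carrier)

lemma DL_add_arg:
  "\<lbrakk>f \<in> carrier DLl; x \<in> carrier L; y \<in> carrier L\<rbrakk> \<Longrightarrow> f (x \<oplus>\<^bsub>L\<^esub> y) = f x \<oplus>\<^bsub>E\<^esub> f y"
  using Dual_add_arg[of f "regular L" x y] by (simp add: DL_carrier)

lemma DLr_smult_closed: "\<lbrakk>l \<in> carrier L; f \<in> carrier DLl\<rbrakk> \<Longrightarrow> l \<odot>\<^bsub>DLr\<^esub> f \<in> carrier DLl"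
  using lmodule.smult_closed[OF lmodule_DLr, of l f] by (simp add: DL_carrier)

lemma hom_DL_simps:
  "carrier (hom_DL R \<phi> E L M) = hom_set L DLl M"
  "f \<in> carrier DLl \<Longrightarrow> (g \<oplus>\<^bsub>hom_DL R \<phi> E L M\<^esub> h) f = g f \<oplus>\<^bsub>M\<^esub> h f"
  "f \<in> carrier DLl \<Longrightarrow> (l \<odot>\<^bsub>hom_DL R \<phi> E L M\<^esub> h) f = h (l \<odot>\<^bsub>DLr\<^esub> f)"
  by (auto simp: hom_DL_def hom_mod_simps)

text \<open>The scaled map stays linear because the two actions on the dual of \<open>L\<close>
  commute, fact \<open>2\<close>. By fact \<open>4\<close> the right action reverses products, so
  composing with it gives a left module again.\<close>

lemma lmodule_hom_DL:
  assumes "lmodule L M"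
  shows "lmodule L (hom_DL R \<phi> E L M)"
proof -
  interpret M: lmodule L M by fact
  interpret l: lmodule L DLl by (rule lmodule_DLl)
  interpret r: lmodule "opp L" DLr by (rule lmodule_DLr)
  note [simp] = DLr_smult_closed
  have 1: "l \<odot>\<^bsub>DLr\<^esub> (f \<oplus>\<^bsub>DLl\<^esub> g) = l \<odot>\<^bsub>DLr\<^esub> f \<oplus>\<^bsub>DLl\<^esub> l \<odot>\<^bsub>DLr\<^esub> g"
    if "l \<in> carrier L" "f \<in> carrier DLl" "g \<in> carrier DLl" for l f g
    using that l.M.add.m_closed by (intro DL_ext) (auto simp: DL_smult)
  have 2: "l \<odot>\<^bsub>DLr\<^esub> (s \<odot>\<^bsub>DLl\<^esub> f) = s \<odot>\<^bsub>DLl\<^esub> (l \<odot>\<^bsub>DLr\<^esub> f)"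
    if "l \<in> carrier L" "s \<in> carrier L" "f \<in> carrier DLl" for l s f
    using that l.smult_closed by (intro DL_ext) (auto simp: DL_smult L.m_assoc)
  have 3: "(l \<oplus>\<^bsub>L\<^esub> s) \<odot>\<^bsub>DLr\<^esub> f = l \<odot>\<^bsub>DLr\<^esub> f \<oplus>\<^bsub>DLl\<^esub> s \<odot>\<^bsub>DLr\<^esub> f"
    if "l \<in> carrier L" "s \<in> carrier L" "f \<in> carrier DLl" for l s f
    using that l.M.add.m_closed by (intro DL_ext) (auto simp: DL_smult L.l_distr DL_add_arg)
  have 4: "(l \<otimes>\<^bsub>L\<^esub> s) \<odot>\<^bsub>DLr\<^esub> f = s \<odot>\<^bsub>DLr\<^esub> (l \<odot>\<^bsub>DLr\<^esub> f)"
    if "l \<in> carrier L" "s \<in> carrier L" "f \<in> carrier DLl" for l s f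
    using that by (intro DL_ext) (auto simp: DL_smult L.m_assoc)
  have 5: "\<one>\<^bsub>L\<^esub> \<odot>\<^bsub>DLr\<^esub> f = f" if "f \<in> carrier DLl" for f
    using that by (intro DL_ext) (auto simp: DL_smult)
  have 6: "\<zero>\<^bsub>L\<^esub> \<odot>\<^bsub>DLr\<^esub> f = \<zero>\<^bsub>DLl\<^esub>" if "f \<in> carrier DLl" for f
  proof -
    have "f \<in> carrier DLr" using that by (simp only: DL_carrier)
    from r.smult_zero_left[OF this] show ?thesis by (simp add: Dual_simps(2))
  qed
  show ?thesis
    unfolding hom_DL_def
  proof (rule lmodule_hom_mod[OF lmodule_DLl assms L.ring_axioms])
    fix l h assume l: "l \<in> carrier L" and h: "h \<in> hom_set L DLl M"
    show "(\<lambda>f\<in>carrier DLl. h (l \<odot>\<^bsub>DLr\<^esub> f)) \<in> hom_set L DLl M"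
      using l hom_closed[OF h] hom_add[OF h] hom_smult[OF h] 1 2
      by (intro hom_restrictI[OF lmodule_DLl]) auto
  next
    fix s t h f assume "s \<in> carrier L" "t \<in> carrier L" "h \<in> hom_set L DLl M" "f \<in> carrier DLl"
    then show "(\<lambda>f\<in>carrier DLl. h ((s \<oplus>\<^bsub>L\<^esub> t) \<odot>\<^bsub>DLr\<^esub> f)) f =
        (\<lambda>f\<in>carrier DLl. h (s \<odot>\<^bsub>DLr\<^esub> f)) f \<oplus>\<^bsub>M\<^esub> (\<lambda>f\<in>carrier DLl. h (t \<odot>\<^bsub>DLr\<^esub> f)) f"
      "(\<lambda>f\<in>carrier DLl. h ((s \<otimes>\<^bsub>L\<^esub> t) \<odot>\<^bsub>DLr\<^esub> f)) f =
        (\<lambda>f\<in>carrier DLl. (\<lambda>f\<in>carrier DLl. h (t \<odot>\<^bsub>DLr\<^esub> f)) (s \<odot>\<^bsub>DLr\<^esub> f)) f"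
      using hom_add[of h L DLl M] by (simp_all add: 3 4)
  next
    fix h f assume "h \<in> hom_set L DLl M" "f \<in> carrier DLl"
    then show "(\<lambda>f\<in>carrier DLl. h (\<zero>\<^bsub>L\<^esub> \<odot>\<^bsub>DLr\<^esub> f)) f = \<zero>\<^bsub>M\<^esub>"
      using hom_zero[OF lmodule_DLl assms] by (simp add: 6)
  qed (auto simp: 5)
qed

lemma hom_DL_map:
  assumes "lmodule L M" "lmodule L N" "f \<in> hom_set L M N"
  shows "(\<lambda>h\<in>carrier (hom_DL R \<phi> E L M). compose (carrier DLl) f h)
    \<in> hom_set L (hom_DL R \<phi> E L M) (hom_DL R \<phi> E L N)"
proof -
  interpret M: lmodule L M by fact
  interpret N: lmodule L N by fact
  interpret HM: lmodule L "hom_DL R \<phi> E L M" by (rule lmodule_hom_DL[OF assms(1)])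
  interpret HN: lmodule L "hom_DL R \<phi> E L N" by (rule lmodule_hom_DL[OF assms(2)])
  let ?F = "\<lambda>h. compose (carrier DLl) f h"
  have c: "?F h \<in> hom_set L DLl N" if "h \<in> hom_set L DLl M" for h
    by (rule hom_compose[OF lmodule_DLl that assms(3)])
  show ?thesis
  proof (rule hom_restrictI[OF HM.lmodule_axioms])
    show "?F h \<in> carrier (hom_DL R \<phi> E L N)" if "h \<in> carrier (hom_DL R \<phi> E L M)" for h
      using c that by (simp add: hom_DL_simps)
    show "?F (h \<oplus>\<^bsub>hom_DL R \<phi> E L M\<^esub> k) = ?F h \<oplus>\<^bsub>hom_DL R \<phi> E L N\<^esub> ?F k"
      if hk: "h \<in> carrier (hom_DL R \<phi> E L M)" "k \<in> carrier (hom_DL R \<phi> E L M)" for h k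
    proof (rule hom_ext)
      have hk': "h \<in> hom_set L DLl M" "k \<in> hom_set L DLl M" using hk by (auto simp: hom_DL_simps)
      show "?F (h \<oplus>\<^bsub>hom_DL R \<phi> E L M\<^esub> k) \<in> hom_set L DLl N"
        using c HM.M.add.m_closed[OF hk] by (simp add: hom_DL_simps)
      show "?F h \<oplus>\<^bsub>hom_DL R \<phi> E L N\<^esub> ?F k \<in> hom_set L DLl N"
        using HN.M.add.m_closed[of "?F h" "?F k"] c hk' by (simp add: hom_DL_simps)
      fix w assume w: "w \<in> carrier DLl"
      then show "?F (h \<oplus>\<^bsub>hom_DL R \<phi> E L M\<^esub> k) w = (?F h \<oplus>\<^bsub>hom_DL R \<phi> E L N\<^esub> ?F k) w"
        using hom_add[OF assms(3) hom_closed[OF hk'(1) w] hom_closed[OF hk'(2) w]]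
        by (simp add: hom_DL_simps compose_def)
    qed
    show "?F (l \<odot>\<^bsub>hom_DL R \<phi> E L M\<^esub> h) = l \<odot>\<^bsub>hom_DL R \<phi> E L N\<^esub> ?F h"
      if l: "l \<in> carrier L" and h: "h \<in> carrier (hom_DL R \<phi> E L M)" for l h
    proof (rule hom_ext)
      have h': "h \<in> hom_set L DLl M" using h by (simp add: hom_DL_simps)
      show "?F (l \<odot>\<^bsub>hom_DL R \<phi> E L M\<^esub> h) \<in> hom_set L DLl N"
        using c HM.smult_closed[OF l h] by (simp add: hom_DL_simps)
      show "l \<odot>\<^bsub>hom_DL R \<phi> E L N\<^esub> ?F h \<in> hom_set L DLl N"
        using HN.smult_closed[OF l, of "?F h"] c[OF h'] by (simp add: hom_DL_simps)
      fix w assume w: "w \<in> carrier DLl"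
      then show "?F (l \<odot>\<^bsub>hom_DL R \<phi> E L M\<^esub> h) w = (l \<odot>\<^bsub>hom_DL R \<phi> E L N\<^esub> ?F h) w"
        using DLr_smult_closed[OF l w] by (simp add: hom_DL_simps compose_def)
    qed
  qed
qed

lemma hom_DL_isom:
  assumes M: "lmodule L M" "lmodule L N" and a: "mod_isom L M N a"
  shows "mod_isom L (hom_DL R \<phi> E L M) (hom_DL R \<phi> E L N)
    (\<lambda>h\<in>carrier (hom_DL R \<phi> E L M). compose (carrier DLl) a h)"
proof (rule mod_isomI[OF hom_DL_map[OF M mod_isom_hom[OF a]]])
  let ?A = "\<lambda>h\<in>carrier (hom_DL R \<phi> E L M). compose (carrier DLl) a h"
  obtain b where b: "mod_isom L N M b" "\<And>x. x \<in> carrier M \<Longrightarrow> b (a x) = x"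
    "\<And>y. y \<in> carrier N \<Longrightarrow> a (b y) = y"
    using mod_isom_inv[OF M a] by metis
  show "inj_on ?A (carrier (hom_DL R \<phi> E L M))"
  proof (rule inj_onI)
    fix h k assume "h \<in> carrier (hom_DL R \<phi> E L M)" "k \<in> carrier (hom_DL R \<phi> E L M)" and eq: "?A h = ?A k"
    then have hk: "h \<in> hom_set L DLl M" "k \<in> hom_set L DLl M" by (auto simp: hom_DL_simps)
    show "h = k"
    proof (rule hom_ext[OF hk])
      fix w assume w: "w \<in> carrier DLl"
      then have "a (h w) = a (k w)"
        using fun_cong[OF eq, of w] hk by (simp add: hom_DL_simps compose_def)
      then show "h w = k w" using b(2) hom_closed[OF hk(1) w] hom_closed[OF hk(2) w] by metis
    qed
  qed
  show "?A ` carrier (hom_DL R \<phi> E L M) = carrier (hom_DL R \<phi> E L N)"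
  proof
    show "carrier (hom_DL R \<phi> E L N) \<subseteq> ?A ` carrier (hom_DL R \<phi> E L M)"
    proof
      fix k assume "k \<in> carrier (hom_DL R \<phi> E L N)"
      then have k: "k \<in> hom_set L DLl N" by (simp add: hom_DL_simps)
      let ?h = "compose (carrier DLl) b k"
      have h: "?h \<in> hom_set L DLl M" by (rule hom_compose[OF lmodule_DLl k mod_isom_hom[OF b(1)]])
      have "compose (carrier DLl) a ?h = k"
        using b(3) hom_closed[OF k]
        by (intro hom_ext[OF hom_compose[OF lmodule_DLl h mod_isom_hom[OF a]] k]) (simp add: compose_def)
      then show "k \<in> ?A ` carrier (hom_DL R \<phi> E L M)" using h by (auto simp: hom_DL_simps image_iff intro!: bexI[of _ ?h])
    qed
  qed (rule hom_image[OF hom_DL_map[OF M mod_isom_hom[OF a]]])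
qed

text \<open>The terms \<open>I0\<close> and \<open>I1\<close> may have any type; in the application
  they are duals. Being finitely generated, they have copies in \<open>nat \<Rightarrow> 'a\<close>,
  so the choice in \<open>cTr\<close> succeeds, and the uniqueness of minimal injective
  presentations identifies the two cokernels.\<close>

lemma cTr_iso:
  fixes I0 :: "('a, 'i) module" and I1 :: "('a, 'k) module"
  assumes M: "lmodule L M" "lmodule L M'" "mod_isom L M M' \<theta>"
    and P: "min_inj_presentation L M' j I0 f I1" and fg: "fin_gen L I0" "fin_gen L I1"
  shows "lmodule L (cTr R \<phi> E L M)"
    "mod_iso L (coker (hom_DL R \<phi> E L I0) (hom_DL R \<phi> E L I1) (\<lambda>h. compose (carrier DLl) f h)) (cTr R \<phi> E L M)"
proof -
  have I: "lmodule L I0" "lmodule L I1" and f: "f \<in> hom_set L I0 I1"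
    using P by (auto simp: min_inj_presentation_def injective_envelope_def injective_def)
  obtain c0 :: "'i \<Rightarrow> nat \<Rightarrow> 'a" where c0: "inj_on c0 (carrier I0)" by (rule fin_gen_inj_into[OF I(1) fg(1)])
  obtain c1 :: "'k \<Rightarrow> nat \<Rightarrow> 'a" where c1: "inj_on c1 (carrier I1)" by (rule fin_gen_inj_into[OF I(2) fg(2)])
  have "\<exists>j' f'. min_inj_presentation L M j' (transport I0 c0) f' (transport I1 c1)"
    by (rule min_inj_presentation_iso[OF min_inj_presentation_iso_module[OF M(1,3) P] M(1)
          lmodule_transport[OF I(1) c0] lmodule_transport[OF I(2) c1]
          mod_isom_transport[OF I(1) c0] mod_isom_transport[OF I(2) c1]])
  then have ex: "\<exists>t. case t of (j, I0 :: ('a, nat \<Rightarrow> 'a) module, f, I1 :: ('a, nat \<Rightarrow> 'a) module) \<Rightarrow>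
      min_inj_presentation L M j I0 f I1" by blast
  define t where "t = (SOME (j, I0 :: ('a, nat \<Rightarrow> 'a) module, f, I1 :: ('a, nat \<Rightarrow> 'a) module).
      min_inj_presentation L M j I0 f I1)"
  obtain j' J0 f' J1 where t: "t = (j', J0, f', J1)" by (cases t)
  have P': "min_inj_presentation L M j' J0 f' J1"
    using someI_ex[OF ex] unfolding t_def[symmetric] t by simp
  have J: "lmodule L J0" "lmodule L J1" and f': "f' \<in> hom_set L J0 J1"
    using P' by (auto simp: min_inj_presentation_def injective_envelope_def injective_def)
  have cTr: "cTr R \<phi> E L M = coker (hom_DL R \<phi> E L J0) (hom_DL R \<phi> E L J1)
      (\<lambda>h\<in>carrier (hom_DL R \<phi> E L J0). compose (carrier DLl) f' h)"
    unfolding cTr_def t_def[symmetric] t by (simp add: coker_restrict)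
  show "lmodule L (cTr R \<phi> E L M)"
    unfolding cTr by (intro lmodule_coker lmodule_hom_DL J hom_DL_map f')
  obtain \<theta>' where \<theta>': "mod_isom L M' M \<theta>'" using mod_isom_inv[OF M] by metis
  obtain a b where a: "mod_isom L I0 J0 a" and b: "mod_isom L I1 J1 b"
    and comm: "\<forall>x\<in>carrier I0. b (f x) = f' (a x)"
    by (rule min_inj_presentation_unique[OF M(2,1) \<theta>' P P'])
  let ?F = "\<lambda>h\<in>carrier (hom_DL R \<phi> E L I0). compose (carrier DLl) f h"
  let ?F' = "\<lambda>h\<in>carrier (hom_DL R \<phi> E L J0). compose (carrier DLl) f' h"
  let ?A = "\<lambda>h\<in>carrier (hom_DL R \<phi> E L I0). compose (carrier DLl) a h"
  let ?B = "\<lambda>h\<in>carrier (hom_DL R \<phi> E L I1). compose (carrier DLl) b h"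
  have "?B (?F h) = ?F' (?A h)" if h: "h \<in> carrier (hom_DL R \<phi> E L I0)" for h
  proof -
    have h': "h \<in> hom_set L DLl I0" using h by (simp add: hom_DL_simps)
    have "?F h \<in> carrier (hom_DL R \<phi> E L I1)" by (rule hom_closed[OF hom_DL_map[OF I f] h])
    moreover have "?A h \<in> carrier (hom_DL R \<phi> E L J0)"
      by (rule hom_closed[OF hom_DL_map[OF I(1) J(1) mod_isom_hom[OF a]] h])
    ultimately have "?B (?F h) = compose (carrier DLl) b (compose (carrier DLl) f h)"
      "?F' (?A h) = compose (carrier DLl) f' (compose (carrier DLl) a h)"
      using h by simp_all
    moreover have "compose (carrier DLl) b (compose (carrier DLl) f h) =
        compose (carrier DLl) f' (compose (carrier DLl) a h)"
      using comm hom_closed[OF h'] by (auto simp: compose_def fun_eq_iff)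
    ultimately show ?thesis by simp
  qed
  then have "mod_iso L (coker (hom_DL R \<phi> E L I0) (hom_DL R \<phi> E L I1) ?F) (cTr R \<phi> E L M)"
    unfolding cTr
    by (intro coker_iso[where \<alpha> = ?A and \<beta> = ?B] lmodule_hom_DL I J hom_DL_map f f' hom_DL_isom a b)
  then show "mod_iso L (coker (hom_DL R \<phi> E L I0) (hom_DL R \<phi> E L I1)
      (\<lambda>h. compose (carrier DLl) f h)) (cTr R \<phi> E L M)"
    by (simp add: coker_restrict)
qed

text \<open>Since \<open>L \<cong> D (D L)\<close>, a map \<open>D L \<rightarrow> D P\<close> is the dual of a unique map \<open>P \<rightarrow> L\<close>.\<close>

lemma star_isom_hom_DL:
  assumes P: "lmodule L P"
  shows "mod_isom (opp L) (star L P) (hom_DL R \<phi> E (opp L) (D P))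
    (\<lambda>f\<in>carrier (star L P). Dmap P (regular L) f)"
proof -
  interpret op: matlis R \<iota> E \<phi> "opp L" by (rule matlis_opp)
  note hD = op.hom_DL_simps[where M = "D P", simplified]
  have reg': "lmodule L (regular L)" by (rule lmodule_regular[OF L.ring_axioms])
  have mDP: "lmodule (opp L) (D P)" by (rule lmodule_Dual[OF P])
  interpret S: lmodule "opp L" "star L P" by (rule lmodule_star[OF P])
  interpret H: lmodule "opp L" "hom_DL R \<phi> E (opp L) (D P)" by (rule op.lmodule_hom_DL[OF mDP])
  interpret P: lmodule L P by (rule P)
  let ?T = "\<lambda>f. Dmap P (regular L) f"
  have c: "?T f \<in> hom_set (opp L) DLr (D P)" if "f \<in> hom_set L P (regular L)" for f
    by (rule Dmap_hom[OF P reg' that])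
  have eq: "h = k" if "h \<in> hom_set (opp L) DLr (D P)" "k \<in> hom_set (opp L) DLr (D P)"
    "\<And>w p. \<lbrakk>w \<in> carrier DLr; p \<in> carrier P\<rbrakk> \<Longrightarrow> h w p = k w p" for h k
  proof (rule hom_ext[OF that(1,2)])
    fix w assume w: "w \<in> carrier DLr"
    show "h w = k w"
      using that(3)[OF w] by (rule Dual_ext[OF hom_closed[OF that(1) w] hom_closed[OF that(2) w]])
  qed
  have hom: "(\<lambda>f\<in>carrier (star L P). ?T f) \<in> hom_set (opp L) (star L P) (hom_DL R \<phi> E (opp L) (D P))"
  proof (rule hom_restrictI[OF S.lmodule_axioms])
    show "?T f \<in> carrier (hom_DL R \<phi> E (opp L) (D P))" if "f \<in> carrier (star L P)" for f
      using c that by (simp add: hD star_simps)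
    show "?T (f \<oplus>\<^bsub>star L P\<^esub> g) = ?T f \<oplus>\<^bsub>hom_DL R \<phi> E (opp L) (D P)\<^esub> ?T g"
      if fg: "f \<in> carrier (star L P)" "g \<in> carrier (star L P)" for f g
    proof (rule eq)
      have fg': "f \<in> hom_set L P (regular L)" "g \<in> hom_set L P (regular L)"
        using fg by (auto simp: star_simps)
      show "?T (f \<oplus>\<^bsub>star L P\<^esub> g) \<in> hom_set (opp L) DLr (D P)"
        using c S.M.add.m_closed[OF fg] by (simp add: star_simps)
      show "?T f \<oplus>\<^bsub>hom_DL R \<phi> E (opp L) (D P)\<^esub> ?T g \<in> hom_set (opp L) DLr (D P)"
        using H.M.add.m_closed[of "?T f" "?T g"] c fg' by (simp add: hD)
      fix w p assume w: "w \<in> carrier DLr" and p: "p \<in> carrier P"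
      then show "?T (f \<oplus>\<^bsub>star L P\<^esub> g) w p = (?T f \<oplus>\<^bsub>hom_DL R \<phi> E (opp L) (D P)\<^esub> ?T g) w p"
        using Dual_add_arg[OF w, of "f p" "g p"] hom_closed[OF fg'(1) p] hom_closed[OF fg'(2) p]
        by (simp add: hD star_simps)
    qed
    show "?T (l \<odot>\<^bsub>star L P\<^esub> f) = l \<odot>\<^bsub>hom_DL R \<phi> E (opp L) (D P)\<^esub> ?T f"
      if l: "l \<in> carrier (opp L)" and f: "f \<in> carrier (star L P)" for l f
    proof (rule eq)
      have f': "f \<in> hom_set L P (regular L)" using f by (simp add: star_simps)
      show "?T (l \<odot>\<^bsub>star L P\<^esub> f) \<in> hom_set (opp L) DLr (D P)"
        using c S.smult_closed[OF l f] by (simp add: star_simps)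
      show "l \<odot>\<^bsub>hom_DL R \<phi> E (opp L) (D P)\<^esub> ?T f \<in> hom_set (opp L) DLr (D P)"
        using H.smult_closed[OF l, of "?T f"] c[OF f'] by (simp add: hD)
      fix w p assume w: "w \<in> carrier DLr" and p: "p \<in> carrier P"
      have "l \<odot>\<^bsub>DLl\<^esub> w \<in> carrier DLr"
        using lmodule.smult_closed[OF lmodule_DLl, of l w] l w by (simp add: DL_carrier)
      then show "?T (l \<odot>\<^bsub>star L P\<^esub> f) w p = (l \<odot>\<^bsub>hom_DL R \<phi> E (opp L) (D P)\<^esub> ?T f) w p"
        using w p hom_closed[OF f' p] by (simp add: hD star_simps DL_smult)
    qed
  qed
  show ?thesis
  proof (rule mod_isomI[OF hom])
    show "inj_on (\<lambda>f\<in>carrier (star L P). ?T f) (carrier (star L P))"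
    proof (rule inj_onI)
      fix f g assume "f \<in> carrier (star L P)" "g \<in> carrier (star L P)"
        and e: "(\<lambda>f\<in>carrier (star L P). ?T f) f = (\<lambda>f\<in>carrier (star L P). ?T f) g"
      then have fg: "f \<in> hom_set L P (regular L)" "g \<in> hom_set L P (regular L)" and e: "?T f = ?T g"
        by (auto simp: star_simps)
      show "f = g"
      proof (rule hom_ext[OF fg])
        fix p assume p: "p \<in> carrier P"
        show "f p = g p"
        proof (rule Dual_separates[OF reg' hom_closed[OF fg(1) p] hom_closed[OF fg(2) p]])
          fix w assume "w \<in> carrier DLr"
          then show "w (f p) = w (g p)" using fun_cong[OF fun_cong[OF e, of w], of p] p by simp
        qed
      qed
    qed
    show "(\<lambda>f\<in>carrier (star L P). ?T f) ` carrier (star L P) = carrier (hom_DL R \<phi> E (opp L) (D P))"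
    proof
      show "carrier (hom_DL R \<phi> E (opp L) (D P)) \<subseteq> (\<lambda>f\<in>carrier (star L P). ?T f) ` carrier (star L P)"
      proof
        fix h assume "h \<in> carrier (hom_DL R \<phi> E (opp L) (D P))"
        then have h: "h \<in> hom_set (opp L) DLr (D P)" by (simp add: hD)
        have mDD: "lmodule L (D DLr)" using op.lmodule_Dual[OF lmodule_DLr] by simp
        obtain v where v: "mod_isom L (D DLr) (regular L) v"
          "\<And>\<xi>. \<xi> \<in> carrier (D DLr) \<Longrightarrow> (\<lambda>x\<in>carrier (regular L). \<lambda>f\<in>carrier DLr. f x) (v \<xi>) = \<xi>"
          using mod_isom_inv[OF reg' mDD eval_iso[OF reg' flen_rs_regular]] by metis
        note fl = flip_hom[OF lmodule_DLr P h]
        \<comment> \<open>For each \<open>p\<close>, sending \<open>w\<close> to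
          \<open>h w p\<close> is a functional on the dual of \<open>L\<close>, and \<open>v\<close>
          returns the element of \<open>L\<close> at which it evaluates.\<close>
        let ?f = "compose (carrier P) v (flip DLr P h)"
        have f: "?f \<in> hom_set L P (regular L)" by (rule hom_compose[OF P fl mod_isom_hom[OF v(1)]])
        have "?T ?f = h"
        proof (rule eq[OF c[OF f] h])
          fix w p assume w: "w \<in> carrier DLr" and p: "p \<in> carrier P"
          have fp: "flip DLr P h p \<in> carrier (D DLr)" by (rule hom_closed[OF fl p])
          have "v (flip DLr P h p) \<in> carrier L"
            using hom_closed[OF mod_isom_hom[OF v(1)] fp] by simp
          then have "w (v (flip DLr P h p)) = flip DLr P h p w"
            using fun_cong[OF v(2)[OF fp], of w] w by simp
          then show "?T ?f w p = h w p" using w p by (simp add: compose_def flip_def)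
        qed
        then show "h \<in> (\<lambda>f\<in>carrier (star L P). ?T f) ` carrier (star L P)"
          using f by (auto simp: star_simps image_iff intro!: bexI[of _ ?f])
      qed
    qed (rule hom_image[OF hom])
  qed
qed

lemma star_map:
  assumes "lmodule L P1" "lmodule L P0" "g \<in> hom_set L P1 P0"
  shows "(\<lambda>h\<in>carrier (star L P0). compose (carrier P1) h g) \<in> hom_set (opp L) (star L P0) (star L P1)"
proof -
  interpret S0: lmodule "opp L" "star L P0" by (rule lmodule_star[OF assms(2)])
  interpret S1: lmodule "opp L" "star L P1" by (rule lmodule_star[OF assms(1)])
  let ?F = "\<lambda>h. compose (carrier P1) h g"
  have c: "?F h \<in> carrier (star L P1)" if "h \<in> carrier (star L P0)" for h
    using hom_compose[OF assms(1,3), of h "regular L"] that by (simp add: star_simps)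
  have eq: "h = k" if "h \<in> carrier (star L P1)" "k \<in> carrier (star L P1)"
    "\<And>p. p \<in> carrier P1 \<Longrightarrow> h p = k p" for h k
    using hom_ext[of h L P1 "regular L" k "regular L"] that by (simp add: star_simps)
  show ?thesis
  proof (rule hom_restrictI[OF S0.lmodule_axioms c])
    show "?F (h \<oplus>\<^bsub>star L P0\<^esub> k) = ?F h \<oplus>\<^bsub>star L P1\<^esub> ?F k"
      if "h \<in> carrier (star L P0)" "k \<in> carrier (star L P0)" for h k
      using that c S0.M.add.m_closed S1.M.add.m_closed hom_closed[OF assms(3)]
      by (intro eq) (auto simp: star_simps(2) compose_def)
    show "?F (l \<odot>\<^bsub>star L P0\<^esub> h) = l \<odot>\<^bsub>star L P1\<^esub> ?F h"
      if "l \<in> carrier (opp L)" "h \<in> carrier (star L P0)" for l h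
      using that c S0.smult_closed S1.smult_closed hom_closed[OF assms(3)]
      by (intro eq) (auto simp: star_simps(3) compose_def)
  qed
qed

text \<open>The values at the images of the unit vectors embed \<open>star L P\<close> into a free
  module over \<open>opp L\<close>, from which it inherits finite length. Finite generation of the
  transpose, and with it the existence of its resolution, rests on this.\<close>

lemma fin_gen_star:
  assumes P: "lmodule L P" "fin_gen L P"
  shows "fin_gen (opp L) (star L P)"
proof -
  interpret op: matlis R \<iota> E \<phi> "opp L" by (rule matlis_opp)
  interpret S: lmodule "opp L" "star L P" by (rule lmodule_star[OF P(1)])
  interpret P: lmodule L P by (rule P(1))
  have reg': "lmodule L (regular L)" by (rule lmodule_regular[OF L.ring_axioms])
  have F: "lmodule L (free_mod L n)" for n by (rule lmodule_free_mod[OF L.ring_axioms])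
  have F': "lmodule (opp L) (free_mod (opp L) n)" for n by (rule lmodule_free_mod[OF ring_opp_L])
  obtain n q where q: "q \<in> hom_set L (free_mod L n) P" "q ` carrier (free_mod L n) = carrier P"
    by (rule fin_gen_free_cover[OF P])
  let ?u = "\<lambda>f i. if i < n then f (q (P.unit_vec i)) else \<zero>\<^bsub>L\<^esub>"
  have e: "q (P.unit_vec i) \<in> carrier P" if "i < n" for i
    by (rule hom_closed[OF q(1) P.unit_vec_mem[OF that]])
  have fe: "f (q (P.unit_vec i)) \<in> carrier L" if "f \<in> carrier (star L P)" "i < n" for f i
    using hom_closed[of f L P "regular L"] e[OF that(2)] that(1) by (simp add: star_simps)
  have u: "(\<lambda>f\<in>carrier (star L P). ?u f) \<in> hom_set (opp L) (star L P) (free_mod (opp L) n)"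
    by (rule hom_restrictI[OF S.lmodule_axioms])
      (auto simp: fe e star_simps(2,3) fun_eq_iff)
  have "inj_on (\<lambda>f\<in>carrier (star L P). ?u f) (carrier (star L P))"
  proof (rule inj_onI)
    fix f g assume fg: "f \<in> carrier (star L P)" "g \<in> carrier (star L P)"
      and e: "(\<lambda>f\<in>carrier (star L P). ?u f) f = (\<lambda>f\<in>carrier (star L P). ?u f) g"
    have "?u f = ?u g" using e fg by simp
    then have eq: "f (q (P.unit_vec i)) = g (q (P.unit_vec i))" if "i < n" for i
      using that by (metis (full_types))
    have h: "f \<in> hom_set L P (regular L)" "g \<in> hom_set L P (regular L)" using fg by (auto simp: star_simps)
    show "f = g"
    proof (rule hom_ext[OF h])
      fix x assume "x \<in> carrier P"
      then obtain c where c: "c \<in> carrier (free_mod L n)" "x = q c" using q(2) by blast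
      have ex: "k x = lincomb (regular L) (\<lambda>i. k (q (P.unit_vec i))) n c"
        if k: "k \<in> hom_set L P (regular L)" for k
      proof -
        have "k x = lincomb (regular L) (\<lambda>i. compose (carrier (free_mod L n)) k q (P.unit_vec i)) n c"
          using hom_free_mod[OF reg' hom_compose[OF F q(1) k] c(1)] c by (simp add: compose_def)
        also have "\<dots> = lincomb (regular L) (\<lambda>i. k (q (P.unit_vec i))) n c"
        proof -
          have "lincomb (regular L) (\<lambda>i. compose (carrier (free_mod L n)) k q (P.unit_vec i)) m c =
              lincomb (regular L) (\<lambda>i. k (q (P.unit_vec i))) m c" if "m \<le> n" for m
            using that
            by (induction m) (auto simp: compose_eq P.unit_vec_mem simp del: free_mod_simps)
          then show ?thesis by simp
        qed
        finally show ?thesis .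
      qed
      have "lincomb (regular L) (\<lambda>i. f (q (P.unit_vec i))) m c = lincomb (regular L) (\<lambda>i. g (q (P.unit_vec i))) m c"
        if "m \<le> n" for m
        using that by (induction m) (auto simp: eq)
      then show "f x = g x" using ex[OF h(1)] ex[OF h(2)] by simp
    qed
  qed
  then have "flen (opp L) (star L P)"
    by (rule flen_inj[OF S.lmodule_axioms F' u _ flen_free_mod[OF ring_opp_L op.flen_regular_L]])
  then show ?thesis by (rule flen_fin_gen[OF S.lmodule_axioms])
qed

lemma Tr_eq_coker:
  assumes A: "lmodule L A" "fin_gen L A"
  obtains P1 P0 :: "('a, nat \<Rightarrow> 'a) module" and g p where "min_proj_presentation L P1 g P0 p A"
    "Tr L A = coker (star L P0) (star L P1) (\<lambda>h\<in>carrier (star L P0). compose (carrier P1) h g)"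
proof -
  have ex: "\<exists>t. case t of (P1 :: ('a, nat \<Rightarrow> 'a) module, g, P0 :: ('a, nat \<Rightarrow> 'a) module, p) \<Rightarrow>
      min_proj_presentation L P1 g P0 p A"
    using min_proj_presentation_exists[OF flen_regular_L A] by (metis case_prod_conv)
  define t where "t = (SOME (P1 :: ('a, nat \<Rightarrow> 'a) module, g, P0 :: ('a, nat \<Rightarrow> 'a) module, p).
      min_proj_presentation L P1 g P0 p A)"
  obtain P1 g P0 p where t: "t = (P1, g, P0, p)" by (cases t)
  have P: "min_proj_presentation L P1 g P0 p A"
    using someI_ex[OF ex] unfolding t_def[symmetric] t by simp
  have "Tr L A = coker (star L P0) (star L P1) (\<lambda>h\<in>carrier (star L P0). compose (carrier P1) h g)"
    unfolding Tr_def t_def[symmetric] t by (simp add: coker_restrict)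
  then show ?thesis using that P by blast
qed

lemma fin_gen_Tr:
  assumes A: "lmodule L A" "fin_gen L A"
  shows "lmodule (opp L) (Tr L A)" "fin_gen (opp L) (Tr L A)"
proof -
  obtain P1 P0 :: "('a, nat \<Rightarrow> 'a) module" and g p where P: "min_proj_presentation L P1 g P0 p A"
    and Tr: "Tr L A = coker (star L P0) (star L P1) (\<lambda>h\<in>carrier (star L P0). compose (carrier P1) h g)"
    by (rule Tr_eq_coker[OF A])
  note d = Dual_min_presentation[OF A P]
  have s: "lmodule (opp L) (star L P0)" "lmodule (opp L) (star L P1)" using lmodule_star d by auto
  note m = star_map[OF d(2,1,3)]
  show "lmodule (opp L) (Tr L A)" unfolding Tr by (rule lmodule_coker[OF s m])
  let ?K = "(\<lambda>h\<in>carrier (star L P0). compose (carrier P1) h g) ` carrier (star L P0)"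
  interpret C: lmodule_sub "opp L" "star L P1" ?K
    using submodule_image[OF s m lmodule.submodule_carrier[OF s(1)]] s(2) by (simp add: lmodule_subI)
  show "fin_gen (opp L) (Tr L A)"
    unfolding Tr coker_def
    by (rule fin_gen_image[OF s(2) C.lmodule_quot_mod C.proj_hom C.proj_image fin_gen_star[OF d(2,5)]])
qed

text \<open>The presentation chosen by \<open>Tr\<close> is dualised, and the maps of
  \<open>star_isom_hom_DL\<close> commute with its differential. The module \<open>B\<close> stands
  for any copy of \<open>D A\<close>: taking \<open>D A\<close> itself gives (1), while (2) is the
  instance over \<open>opp L\<close> for \<open>D A\<close>, with \<open>A\<close> as the copy of
  the double dual.\<close>

lemma Tr_iso_cTr:
  assumes A: "lmodule L A" "fin_gen L A"
    and B: "lmodule (opp L) B" "mod_isom (opp L) B (D A) \<theta>"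
  shows "mod_iso (opp L) (Tr L A) (cTr R \<phi> E (opp L) B)" "lmodule (opp L) (cTr R \<phi> E (opp L) B)"
proof -
  interpret op: matlis R \<iota> E \<phi> "opp L" by (rule matlis_opp)
  obtain P1 P0 :: "('a, nat \<Rightarrow> 'a) module" and g p where P: "min_proj_presentation L P1 g P0 p A"
    and Tr: "Tr L A = coker (star L P0) (star L P1) (\<lambda>h\<in>carrier (star L P0). compose (carrier P1) h g)"
    by (rule Tr_eq_coker[OF A])
  note d = Dual_min_presentation[OF A P]
  have fg: "fin_gen (opp L) (D P0)" "fin_gen (opp L) (D P1)"
    using op.fin_gen_iff_flen_rs[OF lmodule_Dual] flen_rs_Dual fin_gen_iff_flen_rs d(1,2,4,5) by blast+
  have mD: "lmodule (opp L) (D P0)" "lmodule (opp L) (D P1)" using lmodule_Dual d(1,2) by auto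
  note c = op.cTr_iso[OF B(1) lmodule_Dual[OF A(1)] B(2) d(6) fg, simplified]
  show "lmodule (opp L) (cTr R \<phi> E (opp L) B)" by (rule c(1))
  note hD = op.hom_DL_simps[where M = "D P0", simplified]
  note Dg = Dmap_hom[OF d(2,1,3)]
  let ?F = "\<lambda>h\<in>carrier (star L P0). compose (carrier P1) h g"
  let ?F' = "\<lambda>h\<in>carrier (hom_DL R \<phi> E (opp L) (D P0)). compose (carrier DLr) (Dmap P1 P0 g) h"
  have F': "?F' \<in> hom_set (opp L) (hom_DL R \<phi> E (opp L) (D P0)) (hom_DL R \<phi> E (opp L) (D P1))"
    using op.hom_DL_map[OF mD Dg] by simp
  let ?A = "\<lambda>f\<in>carrier (star L P0). Dmap P0 (regular L) f"
  let ?B = "\<lambda>f\<in>carrier (star L P1). Dmap P1 (regular L) f"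
  have reg': "lmodule L (regular L)" by (rule lmodule_regular[OF L.ring_axioms])
  have comm: "?B (?F h) = ?F' (?A h)" if h: "h \<in> carrier (star L P0)" for h
  proof -
    have h': "h \<in> hom_set L P0 (regular L)" using h by (simp add: star_simps)
    note Dh = Dmap_hom[OF d(1) reg' h']
    have "?F h \<in> carrier (star L P1)" by (rule hom_closed[OF star_map[OF d(2,1,3)] h])
    moreover have "?A h \<in> carrier (hom_DL R \<phi> E (opp L) (D P0))"
      using Dh h by (simp add: hD)
    ultimately have e: "?B (?F h) = Dmap P1 (regular L) (compose (carrier P1) h g)"
      "?F' (?A h) = compose (carrier DLr) (Dmap P1 P0 g) (Dmap P0 (regular L) h)"
      using h by simp_all
    have hg: "compose (carrier P1) h g \<in> hom_set L P1 (regular L)"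
      by (rule hom_compose[OF d(2,3) h'])
    have "Dmap P1 (regular L) (compose (carrier P1) h g) =
        compose (carrier DLr) (Dmap P1 P0 g) (Dmap P0 (regular L) h)"
    proof (rule hom_ext[OF Dmap_hom[OF d(2) reg' hg] hom_compose[OF lmodule_DLr Dh Dg]])
      fix w assume w: "w \<in> carrier DLr"
      show "Dmap P1 (regular L) (compose (carrier P1) h g) w =
          compose (carrier DLr) (Dmap P1 P0 g) (Dmap P0 (regular L) h) w"
      proof (rule Dual_ext[of _ P1])
        show "Dmap P1 (regular L) (compose (carrier P1) h g) w \<in> carrier (D P1)"
          by (rule hom_closed[OF Dmap_hom[OF d(2) reg' hg] w])
        show "compose (carrier DLr) (Dmap P1 P0 g) (Dmap P0 (regular L) h) w \<in> carrier (D P1)"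
          by (rule hom_closed[OF hom_compose[OF lmodule_DLr Dh Dg] w])
        fix x assume x: "x \<in> carrier P1"
        then show "Dmap P1 (regular L) (compose (carrier P1) h g) w x =
            compose (carrier DLr) (Dmap P1 P0 g) (Dmap P0 (regular L) h) w x"
          using w hom_closed[OF Dh w] hom_closed[OF d(3) x] by (simp add: compose_def)
      qed
    qed
    then show ?thesis using e by simp
  qed
  have "mod_iso (opp L) (Tr L A) (coker (hom_DL R \<phi> E (opp L) (D P0)) (hom_DL R \<phi> E (opp L) (D P1)) ?F')"
    unfolding Tr
    by (rule coker_iso[where f = ?F and f' = ?F' and \<alpha> = ?A and \<beta> = ?B, OF lmodule_star[OF d(1)] lmodule_star[OF d(2)] op.lmodule_hom_DL[OF mD(1)]
          op.lmodule_hom_DL[OF mD(2)] star_map[OF d(2,1,3)] F' star_isom_hom_DL[OF d(1)]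
          star_isom_hom_DL[OF d(2)] comm])
  then show "mod_iso (opp L) (Tr L A) (cTr R \<phi> E (opp L) B)"
    using mod_iso_trans[OF fin_gen_Tr(1)[OF A]] c(2) by (simp add: coker_restrict)
qed

end

section \<open>Resolutions\<close>

lemma free_mod_projective: "ring R \<Longrightarrow> projective R (free_mod R n)"
proof -
  assume "ring R"
  then have F: "lmodule R (free_mod R n)" by (rule lmodule_free_mod)
  have "free_summand R (free_mod R n) n (\<lambda>x\<in>carrier (free_mod R n). x) (\<lambda>x\<in>carrier (free_mod R n). x)"
    unfolding free_summand_def using F hom_id[OF F] by (simp del: free_mod_simps)
  then show ?thesis by (rule free_summand_projective)
qed

text \<open>A submodule of a finitely generated free module has finite length, so it is again the
  image of a finitely generated free module.\<close>

lemma proj_resolution_exists: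
  fixes M :: "('a, 'm) module"
  assumes L: "flen L (regular L)" and M: "lmodule L M" "fin_gen L M"
  shows "\<exists>(P :: nat \<Rightarrow> ('a, nat \<Rightarrow> 'a) module) d e. proj_resolution L P d e M"
proof -
  interpret M: lmodule L M by fact
  let ?F = "free_mod L"
  have F: "lmodule L (?F n)" for n by (rule lmodule_free_mod[OF M.R.ring_axioms])
  obtain n0 e where e: "e \<in> hom_set L (?F n0) M" "e ` carrier (?F n0) = carrier M"
    by (rule fin_gen_free_cover[OF M])
  let ?K0 = "mker (?F n0) M e"
  have K0: "submodule ?K0 L (?F n0)" by (rule submodule_mker[OF F M(1) e(1)])
  \<comment> \<open>The state of the dependent choice is a pair: the rank of the current free module
    and the kernel in it that the next differential has to cover. The clause for index 0 fixes the
    start.\<close>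
  define p where "p = (\<lambda>i (x :: nat \<times> (nat \<Rightarrow> 'a) set). submodule (snd x) L (?F (fst x)) \<and>
    (i = (0::nat) \<longrightarrow> x = (n0, ?K0)))"
  define Q where "Q = (\<lambda>x y :: nat \<times> (nat \<Rightarrow> 'a) set. \<exists>q\<in>hom_set L (?F (fst y)) (?F (fst x)).
    q ` carrier (?F (fst y)) = snd x \<and> snd y = mker (?F (fst y)) (?F (fst x)) q)"
  have "\<exists>f. \<forall>i. p i (f i) \<and> Q (f i) (f (Suc i))"
  proof (rule dependent_nat_choice)
    show "\<exists>x. p 0 x" using K0 by (auto simp: p_def)
    fix x and i :: nat assume "p i x"
    then have K: "submodule (snd x) L (?F (fst x))" by (simp add: p_def)
    have mK: "lmodule L (submod (?F (fst x)) (snd x))" by (rule lmodule_submod[OF F K])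
    have "fin_gen L (submod (?F (fst x)) (snd x))"
      by (rule flen_fin_gen[OF mK flen_submod[OF F K flen_free_mod[OF M.R.ring_axioms L]]])
    then obtain n q where q: "q \<in> hom_set L (?F n) (submod (?F (fst x)) (snd x))"
      "q ` carrier (?F n) = carrier (submod (?F (fst x)) (snd x))"
      by (rule fin_gen_free_cover[OF mK])
    have q': "q \<in> hom_set L (?F n) (?F (fst x))" by (rule hom_from_submod[OF q(1) submodule_subset[OF K]])
    show "\<exists>y. p (Suc i) y \<and> Q x y"
      using q q' submodule_mker[OF F F q']
      by (intro exI[of _ "(n, mker (?F n) (?F (fst x)) q)"]) (auto simp: p_def Q_def)
  qed
  then obtain f where f: "\<And>i. p i (f i)" "\<And>i. Q (f i) (f (Suc i))" by blast
  have "\<exists>d. \<forall>i. d i \<in> hom_set L (?F (fst (f (Suc i)))) (?F (fst (f i))) \<and>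
      d i ` carrier (?F (fst (f (Suc i)))) = snd (f i) \<and>
      snd (f (Suc i)) = mker (?F (fst (f (Suc i)))) (?F (fst (f i))) (d i)"
    using f(2) unfolding Q_def by (intro choice) blast
  then obtain d where d: "\<And>i. d i \<in> hom_set L (?F (fst (f (Suc i)))) (?F (fst (f i)))"
    "\<And>i. d i ` carrier (?F (fst (f (Suc i)))) = snd (f i)"
    "\<And>i. snd (f (Suc i)) = mker (?F (fst (f (Suc i)))) (?F (fst (f i))) (d i)" by blast
  have f0: "f 0 = (n0, ?K0)" using f(1)[of 0] by (simp add: p_def)
  have "proj_resolution L (\<lambda>i. ?F (fst (f i))) d e M"
    unfolding proj_resolution_def
  proof (intro conjI allI)
    show "projective L (?F (fst (f i)))" for i by (rule free_mod_projective[OF M.R.ring_axioms])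
    show "e \<in> hom_set L (?F (fst (f 0))) M" "e ` carrier (?F (fst (f 0))) = carrier M"
      using e f0 by auto
    show "d i \<in> hom_set L (?F (fst (f (Suc i)))) (?F (fst (f i)))" for i by (rule d(1))
    show "d 0 ` carrier (?F (fst (f 1))) = mker (?F (fst (f 0))) M e" using d(2)[of 0] f0 by simp
    show "d (Suc i) ` carrier (?F (fst (f (Suc (Suc i))))) =
        mker (?F (fst (f (Suc i)))) (?F (fst (f i))) (d i)" for i
      using d(2)[of "Suc i"] d(3)[of i] by simp
  qed
  then show ?thesis by blast
qed

lemma some_resolution:
  assumes "flen L (regular L)" "lmodule L M" "fin_gen L M"
  obtains P d e where "some_resolution L M = (P, d, e)" "proj_resolution L P d e M"
proof -
  have ex: "\<exists>t. case t of (P :: nat \<Rightarrow> ('a, nat \<Rightarrow> 'a) module, d, e) \<Rightarrow> proj_resolution L P d e M"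
    using proj_resolution_exists[OF assms] by auto
  obtain P d e where t: "some_resolution L M = (P, d, e)" by (cases "some_resolution L M")
  have "proj_resolution L P d e M"
    using someI_ex[OF ex] unfolding some_resolution_def[symmetric] t by simp
  then show ?thesis using that t by blast
qed

text \<open>Lifting is done against \<open>q\<close> restricted to its image, so that
  \<open>f\<close> has to land only there. The injection \<open>c\<close> brings \<open>Z\<close>,
  whose type is arbitrary, among the test modules.\<close>

lemma proj_lift:
  fixes X P :: "('a, nat \<Rightarrow> 'a) module" and Z :: "('a, 'z) module" and c :: "'z \<Rightarrow> nat \<Rightarrow> 'a"
  assumes P: "projective R P" and X: "lmodule R X" and Z: "lmodule R Z" "inj_on c (carrier Z)"
    and q: "q \<in> hom_set R X Z" and f: "f \<in> hom_set R P Z" "f ` carrier P \<subseteq> q ` carrier X"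
  obtains g where "g \<in> hom_set R P X" "\<forall>x\<in>carrier P. q (g x) = f x"
proof -
  have mP: "lmodule R P" using P by (simp add: projective_def)
  let ?Z = "transport Z c"
  have mZ: "lmodule R ?Z" by (rule lmodule_transport[OF Z])
  have cz: "restrict c (carrier Z) \<in> hom_set R Z ?Z"
    by (rule mod_isom_hom[OF mod_isom_transport[OF Z]])
  let ?q = "compose (carrier X) (restrict c (carrier Z)) q"
  let ?f = "compose (carrier P) (restrict c (carrier Z)) f"
  have q': "?q \<in> hom_set R X ?Z" by (rule hom_compose[OF X q cz])
  have f': "?f \<in> hom_set R P ?Z" by (rule hom_compose[OF mP f(1) cz])
  let ?Y = "submod ?Z (?q ` carrier X)"
  have Y: "submodule (?q ` carrier X) R ?Z"
    by (rule submodule_image[OF X mZ q' lmodule.submodule_carrier[OF X]])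
  have sub: "?f ` carrier P \<subseteq> ?q ` carrier X"
  proof
    fix y assume "y \<in> ?f ` carrier P"
    then obtain x where x: "x \<in> carrier P" "y = ?f x" by blast
    obtain z where z: "z \<in> carrier X" "f x = q z" using f(2) x(1) by blast
    then have "y = ?q z" using x by (simp add: compose_def)
    then show "y \<in> ?q ` carrier X" using z(1) by blast
  qed
  have "\<exists>g\<in>hom_set R P X. \<forall>x\<in>carrier P. ?q (g x) = ?f x"
    using P[unfolded projective_def, THEN conjunct2, rule_format, OF X lmodule_submod[OF mZ Y]
        hom_to_submod[OF q' order.refl] _ hom_to_submod[OF f' sub]] by simp
  then obtain g where g: "g \<in> hom_set R P X" "\<forall>x\<in>carrier P. ?q (g x) = ?f x" by blast
  have "q (g x) = f x" if x: "x \<in> carrier P" for x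
  proof -
    have "c (q (g x)) = c (f x)"
      using bspec[OF g(2) x] x hom_closed[OF g(1) x] hom_closed[OF f(1) x] hom_closed[OF q hom_closed[OF g(1) x]]
      by (simp add: compose_def)
    then show ?thesis
      using inj_onD[OF Z(2)] hom_closed[OF f(1) x] hom_closed[OF q hom_closed[OF g(1) x]] by blast
  qed
  then show ?thesis using that g(1) by blast
qed

lemma hom_diff_mem:
  assumes "lmodule R M" "lmodule R N" "f \<in> hom_set R M N" "g \<in> hom_set R M N"
  shows "(\<lambda>x\<in>carrier M. f x \<ominus>\<^bsub>N\<^esub> g x) \<in> hom_set R M N"
proof -
  interpret M: lmodule R M by fact
  interpret N: lmodule R N by fact
  note fc = hom_closed[OF assms(3)] and gc = hom_closed[OF assms(4)]
  show ?thesis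
  proof (rule hom_restrictI[OF assms(1)])
    fix x y assume "x \<in> carrier M" "y \<in> carrier M"
    then show "f (x \<oplus>\<^bsub>M\<^esub> y) \<ominus>\<^bsub>N\<^esub> g (x \<oplus>\<^bsub>M\<^esub> y) = (f x \<ominus>\<^bsub>N\<^esub> g x) \<oplus>\<^bsub>N\<^esub> (f y \<ominus>\<^bsub>N\<^esub> g y)"
      using fc gc hom_add[OF assms(3)] hom_add[OF assms(4)]
      by (simp add: a_minus_def N.M.minus_add N.M.a_ac)
  next
    fix r x assume r: "r \<in> carrier R" and x: "x \<in> carrier M"
    have "r \<odot>\<^bsub>N\<^esub> (\<ominus>\<^bsub>N\<^esub> g x) = \<ominus>\<^bsub>N\<^esub> (r \<odot>\<^bsub>N\<^esub> g x)"
      using hom_minus[OF assms(1,2,4), of "r \<odot>\<^bsub>M\<^esub> x"] hom_smult[OF assms(4) r, of "\<ominus>\<^bsub>M\<^esub> x"]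
        hom_smult[OF assms(4) r x] hom_minus[OF assms(1,2,4) x] r x
      by (metis M.M.a_inv_closed M.M.minus_equality M.M.r_neg M.smult_closed M.smult_r_distr
          M.smult_zero_right M.M.a_comm)
    then show "f (r \<odot>\<^bsub>M\<^esub> x) \<ominus>\<^bsub>N\<^esub> g (r \<odot>\<^bsub>M\<^esub> x) = r \<odot>\<^bsub>N\<^esub> (f x \<ominus>\<^bsub>N\<^esub> g x)"
      using r x fc gc hom_smult[OF assms(3) r x] hom_smult[OF assms(4) r x]
      by (simp add: a_minus_def N.smult_r_distr)
  qed (use fc gc in auto)
qed

section \<open>Comparison of projective resolutions\<close>

context
  fixes R :: "'a ring" and P :: "nat \<Rightarrow> ('a, nat \<Rightarrow> 'a) module" and d e and M :: "('a, 'm) module"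
  assumes res: "proj_resolution R P d e M"
begin

lemma res_projective: "projective R (P i)"
  and res_module: "lmodule R (P i)"
  and res_e: "e \<in> hom_set R (P 0) M" "e ` carrier (P 0) = carrier M"
  and res_d: "d i \<in> hom_set R (P (Suc i)) (P i)"
  and res_exact0: "d 0 ` carrier (P 1) = mker (P 0) M e"
  and res_exact: "d (Suc i) ` carrier (P (Suc (Suc i))) = mker (P (Suc i)) (P i) (d i)"
  using res by (auto simp: proj_resolution_def projective_def)

lemma res_dd: "x \<in> carrier (P (Suc (Suc i))) \<Longrightarrow> d i (d (Suc i) x) = \<zero>\<^bsub>P i\<^esub>"
  using res_exact[of i] by (auto simp: mker_def)

lemma res_ed: "x \<in> carrier (P (Suc 0)) \<Longrightarrow> e (d 0 x) = \<zero>\<^bsub>M\<^esub>"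
  using res_exact0 by (auto simp: mker_def)

end

lemma res_lift_next:
  fixes P' :: "nat \<Rightarrow> ('a, nat \<Rightarrow> 'a) module" and Q :: "('a, nat \<Rightarrow> 'a) module"
  assumes P': "proj_resolution R P' d' e' M'" and Q: "projective R Q"
    and f: "f \<in> hom_set R Q (P' (Suc i))" "\<forall>x\<in>carrier Q. d' i (f x) = \<zero>\<^bsub>P' i\<^esub>"
  obtains g where "g \<in> hom_set R Q (P' (Suc (Suc i)))" "\<forall>x\<in>carrier Q. d' (Suc i) (g x) = f x"
proof -
  have sub: "f ` carrier Q \<subseteq> d' (Suc i) ` carrier (P' (Suc (Suc i)))"
    using f hom_closed[OF f(1)] by (auto simp: res_exact[OF P'] mker_def)
  show ?thesis
    using proj_lift[where c = id, OF Q res_module[OF P'] res_module[OF P'] _ res_d[OF P'] f(1) sub] that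
    by (metis inj_on_id)
qed

text \<open>The comparison theorem. Finite generation of \<open>M'\<close> supplies the injection
  that \<open>proj_lift\<close> asks for at the augmentation; in higher degrees all modules already
  have the type of test modules.\<close>

lemma res_chain_map:
  fixes P P' :: "nat \<Rightarrow> ('a, nat \<Rightarrow> 'a) module" and M' :: "('a, 'm) module"
  assumes P: "proj_resolution R P d e M" and P': "proj_resolution R P' d' e' M'"
    and M: "lmodule R M" "lmodule R M'" "fin_gen R M'" and \<theta>: "\<theta> \<in> hom_set R M M'"
  obtains u where "\<And>i. u i \<in> hom_set R (P i) (P' i)" "\<forall>x\<in>carrier (P 0). e' (u 0 x) = \<theta> (e x)"
    "\<And>i. \<forall>x\<in>carrier (P (Suc i)). d' i (u (Suc i) x) = u i (d i x)"
proof -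
  note m = res_module[OF P] and m' = res_module[OF P']
  obtain c :: "'m \<Rightarrow> nat \<Rightarrow> 'a" where c: "inj_on c (carrier M')" by (rule fin_gen_inj_into[OF M(2,3)])
  have "compose (carrier (P 0)) \<theta> e \<in> hom_set R (P 0) M'"
    by (rule hom_compose[OF m res_e(1)[OF P] \<theta>])
  moreover have "compose (carrier (P 0)) \<theta> e ` carrier (P 0) \<subseteq> e' ` carrier (P' 0)"
    using hom_closed[OF \<theta>] hom_closed[OF res_e(1)[OF P]]
    by (auto simp: res_e(2)[OF P'] compose_def)
  ultimately obtain u0 where u0: "u0 \<in> hom_set R (P 0) (P' 0)"
    "\<forall>x\<in>carrier (P 0). e' (u0 x) = compose (carrier (P 0)) \<theta> e x"
    by (rule proj_lift[OF res_projective[OF P] m' M(2) c res_e(1)[OF P']])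
  \<comment> \<open>Besides being a map, \<open>u\<close> must send boundaries to cycles, since this
    lets the next lift exist. In degree 0 the augmentation plays the role of the previous
    differential; \<open>i - 1\<close> is read for positive \<open>i\<close> only.\<close>
  define p where "p = (\<lambda>i u. u \<in> hom_set R (P i) (P' i) \<and> (i = 0 \<longrightarrow> u = u0) \<and>
    (\<forall>x\<in>carrier (P (Suc i)). (if i = 0 then e' (u (d i x)) = \<zero>\<^bsub>M'\<^esub> else d' (i - 1) (u (d i x)) = \<zero>\<^bsub>P' (i - 1)\<^esub>)))"
  have "\<exists>f. \<forall>i. p i (f i) \<and> (\<forall>x\<in>carrier (P (Suc i)). d' i (f (Suc i) x) = f i (d i x))"
  proof (rule dependent_nat_choice)
    show "\<exists>u. p 0 u"
      using u0 hom_closed[OF res_d[OF P], of _ 0] res_ed[OF P] hom_zero[OF M(1,2) \<theta>]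
      by (intro exI[of _ u0]) (simp add: p_def compose_def)
    fix u and i :: nat assume pu: "p i u"
    then have u: "u \<in> hom_set R (P i) (P' i)" by (simp add: p_def)
    let ?f = "compose (carrier (P (Suc i))) u (d i)"
    have f: "?f \<in> hom_set R (P (Suc i)) (P' i)" by (rule hom_compose[OF m res_d[OF P] u])
    have "\<exists>g\<in>hom_set R (P (Suc i)) (P' (Suc i)). \<forall>x\<in>carrier (P (Suc i)). d' i (g x) = ?f x"
    proof (cases i)
      case 0
      have "?f ` carrier (P (Suc i)) \<subseteq> d' i ` carrier (P' (Suc i))"
        using pu 0 hom_closed[OF f] res_exact0[OF P'] by (auto simp: p_def mker_def compose_def)
      then show ?thesis
        using proj_lift[where c = id, OF res_projective[OF P] m' m' _ res_d[OF P'] f] by (metis inj_on_id)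
    next
      case (Suc k)
      have z: "\<forall>x\<in>carrier (P (Suc i)). d' k (?f x) = \<zero>\<^bsub>P' k\<^esub>"
        using pu Suc by (simp add: p_def compose_def)
      have f': "?f \<in> hom_set R (P (Suc i)) (P' (Suc k))" using f Suc by simp
      from res_lift_next[OF P' res_projective[OF P] f' z] Suc show ?thesis by metis
    qed
    then obtain g where g: "g \<in> hom_set R (P (Suc i)) (P' (Suc i))"
      "\<forall>x\<in>carrier (P (Suc i)). d' i (g x) = ?f x" by blast
    have "p (Suc i) g"
      using g res_dd[OF P] hom_closed[OF res_d[OF P], of _ "Suc i"] hom_zero[OF m m' u]
      by (simp add: p_def compose_def)
    then show "\<exists>y. p (Suc i) y \<and> (\<forall>x\<in>carrier (P (Suc i)). d' i (y x) = u (d i x))"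
      using g(2) by (auto simp: compose_def)
  qed
  then obtain u where u: "\<And>i. p i (u i)" "\<And>i. \<forall>x\<in>carrier (P (Suc i)). d' i (u (Suc i) x) = u i (d i x)"
    by blast
  have "\<forall>x\<in>carrier (P 0). e' (u 0 x) = \<theta> (e x)"
    using u(1)[of 0] u0(2) by (simp add: p_def compose_def)
  then show ?thesis using that[of u] u by (simp add: p_def)
qed

text \<open>A null-homotopy \<open>s\<close> satisfies \<open>d s d = w d\<close>, and this identity suffices to construct its next term.\<close>

lemma res_homotopy:
  fixes P :: "nat \<Rightarrow> ('a, nat \<Rightarrow> 'a) module" and M :: "('a, 'm) module"
  assumes P: "proj_resolution R P d e M" and M: "lmodule R M" "fin_gen R M"
    and w: "\<And>i. w i \<in> hom_set R (P i) (P i)" "\<forall>x\<in>carrier (P 0). e (w 0 x) = \<zero>\<^bsub>M\<^esub>"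
      "\<And>i. \<forall>x\<in>carrier (P (Suc i)). d i (w (Suc i) x) = w i (d i x)"
  shows "\<exists>s\<in>hom_set R (P j) (P (Suc j)). \<forall>x\<in>carrier (P (Suc j)). d j (s (d j x)) = w j (d j x)"
proof (induction j)
  note m = res_module[OF P]
  case 0
  have "w 0 ` carrier (P 0) \<subseteq> d 0 ` carrier (P (Suc 0))"
    using w(2) hom_closed[OF w(1)] res_exact0[OF P] by (auto simp: mker_def)
  then obtain s where s: "s \<in> hom_set R (P 0) (P (Suc 0))" "\<forall>x\<in>carrier (P 0). d 0 (s x) = w 0 x"
    using proj_lift[where c = id, OF res_projective[OF P] m m _ res_d[OF P] w(1)] by (metis inj_on_id)
  then show ?case using hom_closed[OF res_d[OF P], of _ 0] by auto
next
  note m = res_module[OF P]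
  case (Suc j)
  then obtain s where s: "s \<in> hom_set R (P j) (P (Suc j))"
    "\<forall>x\<in>carrier (P (Suc j)). d j (s (d j x)) = w j (d j x)" by blast
  let ?P = "P (Suc j)"
  interpret P1: lmodule R ?P by (rule m)
  interpret P0: lmodule R "P j" by (rule m)
  have sd: "compose (carrier ?P) s (d j) \<in> hom_set R ?P ?P" by (rule hom_compose[OF m res_d[OF P] s(1)])
  \<comment> \<open>This difference is killed by \<open>d j\<close>, so it lifts along
    \<open>d (Suc j)\<close>. On boundaries the subtracted term vanishes, since two successive
    differentials compose to zero, and the identity holds one degree higher.\<close>
  let ?f = "\<lambda>x\<in>carrier ?P. w (Suc j) x \<ominus>\<^bsub>?P\<^esub> compose (carrier ?P) s (d j) x"
  have f: "?f \<in> hom_set R ?P ?P" by (rule hom_diff_mem[OF m m w(1) sd])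
  have "d j (?f x) = \<zero>\<^bsub>P j\<^esub>" if x: "x \<in> carrier ?P" for x
  proof -
    have "d j (?f x) = d j (w (Suc j) x) \<ominus>\<^bsub>P j\<^esub> d j (s (d j x))"
      using hom_diff[OF m m res_d[OF P] hom_closed[OF w(1) x] hom_closed[OF sd x]] x
      by (simp add: compose_def)
    also have "\<dots> = \<zero>\<^bsub>P j\<^esub>"
      using w(3)[of j] s(2) x hom_closed[OF w(1) hom_closed[OF res_d[OF P] x]]
      by (simp add: P0.M.diff_eq_zero_iff)
    finally show ?thesis .
  qed
  then obtain t where t: "t \<in> hom_set R ?P (P (Suc (Suc j)))" "\<forall>x\<in>carrier ?P. d (Suc j) (t x) = ?f x"
    using res_lift_next[OF P res_projective[OF P] f] by blast
  have "d (Suc j) (t (d (Suc j) x)) = w (Suc j) (d (Suc j) x)" if x: "x \<in> carrier (P (Suc (Suc j)))" for x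
  proof -
    have dx: "d (Suc j) x \<in> carrier ?P" by (rule hom_closed[OF res_d[OF P] x])
    show ?thesis
      using t(2) dx res_dd[OF P x] hom_zero[OF m m s(1)] hom_closed[OF w(1) dx]
      by (simp add: compose_def a_minus_def P1.minus_eq_smult)
  qed
  then show ?case using t(1) by blast
qed

text \<open>The vanishing of \<open>Ext\<^sup>j\<^sup>+\<^sup>1(M, N)\<close> computed from the complex \<open>(P, d)\<close>.\<close>

definition ext_exact ::
    "'a ring \<Rightarrow> (nat \<Rightarrow> ('a, 'p) module) \<Rightarrow> (nat \<Rightarrow> 'p \<Rightarrow> 'p) \<Rightarrow> ('a, 'n) module \<Rightarrow> nat \<Rightarrow> bool" where
  "ext_exact R P d N j \<longleftrightarrow> (\<forall>h\<in>hom_set R (P (Suc j)) N.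
     (\<forall>x\<in>carrier (P (Suc (Suc j))). h (d (Suc j) x) = \<zero>\<^bsub>N\<^esub>) \<longrightarrow>
     (\<exists>k\<in>hom_set R (P j) N. \<forall>x\<in>carrier (P (Suc j)). h x = k (d j x)))"

text \<open>A cocycle \<open>h\<close> is pulled back along \<open>v\<close>, solved on the second
  resolution by \<open>k\<close>, and the solution is pulled back along \<open>u\<close>. The round
  trip differs from the identity by \<open>w\<close>, and a homotopy for \<open>w\<close> corrects
  the solution.\<close>

lemma ext_exact_transfer:
  fixes P P' :: "nat \<Rightarrow> ('a, nat \<Rightarrow> 'a) module"
  assumes P: "proj_resolution R P d e M" and P': "proj_resolution R P' d' e' M'"
    and M: "lmodule R M" "fin_gen R M" "lmodule R M'" "fin_gen R M'" and \<theta>: "mod_isom R M M' \<theta>"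
    and N: "lmodule R N" and ex: "ext_exact R P' d' N j"
  shows "ext_exact R P d N j"
  unfolding ext_exact_def
proof (intro ballI impI)
  fix h assume h: "h \<in> hom_set R (P (Suc j)) N" and hd: "\<forall>x\<in>carrier (P (Suc (Suc j))). h (d (Suc j) x) = \<zero>\<^bsub>N\<^esub>"
  interpret N: lmodule R N by fact
  interpret M: lmodule R M by fact
  note m = res_module[OF P] and m' = res_module[OF P']
  obtain \<theta>' where \<theta>': "mod_isom R M' M \<theta>'" "\<And>x. x \<in> carrier M \<Longrightarrow> \<theta>' (\<theta> x) = x"
    using mod_isom_inv[OF M(1,3) \<theta>] by metis
  obtain u where u: "\<And>i. u i \<in> hom_set R (P i) (P' i)" "\<forall>x\<in>carrier (P 0). e' (u 0 x) = \<theta> (e x)"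
    "\<And>i. \<forall>x\<in>carrier (P (Suc i)). d' i (u (Suc i) x) = u i (d i x)"
    using res_chain_map[OF P P' M(1,3,4) mod_isom_hom[OF \<theta>]] by metis
  obtain v where v: "\<And>i. v i \<in> hom_set R (P' i) (P i)" "\<forall>x\<in>carrier (P' 0). e (v 0 x) = \<theta>' (e' x)"
    "\<And>i. \<forall>x\<in>carrier (P' (Suc i)). d i (v (Suc i) x) = v i (d' i x)"
    using res_chain_map[OF P' P M(3,1,2) mod_isom_hom[OF \<theta>'(1)]] by metis
  \<comment> \<open>The round trip \<open>v u\<close> minus the identity, a chain map over the zero
    map of \<open>M\<close>.\<close>
  define w where "w = (\<lambda>i. \<lambda>x\<in>carrier (P i). compose (carrier (P i)) (v i) (u i) x \<ominus>\<^bsub>P i\<^esub> (\<lambda>x\<in>carrier (P i). x) x)"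
  have wx: "w i x = v i (u i x) \<ominus>\<^bsub>P i\<^esub> x" if "x \<in> carrier (P i)" for i x
    using that by (simp add: w_def compose_def)
  have uc: "u i x \<in> carrier (P' i)" and vc: "v i (u i x) \<in> carrier (P i)" if "x \<in> carrier (P i)" for i x
    using hom_closed[OF u(1) that] hom_closed[OF v(1)] by auto
  have w: "w i \<in> hom_set R (P i) (P i)" for i
    unfolding w_def by (rule hom_diff_mem[OF m m hom_compose[OF m u(1) v(1)] hom_id[OF m]])
  have w0: "\<forall>x\<in>carrier (P 0). e (w 0 x) = \<zero>\<^bsub>M\<^esub>"
  proof
    fix x assume x: "x \<in> carrier (P 0)"
    have ex: "e x \<in> carrier M" by (rule hom_closed[OF res_e(1)[OF P] x])
    have "e (w 0 x) = e (v 0 (u 0 x)) \<ominus>\<^bsub>M\<^esub> e x"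
      unfolding wx[OF x] by (rule hom_diff[OF m M(1) res_e(1)[OF P] vc[OF x] x])
    also have "e (v 0 (u 0 x)) = e x" using v(2) u(2) uc[OF x] x \<theta>'(2)[OF ex] by simp
    finally show "e (w 0 x) = \<zero>\<^bsub>M\<^esub>" using ex by (simp add: M.M.diff_eq_zero_iff)
  qed
  have wd: "\<forall>x\<in>carrier (P (Suc i)). d i (w (Suc i) x) = w i (d i x)" for i
  proof
    fix x assume x: "x \<in> carrier (P (Suc i))"
    have dx: "d i x \<in> carrier (P i)" by (rule hom_closed[OF res_d[OF P] x])
    have "d i (w (Suc i) x) = d i (v (Suc i) (u (Suc i) x)) \<ominus>\<^bsub>P i\<^esub> d i x"
      unfolding wx[OF x] by (rule hom_diff[OF m m res_d[OF P] vc[OF x] x])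
    also have "d i (v (Suc i) (u (Suc i) x)) = v i (u i (d i x))"
      using v(3)[of i] u(3)[of i] uc[OF x] x by simp
    finally show "d i (w (Suc i) x) = w i (d i x)" using wx[OF dx] by simp
  qed
  obtain s where s: "s \<in> hom_set R (P j) (P (Suc j))"
    "\<forall>x\<in>carrier (P (Suc j)). d j (s (d j x)) = w j (d j x)"
    using res_homotopy[OF P M(1,2) w w0 wd] by blast
  \<comment> \<open>\<open>w - s d\<close> takes values in the kernel of \<open>d j\<close>, which
    consists of boundaries and is therefore killed by \<open>h\<close>. This is why a homotopy
    identity in the single degree \<open>j\<close> suffices.\<close>
  have hw: "h (w (Suc j) x) = h (s (d j x))" if x: "x \<in> carrier (P (Suc j))" for x
  proof -
    interpret Pj: lmodule R "P j" by (rule m)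
    interpret Pj1: lmodule R "P (Suc j)" by (rule m)
    have c: "w (Suc j) x \<in> carrier (P (Suc j))" "s (d j x) \<in> carrier (P (Suc j))"
      using hom_closed[OF w x] hom_closed[OF s(1) hom_closed[OF res_d[OF P] x]] by auto
    let ?y = "w (Suc j) x \<ominus>\<^bsub>P (Suc j)\<^esub> s (d j x)"
    have "d j ?y = \<zero>\<^bsub>P j\<^esub>"
      using hom_diff[OF m m res_d[OF P] c] wd[of j] s(2) x hom_closed[OF w hom_closed[OF res_d[OF P] x]]
      by (simp add: Pj.M.diff_eq_zero_iff)
    then have "?y \<in> d (Suc j) ` carrier (P (Suc (Suc j)))"
      using c by (simp add: res_exact[OF P] mker_def)
    then have "h ?y = \<zero>\<^bsub>N\<^esub>" using hd by auto
    then show ?thesis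
      using hom_diff[OF m N h c] hom_closed[OF h c(1)] hom_closed[OF h c(2)] by (simp add: N.M.diff_eq_zero_iff)
  qed
  let ?hv = "compose (carrier (P' (Suc j))) h (v (Suc j))"
  have hv: "?hv \<in> hom_set R (P' (Suc j)) N" by (rule hom_compose[OF m' v(1) h])
  have "\<forall>x\<in>carrier (P' (Suc (Suc j))). ?hv (d' (Suc j) x) = \<zero>\<^bsub>N\<^esub>"
    using v(3)[of "Suc j"] hd hom_closed[OF v(1)] hom_closed[OF res_d[OF P']]
    by (metis compose_eq)
  then obtain k where k: "k \<in> hom_set R (P' j) N" "\<forall>x\<in>carrier (P' (Suc j)). ?hv x = k (d' j x)"
    using ex hv unfolding ext_exact_def by blast
  \<comment> \<open>From \<open>h = h v u - h w\<close> and \<open>h w = h s d\<close> the solution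
    is read off as \<open>k u - h s\<close>.\<close>
  let ?k = "\<lambda>x\<in>carrier (P j). compose (carrier (P j)) k (u j) x \<ominus>\<^bsub>N\<^esub> compose (carrier (P j)) h s x"
  have k': "?k \<in> hom_set R (P j) N"
    by (rule hom_diff_mem[OF m N hom_compose[OF m u(1) k(1)] hom_compose[OF m s(1) h]])
  have "h x = ?k (d j x)" if x: "x \<in> carrier (P (Suc j))" for x
  proof -
    have dx: "d j x \<in> carrier (P j)" by (rule hom_closed[OF res_d[OF P] x])
    have c: "h x \<in> carrier N" "h (v (Suc j) (u (Suc j) x)) \<in> carrier N"
      using hom_closed[OF h x] hom_closed[OF h vc[OF x]] by auto
    have "h (w (Suc j) x) = h (v (Suc j) (u (Suc j) x)) \<ominus>\<^bsub>N\<^esub> h x"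
      unfolding wx[OF x] by (rule hom_diff[OF m N h vc[OF x] x])
    then have "h x = h (v (Suc j) (u (Suc j) x)) \<ominus>\<^bsub>N\<^esub> h (w (Suc j) x)"
      using c by (simp add: a_minus_def N.M.minus_add N.M.r_neg2)
    also have "h (v (Suc j) (u (Suc j) x)) = k (u j (d j x))"
      using k(2) uc[OF x] u(3)[of j] x by (metis compose_eq)
    also have "h (w (Suc j) x) = h (s (d j x))" by (rule hw[OF x])
    finally show ?thesis using dx by (simp add: compose_def)
  qed
  then show "\<exists>k\<in>hom_set R (P j) N. \<forall>x\<in>carrier (P (Suc j)). h x = k (d j x)" using k' by blast
qed

section \<open>Homology groups and tensor products\<close>

text \<open>Commutativity makes the boundaries normal in the cycles, so the homology is a group, and
  it is trivial exactly when each coset of a cycle is the set of boundaries.\<close>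

lemma trivial_homology_iff:
  assumes A: "group A" and B: "comm_group B" and C: "group C" and f: "f \<in> hom A B" and g: "g \<in> hom B C"
    and gf: "\<And>x. x \<in> carrier A \<Longrightarrow> g (f x) = \<one>\<^bsub>C\<^esub>"
  shows "trivial_group (homology_at A f B g C) \<longleftrightarrow> (\<forall>y\<in>carrier B. g y = \<one>\<^bsub>C\<^esub> \<longrightarrow> y \<in> f ` carrier A)"
proof -
  interpret B: comm_group B by fact
  interpret f: group_hom A B f using A f by (simp add: group_hom_def group_hom_axioms_def B.is_group)
  interpret g: group_hom B C g using C g by (simp add: group_hom_def group_hom_axioms_def B.is_group)
  let ?K = "kernel B C g" and ?I = "f ` carrier A"
  let ?Z = "B\<lparr>carrier := ?K\<rparr>"
  have K: "subgroup ?K B" by (rule g.subgroup_kernel)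
  have I: "subgroup ?I B" by (rule f.img_is_subgroup)
  have IK: "?I \<subseteq> ?K" using gf hom_closed f by (auto simp: kernel_def)
  interpret Z: group ?Z by (rule B.subgroup_imp_group[OF K])
  interpret Z: comm_group ?Z
    by (rule Z.group_comm_groupI) (use subgroup.subset[OF K] B.m_comm in auto)
  have IZ: "subgroup ?I ?Z" by (rule B.subgroup_incl[OF I K IK])
  interpret H: comm_group "?Z Mod ?I" by (rule Z.abelian_FactGroup[OF IZ])
  have "trivial_group (?Z Mod ?I) \<longleftrightarrow> carrier (?Z Mod ?I) \<subseteq> {?I}"
    unfolding H.trivial_group_subset by simp
  also have "\<dots> \<longleftrightarrow> (\<forall>y\<in>?K. ?I #>\<^bsub>?Z\<^esub> y = ?I)"
    by (auto simp: carrier_FactGroup)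
  also have "\<dots> \<longleftrightarrow> ?K \<subseteq> ?I"
    using Z.coset_join1[OF _ _ IZ] Z.coset_join2[OF _ IZ] by auto
  finally show ?thesis unfolding homology_at_def by (auto simp: kernel_def)
qed

section \<open>Tensor products as quotients of free abelian groups\<close>

locale tensor_prod =
  fixes \<Gamma> :: "'a ring" and W :: "('a, 'w) module" and N :: "('a, 'n) module"
  assumes W: "lmodule (opp \<Gamma>) W" and N: "lmodule \<Gamma> N"
begin

sublocale W: lmodule "opp \<Gamma>" W by (rule W)
sublocale N: lmodule \<Gamma> N by (rule N)

abbreviation G where "G \<equiv> free_Abelian_group (carrier W \<times> carrier N)"
abbreviation H where "H \<equiv> tensor_rel \<Gamma> W N"
abbreviation T where "T \<equiv> tensor \<Gamma> W N"

definition cls where "cls x = H #>\<^bsub>G\<^esub> x"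
definition pure where "pure w n = cls (frag_of (w, n))"

sublocale G: comm_group G by (rule abelian_free_Abelian_group)

definition relators :: "('w \<times> 'n \<Rightarrow>\<^sub>0 int) set" where
  "relators = {frag_of (m \<oplus>\<^bsub>W\<^esub> m', n) - frag_of (m, n) - frag_of (m', n) | m m' n.
         m \<in> carrier W \<and> m' \<in> carrier W \<and> n \<in> carrier N} \<union>
      {frag_of (m, n \<oplus>\<^bsub>N\<^esub> n') - frag_of (m, n) - frag_of (m, n') | m n n'.
         m \<in> carrier W \<and> n \<in> carrier N \<and> n' \<in> carrier N} \<union>
      {frag_of (r \<odot>\<^bsub>W\<^esub> m, n) - frag_of (m, r \<odot>\<^bsub>N\<^esub> n) | r m n.
         r \<in> carrier \<Gamma> \<and> m \<in> carrier W \<and> n \<in> carrier N}"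

lemma H_eq: "H = generate G relators"
  by (simp add: tensor_rel_def relators_def)

lemma keys_diff_subset: "\<lbrakk>Poly_Mapping.keys x \<subseteq> S; Poly_Mapping.keys y \<subseteq> S\<rbrakk> \<Longrightarrow> Poly_Mapping.keys (x - y) \<subseteq> S"
  using keys_diff[of x y] by blast

lemma frag_of_mem: "frag_of (w, n) \<in> carrier G \<longleftrightarrow> w \<in> carrier W \<and> n \<in> carrier N"
  by simp

lemma diff_mem: "\<lbrakk>x \<in> carrier G; y \<in> carrier G\<rbrakk> \<Longrightarrow> x - y \<in> carrier G"
  using keys_diff_subset by simp

lemma relators_subset: "relators \<subseteq> carrier G"
  unfolding relators_def
  by (auto simp del: carrier_free_Abelian_group_iff intro!: diff_mem simp: frag_of_mem W.smult_closed N.smult_closed)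

lemma subgroup_H: "subgroup H G"
  unfolding H_eq by (rule G.generate_is_subgroup[OF relators_subset])

sublocale H: normal H G
  using subgroup_H by (simp add: G.normal_iff_subgroup)

lemma comm_group_T: "comm_group T"
  unfolding tensor_def by (rule G.abelian_FactGroup[OF subgroup_H])

sublocale T: comm_group T by (rule comm_group_T)

lemma T_carrier: "carrier T = cls ` carrier G"
  by (simp add: tensor_def carrier_FactGroup cls_def)

lemma cls_hom: "cls \<in> hom G T"
  using H.r_coset_hom_Mod by (simp add: tensor_def cls_def[abs_def])

lemma cls_add: "\<lbrakk>x \<in> carrier G; y \<in> carrier G\<rbrakk> \<Longrightarrow> cls (x + y) = cls x \<otimes>\<^bsub>T\<^esub> cls y"
  using hom_mult[OF cls_hom] by simp

lemma cls_closed: "x \<in> carrier G \<Longrightarrow> cls x \<in> carrier T"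
  by (simp add: T_carrier del: carrier_free_Abelian_group_iff)

lemma cls_H: "x \<in> H \<Longrightarrow> cls x = \<one>\<^bsub>T\<^esub>"
  using G.coset_join2[OF _ subgroup_H] subgroup.subset[OF subgroup_H] by (auto simp: cls_def tensor_def)

lemma cls_eq:
  assumes "x \<in> carrier G" "y \<in> carrier G" "x - y \<in> H"
  shows "cls x = cls y"
proof -
  have "x - y \<in> carrier G" using diff_mem[OF assms(1,2)] .
  then show ?thesis
    using cls_add[of "x - y" y] cls_H[OF assms(3)] assms(2) cls_closed[OF assms(2)] by simp
qed

lemma relator_mem: "x \<in> relators \<Longrightarrow> x \<in> H"
  unfolding H_eq by (rule generate.incl)

lemma pure_closed [simp]: "\<lbrakk>w \<in> carrier W; n \<in> carrier N\<rbrakk> \<Longrightarrow> pure w n \<in> carrier T"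
  unfolding pure_def by (rule cls_closed) simp

lemma sum_mem: "\<lbrakk>x \<in> carrier G; y \<in> carrier G\<rbrakk> \<Longrightarrow> x + y \<in> carrier G"
  using G.m_closed[of x y] by simp

lemma pure_add_left:
  assumes "w \<in> carrier W" "w' \<in> carrier W" "n \<in> carrier N"
  shows "pure (w \<oplus>\<^bsub>W\<^esub> w') n = pure w n \<otimes>\<^bsub>T\<^esub> pure w' n"
proof -
  have m: "frag_of (w, n) \<in> carrier G" "frag_of (w', n) \<in> carrier G" "frag_of (w \<oplus>\<^bsub>W\<^esub> w', n) \<in> carrier G"
    using assms by auto
  have "frag_of (w \<oplus>\<^bsub>W\<^esub> w', n) - (frag_of (w, n) + frag_of (w', n)) \<in> H"
    using assms by (intro relator_mem) (auto simp: relators_def diff_diff_eq)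
  then have "cls (frag_of (w \<oplus>\<^bsub>W\<^esub> w', n)) = cls (frag_of (w, n) + frag_of (w', n))"
    by (rule cls_eq[OF m(3) sum_mem[OF m(1,2)]])
  then show ?thesis unfolding pure_def cls_add[OF m(1,2)] .
qed

lemma pure_add_right:
  assumes "w \<in> carrier W" "n \<in> carrier N" "n' \<in> carrier N"
  shows "pure w (n \<oplus>\<^bsub>N\<^esub> n') = pure w n \<otimes>\<^bsub>T\<^esub> pure w n'"
proof -
  have m: "frag_of (w, n) \<in> carrier G" "frag_of (w, n') \<in> carrier G" "frag_of (w, n \<oplus>\<^bsub>N\<^esub> n') \<in> carrier G"
    using assms by auto
  have "frag_of (w, n \<oplus>\<^bsub>N\<^esub> n') - (frag_of (w, n) + frag_of (w, n')) \<in> H"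
    using assms by (intro relator_mem) (auto simp: relators_def diff_diff_eq)
  then have "cls (frag_of (w, n \<oplus>\<^bsub>N\<^esub> n')) = cls (frag_of (w, n) + frag_of (w, n'))"
    by (rule cls_eq[OF m(3) sum_mem[OF m(1,2)]])
  then show ?thesis unfolding pure_def cls_add[OF m(1,2)] .
qed

lemma pure_balanced:
  assumes "r \<in> carrier \<Gamma>" "w \<in> carrier W" "n \<in> carrier N"
  shows "pure (r \<odot>\<^bsub>W\<^esub> w) n = pure w (r \<odot>\<^bsub>N\<^esub> n)"
  unfolding pure_def
proof (rule cls_eq)
  show "frag_of (r \<odot>\<^bsub>W\<^esub> w, n) - frag_of (w, r \<odot>\<^bsub>N\<^esub> n) \<in> H"
    using assms by (intro relator_mem) (auto simp: relators_def)
qed (use assms W.smult_closed N.smult_closed in auto)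

lemma pure_zero_right: "w \<in> carrier W \<Longrightarrow> pure w \<zero>\<^bsub>N\<^esub> = \<one>\<^bsub>T\<^esub>"
  using pure_add_right[of w "\<zero>\<^bsub>N\<^esub>" "\<zero>\<^bsub>N\<^esub>"] by (simp add: T.r_cancel_one')

text \<open>Pure tensors generate the group. Linearity and naturality identities below are reduced
  to them by this rule.\<close>

lemma hom_eqI:
  assumes C: "group C" and t: "t \<in> hom T C" "t' \<in> hom T C"
    and eq: "\<And>w n. \<lbrakk>w \<in> carrier W; n \<in> carrier N\<rbrakk> \<Longrightarrow> t (pure w n) = t' (pure w n)"
    and X: "X \<in> carrier T"
  shows "t X = t' X"
proof -
  interpret C: group C by fact
  interpret t: group_hom T C t using t by (simp add: group_hom_def group_hom_axioms_def T.is_group C)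
  interpret t': group_hom T C t' using t by (simp add: group_hom_def group_hom_axioms_def T.is_group C)
  interpret c: group_hom G T cls
    using cls_hom by (simp add: group_hom_def group_hom_axioms_def T.is_group)
  obtain x where x: "x \<in> carrier G" "X = cls x" using X T_carrier by blast
  have "t (cls x) = t' (cls x)"
  proof (rule free_Abelian_group_induct[of x "carrier W \<times> carrier N"])
    show "Poly_Mapping.keys x \<subseteq> carrier W \<times> carrier N" using x(1) by simp
    have "cls 0 = \<one>\<^bsub>T\<^esub>" using c.hom_one by simp
    then show "t (cls 0) = t' (cls 0)" by simp
    show "t (cls (frag_of a)) = t' (cls (frag_of a))" if "a \<in> carrier W \<times> carrier N" for a
      using that eq by (auto simp: pure_def)
    fix a b assume k: "Poly_Mapping.keys a \<subseteq> carrier W \<times> carrier N" "Poly_Mapping.keys b \<subseteq> carrier W \<times> carrier N"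
      and ab: "t (cls a) = t' (cls a)" "t (cls b) = t' (cls b)"
    have "a - b = a \<otimes>\<^bsub>G\<^esub> inv\<^bsub>G\<^esub> b" using k by simp
    then have "cls (a - b) = cls a \<otimes>\<^bsub>T\<^esub> inv\<^bsub>T\<^esub> cls b"
      using c.hom_mult[of a "inv\<^bsub>G\<^esub> b"] c.hom_inv[of b] k G.inv_closed[of b] by simp
    then show "t (cls (a - b)) = t' (cls (a - b))"
      using ab k cls_closed[of a] cls_closed[of b] by simp
  qed
  then show ?thesis using x(2) by simp
qed

text \<open>The map that \<open>b\<close> defines on the free abelian group kills each of the three
  kinds of relators, so it factors through the quotient.\<close>

lemma universal:
  assumes C: "comm_group C" and b: "\<And>w n. \<lbrakk>w \<in> carrier W; n \<in> carrier N\<rbrakk> \<Longrightarrow> b w n \<in> carrier C"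
    and left: "\<And>w w' n. \<lbrakk>w \<in> carrier W; w' \<in> carrier W; n \<in> carrier N\<rbrakk> \<Longrightarrow> b (w \<oplus>\<^bsub>W\<^esub> w') n = b w n \<otimes>\<^bsub>C\<^esub> b w' n"
    and right: "\<And>w n n'. \<lbrakk>w \<in> carrier W; n \<in> carrier N; n' \<in> carrier N\<rbrakk> \<Longrightarrow> b w (n \<oplus>\<^bsub>N\<^esub> n') = b w n \<otimes>\<^bsub>C\<^esub> b w n'"
    and bal: "\<And>r w n. \<lbrakk>r \<in> carrier \<Gamma>; w \<in> carrier W; n \<in> carrier N\<rbrakk> \<Longrightarrow> b (r \<odot>\<^bsub>W\<^esub> w) n = b w (r \<odot>\<^bsub>N\<^esub> n)"
  obtains t where "t \<in> hom T C" "\<forall>w\<in>carrier W. \<forall>n\<in>carrier N. t (pure w n) = b w n"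
proof -
  interpret C: comm_group C by fact
  have "(\<lambda>(w, n). b w n) ` (carrier W \<times> carrier N) \<subseteq> carrier C" using b by auto
  then obtain h where h: "h \<in> hom G C" "\<And>x. x \<in> carrier W \<times> carrier N \<Longrightarrow> h (frag_of x) = (\<lambda>(w, n). b w n) x"
    by (rule C.free_Abelian_group_universal) blast
  interpret h: group_hom G C h using h(1) by (simp add: group_hom_def group_hom_axioms_def)
  have hd: "h (x - y) = h x \<otimes>\<^bsub>C\<^esub> inv\<^bsub>C\<^esub> h y" if "x \<in> carrier G" "y \<in> carrier G" for x y
  proof -
    have "x - y = x \<otimes>\<^bsub>G\<^esub> inv\<^bsub>G\<^esub> y" using that by simp
    then show ?thesis
      using h.hom_mult[OF that(1) G.inv_closed[OF that(2)]] h.hom_inv[OF that(2)] by (simp only:)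
  qed
  have hf: "h (frag_of (w, n)) = b w n" if "w \<in> carrier W" "n \<in> carrier N" for w n
    using h(2) that by simp
  have "x \<in> kernel G C h" if x: "x \<in> relators" for x
  proof -
    have xG: "x \<in> carrier G" using x relators_subset by blast
    consider (1) m m' n where "x = frag_of (m \<oplus>\<^bsub>W\<^esub> m', n) - frag_of (m, n) - frag_of (m', n)"
        "m \<in> carrier W" "m' \<in> carrier W" "n \<in> carrier N"
      | (2) m n n' where "x = frag_of (m, n \<oplus>\<^bsub>N\<^esub> n') - frag_of (m, n) - frag_of (m, n')"
        "m \<in> carrier W" "n \<in> carrier N" "n' \<in> carrier N"
      | (3) r m n where "x = frag_of (r \<odot>\<^bsub>W\<^esub> m, n) - frag_of (m, r \<odot>\<^bsub>N\<^esub> n)"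
        "r \<in> carrier \<Gamma>" "m \<in> carrier W" "n \<in> carrier N"
      using x unfolding relators_def by blast
    then have "h x = \<one>\<^bsub>C\<^esub>"
    proof cases
      case 1
      have m: "frag_of (m, n) \<in> carrier G" "frag_of (m', n) \<in> carrier G" "frag_of (m \<oplus>\<^bsub>W\<^esub> m', n) \<in> carrier G"
        using 1 by auto
      show ?thesis
        using 1(2-4) b hd[OF diff_mem[OF m(3,1)] m(2)] hd[OF m(3,1)]
        by (simp add: hf left 1(1) C.m_ac C.m_assoc[symmetric])
    next
      case 2
      have m: "frag_of (m, n) \<in> carrier G" "frag_of (m, n') \<in> carrier G" "frag_of (m, n \<oplus>\<^bsub>N\<^esub> n') \<in> carrier G"
        using 2 by auto
      show ?thesis
        using 2(2-4) b hd[OF diff_mem[OF m(3,1)] m(2)] hd[OF m(3,1)]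
        by (simp add: hf right 2(1) C.m_ac C.m_assoc[symmetric])
    next
      case 3
      have m: "frag_of (r \<odot>\<^bsub>W\<^esub> m, n) \<in> carrier G" "frag_of (m, r \<odot>\<^bsub>N\<^esub> n) \<in> carrier G"
        using 3 W.smult_closed N.smult_closed by auto
      show ?thesis
        using 3(2-4) b hd[OF m] W.smult_closed[of r m] N.smult_closed[of r n]
        by (simp add: hf bal 3(1))
    qed
    then show ?thesis using xG by (simp add: kernel_def)
  qed
  then have "H \<subseteq> kernel G C h"
    unfolding H_eq by (intro G.generate_subgroup_incl[OF _ h.subgroup_kernel]) blast
  then obtain t where "t \<in> hom (G Mod H) C" "\<And>x. x \<in> carrier G \<Longrightarrow> t (H #>\<^bsub>G\<^esub> x) = h x"
    by (rule h.FactGroup_universal_kernel[OF H.normal_axioms]) blast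
  then show ?thesis using that[of t] hf by (simp add: tensor_def pure_def cls_def)
qed

end

locale tensor_hom = A: tensor_prod \<Gamma> W N + B: tensor_prod \<Gamma> W N'
  for \<Gamma> :: "'a ring" and W :: "('a, 'w) module" and N :: "('a, 'n) module" and N' :: "('a, 'k) module" +
  fixes f assumes f: "f \<in> hom_set \<Gamma> N N'"
begin

abbreviation F where "F \<equiv> frag_extend (\<lambda>(m, n). frag_of (m, f n))"

lemma F_closed: "x \<in> carrier A.G \<Longrightarrow> F x \<in> carrier B.G"
proof -
  assume "x \<in> carrier A.G"
  then have "Poly_Mapping.keys x \<subseteq> carrier W \<times> carrier N" by simp
  then have "F x \<in> carrier B.G"
  proof (rule free_Abelian_group_induct)
    show "F 0 \<in> carrier B.G" by simp
    show "F (frag_of a) \<in> carrier B.G" if "a \<in> carrier W \<times> carrier N" for a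
      using that hom_closed[OF f] by auto
    show "F (x - y) \<in> carrier B.G" if "F x \<in> carrier B.G" "F y \<in> carrier B.G" for x y
      unfolding frag_extend_diff by (rule B.diff_mem[OF that])
  qed
  then show ?thesis .
qed

lemma F_hom: "F \<in> hom A.G B.G"
  using F_closed by (intro homI) (auto simp: frag_extend_add)

text \<open>\<open>F\<close> sends each relator to a relator of the same kind, so the generated
  subgroups correspond.\<close>

lemma F_H: "x \<in> A.H \<Longrightarrow> F x \<in> B.H"
proof -
  assume x: "x \<in> A.H"
  interpret F: group_hom A.G B.G F
    using F_hom by (simp add: group_hom_def group_hom_axioms_def)
  have "F ` A.relators \<subseteq> B.relators"
  proof
    fix y assume "y \<in> F ` A.relators"
    then obtain x where x: "x \<in> A.relators" "y = F x" by blast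
    then consider (1) m m' n where "x = frag_of (m \<oplus>\<^bsub>W\<^esub> m', n) - frag_of (m, n) - frag_of (m', n)"
        "m \<in> carrier W" "m' \<in> carrier W" "n \<in> carrier N"
      | (2) m n n' where "x = frag_of (m, n \<oplus>\<^bsub>N\<^esub> n') - frag_of (m, n) - frag_of (m, n')"
        "m \<in> carrier W" "n \<in> carrier N" "n' \<in> carrier N"
      | (3) r m n where "x = frag_of (r \<odot>\<^bsub>W\<^esub> m, n) - frag_of (m, r \<odot>\<^bsub>N\<^esub> n)"
        "r \<in> carrier \<Gamma>" "m \<in> carrier W" "n \<in> carrier N"
      unfolding A.relators_def by blast
    then show "y \<in> B.relators"
    proof cases
      case 1
      then have "y = frag_of (m \<oplus>\<^bsub>W\<^esub> m', f n) - frag_of (m, f n) - frag_of (m', f n)"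
        using x(2) by (simp add: frag_extend_diff)
      then show ?thesis using 1 hom_closed[OF f 1(4)] unfolding B.relators_def by blast
    next
      case 2
      then have "y = frag_of (m, f n \<oplus>\<^bsub>N'\<^esub> f n') - frag_of (m, f n) - frag_of (m, f n')"
        using x(2) hom_add[OF f 2(3,4)] by (simp add: frag_extend_diff)
      then show ?thesis using 2 hom_closed[OF f 2(3)] hom_closed[OF f 2(4)] unfolding B.relators_def by blast
    next
      case 3
      then have "y = frag_of (r \<odot>\<^bsub>W\<^esub> m, f n) - frag_of (m, r \<odot>\<^bsub>N'\<^esub> f n)"
        using x(2) hom_smult[OF f 3(2,4)] by (simp add: frag_extend_diff)
      then show ?thesis using 3 hom_closed[OF f 3(4)] unfolding B.relators_def by blast
    qed
  qed
  then have "F ` generate A.G A.relators \<subseteq> generate B.G B.relators"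
    unfolding F.generate_img[OF A.relators_subset, symmetric] by (rule B.G.mono_generate)
  then show "F x \<in> B.H" using x unfolding A.H_eq B.H_eq by blast
qed

text \<open>All representatives give the same coset because \<open>F\<close> respects the relations,
  so the union in \<open>tensor_map\<close> collapses to it.\<close>

lemma tensor_map_cls:
  assumes x: "x \<in> carrier A.G"
  shows "tensor_map \<Gamma> W f N' (A.cls x) = B.cls (F x)"
proof -
  have "B.cls (F y) = B.cls (F x)" if y: "y \<in> A.cls x" for y
  proof -
    obtain h where h: "h \<in> A.H" "y = h + x" using y by (auto simp: A.cls_def r_coset_def)
    have hG: "h \<in> carrier A.G" using subgroup.subset[OF A.subgroup_H] h(1) by blast
    have "F y = F h + F x" using h(2) by (simp add: frag_extend_add)
    then have "B.cls (F y) = B.cls (F h) \<otimes>\<^bsub>B.T\<^esub> B.cls (F x)"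
      using B.cls_add[OF F_closed[OF hG] F_closed[OF x]] by simp
    then show ?thesis using B.cls_H[OF F_H[OF h(1)]] B.cls_closed[OF F_closed[OF x]] by simp
  qed
  then have "tensor_map \<Gamma> W f N' (A.cls x) = (\<Union>y\<in>A.cls x. B.cls (F x))"
    unfolding tensor_map_def B.cls_def by (intro SUP_cong) auto
  moreover have "x \<in> A.cls x" unfolding A.cls_def by (rule A.G.rcos_self[OF x A.subgroup_H])
  ultimately show ?thesis by auto
qed

lemma tensor_map_pure:
  "\<lbrakk>w \<in> carrier W; n \<in> carrier N\<rbrakk> \<Longrightarrow> tensor_map \<Gamma> W f N' (A.pure w n) = B.pure w (f n)"
  unfolding A.pure_def by (subst tensor_map_cls) (auto simp: B.pure_def)

lemma tensor_map_hom: "tensor_map \<Gamma> W f N' \<in> hom A.T B.T"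
proof (rule homI)
  fix X assume "X \<in> carrier A.T"
  then obtain x where x: "x \<in> carrier A.G" "X = A.cls x" using A.T_carrier by blast
  then show "tensor_map \<Gamma> W f N' X \<in> carrier B.T"
    using tensor_map_cls B.cls_closed F_closed by simp
  fix Y assume "Y \<in> carrier A.T"
  then obtain y where y: "y \<in> carrier A.G" "Y = A.cls y" using A.T_carrier by blast
  have "X \<otimes>\<^bsub>A.T\<^esub> Y = A.cls (x + y)" using x y A.cls_add by simp
  then show "tensor_map \<Gamma> W f N' (X \<otimes>\<^bsub>A.T\<^esub> Y) = tensor_map \<Gamma> W f N' X \<otimes>\<^bsub>B.T\<^esub> tensor_map \<Gamma> W f N' Y"
    using x y tensor_map_cls A.sum_mem[OF x(1) y(1)] B.cls_add F_closed
    by (simp add: frag_extend_add del: carrier_free_Abelian_group_iff)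
qed

end

section \<open>The tensor product with the dual of \<open>L\<close> as a module over
  \<open>R\<close>, and the vanishing of Ext and Tor\<close>

context matlis begin

lemma lmodule_reg: "lmodule L (regular L)"
  by (rule lmodule_regular[OF L.ring_axioms])

lemma tensor_prod_DL: "lmodule L N \<Longrightarrow> tensor_prod L DLr N"
  by (rule tensor_prod.intro[OF lmodule_DLr])

lemma tensor_hom_DL: "\<lbrakk>lmodule L N; lmodule L N'; f \<in> hom_set L N N'\<rbrakk> \<Longrightarrow> tensor_hom L DLr N N' f"
  by (intro tensor_hom.intro tensor_prod_DL tensor_hom_axioms.intro)

definition scal :: "('a, 'n) module \<Rightarrow> 'r \<Rightarrow> 'n \<Rightarrow> 'n" where
  "scal N r = (\<lambda>p\<in>carrier N. \<phi> r \<odot>\<^bsub>N\<^esub> p)"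

lemma scal_hom:
  assumes "lmodule L N" "r \<in> carrier R"
  shows "scal N r \<in> hom_set L N N"
proof -
  interpret N: lmodule L N by fact
  show ?thesis
    unfolding scal_def
  proof (rule hom_restrictI[OF assms(1)])
    fix l x assume lx: "l \<in> carrier L" "x \<in> carrier N"
    then have "\<phi> r \<odot>\<^bsub>N\<^esub> (l \<odot>\<^bsub>N\<^esub> x) = (l \<otimes>\<^bsub>L\<^esub> \<phi> r) \<odot>\<^bsub>N\<^esub> x"
      using \<phi>_closed[OF assms(2)] central[OF assms(2) lx(1)] by (simp flip: N.smult_assoc)
    then show "\<phi> r \<odot>\<^bsub>N\<^esub> (l \<odot>\<^bsub>N\<^esub> x) = l \<odot>\<^bsub>N\<^esub> (\<phi> r \<odot>\<^bsub>N\<^esub> x)"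
      using lx \<phi>_closed[OF assms(2)] by (simp add: N.smult_assoc)
  qed (use \<phi>_closed[OF assms(2)] in \<open>auto simp: N.smult_closed N.smult_r_distr\<close>)
qed

text \<open>\<open>tensor\<close> is only an abelian group. Functoriality in \<open>N\<close> lets
  \<open>R\<close> act through its central scalars, which yields a module to which separation by
  \<open>E\<close> and extension into \<open>E\<close> apply.\<close>

definition DL_tensor :: "('a, 'n) module \<Rightarrow> ('r, (('a \<Rightarrow> 'e) \<times> 'n \<Rightarrow>\<^sub>0 int) set) module" where
  "DL_tensor N = \<lparr>carrier = carrier (tensor L DLr N), monoid.mult = undefined, monoid.one = undefined,
     ring.zero = \<one>\<^bsub>tensor L DLr N\<^esub>, add = monoid.mult (tensor L DLr N),
     smult = (\<lambda>r. tensor_map L DLr (scal N r) N)\<rparr>"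

lemma DL_tensor_simps [simp]:
  "carrier (DL_tensor N) = carrier (tensor L DLr N)" "\<zero>\<^bsub>DL_tensor N\<^esub> = \<one>\<^bsub>tensor L DLr N\<^esub>"
  "X \<oplus>\<^bsub>DL_tensor N\<^esub> Y = X \<otimes>\<^bsub>tensor L DLr N\<^esub> Y" "r \<odot>\<^bsub>DL_tensor N\<^esub> X = tensor_map L DLr (scal N r) N X"
  by (auto simp: DL_tensor_def)

lemma
  assumes N: "lmodule L N"
  shows lmodule_DL_tensor: "lmodule R (DL_tensor N)"
    and DL_tensor_smult_pure: "\<lbrakk>r \<in> carrier R; w \<in> carrier DLr; p \<in> carrier N\<rbrakk> \<Longrightarrow>
      tensor_map L DLr (scal N r) N (tensor_prod.pure L DLr N w p) = tensor_prod.pure L DLr N w (\<phi> r \<odot>\<^bsub>N\<^esub> p)"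
proof -
  interpret t: tensor_prod L DLr N by (rule tensor_prod_DL[OF N])
  let ?T = "tensor L DLr N" and ?m = "\<lambda>r. tensor_map L DLr (scal N r) N"
  have th: "tensor_hom L DLr N N (scal N r)" if "r \<in> carrier R" for r
    by (rule tensor_hom_DL[OF N N scal_hom[OF N that]])
  have mh: "?m r \<in> hom ?T ?T" if "r \<in> carrier R" for r
    using tensor_hom.tensor_map_hom[OF th[OF that]] .
  have mc: "?m r X \<in> carrier ?T" if "r \<in> carrier R" "X \<in> carrier ?T" for r X
    using Group.hom_in_carrier[OF mh[OF that(1)] that(2)] .
  have mp: "?m r (t.pure w p) = t.pure w (\<phi> r \<odot>\<^bsub>N\<^esub> p)"
    if "r \<in> carrier R" "w \<in> carrier DLr" "p \<in> carrier N" for r w p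
    using tensor_hom.tensor_map_pure[OF th[OF that(1)] that(2,3)] that(3) by (simp add: scal_def)
  then show "\<lbrakk>r \<in> carrier R; w \<in> carrier DLr; p \<in> carrier N\<rbrakk> \<Longrightarrow>
      ?m r (t.pure w p) = t.pure w (\<phi> r \<odot>\<^bsub>N\<^esub> p)" .
  have \<phi>z: "\<phi> \<zero>\<^bsub>R\<^esub> = \<zero>\<^bsub>L\<^esub>" by (rule ring_hom_zero[OF structure_hom ring_axioms L.ring_axioms])
  show "lmodule R (DL_tensor N)"
  proof (rule lmoduleI[OF ring_axioms], simp_all only: DL_tensor_simps)
    fix X assume X: "X \<in> carrier ?T"
    show "?m r X \<in> carrier ?T" if "r \<in> carrier R" for r by (rule mc[OF that X])
    show "?m (r \<oplus>\<^bsub>R\<^esub> s) X = ?m r X \<otimes>\<^bsub>?T\<^esub> ?m s X" if rs: "r \<in> carrier R" "s \<in> carrier R" for r s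
    proof (rule t.hom_eqI[OF t.T.is_group mh _ _ X])
      show "(\<lambda>X. ?m r X \<otimes>\<^bsub>?T\<^esub> ?m s X) \<in> hom ?T ?T"
        using mc rs hom_mult[OF mh] by (intro homI) (auto simp: t.T.m_ac)
      show "?m (r \<oplus>\<^bsub>R\<^esub> s) (t.pure w p) = ?m r (t.pure w p) \<otimes>\<^bsub>?T\<^esub> ?m s (t.pure w p)"
        if "w \<in> carrier DLr" "p \<in> carrier N" for w p
        using that rs \<phi>_closed ring_hom_add[OF structure_hom rs]
        by (simp add: mp t.N.smult_l_distr t.pure_add_right t.N.smult_closed)
    qed (use rs in simp)
    show "?m (r \<otimes>\<^bsub>R\<^esub> s) X = ?m r (?m s X)" if rs: "r \<in> carrier R" "s \<in> carrier R" for r s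
    proof (rule t.hom_eqI[OF t.T.is_group mh _ _ X])
      show "(\<lambda>X. ?m r (?m s X)) \<in> hom ?T ?T"
        using mc rs hom_mult[OF mh] by (intro homI) auto
      show "?m (r \<otimes>\<^bsub>R\<^esub> s) (t.pure w p) = ?m r (?m s (t.pure w p))"
        if "w \<in> carrier DLr" "p \<in> carrier N" for w p
        using that rs \<phi>_closed ring_hom_mult[OF structure_hom rs]
        by (simp add: mp t.N.smult_assoc t.N.smult_closed)
    qed (use rs in simp)
    show "?m \<one>\<^bsub>R\<^esub> X = X"
    proof (rule t.hom_eqI[OF t.T.is_group mh _ _ X])
      show "(\<lambda>X. X) \<in> hom ?T ?T" by (intro homI) auto
      show "?m \<one>\<^bsub>R\<^esub> (t.pure w p) = t.pure w p" if "w \<in> carrier DLr" "p \<in> carrier N" for w p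
        using that ring_hom_one[OF structure_hom] by (simp add: mp t.N.smult_one)
    qed simp
    show "?m \<zero>\<^bsub>R\<^esub> X = \<one>\<^bsub>?T\<^esub>"
    proof (rule t.hom_eqI[OF t.T.is_group mh _ _ X])
      show "(\<lambda>X. \<one>\<^bsub>?T\<^esub>) \<in> hom ?T ?T" by (intro homI) auto
      show "?m \<zero>\<^bsub>R\<^esub> (t.pure w p) = \<one>\<^bsub>?T\<^esub>" if "w \<in> carrier DLr" "p \<in> carrier N" for w p
        using that \<phi>z by (simp add: mp t.pure_zero_right)
    qed simp
    show "?m r (X \<otimes>\<^bsub>?T\<^esub> Y) = ?m r X \<otimes>\<^bsub>?T\<^esub> ?m r Y" if "r \<in> carrier R" "Y \<in> carrier ?T" for r Y
      by (rule hom_mult[OF mh[OF that(1)] X that(2)])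
  qed (auto simp: t.T.m_ac)
qed

lemma E_comm_group: "comm_group (add_monoid E)"
  by (rule E.M.a_comm_group)

text \<open>The adjunction \<open>Hom\<^sub>R(D L \<otimes> N, E) \<cong> Hom\<^sub>L(N, D (D L)) \<cong> Hom\<^sub>L(N, L)\<close>.\<close>

lemma adjoint_left:
  assumes N: "lmodule L N" and h: "h \<in> hom_set L N (regular L)"
  obtains t where "t \<in> hom_set R (DL_tensor N) E"
    "\<forall>w\<in>carrier DLr. \<forall>p\<in>carrier N. t (tensor_prod.pure L DLr N w p) = w (h p)"
proof -
  interpret t: tensor_prod L DLr N by (rule tensor_prod_DL[OF N])
  let ?T = "tensor L DLr N" and ?m = "\<lambda>r. tensor_map L DLr (scal N r) N"
  interpret TM: lmodule R "DL_tensor N" by (rule lmodule_DL_tensor[OF N])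
  have hc: "h p \<in> carrier L" if "p \<in> carrier N" for p using hom_closed[OF h that] by simp
  have wc: "w x \<in> carrier E" if "w \<in> carrier DLr" "x \<in> carrier L" for w x
    using Dual_closed[OF that(1), of x] that(2) by simp
  obtain t where t: "t \<in> hom ?T (add_monoid E)" "\<forall>w\<in>carrier DLr. \<forall>p\<in>carrier N. t (t.pure w p) = w (h p)"
  proof (rule t.universal[OF E_comm_group, of "\<lambda>w p. w (h p)"])
    show "w (h n) \<in> carrier (add_monoid E)" if "w \<in> carrier DLr" "n \<in> carrier N" for w n
      using that wc hc by simp
    show "(w \<oplus>\<^bsub>DLr\<^esub> w') (h n) = w (h n) \<otimes>\<^bsub>add_monoid E\<^esub> w' (h n)"
      if "w \<in> carrier DLr" "w' \<in> carrier DLr" "n \<in> carrier N" for w w' n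
      using that hc by simp
    show "w (h (n \<oplus>\<^bsub>N\<^esub> n')) = w (h n) \<otimes>\<^bsub>add_monoid E\<^esub> w (h n')"
      if "w \<in> carrier DLr" "n \<in> carrier N" "n' \<in> carrier N" for w n n'
      using that hc hom_add[OF h that(2,3)] Dual_add_arg[OF that(1), of "h n" "h n'"] by simp
    show "(r \<odot>\<^bsub>DLr\<^esub> w) (h n) = w (h (r \<odot>\<^bsub>N\<^esub> n))"
      if "r \<in> carrier L" "w \<in> carrier DLr" "n \<in> carrier N" for r w n
      using that hc hom_smult[OF h that(1,3)] by simp
  qed (rule that)
  have tc: "t X \<in> carrier E" if "X \<in> carrier ?T" for X
    using Group.hom_in_carrier[OF t(1) that] by simp
  have tadd: "t (X \<otimes>\<^bsub>?T\<^esub> Y) = t X \<oplus>\<^bsub>E\<^esub> t Y" if "X \<in> carrier ?T" "Y \<in> carrier ?T" for X Y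
    using hom_mult[OF t(1) that] by simp
  have mc: "?m r X \<in> carrier ?T" if "r \<in> carrier R" "X \<in> carrier ?T" for r X
    using TM.smult_closed[of r X] that by simp
  have madd: "?m r (X \<otimes>\<^bsub>?T\<^esub> Y) = ?m r X \<otimes>\<^bsub>?T\<^esub> ?m r Y" if "r \<in> carrier R" "X \<in> carrier ?T" "Y \<in> carrier ?T" for r X Y
    using TM.smult_r_distr[of r X Y] that by simp
  have lin: "t (?m r X) = r \<odot>\<^bsub>E\<^esub> t X" if r: "r \<in> carrier R" and X: "X \<in> carrier ?T" for r X
  proof (rule t.hom_eqI[OF _ _ _ _ X, where C = "add_monoid E"])
    show "group (add_monoid E)" using E_comm_group by (simp add: comm_group_def)
    show "(\<lambda>X. t (?m r X)) \<in> hom ?T (add_monoid E)"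
      using tc mc[OF r] tadd madd[OF r] by (intro homI) auto
    show "(\<lambda>X. r \<odot>\<^bsub>E\<^esub> t X) \<in> hom ?T (add_monoid E)"
      using tc tadd r by (intro homI) (auto simp: E.smult_closed E.smult_r_distr)
    show "t (?m r (t.pure w p)) = r \<odot>\<^bsub>E\<^esub> t (t.pure w p)" if "w \<in> carrier DLr" "p \<in> carrier N" for w p
      using that r t(2) DL_tensor_smult_pure[OF N r that] t.N.smult_closed[OF \<phi>_closed[OF r] that(2)]
        hom_smult[OF h \<phi>_closed[OF r] that(2)] Dual_smult_arg[OF that(1) r, of "h p"] hc[OF that(2)]
      by simp
  qed
  have "restrict t (carrier (DL_tensor N)) \<in> hom_set R (DL_tensor N) E"
    using tc tadd lin by (intro hom_restrictI[OF TM.lmodule_axioms]) auto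
  moreover have "\<forall>w\<in>carrier DLr. \<forall>p\<in>carrier N. restrict t (carrier (DL_tensor N)) (t.pure w p) = w (h p)"
    using t(2) by simp
  ultimately show ?thesis by (rule that)
qed

text \<open>For fixed \<open>p\<close>, sending \<open>w\<close> to the value of \<open>t\<close> at
  the pure tensor is a functional on the dual of \<open>L\<close>, hence evaluation at an element
  \<open>h p\<close>. Separation makes that element unique, and uniqueness makes \<open>h\<close>
  linear.\<close>

lemma adjoint_right:
  assumes N: "lmodule L N" and t: "t \<in> hom_set R (DL_tensor N) E"
  obtains h where "h \<in> hom_set L N (regular L)"
    "\<forall>w\<in>carrier DLr. \<forall>p\<in>carrier N. t (tensor_prod.pure L DLr N w p) = w (h p)"
proof -
  interpret op: matlis R \<iota> E \<phi> "opp L" by (rule matlis_opp)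
  interpret t: tensor_prod L DLr N by (rule tensor_prod_DL[OF N])
  have tc: "t (t.pure w p) \<in> carrier E" if "w \<in> carrier DLr" "p \<in> carrier N" for w p
    using hom_closed[OF t] that by simp
  have tadd: "t (X \<otimes>\<^bsub>tensor L DLr N\<^esub> Y) = t X \<oplus>\<^bsub>E\<^esub> t Y"
    if "X \<in> carrier (tensor L DLr N)" "Y \<in> carrier (tensor L DLr N)" for X Y
    using hom_add[OF t, of X Y] that by simp
  have "\<exists>x\<in>carrier L. \<forall>w\<in>carrier DLr. t (t.pure w p) = w x" if p: "p \<in> carrier N" for p
  proof -
    have "(\<lambda>w\<in>carrier DLr. t (t.pure w p)) \<in> carrier (D DLr)"
    proof (rule op.DualI[OF lmodule_DLr])
      show "t (t.pure w p) \<in> carrier E" if "w \<in> carrier DLr" for w by (rule tc[OF that p])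
      show "t (t.pure (w \<oplus>\<^bsub>DLr\<^esub> w') p) = t (t.pure w p) \<oplus>\<^bsub>E\<^esub> t (t.pure w' p)"
        if "w \<in> carrier DLr" "w' \<in> carrier DLr" for w w'
        using that p by (simp add: t.pure_add_left tadd)
      show "t (t.pure (\<phi> r \<odot>\<^bsub>DLr\<^esub> w) p) = r \<odot>\<^bsub>E\<^esub> t (t.pure w p)"
        if "r \<in> carrier R" "w \<in> carrier DLr" for r w
        using that p \<phi>_closed t.pure_balanced[of "\<phi> r" w p] DL_tensor_smult_pure[OF N that p]
          hom_smult[OF t that(1), of "t.pure w p"] by simp
    qed
    then obtain x where "x \<in> carrier (regular L)" "\<forall>w\<in>carrier DLr. (\<lambda>w\<in>carrier DLr. t (t.pure w p)) w = w x"
      by (rule reflexive[OF lmodule_reg flen_rs_regular])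
    then show ?thesis by auto
  qed
  then obtain h where h: "\<And>p. p \<in> carrier N \<Longrightarrow> h p \<in> carrier L \<and> (\<forall>w\<in>carrier DLr. t (t.pure w p) = w (h p))"
    by metis
  have eq: "x = y" if "x \<in> carrier L" "y \<in> carrier L" "\<And>w. w \<in> carrier DLr \<Longrightarrow> w x = w y" for x y
    using Dual_separates[OF lmodule_reg, of x y] that by simp
  have "restrict h (carrier N) \<in> hom_set L N (regular L)"
  proof (rule hom_restrictI[OF N])
    show "h p \<in> carrier (regular L)" if "p \<in> carrier N" for p using h that by simp
    show "h (p \<oplus>\<^bsub>N\<^esub> q) = h p \<oplus>\<^bsub>regular L\<^esub> h q" if pq: "p \<in> carrier N" "q \<in> carrier N" for p q
    proof (rule eq)
      fix w assume w: "w \<in> carrier DLr"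
      have "w (h (p \<oplus>\<^bsub>N\<^esub> q)) = t (t.pure w (p \<oplus>\<^bsub>N\<^esub> q))"
        using h[of "p \<oplus>\<^bsub>N\<^esub> q"] pq w by simp
      also have "\<dots> = t (t.pure w p) \<oplus>\<^bsub>E\<^esub> t (t.pure w q)"
        unfolding t.pure_add_right[OF w pq] using pq w by (simp add: tadd)
      finally have "w (h (p \<oplus>\<^bsub>N\<^esub> q)) = t (t.pure w p) \<oplus>\<^bsub>E\<^esub> t (t.pure w q)" .
      then show "w (h (p \<oplus>\<^bsub>N\<^esub> q)) = w (h p \<oplus>\<^bsub>regular L\<^esub> h q)"
        using h pq w Dual_add_arg[OF w, of "h p" "h q"] by simp
    qed (use h pq in auto)
    show "h (l \<odot>\<^bsub>N\<^esub> p) = l \<odot>\<^bsub>regular L\<^esub> h p" if lp: "l \<in> carrier L" "p \<in> carrier N" for l p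
    proof (rule eq)
      have lpN: "l \<odot>\<^bsub>N\<^esub> p \<in> carrier N" by (rule t.N.smult_closed[OF lp])
      show "h (l \<odot>\<^bsub>N\<^esub> p) \<in> carrier L" using h[OF lpN] by simp
      show "l \<odot>\<^bsub>regular L\<^esub> h p \<in> carrier L" using h[OF lp(2)] lp(1) by simp
      fix w assume w: "w \<in> carrier DLr"
      have lw: "l \<odot>\<^bsub>DLr\<^esub> w \<in> carrier DLr" using t.W.smult_closed[of l w] lp(1) w by simp
      have "w (h (l \<odot>\<^bsub>N\<^esub> p)) = t (t.pure (l \<odot>\<^bsub>DLr\<^esub> w) p)"
        using h[OF lpN] w t.pure_balanced[OF lp(1) w lp(2)] by simp
      also have "\<dots> = (l \<odot>\<^bsub>DLr\<^esub> w) (h p)" using h[OF lp(2)] lw by blast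
      also have "\<dots> = w (l \<otimes>\<^bsub>L\<^esub> h p)" using h[OF lp(2)] by simp
      finally show "w (h (l \<odot>\<^bsub>N\<^esub> p)) = w (l \<odot>\<^bsub>regular L\<^esub> h p)" by simp
    qed
  qed
  moreover have "\<forall>w\<in>carrier DLr. \<forall>p\<in>carrier N. t (t.pure w p) = w (restrict h (carrier N) p)"
    using h by simp
  ultimately show ?thesis by (rule that)
qed

lemma tensor_map_linear:
  assumes N: "lmodule L N" "lmodule L N'" and f: "f \<in> hom_set L N N'"
  shows "restrict (tensor_map L DLr f N') (carrier (DL_tensor N)) \<in> hom_set R (DL_tensor N) (DL_tensor N')"
proof -
  interpret f: tensor_hom L DLr N N' f by (rule tensor_hom_DL[OF N f])
  interpret TN: lmodule R "DL_tensor N" by (rule lmodule_DL_tensor[OF N(1)])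
  interpret TN': lmodule R "DL_tensor N'" by (rule lmodule_DL_tensor[OF N(2)])
  let ?f = "tensor_map L DLr f N'" and ?T = "tensor L DLr N" and ?T' = "tensor L DLr N'"
  let ?m = "\<lambda>r. tensor_map L DLr (scal N r) N" and ?m' = "\<lambda>r. tensor_map L DLr (scal N' r) N'"
  have fc: "?f X \<in> carrier ?T'" if "X \<in> carrier ?T" for X
    by (rule Group.hom_in_carrier[OF f.tensor_map_hom that])
  have fadd: "?f (X \<otimes>\<^bsub>?T\<^esub> Y) = ?f X \<otimes>\<^bsub>?T'\<^esub> ?f Y" if "X \<in> carrier ?T" "Y \<in> carrier ?T" for X Y
    by (rule hom_mult[OF f.tensor_map_hom that])
  have mc: "?m r X \<in> carrier ?T" if "r \<in> carrier R" "X \<in> carrier ?T" for r X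
    using TN.smult_closed[of r X] that by simp
  have madd: "?m r (X \<otimes>\<^bsub>?T\<^esub> Y) = ?m r X \<otimes>\<^bsub>?T\<^esub> ?m r Y" if "r \<in> carrier R" "X \<in> carrier ?T" "Y \<in> carrier ?T" for r X Y
    using TN.smult_r_distr[of r X Y] that by simp
  have mc': "?m' r X \<in> carrier ?T'" if "r \<in> carrier R" "X \<in> carrier ?T'" for r X
    using TN'.smult_closed[of r X] that by simp
  have madd': "?m' r (X \<otimes>\<^bsub>?T'\<^esub> Y) = ?m' r X \<otimes>\<^bsub>?T'\<^esub> ?m' r Y" if "r \<in> carrier R" "X \<in> carrier ?T'" "Y \<in> carrier ?T'" for r X Y
    using TN'.smult_r_distr[of r X Y] that by simp
  have "?f (?m r X) = ?m' r (?f X)" if r: "r \<in> carrier R" and X: "X \<in> carrier ?T" for r X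
  proof (rule f.A.hom_eqI[OF f.B.T.is_group _ _ _ X])
    show "(\<lambda>X. ?f (?m r X)) \<in> hom ?T ?T'" using fc mc[OF r] fadd madd[OF r] by (intro homI) auto
    show "(\<lambda>X. ?m' r (?f X)) \<in> hom ?T ?T'" using fc mc'[OF r] fadd madd'[OF r] by (intro homI) auto
    show "?f (?m r (f.A.pure w p)) = ?m' r (?f (f.A.pure w p))" if wp: "w \<in> carrier DLr" "p \<in> carrier N" for w p
      using f.tensor_map_pure[OF wp] f.tensor_map_pure[OF wp(1) f.A.N.smult_closed[OF \<phi>_closed[OF r] wp(2)]]
        DL_tensor_smult_pure[OF N(1) r wp] DL_tensor_smult_pure[OF N(2) r wp(1) hom_closed[OF f wp(2)]]
        hom_smult[OF f \<phi>_closed[OF r] wp(2)] by simp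
  qed
  then show ?thesis
    using fc fadd by (intro hom_restrictI[OF TN.lmodule_axioms]) auto
qed

text \<open>The vanishing of \<open>Tor\<^sub>j\<^sub>+\<^sub>1(D L, M)\<close> computed from the complex \<open>(P, d)\<close>.\<close>

definition tor_exact :: "(nat \<Rightarrow> ('a, 'p) module) \<Rightarrow> (nat \<Rightarrow> 'p \<Rightarrow> 'p) \<Rightarrow> nat \<Rightarrow> bool" where
  "tor_exact P d j \<longleftrightarrow> (\<forall>y\<in>carrier (tensor L DLr (P (Suc j))).
     tensor_map L DLr (d j) (P j) y = \<one>\<^bsub>tensor L DLr (P j)\<^esub> \<longrightarrow>
     y \<in> tensor_map L DLr (d (Suc j)) (P (Suc j)) ` carrier (tensor L DLr (P (Suc (Suc j)))))"

text \<open>By the adjunction, the functionals into \<open>E\<close> on the tensor complex form the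
  complex of maps from \<open>P\<close> to \<open>L\<close>, and an injective cogenerator both
  preserves and reflects exactness.\<close>

lemma ext_exact_iff_tor_exact:
  assumes P: "\<And>i. lmodule L (P i)" and d: "\<And>i. d i \<in> hom_set L (P (Suc i)) (P i)"
  shows "ext_exact L P d (regular L) j \<longleftrightarrow> tor_exact P d j"
proof -
  let ?T = "\<lambda>i. DL_tensor (P i)"
  let ?\<tau> = "\<lambda>i. tensor_map L DLr (d i) (P i)"
  let ?pure = "\<lambda>i. tensor_prod.pure L DLr (P i)"
  let ?q = "restrict (?\<tau> j) (carrier (?T (Suc j)))"
  have mT: "lmodule R (?T i)" for i by (rule lmodule_DL_tensor[OF P])
  have tp: "tensor_prod L DLr (P i)" for i by (rule tensor_prod_DL[OF P])
  have th: "tensor_hom L DLr (P (Suc i)) (P i) (d i)" for i by (rule tensor_hom_DL[OF P P d])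
  have \<tau>: "restrict (?\<tau> i) (carrier (?T (Suc i))) \<in> hom_set R (?T (Suc i)) (?T i)" for i
    by (rule tensor_map_linear[OF P P d])
  have \<tau>p: "?\<tau> i (?pure (Suc i) w p) = ?pure i w (d i p)" if "w \<in> carrier DLr" "p \<in> carrier (P (Suc i))" for i w p
    by (rule tensor_hom.tensor_map_pure[OF th that])
  have pc: "?pure i w p \<in> carrier (tensor L DLr (P i))" if "w \<in> carrier DLr" "p \<in> carrier (P i)" for i w p
    by (rule tensor_prod.pure_closed[OF tp that])
  have uniq: "s X = s' X"
    if "s \<in> hom_set R (?T i) E" "s' \<in> hom_set R (?T i) E" "X \<in> carrier (?T i)"
      "\<And>w p. \<lbrakk>w \<in> carrier DLr; p \<in> carrier (P i)\<rbrakk> \<Longrightarrow> s (?pure i w p) = s' (?pure i w p)" for i s s' X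
  proof (rule tensor_prod.hom_eqI[OF tp, where C = "add_monoid E"])
    show "group (add_monoid E)" using E_comm_group by (simp add: comm_group_def)
    show "s \<in> hom (tensor L DLr (P i)) (add_monoid E)" "s' \<in> hom (tensor L DLr (P i)) (add_monoid E)"
      using hom_closed[OF that(1)] hom_closed[OF that(2)] hom_add[OF that(1)] hom_add[OF that(2)]
      by (auto intro!: homI)
  qed (use that in auto)
  have zero_hom: "(\<lambda>X\<in>carrier (?T i). \<zero>\<^bsub>E\<^esub>) \<in> hom_set R (?T i) E" for i
    by (rule hom_restrictI[OF mT]) auto
  show ?thesis
  proof
    assume ext: "ext_exact L P d (regular L) j"
    show "tor_exact P d j"
      unfolding tor_exact_def
    proof (intro ballI impI, rule ccontr)
      fix y assume y: "y \<in> carrier (tensor L DLr (P (Suc j)))" and y0: "?\<tau> j y = \<one>\<^bsub>tensor L DLr (P j)\<^esub>"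
      let ?I = "?\<tau> (Suc j) ` carrier (tensor L DLr (P (Suc (Suc j))))"
      assume "y \<notin> ?I"
      have I: "submodule ?I R (?T (Suc j))"
        using submodule_image[OF mT mT \<tau> lmodule.submodule_carrier[OF mT], of "Suc j"] by simp
      \<comment> \<open>A cycle outside the boundaries is detected by a functional that vanishes on
        them. Its adjoint is a cocycle, and writing the cocycle as a coboundary forces the
        functional to vanish at \<open>y\<close>.\<close>
      obtain t where t: "t \<in> hom_set R (?T (Suc j)) E" "\<And>k. k \<in> ?I \<Longrightarrow> t k = \<zero>\<^bsub>E\<^esub>" "t y \<noteq> \<zero>\<^bsub>E\<^esub>"
        using separation[OF mT I _ \<open>y \<notin> ?I\<close>] y by (metis DL_tensor_simps(1))
      obtain h where h: "h \<in> hom_set L (P (Suc j)) (regular L)"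
        "\<forall>w\<in>carrier DLr. \<forall>p\<in>carrier (P (Suc j)). t (?pure (Suc j) w p) = w (h p)"
        by (rule adjoint_right[OF P t(1)])
      have "\<forall>x\<in>carrier (P (Suc (Suc j))). h (d (Suc j) x) = \<zero>\<^bsub>regular L\<^esub>"
      proof
        fix x assume x: "x \<in> carrier (P (Suc (Suc j)))"
        have dx: "d (Suc j) x \<in> carrier (P (Suc j))" by (rule hom_closed[OF d x])
        show "h (d (Suc j) x) = \<zero>\<^bsub>regular L\<^esub>"
        proof (rule Dual_separates[OF lmodule_reg hom_closed[OF h(1) dx]])
          fix w assume w: "w \<in> carrier DLr"
          have "w (h (d (Suc j) x)) = t (?\<tau> (Suc j) (?pure (Suc (Suc j)) w x))"
            using h(2) w dx \<tau>p[OF w x] by simp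
          also have "\<dots> = \<zero>\<^bsub>E\<^esub>" using t(2) pc[OF w x] by blast
          finally show "w (h (d (Suc j) x)) = w \<zero>\<^bsub>regular L\<^esub>" using Dual_zero_arg[OF lmodule_reg w] by simp
        qed simp
      qed
      then obtain k where k: "k \<in> hom_set L (P j) (regular L)" "\<forall>x\<in>carrier (P (Suc j)). h x = k (d j x)"
        using ext h(1) unfolding ext_exact_def by blast
      obtain s where s: "s \<in> hom_set R (?T j) E" "\<forall>w\<in>carrier DLr. \<forall>p\<in>carrier (P j). s (?pure j w p) = w (k p)"
        by (rule adjoint_left[OF P k(1)])
      have "t y = compose (carrier (?T (Suc j))) s ?q y"
      proof (rule uniq[OF t(1) hom_compose[OF mT \<tau> s(1)]])
        show "y \<in> carrier (?T (Suc j))" using y by simp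
        fix w p assume wp: "w \<in> carrier DLr" "p \<in> carrier (P (Suc j))"
        show "t (?pure (Suc j) w p) = compose (carrier (?T (Suc j))) s ?q (?pure (Suc j) w p)"
          using wp pc[OF wp] \<tau>p[OF wp] h(2) k(2) s(2) hom_closed[OF d wp(2)] by (simp add: compose_def)
      qed
      then show False using t(3) y y0 hom_zero[OF mT E s(1)] by (simp add: compose_def)
    qed
  next
    assume tor: "tor_exact P d j"
    show "ext_exact L P d (regular L) j"
      unfolding ext_exact_def
    proof (intro ballI impI)
      fix h assume h: "h \<in> hom_set L (P (Suc j)) (regular L)"
        and hd: "\<forall>x\<in>carrier (P (Suc (Suc j))). h (d (Suc j) x) = \<zero>\<^bsub>regular L\<^esub>"
      obtain t where t: "t \<in> hom_set R (?T (Suc j)) E"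
        "\<forall>w\<in>carrier DLr. \<forall>p\<in>carrier (P (Suc j)). t (?pure (Suc j) w p) = w (h p)"
        by (rule adjoint_left[OF P h])
      let ?q' = "restrict (?\<tau> (Suc j)) (carrier (?T (Suc (Suc j))))"
      have t0: "t (?\<tau> (Suc j) X) = \<zero>\<^bsub>E\<^esub>" if X: "X \<in> carrier (tensor L DLr (P (Suc (Suc j))))" for X
      proof -
        have "compose (carrier (?T (Suc (Suc j)))) t ?q' X = (\<lambda>X\<in>carrier (?T (Suc (Suc j))). \<zero>\<^bsub>E\<^esub>) X"
        proof (rule uniq[OF hom_compose[OF mT \<tau> t(1)] zero_hom])
          show "X \<in> carrier (?T (Suc (Suc j)))" using X by simp
          fix w p assume wp: "w \<in> carrier DLr" "p \<in> carrier (P (Suc (Suc j)))"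
          show "compose (carrier (?T (Suc (Suc j)))) t ?q' (?pure (Suc (Suc j)) w p) =
              (\<lambda>X\<in>carrier (?T (Suc (Suc j))). \<zero>\<^bsub>E\<^esub>) (?pure (Suc (Suc j)) w p)"
            using wp pc[OF wp] \<tau>p[OF wp] t(2) hd hom_closed[OF d wp(2)] Dual_zero_arg[OF lmodule_reg wp(1)]
            by (simp add: compose_def)
        qed
        then show ?thesis using X by (simp add: compose_def)
      qed
      \<comment> \<open>By exactness \<open>t\<close> vanishes on the kernel of \<open>?q\<close>,
        so it descends to the image and extends to the whole tensor product; the adjoint of the
        extension is the required \<open>k\<close>.\<close>
      let ?W = "?q ` carrier (?T (Suc j))"
      have W: "submodule ?W R (?T j)"
        by (rule submodule_image[OF mT mT \<tau> lmodule.submodule_carrier[OF mT]])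
      have q: "?q \<in> hom_set R (?T (Suc j)) (submod (?T j) ?W)"
        by (rule hom_to_submod[OF \<tau> order.refl])
      have q_img: "?q ` carrier (?T (Suc j)) = carrier (submod (?T j) ?W)" by simp
      have qt: "t y = \<zero>\<^bsub>E\<^esub>" if "y \<in> carrier (?T (Suc j))" "?q y = \<zero>\<^bsub>submod (?T j) ?W\<^esub>" for y
      proof -
        have "y \<in> ?\<tau> (Suc j) ` carrier (tensor L DLr (P (Suc (Suc j))))"
          using tor that unfolding tor_exact_def by simp
        then show ?thesis using t0 by blast
      qed
      obtain g where g: "g \<in> hom_set R (submod (?T j) ?W) E" "\<And>y. y \<in> carrier (?T (Suc j)) \<Longrightarrow> g (?q y) = t y"
        using hom_factor[OF mT lmodule_submod[OF mT W] E q q_img t(1) qt] by metis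
      obtain s where s: "s \<in> hom_set R (?T j) E" "\<And>z. z \<in> ?W \<Longrightarrow> s z = g z"
        using injective_extend[OF inj mT W g(1)] by metis
      obtain k where k: "k \<in> hom_set L (P j) (regular L)"
        "\<forall>w\<in>carrier DLr. \<forall>p\<in>carrier (P j). s (?pure j w p) = w (k p)"
        by (rule adjoint_right[OF P s(1)])
      have "h x = k (d j x)" if x: "x \<in> carrier (P (Suc j))" for x
      proof (rule Dual_separates[OF lmodule_reg hom_closed[OF h x] hom_closed[OF k(1) hom_closed[OF d x]]])
        fix w assume w: "w \<in> carrier DLr"
        let ?y = "?pure (Suc j) w x"
        have y: "?y \<in> carrier (?T (Suc j))" using pc[OF w x] by simp
        have "w (h x) = t ?y" using t(2) w x by simp
        also have "\<dots> = s (?q ?y)" using g(2)[OF y] s(2)[of "?q ?y"] y by auto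
        also have "?q ?y = ?pure j w (d j x)" using y \<tau>p[OF w x] by simp
        also have "s \<dots> = w (k (d j x))" using k(2) w hom_closed[OF d x] by simp
        finally show "w (h x) = w (k (d j x))" .
      qed
      then show "\<exists>k\<in>hom_set L (P j) (regular L). \<forall>x\<in>carrier (P (Suc j)). h x = k (d j x)"
        using k(1) by blast
    qed
  qed
qed

text \<open>Lets the cochain groups inherit their group axioms, and the coboundaries their
  additivity, from \<open>star\<close>.\<close>

lemma hom_group_star:
  "carrier (hom_group L M (regular L)) = carrier (star L M)"
  "f \<otimes>\<^bsub>hom_group L M (regular L)\<^esub> g = f \<oplus>\<^bsub>star L M\<^esub> g"
  "\<one>\<^bsub>hom_group L M (regular L)\<^esub> = \<zero>\<^bsub>star L M\<^esub>"
  by (simp_all add: star_def hom_mod_def hom_group_def)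

lemma comm_group_hom_group:
  assumes "lmodule L M"
  shows "comm_group (hom_group L M (regular L))"
proof -
  interpret S: lmodule "opp L" "star L M" by (rule lmodule_star[OF assms])
  show ?thesis
    by (rule comm_groupI) (auto simp: hom_group_star S.M.a_ac intro: S.M.add.l_inv_ex)
qed

lemma trivial_Ext_iff:
  assumes "some_resolution L M = (P, d, e)"
    and P: "\<And>i. lmodule L (P i)" and d: "\<And>i. d i \<in> hom_set L (P (Suc i)) (P i)"
    and dd: "\<And>i x. x \<in> carrier (P (Suc (Suc i))) \<Longrightarrow> d i (d (Suc i) x) = \<zero>\<^bsub>P i\<^esub>"
  shows "trivial_group (Ext L (Suc j) M (regular L)) \<longleftrightarrow> ext_exact L P d (regular L) j"
proof -
  let ?C = "\<lambda>k. hom_group L (P k) (regular L)"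
  let ?\<delta> = "\<lambda>k h. compose (carrier (P (Suc k))) h (d k)"
  have C: "comm_group (?C k)" for k
    by (rule comm_group_hom_group[OF P])
  have Cc: "carrier (?C k) = hom_set L (P k) (regular L)" for k
    by (simp add: hom_group_def)
  have \<delta>: "?\<delta> k \<in> hom (?C k) (?C (Suc k))" for k
  proof -
    note m = star_map[OF P P d, of k]
    show ?thesis
    proof (rule homI; simp only: hom_group_star)
      fix x y assume x: "x \<in> carrier (star L (P k))" and y: "y \<in> carrier (star L (P k))"
      show "?\<delta> k x \<in> carrier (star L (P (Suc k)))" using hom_closed[OF m x] x by simp
      have "x \<oplus>\<^bsub>star L (P k)\<^esub> y \<in> carrier (star L (P k))"
        using abelian_monoid.a_closed[OF abelian_group.axioms(1)[OF lmodule.axioms(2)[OF lmodule_star[OF P]]] x y] .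
      then show "?\<delta> k (x \<oplus>\<^bsub>star L (P k)\<^esub> y) = ?\<delta> k x \<oplus>\<^bsub>star L (P (Suc k))\<^esub> ?\<delta> k y"
        using hom_add[OF m x y] x y by simp
    qed
  qed
  have one: "?\<delta> k h = \<one>\<^bsub>?C (Suc k)\<^esub> \<longleftrightarrow> (\<forall>x\<in>carrier (P (Suc k)). h (d k x) = \<zero>\<^bsub>regular L\<^esub>)" for k h
    by (auto simp: hom_group_def compose_def fun_eq_iff)
  have img: "h \<in> ?\<delta> k ` carrier (?C k) \<longleftrightarrow> (\<exists>g\<in>hom_set L (P k) (regular L). \<forall>x\<in>carrier (P (Suc k)). h x = g (d k x))"
    if h: "h \<in> hom_set L (P (Suc k)) (regular L)" for k h
  proof -
    have "h = ?\<delta> k g \<longleftrightarrow> (\<forall>x\<in>carrier (P (Suc k)). h x = g (d k x))" if g: "g \<in> hom_set L (P k) (regular L)" for g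
      using hom_ext[OF h hom_compose[OF P d g]] by (metis compose_eq)
    then show ?thesis unfolding Cc by blast
  qed
  have dd': "?\<delta> (Suc j) (?\<delta> j h) = \<one>\<^bsub>?C (Suc (Suc j))\<^esub>" if h: "h \<in> carrier (?C j)" for h
    unfolding one using dd hom_closed[OF d] hom_zero[OF P lmodule_reg, of h j] h
    by (simp add: Cc compose_def)
  have "Ext L (Suc j) M (regular L) = homology_at (?C j) (?\<delta> j) (?C (Suc j)) (?\<delta> (Suc j)) (?C (Suc (Suc j)))"
    by (simp add: Ext_def assms(1))
  then have "trivial_group (Ext L (Suc j) M (regular L)) \<longleftrightarrow>
      (\<forall>h\<in>carrier (?C (Suc j)). ?\<delta> (Suc j) h = \<one>\<^bsub>?C (Suc (Suc j))\<^esub> \<longrightarrow> h \<in> ?\<delta> j ` carrier (?C j))"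
    using trivial_homology_iff[where A = "?C j" and B = "?C (Suc j)" and C = "?C (Suc (Suc j))"
        and f = "?\<delta> j" and g = "?\<delta> (Suc j)", OF comm_group.axioms(2)[OF C] C comm_group.axioms(2)[OF C] \<delta> \<delta> dd'] by simp
  then show ?thesis unfolding ext_exact_def using one[of "Suc j"] img[of _ j] by (simp add: Cc)
qed

lemma trivial_Tor_iff:
  assumes "some_resolution L M = (P, d, e)"
    and P: "\<And>i. lmodule L (P i)" and d: "\<And>i. d i \<in> hom_set L (P (Suc i)) (P i)"
    and dd: "\<And>i x. x \<in> carrier (P (Suc (Suc i))) \<Longrightarrow> d i (d (Suc i) x) = \<zero>\<^bsub>P i\<^esub>"
  shows "trivial_group (Tor L (Suc j) DLr M) \<longleftrightarrow> tor_exact P d j"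
proof -
  let ?T = "\<lambda>k. tensor L DLr (P k)"
  let ?\<tau> = "\<lambda>k. tensor_map L DLr (d k) (P k)"
  have tp: "tensor_prod L DLr (P i)" for i by (rule tensor_prod_DL[OF P])
  have th: "tensor_hom L DLr (P (Suc i)) (P i) (d i)" for i by (rule tensor_hom_DL[OF P P d])
  have T: "comm_group (?T k)" for k by (rule tensor_prod.comm_group_T[OF tp])
  then have G: "group (?T k)" for k by (simp add: comm_group_def)
  have \<tau>: "?\<tau> k \<in> hom (?T (Suc k)) (?T k)" for k by (rule tensor_hom.tensor_map_hom[OF th])
  have \<tau>\<tau>: "?\<tau> j (?\<tau> (Suc j) X) = \<one>\<^bsub>?T j\<^esub>" if X: "X \<in> carrier (?T (Suc (Suc j)))" for X
  proof (rule tensor_prod.hom_eqI[OF tp G _ _ _ X])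
    show "(\<lambda>X. ?\<tau> j (?\<tau> (Suc j) X)) \<in> hom (?T (Suc (Suc j))) (?T j)"
      using Group.hom_in_carrier[OF \<tau>] hom_mult[OF \<tau>] by (intro homI) auto
    show "(\<lambda>X. \<one>\<^bsub>?T j\<^esub>) \<in> hom (?T (Suc (Suc j))) (?T j)"
      using G by (intro homI) (auto simp: group.is_monoid monoid.l_one)
    show "?\<tau> j (?\<tau> (Suc j) (tensor_prod.pure L DLr (P (Suc (Suc j))) w p)) = \<one>\<^bsub>?T j\<^esub>"
      if "w \<in> carrier DLr" "p \<in> carrier (P (Suc (Suc j)))" for w p
      using that tensor_hom.tensor_map_pure[OF th] hom_closed[OF d] dd tensor_prod.pure_zero_right[OF tp] by simp
  qed
  have "Tor L (Suc j) DLr M = homology_at (?T (Suc (Suc j))) (?\<tau> (Suc j)) (?T (Suc j)) (?\<tau> j) (?T j)"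
    by (simp add: Tor_def assms(1))
  then show ?thesis
    using trivial_homology_iff[OF G T G \<tau> \<tau> \<tau>\<tau>] unfolding tor_exact_def by simp
qed

text \<open>\<open>M\<close> and \<open>M'\<close> may have different types, and their chosen
  resolutions are unrelated. Ext is moved from one resolution to the other and only then, on the
  resolution of \<open>M'\<close>, exchanged for Tor.\<close>

lemma trivial_Ext_iff_trivial_Tor:
  assumes M: "lmodule L M" "fin_gen L M" "lmodule L M'" and iso: "mod_iso L M M'"
  shows "trivial_group (Ext L (Suc j) M (regular L)) \<longleftrightarrow> trivial_group (Tor L (Suc j) DLr M')"
proof -
  obtain \<theta> where \<theta>: "mod_isom L M M' \<theta>" using iso by (auto simp: mod_iso_iff)
  obtain \<theta>' where \<theta>': "mod_isom L M' M \<theta>'" using mod_isom_inv[OF M(1,3) \<theta>] by metis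
  have fg: "fin_gen L M'"
    by (rule fin_gen_image[OF M(1,3) mod_isom_hom[OF \<theta>] mod_isom_image[OF \<theta>] M(2)])
  obtain P d e where P: "some_resolution L M = (P, d, e)" "proj_resolution L P d e M"
    by (rule some_resolution[OF flen_regular_L M(1,2)])
  obtain P' d' e' where P': "some_resolution L M' = (P', d', e')" "proj_resolution L P' d' e' M'"
    by (rule some_resolution[OF flen_regular_L M(3) fg])
  have "trivial_group (Ext L (Suc j) M (regular L)) \<longleftrightarrow> ext_exact L P d (regular L) j"
    by (rule trivial_Ext_iff[OF P(1) res_module[OF P(2)] res_d[OF P(2)] res_dd[OF P(2)]])
  also have "\<dots> \<longleftrightarrow> ext_exact L P' d' (regular L) j"
    using ext_exact_transfer[OF P(2) P'(2) M(1,2,3) fg \<theta> lmodule_reg]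
      ext_exact_transfer[OF P'(2) P(2) M(3) fg M(1,2) \<theta>' lmodule_reg] by blast
  also have "\<dots> \<longleftrightarrow> tor_exact P' d' j"
    by (rule ext_exact_iff_tor_exact[where P = P' and d = d', OF res_module[OF P'(2)] res_d[OF P'(2)]])
  also have "\<dots> \<longleftrightarrow> trivial_group (Tor L (Suc j) DLr M')"
    by (rule trivial_Tor_iff[OF P'(1) res_module[OF P'(2)] res_d[OF P'(2)] res_dd[OF P'(2)], symmetric])
  finally show ?thesis .
qed

end

section \<open>Transpose and cotranspose under the duality\<close>

theorem proposition5p1:
  fixes R :: "'r ring" and \<phi> :: "'r \<Rightarrow> 'a" and L :: "'a ring"
    and \<iota> :: "'r set \<Rightarrow> 'e" and E :: "('r, 'e) module"
    and A :: "('a, 'm) module" and n :: nat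
  assumes "artin_algebra R \<phi> L"
    and "injective_envelope R (quot_mod (regular R) (jacobson_radical R)) \<iota> E"
    and "lmodule L A" and "fin_gen L A" and "n \<ge> 1"
  shows "mod_iso (opp L) (Tr L A) (cTr R \<phi> E (opp L) (Dual R \<phi> E A))
       \<and> mod_iso L (cTr R \<phi> E L A) (Tr (opp L) (Dual R \<phi> E A))
       \<and> (n_torsionfree L n A \<longleftrightarrow> n_cotorsionfree R \<phi> E (opp L) n (Dual R \<phi> E A))
       \<and> (n_cotorsionfree R \<phi> E L n A \<longleftrightarrow> n_torsionfree (opp L) n (Dual R \<phi> E A))"
proof -
  interpret artin_algebra R \<phi> L by fact
  interpret matlis R \<iota> E \<phi> L
    using assms(1,2)
    by (intro matlis.intro matlis_base.intro artin_base.intro matlis_base_axioms.intro R.artinian_cring_axioms)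
  interpret op: matlis R \<iota> E \<phi> "opp L" by (rule matlis_opp)
  note A = assms(3,4)
  have DA: "lmodule (opp L) (D A)" by (rule lmodule_Dual[OF A(1)])
  have fl: "flen R (rs A)" using fin_gen_iff_flen_rs[OF A(1)] A(2) by simp
  have fg: "fin_gen (opp L) (D A)"
    using op.fin_gen_iff_flen_rs[OF DA] flen_rs_Dual[OF A(1) fl] by simp
  \<comment> \<open>For (1) the copy of \<open>D A\<close> is \<open>D A\<close> itself, by the
    identity; for (2) the copy of the double dual is \<open>A\<close>, by the evaluation
    isomorphism.\<close>
  have "mod_isom (opp L) (D A) (D A) (\<lambda>x\<in>carrier (D A). x)"
    using hom_id[OF DA] by (intro mod_isomI) (auto simp: inj_on_def)
  note 1 = Tr_iso_cTr[OF A DA this]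
  note 2 = op.Tr_iso_cTr[OF DA fg, simplified, OF A(1) eval_iso[OF A(1) fl]]
  note Tr1 = fin_gen_Tr[OF A] and Tr2 = op.fin_gen_Tr[OF DA fg, simplified]
  \<comment> \<open>The degrees run from 1, and the vanishing criterion is stated for degree
    \<open>Suc j\<close>.\<close>
  have all: "(\<forall>i\<in>{1..n}. Q i) \<longleftrightarrow> (\<forall>j<n. Q (Suc j))" for Q :: "nat \<Rightarrow> bool"
    by (metis Suc_le_eq Suc_pred' atLeastAtMost_iff less_eq_Suc_le One_nat_def le_numeral_extra(4) Suc_le_mono le0)
  show ?thesis
  proof (intro conjI)
    show "mod_iso (opp L) (Tr L A) (cTr R \<phi> E (opp L) (D A))" by (rule 1(1))
    show "mod_iso L (cTr R \<phi> E L A) (Tr (opp L) (D A))" by (rule mod_iso_sym[OF Tr2(1) 2(2,1)])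
    \<comment> \<open>The transpose of \<open>A\<close> is a module over \<open>opp L\<close>, so
      the criterion is used over \<open>opp L\<close> here and over \<open>L\<close> in the last
      case, where the transpose of \<open>D A\<close> lives.\<close>
    show "n_torsionfree L n A \<longleftrightarrow> n_cotorsionfree R \<phi> E (opp L) n (D A)"
      unfolding n_torsionfree_def n_cotorsionfree_def all
      using op.trivial_Ext_iff_trivial_Tor[OF Tr1 1(2,1)] by simp
    show "n_cotorsionfree R \<phi> E L n A \<longleftrightarrow> n_torsionfree (opp L) n (D A)"
      unfolding n_torsionfree_def n_cotorsionfree_def all
      using trivial_Ext_iff_trivial_Tor[OF Tr2 2(2,1)] by simp
  qed
qed

end
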